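(* Let $p$ be a prime and let $(M_*,\sigma)$ be a differential graded right $\mathcal A$-module algebra. If $\beta_*$ acts trivially on $M_*$, then $(r_+(M_* ),\bar\sigma)$ is a filtered differential graded right $\mathcal A$-module algebra and its completion $(R_+(M_* ),\bar\sigma)$ is a complete differential graded right $\mathcal A$-module algebra. If $M_*$ is bounded below, then these filtered algebras are relatively bounded below (rbb).
   Context: $\mathcal A$ is the mod $p$ Steenrod algebra; $P^s_*,\beta_*$ ($Sq^s_*$ for $p=2$, $Sq^1_*=\beta_*$) denote right actions of $P^s,\beta$ ($Sq^s$), where $a\in\mathcal A^k$ lowers degree by $k$. Binomials: $\binom a0=1$, $\binom ab=0$ for $b<0$, $\binom ab=a(a-1)\cdots(a-b+1)/b!$ for $b\ge1$. A differential graded right $\mathcal A$-module algebra $(M_*,\sigma)$ is a graded $\mathbb F_p$-algebra and right $\mathcal A$-module whose unit and product are $\mathcal A$-linear (diagonal action on tensor products), with a degree $+1$ differential $\sigma$, $\sigma^2=0$, satisfying $\sigma(xy)=\sigma(x)y+(-1)^{|x|}x\sigma(y)$ and $\sigma(x)\cdot a=(-1)^{|a|}\sigma(x\cdot a)$. A filtered differential graded right $\mathcal A$-module algebra $(P_*,\bar\sigma)$ is such an algebra with an ascending filtration by right $\mathcal A$-submodules $F_nP_*$, $n\in\mathbb Z$, with $F_aP_*\cdot F_bP_*\subset F_{a+b}P_*$ and $\bar\sigma(F_nP_* )\subset F_{n+a}P_*$ for some fixed $a$ (here $a=1$). The completion is $P_*^\wedge=\lim_nP_*/F_nP_*$ with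 $F_nP_*^\wedge=\ker(P_*^\wedge\to P_*/F_nP_* )$; $P_*$ is complete (Hausdorff) if $P_*\cong P_*^\wedge$, and a complete differential graded right $\mathcal A$-module algebra is the corresponding structure on a complete Hausdorff object, with product defined on the completed tensor product $P_*\widehat\otimes P_*=(P_*\otimes P_* )^\wedge$ formed with respect to $F_n(P_*\otimes P_* )=\sum_{a+b=n}F_aP_*\otimes F_bP_*$. A filtration is relatively bounded below if for some $k$, $P_*/F_nP_*$ vanishes in degrees $\le n+k$ for all $n$. $r_+(M_* )=\hat H^{-*}(C_p;\mathbb F_p)\otimes M_*$, with $\hat H^{-*}(C_p;\mathbb F_p)=E(u)\otimes P(t^{\pm1})$ for $p$ odd and $P(u^{\pm1})$ for $p=2$ (with $t=u^2$), $|u|=-1$, $|t|=-2$; filtration $F_nr_+(M_* )=\langle u^it^r\otimes x\mid-i-2r-|x|(p-1)\le n\rangle$ ($i\in\{0,1\}$); product $(u^it^r\otimes x)(u^jt^s\otimes y)=(-1)^{|x|j}u^{i+j}t^{r+s}\otimes xy$; $R_+(M_* )=r_+(M_* )^\wedge$. Operations: $$P^s_*(t^r\otimes x)=\sum_k\binom{-1-r-s(p-1)}{s-pk}t^{r+(s-k)(p-1)}\otimes P^k_*(x)-\sum_k\binom{-1-r-s(p-1)}{s-pk-1}ut^{-1+r+(s-k)(p-1)}\otimes P^k_*\beta_*(x),$$ $P^s_*(ut^r\otimes x)=\sum_k\binom{-1-r-s(p-1)}{s-pk}ut^{r+(s-k)(p-1)}\otimes P^k_*(x)$, $\beta_*(t^r\otimes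 x)=0$, $\beta_*(ut^r\otimes x)=t^{r+1}\otimes x$ for $p$ odd; $Sq^s_*(u^r\otimes x)=\sum_k\binom{-1-r-s}{s-2k}u^{r+s-k}\otimes Sq^k_*(x)$ for $p=2$. The differential: $\bar\sigma(t^r\otimes x)=t^r\otimes\sigma(x)$ and $\bar\sigma(ut^r\otimes x)=t^r\otimes x-ut^r\otimes\sigma(x)$ for $p$ odd; $\bar\sigma(u^{2r}\otimes x)=u^{2r}\otimes\sigma(x)$ and $\bar\sigma(u^{2r+1}\otimes x)=u^{2r}\otimes x+u^{2r+1}\otimes\sigma(x)$ for $p=2$; on $R_+(M_* )$, $\bar\sigma$ is the induced differential. *)

theory Defs
  imports
    "HOL-Algebra.QuotRing"
    "HOL-Algebra.Module"
    "HOL-Number_Theory.Residues"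
    "HOL-Library.Poly_Mapping"
begin

section \<open>Modules: homomorphisms, spans, quotients, free modules\<close>

text \<open>Records extending \<^typ>\<open>('a, 'b) module\<close> carry ring multiplication and unit fields that
  play no role for modules; they are left undefined in all constructions below.\<close>

definition mod_hom :: "('c, 'k) ring_scheme \<Rightarrow> ('c, 'a, 'm) module_scheme
    \<Rightarrow> ('c, 'b, 'n) module_scheme \<Rightarrow> ('a \<Rightarrow> 'b) set" where
  "mod_hom R V W = {f \<in> carrier V \<rightarrow> carrier W.
     (\<forall>x\<in>carrier V. \<forall>y\<in>carrier V. f (x \<oplus>\<^bsub>V\<^esub> y) = f x \<oplus>\<^bsub>W\<^esub> f y) \<and>
     (\<forall>c\<in>carrier R. \<forall>x\<in>carrier V. f (c \<odot>\<^bsub>V\<^esub> x) = c \<odot>\<^bsub>W\<^esub> f x)}"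

definition mod_span :: "('c, 'k) ring_scheme \<Rightarrow> ('c, 'a, 'm) module_scheme \<Rightarrow> 'a set \<Rightarrow> 'a set" where
  "mod_span R V S = \<Inter>{W. submodule W R V \<and> S \<subseteq> W}"

definition quot_mod :: "('c, 'a, 'm) module_scheme \<Rightarrow> 'a set \<Rightarrow> ('c, 'a set) module" where
  "quot_mod V W = \<lparr>carrier = a_rcosets\<^bsub>V\<^esub> W, monoid.mult = undefined, one = undefined,
     zero = W, add = set_add V, smult = (\<lambda>c X. (smult V c ` X) <+>\<^bsub>V\<^esub> W)\<rparr>"

text \<open>For \<open>f : V \<rightarrow> V'\<close> carrying a submodule of \<open>V\<close> into \<open>W'\<close>, the map induced on cosets with
  values in \<open>V'/W'\<close>.\<close>

definition quot_map :: "('c, 'b, 'm) module_scheme \<Rightarrow> 'b set \<Rightarrow> ('a \<Rightarrow> 'b) \<Rightarrow> 'a set \<Rightarrow> 'b set" where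
  "quot_map V' W' f X = (f ` X) <+>\<^bsub>V'\<^esub> W'"

definition free_mod :: "('c, 'k) ring_scheme \<Rightarrow> 'g set \<Rightarrow> ('c, 'g \<Rightarrow> 'c) module" where
  "free_mod R G = \<lparr>carrier = {f. (\<forall>g. f g \<in> carrier R) \<and> finite {g. f g \<noteq> \<zero>\<^bsub>R\<^esub>} \<and> {g. f g \<noteq> \<zero>\<^bsub>R\<^esub>} \<subseteq> G},
     monoid.mult = undefined, one = undefined,
     zero = (\<lambda>g. \<zero>\<^bsub>R\<^esub>), add = (\<lambda>f h g. f g \<oplus>\<^bsub>R\<^esub> h g),
     smult = (\<lambda>c f g. c \<otimes>\<^bsub>R\<^esub> f g)\<rparr>"

definition free_basis :: "('c, 'k) ring_scheme \<Rightarrow> 'g \<Rightarrow> 'g \<Rightarrow> 'c" where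
  "free_basis R g = (\<lambda>h. if h = g then \<one>\<^bsub>R\<^esub> else \<zero>\<^bsub>R\<^esub>)"

definition free_ext :: "('c, 'k) ring_scheme \<Rightarrow> ('c, 'b, 'm) module_scheme \<Rightarrow> ('g \<Rightarrow> 'b)
    \<Rightarrow> ('g \<Rightarrow> 'c) \<Rightarrow> 'b" where
  "free_ext R W T f = (\<Oplus>\<^bsub>W\<^esub>g\<in>{g. f g \<noteq> \<zero>\<^bsub>R\<^esub>}. f g \<odot>\<^bsub>W\<^esub> T g)"

abbreviation Fp :: "nat \<Rightarrow> int ring" where
  "Fp p \<equiv> residue_ring (int p)"

text \<open>Integers acting through their residue class, and the sign \<open>(-1)\<^sup>e\<close>.\<close>

definition zmult :: "nat \<Rightarrow> (int, 'a, 'm) module_scheme \<Rightarrow> int \<Rightarrow> 'a \<Rightarrow> 'a" where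
  "zmult p V c x = (c mod int p) \<odot>\<^bsub>V\<^esub> x"

definition sgn_mult :: "(int, 'a, 'm) module_scheme \<Rightarrow> int \<Rightarrow> 'a \<Rightarrow> 'a" where
  "sgn_mult V e x = (if even e then x else \<ominus>\<^bsub>V\<^esub> x)"

definition ibinom :: "int \<Rightarrow> int \<Rightarrow> int" where
  "ibinom a b = (if b < 0 then 0 else (\<Prod>i<nat b. a - int i) div fact (nat b))"


section \<open>The mod p Steenrod algebra\<close>

text \<open>\<open>Pow s\<close> stands for \<open>P\<^sup>s\<close> if \<open>p\<close> is odd and for \<open>Sq\<^sup>s\<close> if \<open>p = 2\<close>;
  \<open>Bock\<close> stands for \<open>\<beta>\<close>, which is identified with \<open>Sq\<^sup>1\<close> if \<open>p = 2\<close>.\<close>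

datatype sgen = Bock | Pow nat

definition gen_deg :: "nat \<Rightarrow> sgen \<Rightarrow> nat" where
  "gen_deg p g = (case g of Bock \<Rightarrow> 1 | Pow s \<Rightarrow> if p = 2 then s else 2 * s * (p - 1))"

text \<open>Words in the generators form the free monoid, written additively so that
  \<^typ>\<open>_ \<Rightarrow>\<^sub>0 int\<close> with convolution product is the free associative ring on the generators.\<close>

datatype word = Word (letters: "sgen list")

instantiation word :: monoid_add
begin
definition zero_word :: word where "zero_word = Word []"
definition plus_word :: "word \<Rightarrow> word \<Rightarrow> word" where "plus_word v w = Word (letters v @ letters w)"
instance by standard (auto simp: zero_word_def plus_word_def)
end

type_synonym free_alg = "word \<Rightarrow>\<^sub>0 int"

definition wmon :: "sgen list \<Rightarrow> free_alg" where
  "wmon gs = Poly_Mapping.single (Word gs) 1"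

definition free_ring :: "free_alg ring" where
  "free_ring = \<lparr>carrier = UNIV, monoid.mult = (*), one = 1, zero = 0, add = (+)\<rparr>"

definition word_deg :: "nat \<Rightarrow> word \<Rightarrow> nat" where
  "word_deg p w = sum_list (map (gen_deg p) (letters w))"

definition free_deg :: "nat \<Rightarrow> nat \<Rightarrow> free_alg set" where
  "free_deg p k = {f. \<forall>w\<in>Poly_Mapping.keys f. word_deg p w = k}"

definition adem_even :: "free_alg set" where
  "adem_even = {wmon [Pow a, Pow b]
       - (\<Sum>c = 0..a div 2. of_int (ibinom (int b - int c - 1) (int a - 2 * int c))
            * wmon [Pow (a + b - c), Pow c]) | a b. 0 < a \<and> a < 2 * b}"

definition adem_odd :: "nat \<Rightarrow> free_alg set" where
  "adem_odd p = {wmon [Pow a, Pow b]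
       - (\<Sum>i = 0..a div p. of_int ((-1) ^ (a + i)
              * ibinom ((int p - 1) * (int b - int i) - 1) (int a - int p * int i))
            * wmon [Pow (a + b - i), Pow i]) | a b. 0 < a \<and> a < p * b}
   \<union> {wmon [Pow a, Bock, Pow b]
       - (\<Sum>i = 0..a div p. of_int ((-1) ^ (a + i)
              * ibinom ((int p - 1) * (int b - int i)) (int a - int p * int i))
            * wmon [Bock, Pow (a + b - i), Pow i])
       - (\<Sum>i = 0..(a - 1) div p. of_int ((-1) ^ (a + i + 1)
              * ibinom ((int p - 1) * (int b - int i) - 1) (int a - int p * int i - 1))
            * wmon [Pow (a + b - i), Bock, Pow i]) | a b. 0 < a \<and> a \<le> p * b}"

definition steenrod_rels :: "nat \<Rightarrow> free_alg set" where
  "steenrod_rels p = {of_nat p, wmon [Pow 0] - 1} \<union>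
     (if p = 2 then {wmon [Bock] - wmon [Pow 1]} \<union> adem_even
      else {wmon [Bock, Bock]} \<union> adem_odd p)"

definition steenrod_ideal :: "nat \<Rightarrow> free_alg set" where
  "steenrod_ideal p = Idl\<^bsub>free_ring\<^esub> (steenrod_rels p)"

definition steenrod :: "nat \<Rightarrow> free_alg set ring" where
  "steenrod p = free_ring Quot steenrod_ideal p"

definition steenrod_class :: "nat \<Rightarrow> free_alg \<Rightarrow> free_alg set" where
  "steenrod_class p f = steenrod_ideal p +>\<^bsub>free_ring\<^esub> f"

definition steenrod_deg :: "nat \<Rightarrow> nat \<Rightarrow> free_alg set set" where
  "steenrod_deg p k = {a \<in> carrier (steenrod p). \<exists>f\<in>free_deg p k. a = steenrod_class p f}"


section \<open>Differential graded right modules over the Steenrod algebra\<close>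

text \<open>A graded object is a family of \<open>\<F>\<^sub>p\<close>-modules indexed by the degree. Maps between graded objects
  take the degree of their argument as an explicit parameter. The right action of the
  Steenrod algebra is stored through the operators of its generators: \<open>sop V (Pow s) d\<close> is
  \<open>P\<^sup>s\<^sub>*\<close> (or \<open>Sq\<^sup>s\<^sub>*\<close>) and \<open>sop V Bock d\<close> is \<open>\<beta>\<^sub>*\<close> on elements of degree \<open>d\<close>.\<close>

record 'a dgmod =
  grd :: "int \<Rightarrow> (int, 'a) module"
  sop :: "sgen \<Rightarrow> int \<Rightarrow> 'a \<Rightarrow> 'a"
  dif :: "int \<Rightarrow> 'a \<Rightarrow> 'a"

primrec word_act :: "nat \<Rightarrow> ('a, 'z) dgmod_scheme \<Rightarrow> sgen list \<Rightarrow> int \<Rightarrow> 'a \<Rightarrow> 'a" where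
  "word_act p V [] d x = x"
| "word_act p V (g # gs) d x = word_act p V gs (d - int (gen_deg p g)) (sop V g d x)"

definition free_act :: "nat \<Rightarrow> ('a, 'z) dgmod_scheme \<Rightarrow> nat \<Rightarrow> int \<Rightarrow> free_alg \<Rightarrow> 'a \<Rightarrow> 'a" where
  "free_act p V k d f x = (\<Oplus>\<^bsub>grd V (d - int k)\<^esub>w\<in>Poly_Mapping.keys f.
     zmult p (grd V (d - int k)) (Poly_Mapping.lookup f w) (word_act p V (letters w) d x))"

text \<open>\<open>sact p V k d a x\<close> is \<open>x \<cdot> a\<close> for \<open>x\<close> of degree \<open>d\<close> and \<open>a\<close> in degree \<open>k\<close> of the Steenrod algebra.\<close>

definition sact :: "nat \<Rightarrow> ('a, 'z) dgmod_scheme \<Rightarrow> nat \<Rightarrow> int \<Rightarrow> free_alg set \<Rightarrow> 'a \<Rightarrow> 'a" where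
  "sact p V k d a x = free_act p V k d (SOME f. f \<in> a \<and> f \<in> free_deg p k) x"

text \<open>A right module over the quotient \<^term>\<open>steenrod p\<close> of the free algebra is a right module over
  the free algebra (arbitrary linear operators for the generators) whose action factors
  through the quotient.\<close>

locale right_A_module =
  fixes p :: nat and V :: "('a, 'z) dgmod_scheme"
  assumes p_prime: "prime p"
    and grd_module: "\<And>d. module (Fp p) (grd V d)"
    and sop_hom: "\<And>g d. sop V g d \<in> mod_hom (Fp p) (grd V d) (grd V (d - int (gen_deg p g)))"
    and act_descends: "\<And>k d f g x. \<lbrakk>f \<in> free_deg p k; g \<in> free_deg p k;
          steenrod_class p f = steenrod_class p g; x \<in> carrier (grd V d)\<rbrakk>
        \<Longrightarrow> free_act p V k d f x = free_act p V k d g x"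

locale dg_right_A_module = right_A_module p V for p and V :: "('a, 'z) dgmod_scheme" +
  assumes dif_hom: "\<And>d. dif V d \<in> mod_hom (Fp p) (grd V d) (grd V (d + 1))"
    and dif_dif: "\<And>d x. x \<in> carrier (grd V d) \<Longrightarrow> dif V (d + 1) (dif V d x) = \<zero>\<^bsub>grd V (d + 2)\<^esub>"
    and dif_act: "\<And>k d a x. \<lbrakk>a \<in> steenrod_deg p k; x \<in> carrier (grd V d)\<rbrakk> \<Longrightarrow>
          sact p V k (d + 1) a (dif V d x)
          = sgn_mult (grd V (d - int k + 1)) (int k) (dif V (d - int k) (sact p V k d a x))"

record 'a dgalg = "'a dgmod" +
  gunit :: 'a
  gmul :: "int \<Rightarrow> int \<Rightarrow> 'a \<Rightarrow> 'a \<Rightarrow> 'a"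

text \<open>\<open>gmul M d e\<close> multiplies elements of degrees \<open>d\<close> and \<open>e\<close>. Linearity of unit and product over the
  Steenrod algebra is stated on its generators. The operators \<open>P\<^sup>s\<^sub>*\<close> and \<open>\<beta>\<^sub>*\<close> follow the sign rule
  for operators written on the left, so \<open>\<beta>\<^sub>*\<close> acts diagonally by
  \<open>\<beta>\<^sub>*(x \<otimes> y) = \<beta>\<^sub>* x \<otimes> y + (-1)\<^bsup>|x|\<^esup> x \<otimes> \<beta>\<^sub>* y\<close>.\<close>

locale dg_A_algebra = dg_right_A_module p M for p and M :: "('a, 'z) dgalg_scheme" +
  assumes mul_left: "\<And>d e y. y \<in> carrier (grd M e) \<Longrightarrow>
        (\<lambda>x. gmul M d e x y) \<in> mod_hom (Fp p) (grd M d) (grd M (d + e))"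
    and mul_right: "\<And>d e x. x \<in> carrier (grd M d) \<Longrightarrow>
        gmul M d e x \<in> mod_hom (Fp p) (grd M e) (grd M (d + e))"
    and unit_closed: "gunit M \<in> carrier (grd M 0)"
    and unit_left: "\<And>d x. x \<in> carrier (grd M d) \<Longrightarrow> gmul M 0 d (gunit M) x = x"
    and unit_right: "\<And>d x. x \<in> carrier (grd M d) \<Longrightarrow> gmul M d 0 x (gunit M) = x"
    and mul_assoc: "\<And>d e f x y z. \<lbrakk>x \<in> carrier (grd M d); y \<in> carrier (grd M e); z \<in> carrier (grd M f)\<rbrakk>
        \<Longrightarrow> gmul M (d + e) f (gmul M d e x y) z = gmul M d (e + f) x (gmul M e f y z)"
    and unit_Bock: "sop M Bock 0 (gunit M) = \<zero>\<^bsub>grd M (-1)\<^esub>"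
    and unit_Pow: "\<And>s. s > 0 \<Longrightarrow> sop M (Pow s) 0 (gunit M) = \<zero>\<^bsub>grd M (- int (gen_deg p (Pow s)))\<^esub>"
    and mul_Bock: "\<And>d e x y. \<lbrakk>x \<in> carrier (grd M d); y \<in> carrier (grd M e)\<rbrakk> \<Longrightarrow>
        sop M Bock (d + e) (gmul M d e x y)
        = gmul M (d - 1) e (sop M Bock d x) y
          \<oplus>\<^bsub>grd M (d + e - 1)\<^esub> sgn_mult (grd M (d + e - 1)) d (gmul M d (e - 1) x (sop M Bock e y))"
    and mul_Pow: "\<And>s d e x y. \<lbrakk>x \<in> carrier (grd M d); y \<in> carrier (grd M e)\<rbrakk> \<Longrightarrow>
        sop M (Pow s) (d + e) (gmul M d e x y)
        = (\<Oplus>\<^bsub>grd M (d + e - int (gen_deg p (Pow s)))\<^esub>i\<in>{0..s}.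
             gmul M (d - int (gen_deg p (Pow i))) (e - int (gen_deg p (Pow (s - i))))
               (sop M (Pow i) d x) (sop M (Pow (s - i)) e y))"
    and dif_mul: "\<And>d e x y. \<lbrakk>x \<in> carrier (grd M d); y \<in> carrier (grd M e)\<rbrakk> \<Longrightarrow>
        dif M (d + e) (gmul M d e x y)
        = gmul M (d + 1) e (dif M d x) y
          \<oplus>\<^bsub>grd M (d + e + 1)\<^esub> sgn_mult (grd M (d + e + 1)) d (gmul M d (e + 1) x (dif M e y))"


section \<open>Filtrations\<close>

text \<open>\<open>Fl n d\<close> is the degree \<open>d\<close> part of filtration \<open>n\<close>; \<open>s\<close> is the amount by which the differential
  may raise filtration.\<close>

locale filtered_dg_right_A_module = dg_right_A_module p V for p and V :: "('a, 'z) dgmod_scheme" +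
  fixes Fl :: "int \<Rightarrow> int \<Rightarrow> 'a set" and s :: int
  assumes Fl_submodule: "\<And>n d. submodule (Fl n d) (Fp p) (grd V d)"
    and Fl_mono: "\<And>m n d. m \<le> n \<Longrightarrow> Fl m d \<subseteq> Fl n d"
    and Fl_act: "\<And>n k d a x. \<lbrakk>a \<in> steenrod_deg p k; x \<in> Fl n d\<rbrakk> \<Longrightarrow> sact p V k d a x \<in> Fl n (d - int k)"
    and Fl_dif: "\<And>n d x. x \<in> Fl n d \<Longrightarrow> dif V d x \<in> Fl (n + s) (d + 1)"

locale filtered_dg_A_algebra =
  dg_A_algebra p P + filtered_dg_right_A_module p P Fl s
  for p and P :: "('a, 'z) dgalg_scheme" and Fl and s +
  assumes Fl_mul: "\<And>m n d e x y. \<lbrakk>x \<in> Fl m d; y \<in> Fl n e\<rbrakk> \<Longrightarrow> gmul P d e x y \<in> Fl (m + n) (d + e)"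

definition rel_bounded_below :: "('a, 'z) dgmod_scheme \<Rightarrow> (int \<Rightarrow> int \<Rightarrow> 'a set) \<Rightarrow> bool" where
  "rel_bounded_below V Fl \<longleftrightarrow> (\<exists>k. \<forall>n d. d \<le> n + k \<longrightarrow>
     carrier (quot_mod (grd V d) (Fl n d)) = {\<zero>\<^bsub>quot_mod (grd V d) (Fl n d)\<^esub>})"

definition bounded_below :: "('a, 'z) dgmod_scheme \<Rightarrow> bool" where
  "bounded_below V \<longleftrightarrow> (\<exists>k. \<forall>d<k. carrier (grd V d) = {\<zero>\<^bsub>grd V d\<^esub>})"

text \<open>An element of \<open>lim\<^sub>n V/F\<^sub>nV\<close> is a family of cosets \<open>x n\<close>, each mapping to the next under the
  projections \<open>V/F\<^sub>m \<rightarrow> V/F\<^sub>n\<close> for \<open>m \<le> n\<close>. A map raising filtration by \<open>s\<close> sends \<open>x\<close> to the family whose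
  \<open>n\<close>-th member is the image of \<open>x (n - s)\<close>.\<close>

definition completion :: "int \<Rightarrow> nat \<Rightarrow> ('a, 'z) dgmod_scheme \<Rightarrow> (int \<Rightarrow> int \<Rightarrow> 'a set)
    \<Rightarrow> (int \<Rightarrow> 'a set) dgmod" where
  "completion s p V Fl =
     \<lparr>grd = (\<lambda>d. \<lparr>carrier = {x. (\<forall>n. x n \<in> carrier (quot_mod (grd V d) (Fl n d))) \<and>
                             (\<forall>m n. m \<le> n \<longrightarrow> quot_map (grd V d) (Fl n d) id (x m) = x n)},
               monoid.mult = undefined, one = undefined,
               zero = (\<lambda>n. \<zero>\<^bsub>quot_mod (grd V d) (Fl n d)\<^esub>),
               add = (\<lambda>x y n. x n \<oplus>\<^bsub>quot_mod (grd V d) (Fl n d)\<^esub> y n),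
               smult = (\<lambda>c x n. c \<odot>\<^bsub>quot_mod (grd V d) (Fl n d)\<^esub> x n)\<rparr>),
      sop = (\<lambda>g d x n. quot_map (grd V (d - int (gen_deg p g))) (Fl n (d - int (gen_deg p g)))
               (sop V g d) (x n)),
      dif = (\<lambda>d x n. quot_map (grd V (d + 1)) (Fl n (d + 1)) (dif V d) (x (n - s)))\<rparr>"

definition compl_map :: "('a, 'z) dgmod_scheme \<Rightarrow> (int \<Rightarrow> int \<Rightarrow> 'a set) \<Rightarrow> int \<Rightarrow> 'a \<Rightarrow> int \<Rightarrow> 'a set" where
  "compl_map V Fl d x = (\<lambda>n. Fl n d +>\<^bsub>grd V d\<^esub> x)"

text \<open>The kernel of the projection to \<open>V/F\<^sub>nV\<close>.\<close>

definition compl_fil :: "int \<Rightarrow> nat \<Rightarrow> ('a, 'z) dgmod_scheme \<Rightarrow> (int \<Rightarrow> int \<Rightarrow> 'a set)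
    \<Rightarrow> int \<Rightarrow> int \<Rightarrow> (int \<Rightarrow> 'a set) set" where
  "compl_fil s p V Fl n d = {x \<in> carrier (grd (completion s p V Fl) d). x n = \<zero>\<^bsub>quot_mod (grd V d) (Fl n d)\<^esub>}"

definition complete_Hausdorff :: "int \<Rightarrow> nat \<Rightarrow> ('a, 'z) dgmod_scheme \<Rightarrow> (int \<Rightarrow> int \<Rightarrow> 'a set) \<Rightarrow> bool" where
  "complete_Hausdorff s p V Fl \<longleftrightarrow>
     (\<forall>d. bij_betw (compl_map V Fl d) (carrier (grd V d)) (carrier (grd (completion s p V Fl) d)))"


section \<open>Tensor products\<close>

text \<open>The degree \<open>d\<close> part of \<open>V \<otimes> W\<close> is the free \<open>\<F>\<^sub>p\<close>-module on symbols \<open>(i, x, y)\<close>, with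
  \<open>|x| = i\<close> and \<open>|y| = d - i\<close>, modulo the bilinearity relations.\<close>

type_synonym ('a, 'b) pretensor = "(int \<times> 'a \<times> 'b) \<Rightarrow> int"
type_synonym ('a, 'b) tens = "('a, 'b) pretensor set"
type_synonym ('a, 'b) ctens = "int \<Rightarrow> ('a, 'b) tens set"

definition tens_free :: "nat \<Rightarrow> ('a, 'y) dgmod_scheme \<Rightarrow> ('b, 'z) dgmod_scheme \<Rightarrow> int
    \<Rightarrow> (int, ('a, 'b) pretensor) module" where
  "tens_free p V W d = free_mod (Fp p) {(i, x, y). x \<in> carrier (grd V i) \<and> y \<in> carrier (grd W (d - i))}"

definition tens_gen :: "nat \<Rightarrow> int \<Rightarrow> 'a \<Rightarrow> 'b \<Rightarrow> ('a, 'b) pretensor" where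
  "tens_gen p i x y = free_basis (Fp p) (i, x, y)"

definition tens_rels :: "nat \<Rightarrow> ('a, 'y) dgmod_scheme \<Rightarrow> ('b, 'z) dgmod_scheme \<Rightarrow> int
    \<Rightarrow> ('a, 'b) pretensor set" where
  "tens_rels p V W d =
     {tens_gen p i (x \<oplus>\<^bsub>grd V i\<^esub> x') y \<ominus>\<^bsub>tens_free p V W d\<^esub> (tens_gen p i x y \<oplus>\<^bsub>tens_free p V W d\<^esub> tens_gen p i x' y)
       | i x x' y. x \<in> carrier (grd V i) \<and> x' \<in> carrier (grd V i) \<and> y \<in> carrier (grd W (d - i))}
   \<union> {tens_gen p i x (y \<oplus>\<^bsub>grd W (d - i)\<^esub> y') \<ominus>\<^bsub>tens_free p V W d\<^esub> (tens_gen p i x y \<oplus>\<^bsub>tens_free p V W d\<^esub> tens_gen p i x y')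
       | i x y y'. x \<in> carrier (grd V i) \<and> y \<in> carrier (grd W (d - i)) \<and> y' \<in> carrier (grd W (d - i))}
   \<union> {tens_gen p i (c \<odot>\<^bsub>grd V i\<^esub> x) y \<ominus>\<^bsub>tens_free p V W d\<^esub> (c \<odot>\<^bsub>tens_free p V W d\<^esub> tens_gen p i x y)
       | c i x y. c \<in> carrier (Fp p) \<and> x \<in> carrier (grd V i) \<and> y \<in> carrier (grd W (d - i))}
   \<union> {tens_gen p i x (c \<odot>\<^bsub>grd W (d - i)\<^esub> y) \<ominus>\<^bsub>tens_free p V W d\<^esub> (c \<odot>\<^bsub>tens_free p V W d\<^esub> tens_gen p i x y)
       | c i x y. c \<in> carrier (Fp p) \<and> x \<in> carrier (grd V i) \<and> y \<in> carrier (grd W (d - i))}"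

definition tens_ker :: "nat \<Rightarrow> ('a, 'y) dgmod_scheme \<Rightarrow> ('b, 'z) dgmod_scheme \<Rightarrow> int
    \<Rightarrow> ('a, 'b) pretensor set" where
  "tens_ker p V W d = mod_span (Fp p) (tens_free p V W d) (tens_rels p V W d)"

text \<open>\<open>pure_tens p V W d i x y\<close> is \<open>x \<otimes> y\<close> with \<open>|x| = i\<close> and \<open>|y| = d - i\<close>.\<close>

definition pure_tens :: "nat \<Rightarrow> ('a, 'y) dgmod_scheme \<Rightarrow> ('b, 'z) dgmod_scheme \<Rightarrow> int
    \<Rightarrow> int \<Rightarrow> 'a \<Rightarrow> 'b \<Rightarrow> ('a, 'b) tens" where
  "pure_tens p V W d i x y = tens_ker p V W d +>\<^bsub>tens_free p V W d\<^esub> tens_gen p i x y"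

text \<open>The diagonal operators, on symbols \<open>(i, x, y)\<close> of total degree \<open>d\<close>.\<close>

definition diag_op :: "nat \<Rightarrow> ('a, 'y) dgmod_scheme \<Rightarrow> ('b, 'z) dgmod_scheme \<Rightarrow> sgen \<Rightarrow> int
    \<Rightarrow> int \<times> 'a \<times> 'b \<Rightarrow> ('a, 'b) pretensor" where
  "diag_op p V W g d = (\<lambda>(i, x, y). let T = tens_free p V W (d - int (gen_deg p g)) in
     case g of
       Bock \<Rightarrow> tens_gen p (i - 1) (sop V Bock i x) y
               \<oplus>\<^bsub>T\<^esub> sgn_mult T i (tens_gen p i x (sop W Bock (d - i) y))
     | Pow s \<Rightarrow> (\<Oplus>\<^bsub>T\<^esub>j\<in>{0..s}. tens_gen p (i - int (gen_deg p (Pow j)))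
                   (sop V (Pow j) i x) (sop W (Pow (s - j)) (d - i) y)))"

definition diag_dif :: "nat \<Rightarrow> ('a, 'y) dgmod_scheme \<Rightarrow> ('b, 'z) dgmod_scheme \<Rightarrow> int
    \<Rightarrow> int \<times> 'a \<times> 'b \<Rightarrow> ('a, 'b) pretensor" where
  "diag_dif p V W d = (\<lambda>(i, x, y). let T = tens_free p V W (d + 1) in
     tens_gen p (i + 1) (dif V i x) y \<oplus>\<^bsub>T\<^esub> sgn_mult T i (tens_gen p i x (dif W (d - i) y)))"

definition tensor :: "nat \<Rightarrow> ('a, 'y) dgmod_scheme \<Rightarrow> ('b, 'z) dgmod_scheme
    \<Rightarrow> ('a, 'b) tens dgmod" where
  "tensor p V W =
     \<lparr>grd = (\<lambda>d. quot_mod (tens_free p V W d) (tens_ker p V W d)),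
      sop = (\<lambda>g d. let d' = d - int (gen_deg p g) in
               quot_map (tens_free p V W d') (tens_ker p V W d')
                 (free_ext (Fp p) (tens_free p V W d') (diag_op p V W g d))),
      dif = (\<lambda>d. quot_map (tens_free p V W (d + 1)) (tens_ker p V W (d + 1))
                 (free_ext (Fp p) (tens_free p V W (d + 1)) (diag_dif p V W d)))\<rparr>"

text \<open>\<open>F\<^sub>n(V \<otimes> W) = \<Sum>\<^bsub>a+b=n\<^esub> F\<^sub>aV \<otimes> F\<^sub>bW\<close>.\<close>

definition tensor_fil :: "nat \<Rightarrow> ('a, 'y) dgmod_scheme \<Rightarrow> (int \<Rightarrow> int \<Rightarrow> 'a set)
    \<Rightarrow> ('b, 'z) dgmod_scheme \<Rightarrow> (int \<Rightarrow> int \<Rightarrow> 'b set) \<Rightarrow> int \<Rightarrow> int \<Rightarrow> ('a, 'b) tens set" where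
  "tensor_fil p V FV W FW n d = mod_span (Fp p) (grd (tensor p V W) d)
     {pure_tens p V W d i x y | a b i x y. a + b = n \<and> x \<in> FV a i \<and> y \<in> FW b (d - i)}"

abbreviation ctensor :: "int \<Rightarrow> nat \<Rightarrow> ('a, 'y) dgmod_scheme \<Rightarrow> (int \<Rightarrow> int \<Rightarrow> 'a set)
    \<Rightarrow> ('b, 'z) dgmod_scheme \<Rightarrow> (int \<Rightarrow> int \<Rightarrow> 'b set) \<Rightarrow> ('a, 'b) ctens dgmod" where
  "ctensor s p V FV W FW \<equiv> completion s p (tensor p V W) (tensor_fil p V FV W FW)"

text \<open>The image of \<open>x \<otimes> y\<close>, with \<open>|x| = d\<close> and \<open>|y| = e\<close>, in the completed tensor product.\<close>

definition pure_ctens :: "nat \<Rightarrow> ('a, 'y) dgmod_scheme \<Rightarrow> (int \<Rightarrow> int \<Rightarrow> 'a set)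
    \<Rightarrow> ('b, 'z) dgmod_scheme \<Rightarrow> (int \<Rightarrow> int \<Rightarrow> 'b set) \<Rightarrow> int \<Rightarrow> int \<Rightarrow> 'a \<Rightarrow> 'b
    \<Rightarrow> ('a, 'b) ctens" where
  "pure_ctens p V FV W FW d e x y =
     compl_map (tensor p V W) (tensor_fil p V FV W FW) (d + e) (pure_tens p V W (d + e) d x y)"

text \<open>In the complete setting the product is a filtered map \<open>mu\<close> out of the completed tensor product
  \<open>P \<otimes> P\<close>, compatible with the completed diagonal action and differential; compatibility
  with the latter is the Leibniz rule. As \<open>mu\<close> is filtered, the associativity and unit laws are
  determined by their instances on pure tensors.\<close>

locale complete_dg_A_algebra =
  filtered_dg_right_A_module p P Fl s
  for p and P :: "('a, 'z) dgmod_scheme" and Fl and s +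
  fixes un :: 'a and mu :: "int \<Rightarrow> ('a, 'a) ctens \<Rightarrow> 'a"
  assumes complete: "complete_Hausdorff s p P Fl"
    and mu_hom: "\<And>d. mu d \<in> mod_hom (Fp p) (grd (ctensor s p P Fl P Fl) d) (grd P d)"
    and mu_filtered: "\<And>n d \<xi>. \<xi> \<in> compl_fil s p (tensor p P P) (tensor_fil p P Fl P Fl) n d
          \<Longrightarrow> mu d \<xi> \<in> Fl n d"
    and mu_act: "\<And>k d a \<xi>. \<lbrakk>a \<in> steenrod_deg p k; \<xi> \<in> carrier (grd (ctensor s p P Fl P Fl) d)\<rbrakk> \<Longrightarrow>
          mu (d - int k) (sact p (ctensor s p P Fl P Fl) k d a \<xi>) = sact p P k d a (mu d \<xi>)"
    and mu_dif: "\<And>d \<xi>. \<xi> \<in> carrier (grd (ctensor s p P Fl P Fl) d) \<Longrightarrow>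
          mu (d + 1) (dif (ctensor s p P Fl P Fl) d \<xi>) = dif P d (mu d \<xi>)"
    and mu_assoc: "\<And>d e f x y z. \<lbrakk>x \<in> carrier (grd P d); y \<in> carrier (grd P e); z \<in> carrier (grd P f)\<rbrakk> \<Longrightarrow>
          mu (d + e + f) (pure_ctens p P Fl P Fl (d + e) f (mu (d + e) (pure_ctens p P Fl P Fl d e x y)) z)
          = mu (d + (e + f)) (pure_ctens p P Fl P Fl d (e + f) x (mu (e + f) (pure_ctens p P Fl P Fl e f y z)))"
    and un_closed: "un \<in> carrier (grd P 0)"
    and mu_un_left: "\<And>d x. x \<in> carrier (grd P d) \<Longrightarrow> mu (0 + d) (pure_ctens p P Fl P Fl 0 d un x) = x"
    and mu_un_right: "\<And>d x. x \<in> carrier (grd P d) \<Longrightarrow> mu (d + 0) (pure_ctens p P Fl P Fl d 0 x un) = x"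
    and un_Bock: "sop P Bock 0 un = \<zero>\<^bsub>grd P (-1)\<^esub>"
    and un_Pow: "\<And>r. r > 0 \<Longrightarrow> sop P (Pow r) 0 un = \<zero>\<^bsub>grd P (- int (gen_deg p (Pow r)))\<^esub>"


section \<open>The algebra \<open>r\<^sub>+(M)\<close> and its completion \<open>R\<^sub>+(M)\<close>\<close>

text \<open>Tate cohomology has a basis with one element \<open>u\<^sub>e\<close> in each degree \<open>-e\<close>, namely \<open>u\<^sup>e\<close> if \<open>p = 2\<close>, and
  \<open>u\<^sup>i t\<^sup>r\<close> with \<open>e = i + 2r\<close>, \<open>i \<in> {0,1}\<close> if \<open>p\<close> is odd, so that \<open>i = e mod 2\<close> and \<open>r = e div 2\<close>.
  An element \<open>\<Sum>\<^sub>e u\<^sub>e \<otimes> x\<^sub>e\<close> of degree \<open>d\<close> in \<open>r\<^sub>+(M)\<close> is represented by the finitely supported family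
  \<open>x\<close> with \<open>x e\<close> of degree \<open>d + e\<close>.\<close>

definition rgrd :: "('a, 'z) dgmod_scheme \<Rightarrow> int \<Rightarrow> (int, int \<Rightarrow> 'a) module" where
  "rgrd M d = \<lparr>carrier = {x. (\<forall>e. x e \<in> carrier (grd M (d + e))) \<and> finite {e. x e \<noteq> \<zero>\<^bsub>grd M (d + e)\<^esub>}},
     monoid.mult = undefined, one = undefined,
     zero = (\<lambda>e. \<zero>\<^bsub>grd M (d + e)\<^esub>),
     add = (\<lambda>x y e. x e \<oplus>\<^bsub>grd M (d + e)\<^esub> y e),
     smult = (\<lambda>c x e. c \<odot>\<^bsub>grd M (d + e)\<^esub> x e)\<rparr>"

text \<open>\<open>rmon M d e x\<close> is \<open>u\<^sub>e \<otimes> x\<close> in degree \<open>d = |x| - e\<close>.\<close>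

definition rmon :: "('a, 'z) dgmod_scheme \<Rightarrow> int \<Rightarrow> int \<Rightarrow> 'a \<Rightarrow> int \<Rightarrow> 'a" where
  "rmon M d e x = (\<lambda>e'. if e' = e then x else \<zero>\<^bsub>grd M (d + e')\<^esub>)"

definition rsupp :: "('a, 'z) dgmod_scheme \<Rightarrow> int \<Rightarrow> (int \<Rightarrow> 'a) \<Rightarrow> int set" where
  "rsupp M d x = {e. x e \<noteq> \<zero>\<^bsub>grd M (d + e)\<^esub>}"

text \<open>Linear extension of \<open>T\<close>, given on monomials as \<open>u\<^sub>e \<otimes> x \<mapsto> T e x\<close>, from degree \<open>d\<close> to degree \<open>d'\<close>.\<close>

definition rext :: "('a, 'z) dgmod_scheme \<Rightarrow> int \<Rightarrow> int \<Rightarrow> (int \<Rightarrow> 'a \<Rightarrow> int \<Rightarrow> 'a) \<Rightarrow> (int \<Rightarrow> 'a) \<Rightarrow> int \<Rightarrow> 'a" where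
  "rext M d d' T x = (\<Oplus>\<^bsub>rgrd M d'\<^esub>e\<in>rsupp M d x. T e (x e))"

definition rpow :: "nat \<Rightarrow> ('a, 'z) dgmod_scheme \<Rightarrow> nat \<Rightarrow> int \<Rightarrow> int \<Rightarrow> 'a \<Rightarrow> int \<Rightarrow> 'a" where
  "rpow p M s d e x = (
     let d' = d - int (gen_deg p (Pow s));
         R = rgrd M d';
         q = int p - 1;
         r = e div 2
     in if p = 2 then
          (\<Oplus>\<^bsub>R\<^esub>k\<in>{0..s}. zmult p R (ibinom (- 1 - e - int s) (int s - 2 * int k))
             (rmon M d' (e + int s - int k) (sop M (Pow k) (d + e) x)))
        else if even e then
          (\<Oplus>\<^bsub>R\<^esub>k\<in>{0..s}. zmult p R (ibinom (- 1 - r - int s * q) (int s - int p * int k))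
             (rmon M d' (2 * (r + (int s - int k) * q)) (sop M (Pow k) (d + e) x)))
          \<ominus>\<^bsub>R\<^esub>
          (\<Oplus>\<^bsub>R\<^esub>k\<in>{0..s}. zmult p R (ibinom (- 1 - r - int s * q) (int s - int p * int k - 1))
             (rmon M d' (1 + 2 * (- 1 + r + (int s - int k) * q))
                (sop M (Pow k) (d + e - 1) (sop M Bock (d + e) x))))
        else
          (\<Oplus>\<^bsub>R\<^esub>k\<in>{0..s}. zmult p R (ibinom (- 1 - r - int s * q) (int s - int p * int k))
             (rmon M d' (1 + 2 * (r + (int s - int k) * q)) (sop M (Pow k) (d + e) x))))"

definition rbock :: "nat \<Rightarrow> ('a, 'z) dgmod_scheme \<Rightarrow> int \<Rightarrow> int \<Rightarrow> 'a \<Rightarrow> int \<Rightarrow> 'a" where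
  "rbock p M d e x =
     (if p = 2 then rpow p M 1 d e x
      else if even e then \<zero>\<^bsub>rgrd M (d - 1)\<^esub>
      else rmon M (d - 1) (2 * (e div 2 + 1)) x)"

definition rdif :: "nat \<Rightarrow> ('a, 'z) dgmod_scheme \<Rightarrow> int \<Rightarrow> int \<Rightarrow> 'a \<Rightarrow> int \<Rightarrow> 'a" where
  "rdif p M d e x =
     (let R = rgrd M (d + 1); y = rmon M (d + 1) e (dif M (d + e) x)
      in if even e then y
         else if p = 2 then rmon M (d + 1) (e - 1) x \<oplus>\<^bsub>R\<^esub> y
         else rmon M (d + 1) (e - 1) x \<ominus>\<^bsub>R\<^esub> y)"

text \<open>The product of \<open>u\<^sub>a \<otimes> x\<close> in degree \<open>d\<close> and \<open>u\<^sub>b \<otimes> y\<close> in degree \<open>d'\<close>; note that \<open>u\<^sup>2 = 0\<close> for odd \<open>p\<close>.\<close>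

definition rmul_mon :: "nat \<Rightarrow> ('a, 'z) dgalg_scheme \<Rightarrow> int \<Rightarrow> int \<Rightarrow> int \<Rightarrow> int \<Rightarrow> 'a \<Rightarrow> 'a \<Rightarrow> int \<Rightarrow> 'a" where
  "rmul_mon p M d d' a b x y =
     (let xy = gmul M (d + a) (d' + b) x y
      in if p = 2 then rmon M (d + d') (a + b) xy
         else if odd a \<and> odd b then \<zero>\<^bsub>rgrd M (d + d')\<^esub>
         else sgn_mult (rgrd M (d + d')) ((d + a) * (b mod 2)) (rmon M (d + d') (a + b) xy))"

definition r_plus :: "nat \<Rightarrow> ('a, 'z) dgalg_scheme \<Rightarrow> (int \<Rightarrow> 'a) dgalg" where
  "r_plus p M =
     \<lparr>grd = rgrd M,
      sop = (\<lambda>g d. rext M d (d - int (gen_deg p g))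
               (case g of Bock \<Rightarrow> rbock p M d | Pow s \<Rightarrow> rpow p M s d)),
      dif = (\<lambda>d. rext M d (d + 1) (rdif p M d)),
      gunit = rmon M 0 0 (gunit M),
      gmul = (\<lambda>d d' x y. \<Oplus>\<^bsub>rgrd M (d + d')\<^esub>a\<in>rsupp M d x. \<Oplus>\<^bsub>rgrd M (d + d')\<^esub>b\<in>rsupp M d' y.
                rmul_mon p M d d' a b (x a) (y b))\<rparr>"

definition r_fil :: "nat \<Rightarrow> ('a, 'z) dgmod_scheme \<Rightarrow> int \<Rightarrow> int \<Rightarrow> (int \<Rightarrow> 'a) set" where
  "r_fil p M n d = mod_span (Fp p) (rgrd M d)
     {rmon M d e x | e x. x \<in> carrier (grd M (d + e)) \<and> - e - (d + e) * (int p - 1) \<le> n}"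

definition R_plus :: "nat \<Rightarrow> ('a, 'z) dgalg_scheme \<Rightarrow> (int \<Rightarrow> (int \<Rightarrow> 'a) set) dgmod" where
  "R_plus p M = completion 1 p (r_plus p M) (r_fil p M)"

definition R_fil :: "nat \<Rightarrow> ('a, 'z) dgalg_scheme \<Rightarrow> int \<Rightarrow> int \<Rightarrow> (int \<Rightarrow> (int \<Rightarrow> 'a) set) set" where
  "R_fil p M = compl_fil 1 p (r_plus p M) (r_fil p M)"

definition to_R :: "nat \<Rightarrow> ('a, 'z) dgalg_scheme \<Rightarrow> int \<Rightarrow> (int \<Rightarrow> 'a) \<Rightarrow> int \<Rightarrow> (int \<Rightarrow> 'a) set" where
  "to_R p M = compl_map (r_plus p M) (r_fil p M)"

text \<open>\<open>mu\<close> extends the product of \<open>r\<^sub>+(M)\<close>. As \<open>r\<^sub>+(M)\<close> is dense in \<open>R\<^sub>+(M)\<close>, at most one filtered map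
  \<open>mu\<close> does so.\<close>

definition extends_r_mul :: "nat \<Rightarrow> ('a, 'z) dgalg_scheme
    \<Rightarrow> (int \<Rightarrow> (int \<Rightarrow> (int \<Rightarrow> 'a) set, int \<Rightarrow> (int \<Rightarrow> 'a) set) ctens \<Rightarrow> int \<Rightarrow> (int \<Rightarrow> 'a) set) \<Rightarrow> bool" where
  "extends_r_mul p M mu \<longleftrightarrow>
     (\<forall>d e. \<forall>x\<in>carrier (grd (r_plus p M) d). \<forall>y\<in>carrier (grd (r_plus p M) e).
        mu (d + e) (pure_ctens p (R_plus p M) (R_fil p M) (R_plus p M) (R_fil p M) d e
                     (to_R p M d x) (to_R p M e y))
        = to_R p M (d + e) (gmul (r_plus p M) d e x y))"

end

theory Submission
  imports Defs
begin

text \<open>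
Since \<open>\<beta>\<close> vanishes on \<open>M\<close>, the operations on \<open>r\<^sub>+(M)\<close> take for all \<open>p\<close> (with \<open>t\<close> read as \<open>u\<close> if \<open>p = 2\<close>) the form
\<open>P\<^sup>s(t\<^sup>r \<otimes> x) = \<Sum>\<^sub>k c(r + pk(p-1), s - pk) t\<^bsup>r+(s-k)(p-1)\<^esup> \<otimes> P\<^sup>k x\<close>, where \<open>c(R, j)\<close> is the binomial coefficient
\<open>binom(-1-R-(p-1)j, j)\<close>. Modulo \<open>p\<close> these coefficients are determined by the recursion
\<open>c(R, j) = c(R+1, j) + c(R+p, j-1)\<close> and \<open>c(0, j) = 0\<close> for \<open>j \<noteq> 0\<close>. All identities between them come from this
characterization; the convolution formula \<open>psi_coeff_convolution\<close>, for instance, is the Cartan formula.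

The heart of the matter are the Adem relations. The composite of two operations on \<open>t\<^sup>r \<otimes> x\<close> is a combination of words
\<open>P\<^sup>k P\<^sup>l\<close> applied to \<open>x\<close>, with products of two coefficients \<open>c\<close>. The relations for these composites are derived from
those in \<open>M\<close> without evaluating any sum of triple products of binomial coefficients: call an array \<open>q(a,b)\<close> with values in an
abelian group of exponent \<open>p\<close> Dickson if it is obtained from arrays supported at \<open>(0,0)\<close> by differences and by multiplying
the generating function \<open>\<Sum> q(a,b) X\<^sup>a Y\<^sup>b\<close> with \<open>X + Y\<close> and \<open>X\<^sup>p Y\<close>. Every Dickson array satisfies the Adem relations
(\<open>dickson_adem\<close>); a homogeneous array satisfying them is Dickson (\<open>dickson_if_adem\<close>); and the passage from the words on \<open>x\<close>
to the words on \<open>t\<^sup>r \<otimes> x\<close> preserves Dickson arrays (\<open>dickson_two_step\<close>). Relations with \<open>\<beta>\<close> between two powers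
follow because such a composite is a sum of two composites without \<open>\<beta>\<close> (\<open>two_step_bock_eq\<close>).

The monomial \<open>u\<^sub>e \<otimes> x\<close> has weight \<open>-e - |x|(p-1) = d - p|x|\<close> in degree \<open>d\<close>. Weights add under products, are not raised by the operations and are
raised by at most 1 by the differential; and \<open>d \<le> n + pk\<close> puts everything of degree \<open>d\<close> in filtration \<open>n\<close> if \<open>M\<close> vanishes below \<open>k\<close>.

An element \<open>X\<close> of a completion is a family of cosets, and \<open>x \<in> X n\<close> says that \<open>x\<close> represents \<open>X\<close> modulo filtration \<open>n\<close>. Two
elements are equal if they have a common representative at every level, so linear identities carry over at once. For the product one
takes representatives of sufficiently low level: an exhaustive multiplicative filtration makes the product continuous
(\<open>mul_continuous\<close>). On a complete Hausdorff object, the product on the algebraic tensor square is filtered and hence has a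
unique continuous extension \<open>mu\<close>; compatibility with operations and differential is inherited from the tensor square, where it is
checked on pure tensors.
\<close>

abbreviation (input) grade :: "('a, 'z) dgmod_scheme \<Rightarrow> int \<Rightarrow> 'a set" (infixl "$" 95) where
  "V $ d \<equiv> carrier (grd V d)"

abbreviation (input) rgrade :: "('a, 'z) dgmod_scheme \<Rightarrow> int \<Rightarrow> (int \<Rightarrow> 'a) set" (infixl "$$" 95) where
  "M $$ d \<equiv> carrier (rgrd M d)"

abbreviation (input) deg :: "nat \<Rightarrow> sgen \<Rightarrow> int" where "deg p g \<equiv> int (gen_deg p g)"

text \<open>The coefficients of the Adem relation with \<open>\<beta>\<close> between two powers.\<close>

abbreviation (input) bock_coeff :: "nat \<Rightarrow> nat \<Rightarrow> nat \<Rightarrow> nat \<Rightarrow> int" where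
  "bock_coeff p a b i \<equiv> (-1) ^ (a + i) * ibinom ((int p - 1) * (int b - int i)) (int a - int p * int i)"

abbreviation (input) bock_coeff' :: "nat \<Rightarrow> nat \<Rightarrow> nat \<Rightarrow> nat \<Rightarrow> int" where
  "bock_coeff' p a b i \<equiv> (-1) ^ (a + i + 1) * ibinom ((int p - 1) * (int b - int i) - 1) (int a - int p * int i - 1)"

abbreviation (input) "Hom p \<equiv> mod_hom (Fp p)"

section \<open>Binomial coefficients modulo \<open>p\<close>\<close>

lemma falling_prod_step:
 fixes a :: int
 shows "(\<Prod>i<Suc n. (a + 1) - int i) = (\<Prod>i<Suc n. a - int i) + int (Suc n) * (\<Prod>i<n. a - int i)"
proof -
 have "(\<Prod>i<Suc n. (a + 1) - int i) = (a + 1) * (\<Prod>i<n. a - int i)"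
  by (subst prod.lessThan_Suc_shift) (simp add: algebra_simps)
 then show ?thesis by (simp add: algebra_simps)
qed

text \<open>The quotient in the definition of \<open>ibinom\<close> is exact; without this the Pascal rule could not be read off from falling products.\<close>

lemma fact_dvd_falling_prod: "fact n dvd (\<Prod>i<n. (a::int) - int i)"
proof (induction n arbitrary: a)
 case (Suc n)
 have d: "fact (Suc n) dvd int (Suc n) * (\<Prod>i<n. a - int i)" for a :: int
  using Suc.IH[of a] by (simp add: mult_dvd_mono)
 show ?case
 proof (induction a rule: int_induct[where k = 0])
  case base
  show ?case by (subst prod.lessThan_Suc_shift) simp
 next
  case (step1 i)
  then show ?case using d[of i] falling_prod_step[of i n] by (metis dvd_add)
 next
  case (step2 i)
  then show ?case using d[of "i - 1"] falling_prod_step[of "i - 1" n]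
   by (metis diff_add_cancel dvd_add_left_iff)
 qed
qed simp

lemma ibinom_fact: "ibinom a (int n) * fact n = (\<Prod>i<n. a - int i)"
 using fact_dvd_falling_prod[of n a] by (simp add: ibinom_def)

lemma ibinom_neg [simp]: "b < 0 ==> ibinom a b = 0" by (simp add: ibinom_def)
lemma ibinom_0_right [simp]: "ibinom a 0 = 1" by (simp add: ibinom_def)

lemma ibinom_pascal: "ibinom (a + 1) b = ibinom a b + ibinom a (b - 1)"
proof (cases "b \<le> 0")
 case True
 then show ?thesis by (cases "b = 0") auto
next
 case False
 then have "b = int (Suc (nat (b - 1)))" by simp
 then obtain n where b: "b = int (Suc n)" ..
 have "ibinom (a + 1) b * fact (Suc n) = (ibinom a b + ibinom a (b - 1)) * fact (Suc n)"
 proof -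
  have "b - 1 = int n" using b by simp
  then have "ibinom a (b - 1) * fact (Suc n) = int (Suc n) * (\<Prod>i<n. a - int i)"
   using ibinom_fact[of a n] by (simp add: mult.left_commute)
  then show ?thesis unfolding b ibinom_fact falling_prod_step distrib_right by simp
 qed
 then show ?thesis by simp
qed

lemma ibinom_vandermonde: "ibinom (a + int n) b = (\<Sum>i\<le>n. int (n choose i) * ibinom a (b - int i))"
proof (induction n arbitrary: b)
 case (Suc n)
 have "ibinom (a + int (Suc n)) b = ibinom ((a + int n) + 1) b" by (simp add: algebra_simps)
 also have "... = ibinom (a + int n) b + ibinom (a + int n) (b - 1)" by (rule ibinom_pascal)
 also have "... = (\<Sum>i\<le>n. int (n choose i) * ibinom a (b - int i))
   + (\<Sum>i\<le>n. int (n choose i) * ibinom a (b - int (Suc i)))"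
  by (simp add: Suc.IH algebra_simps)
 also have "(\<Sum>i\<le>n. int (n choose i) * ibinom a (b - int i))
   = ibinom a b + (\<Sum>i\<le>n. int (n choose (Suc i)) * ibinom a (b - int (Suc i)))"
  using sum.atMost_Suc_shift[of "\<lambda>i. int (n choose i) * ibinom a (b - int i)" n] by (simp add: binomial_eq_0)
 also have "ibinom a b + (\<Sum>i\<le>n. int (n choose (Suc i)) * ibinom a (b - int (Suc i)))
   + (\<Sum>i\<le>n. int (n choose i) * ibinom a (b - int (Suc i)))
   = (\<Sum>i\<le>Suc n. int (Suc n choose i) * ibinom a (b - int i))"
  by (subst sum.atMost_Suc_shift) (simp add: sum.distrib algebra_simps)
 finally show ?case .
qed simp

text \<open>In generating functions: \<open>(1+X)\<^sup>p = 1 + X\<^sup>p\<close> modulo \<open>p\<close>.\<close>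

lemma ibinom_frobenius:
 assumes "prime p"
 shows "[ibinom (a + int p) b = ibinom a b + ibinom a (b - int p)] (mod int p)"
proof -
 let ?f = "\<lambda>i. int (p choose i) * ibinom a (b - int i)"
 have p: "p \<ge> 2" using assms by (simp add: prime_ge_2_nat)
 have "(\<Sum>i\<le>p. ?f i) = ?f 0 + ?f p + (\<Sum>i\<in>{0<..<p}. ?f i)"
 proof -
  have "{..p} = insert 0 (insert p {0<..<p})" using p by auto
  then show ?thesis using p by simp
 qed
 moreover have "[(\<Sum>i\<in>{0<..<p}. ?f i) = (\<Sum>i\<in>{0<..<p}. 0)] (mod int p)"
 proof (rule cong_sum)
  fix i assume "i : {0<..<p}"
  then have "p dvd (p choose i)" using assms by (intro dvd_choose_prime) auto
  then have "int p dvd int (p choose i)" by (simp only: of_nat_dvd_iff)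
  then show "[?f i = 0] (mod int p)" by (simp add: cong_0_iff)
 qed
 ultimately show ?thesis unfolding ibinom_vandermonde
  by (simp add: cong_add_lcancel_0)
qed

text \<open>The coefficients of the operations on powers of \<open>t\<close>. By the convolution formula below, their generating function in \<open>j\<close> is, modulo \<open>p\<close>, the \<open>R\<close>-th power of a fixed power series.\<close>

definition psi_coeff :: "nat => int => int => int" where
 "psi_coeff p R j = ibinom (- 1 - R - (int p - 1) * j) j"

lemma psi_coeff_neg [simp]: "j < 0 ==> psi_coeff p R j = 0" by (simp add: psi_coeff_def)
lemma psi_coeff_0 [simp]: "psi_coeff p R 0 = 1" by (simp add: psi_coeff_def)

lemma psi_coeff_pascal: "psi_coeff p R j = psi_coeff p (R + 1) j + psi_coeff p (R + int p) (j - 1)"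
 using ibinom_pascal[of "- 2 - R - (int p - 1) * j" j] by (simp add: psi_coeff_def algebra_simps)

lemma psi_coeff_zero: "[psi_coeff p 0 j = of_bool (j = 0)] (mod int p)"
proof (cases "j \<le> 0")
 case True then show ?thesis by (cases "j = 0") auto
next
 case False
 then have "j = int (Suc (nat (j - 1)))" by simp
 then obtain n where j: "j = int (Suc n)" ..
 define A where "A = - 1 - (int p - 1) * j"
 have "ibinom A j * fact (Suc n) = (\<Prod>i<n. A - int i) * (A - int n)"
  unfolding j ibinom_fact by simp
 also have "A - int n = - (int p * int (Suc n))" by (simp add: A_def j algebra_simps)
 also have "(\<Prod>i<n. A - int i) * - (int p * int (Suc n)) = - (int p * ibinom A (int n)) * fact (Suc n)"
  by (simp flip: ibinom_fact add: algebra_simps)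
 finally have "ibinom A j = - (int p * ibinom A (int n))" by (metis fact_nonzero mult_right_cancel)
 then show ?thesis using False by (simp add: psi_coeff_def A_def cong_0_iff)
qed

lemma psi_coeff_frobenius:
 assumes "prime p"
 shows "[psi_coeff p R j = psi_coeff p (R + int p) j + psi_coeff p (R + int p * int p) (j - int p)] (mod int p)"
 using ibinom_frobenius[OF assms, of "- 1 - (R + int p) - (int p - 1) * j" j]
 by (simp add: psi_coeff_def algebra_simps)

lemma psi_coeff_twist:
 assumes "prime p"
 shows "[psi_coeff p (R + int p * (int p - 1)) (j - int p)
   = psi_coeff p R (j - 1) + psi_coeff p (R - (int p - 1)) j - psi_coeff p R j] (mod int p)"
proof -
 define A where "A = - 1 - R - (int p - 1) * j"
 have 1: "[ibinom (A + int p) j = ibinom A j + ibinom A (j - int p)] (mod int p)"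
  by (rule ibinom_frobenius[OF assms])
 have 2: "ibinom (A + int p) j = ibinom (A + int p - 1) j + ibinom (A + int p - 1) (j - 1)"
  using ibinom_pascal[of "A + int p - 1" j] by simp
 have e: "psi_coeff p (R + int p * (int p - 1)) (j - int p) = ibinom A (j - int p)"
  "psi_coeff p R (j - 1) = ibinom (A + int p - 1) (j - 1)"
  "psi_coeff p (R - (int p - 1)) j = ibinom (A + int p - 1) j" "psi_coeff p R j = ibinom A j"
  by (simp_all add: psi_coeff_def A_def algebra_simps)
 have "[ibinom A (j - int p) = ibinom (A + int p) j - ibinom A j] (mod int p)"
  using 1 by (metis add_diff_cancel_left' cong_diff cong_refl cong_sym)
 then show ?thesis unfolding e 2 by (simp add: algebra_simps)
qed

text \<open>The recursion moves from \<open>R\<close> to \<open>R+1\<close> with an error term of lower \<open>j\<close>; as the values at \<open>R = 0\<close> vanish, induction on \<open>j\<close> and then on \<open>R\<close> in both directions gives uniqueness.\<close>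

lemma psi_recursion_unique:
 fixes f :: "int => int => int"
 assumes rec: "!!R j. [f R j = f (R + 1) j + f (R + int p) (j - 1)] (mod m)"
  and neg: "!!R j. j < 0 ==> [f R j = 0] (mod m)" and zero: "!!j. [f 0 j = 0] (mod m)"
 shows "[f R j = 0] (mod m)"
proof (cases "j < 0")
 case False
 then have "j = int (nat j)" by simp
 then obtain n where "j = int n" ..
 moreover have "[f R (int n) = 0] (mod m)"
 proof (induction n arbitrary: R rule: less_induct)
  case (less n)
  have "[f R (int n - 1) = 0] (mod m)" for R
   using less[of "n - 1" R] neg[of "-1" R] by (cases n) auto
  then have step: "[f R (int n) = f (R + 1) (int n)] (mod m)" for R
   using rec[of R "int n"] by (metis add.right_neutral cong_add cong_refl cong_trans)
  show ?case
  proof (induction R rule: int_induct[where k = 0])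
   case base show ?case by (rule zero)
  next
   case (step1 i) then show ?case using step[of i] by (metis cong_sym cong_trans)
  next
   case (step2 i) then show ?case using step[of "i - 1"] by (metis cong_trans diff_add_cancel)
  qed
 qed
 ultimately show ?thesis by simp
qed (rule neg)

text \<open>Both sides satisfy the Pascal recursion in \<open>R\<close> and agree at \<open>R = 0\<close>.\<close>

lemma psi_coeff_convolution:
 "[psi_coeff p (R + S) j = (\<Sum>i\<in>{0..j}. psi_coeff p R i * psi_coeff p S (j - i))] (mod int p)"
proof -
 let ?c = "psi_coeff p"
 define f where "f R j = ?c (R + S) j - (\<Sum>i\<in>{0..j}. ?c R i * ?c S (j - i))" for R j
 have rec: "f R j = f (R + 1) j + f (R + int p) (j - 1)" for R j
 proof -
  have 1: "(\<Sum>i\<in>{0..j}. ?c (R + int p) (i - 1) * ?c S (j - i))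
    = (\<Sum>i\<in>{0..j-1}. ?c (R + int p) i * ?c S (j - 1 - i))"
  proof (cases "j < 0")
   case False
   then have "{0..j} = insert 0 {1..j}" by auto
   then have "(\<Sum>i\<in>{0..j}. ?c (R + int p) (i - 1) * ?c S (j - i))
    = (\<Sum>i\<in>{1..j}. ?c (R + int p) (i - 1) * ?c S (j - i))" by simp
   also have "... = (\<Sum>i\<in>{0..j-1}. ?c (R + int p) i * ?c S (j - 1 - i))"
    by (rule sum.reindex_bij_witness[of _ "\<lambda>i. i + 1" "\<lambda>i. i - 1"]) auto
   finally show ?thesis .
  qed simp
  have "(\<Sum>i\<in>{0..j}. ?c R i * ?c S (j - i))
    = (\<Sum>i\<in>{0..j}. ?c (R + 1) i * ?c S (j - i) + ?c (R + int p) (i - 1) * ?c S (j - i))"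
   by (rule sum.cong[OF refl], subst psi_coeff_pascal) (simp add: algebra_simps)
  also have "... = (\<Sum>i\<in>{0..j}. ?c (R + 1) i * ?c S (j - i))
    + (\<Sum>i\<in>{0..j-1}. ?c (R + int p) i * ?c S (j - 1 - i))" by (simp add: sum.distrib 1)
  finally show ?thesis unfolding f_def
   using psi_coeff_pascal[of p "R + S" j] by (simp add: algebra_simps)
 qed
 have zero: "[f 0 j = 0] (mod int p)" for j
 proof (cases "j < 0")
  case False
  have "[(\<Sum>i\<in>{0..j}. ?c 0 i * ?c S (j - i)) = (\<Sum>i\<in>{0..j}. of_bool (i = 0) * ?c S (j - i))] (mod int p)"
   by (intro cong_sum cong_mult psi_coeff_zero cong_refl)
  moreover have "(\<Sum>i\<in>{0..j}. of_bool (i = 0) * ?c S (j - i)) = ?c S j"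
  proof -
   have "{0..j} = insert 0 {1..j}" using False by auto
   then show ?thesis by simp
  qed
  ultimately show ?thesis unfolding f_def cong_diff_iff_cong_0 by (metis add_0 cong_sym)
 qed (simp add: f_def)
 have "[f R j = 0] (mod int p)"
 proof (rule psi_recursion_unique[where f = f and p = p])
  show "[f R j = f (R + 1) j + f (R + int p) (j - 1)] (mod int p)" for R j
   by (subst rec) simp
  show "[f R j = 0] (mod int p)" if "j < 0" for R j using that by (simp add: f_def)
 qed (rule zero)
 then show ?thesis by (simp add: f_def cong_diff_iff_cong_0)
qed
section \<open>Arrays satisfying the Adem relations\<close>

text \<open>The Adem coefficients for all integral \<open>a\<close>, \<open>b\<close>, including those outside the range \<open>0 < a < pb\<close> of the relations.\<close>

definition adem_coeff :: "nat => int => int => int => int" where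
 "adem_coeff p a b i = (if even (a + i) then 1 else -1) * ibinom ((int p - 1) * (b - i) - 1) (a - int p * i)"

lemma adem_coeff_eq_0 [simp]: "a < int p * i ==> adem_coeff p a b i = 0"
 by (simp add: adem_coeff_def)

lemma adem_coeff_pascal:
 assumes "prime p"
 shows "[adem_coeff p a b i + adem_coeff p a b (i + 1)
  = adem_coeff p (a - 1) b i + adem_coeff p a (b - 1) i] (mod int p)"
proof -
 define s :: int where "s = (if even (a + i) then 1 else -1)"
 define A where "A = (int p - 1) * (b - i) - int p"
 define j where "j = a - int p * i"
 have e: "adem_coeff p a b i = s * ibinom (A + int p - 1) j"
  "adem_coeff p a b (i + 1) = - s * ibinom A (j - int p)"
  "adem_coeff p (a - 1) b i = - s * ibinom (A + int p - 1) (j - 1)"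
  "adem_coeff p a (b - 1) i = s * ibinom A j"
  by (auto simp: adem_coeff_def s_def A_def j_def algebra_simps)
 have "[ibinom (A + int p - 1) j + ibinom (A + int p - 1) (j - 1) = ibinom A j + ibinom A (j - int p)] (mod int p)"
  using ibinom_frobenius[OF assms, of A j] ibinom_pascal[of "A + int p - 1" j] by simp
 then have "[s * (ibinom (A + int p - 1) j + ibinom (A + int p - 1) (j - 1))
   = s * (ibinom A j + ibinom A (j - int p))] (mod int p)" by (rule cong_scalar_left)
 then have "int p dvd s * (ibinom (A + int p - 1) j + ibinom (A + int p - 1) (j - 1))
   - s * (ibinom A j + ibinom A (j - int p))" by (simp add: cong_iff_dvd_diff)
 then show ?thesis unfolding e cong_iff_dvd_diff by (simp add: algebra_simps)
qed

lemma adem_coeff_shift: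
 assumes "prime p"
 shows "[adem_coeff p (a - int p) (b - 1) i = adem_coeff p a b (i + 1)] (mod int p)"
proof -
 have *: "ibinom ((int p - 1) * (b - 1 - i) - 1) (a - int p - int p * i)
   = ibinom ((int p - 1) * (b - (i + 1)) - 1) (a - int p * (i + 1))" by (simp add: algebra_simps)
 show ?thesis
 proof (cases "p = 2")
  case True
  then show ?thesis by (auto simp: adem_coeff_def * cong_iff_dvd_diff algebra_simps)
 next
  case False
  then have "odd (int p)" using assms by (simp add: prime_odd_nat prime_ge_2_nat le_neq_implies_less)
  then have "even (a - int p + i) = even (a + (i + 1))" by presburger
  then show ?thesis by (simp add: adem_coeff_def *)
 qed
qed

text \<open>Congruence modulo \<open>N\<close> replaces equality, so that the arrays may have values in the free algebra and \<open>N\<close> may be the ideal of relations.\<close>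

locale adem_arrays =
 fixes p :: nat and N :: "'x::ring_1 set"
 assumes p_prime: "prime p" and N_0: "0 : N" and N_diff: "!!x y. x : N ==> y : N ==> x - y : N"
  and N_p: "!!x. of_nat p * x : N"
begin

definition eqv :: "'x => 'x => bool" (infix "\<approx>" 50) where "x \<approx> y \<longleftrightarrow> x - y : N"

lemma eqv_refl [simp]: "x \<approx> x" by (simp add: eqv_def N_0)
lemma N_uminus: "x : N ==> - x : N" using N_diff[OF N_0] by simp
lemma N_add: "x : N ==> y : N ==> x + y : N" using N_diff[of x "- y"] N_uminus by simp
lemma eqv_sym: "x \<approx> y ==> y \<approx> x" unfolding eqv_def using N_uminus by (metis minus_diff_eq)
lemma eqv_trans [trans]: "x \<approx> y ==> y \<approx> z ==> x \<approx> z"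
 unfolding eqv_def using N_add by (metis add_diff_cancel diff_add_eq diff_diff_eq2 add_diff_eq diff_add_cancel)
lemma eqv_eq_trans [trans]: "x \<approx> y ==> y = z ==> x \<approx> z" by simp
lemma eq_eqv_trans [trans]: "x = y ==> y \<approx> z ==> x \<approx> z" by simp
lemma eqv_diff: "x \<approx> y ==> x' \<approx> y' ==> x - x' \<approx> y - y'"
 unfolding eqv_def using N_diff[of "x - y" "x' - y'"] by (simp add: algebra_simps)
lemma eqv_add: "x \<approx> y ==> x' \<approx> y' ==> x + x' \<approx> y + y'"
 unfolding eqv_def using N_add[of "x - y" "x' - y'"] by (simp add: algebra_simps)
lemma eqv_sum: "(!!i. i : A ==> f i \<approx> g i) ==> sum f A \<approx> sum g A"
 by (induction A rule: infinite_finite_induct) (auto intro: eqv_add)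
lemma eqv_0: "x \<approx> 0 \<longleftrightarrow> x : N" by (simp add: eqv_def)

lemma N_of_int: "x : N ==> of_int c * x : N"
proof (induction c rule: int_induct[where k = 0])
 case (step1 i) then show ?case using N_add by (simp add: distrib_right)
next
 case (step2 i) then show ?case using N_diff by (simp add: left_diff_distrib)
qed (simp add: N_0)

lemma eqv_scale:
 assumes "[c = c'] (mod int p)" "x \<approx> x'" shows "of_int c * x \<approx> of_int c' * x'"
proof -
 obtain k where "c - c' = int p * k" using assms(1) by (metis cong_iff_dvd_diff dvdE)
 then have "of_int c * x - of_int c' * x = of_nat p * (of_int k * x)"
  by (metis left_diff_distrib mult.assoc of_int_diff of_int_mult of_int_of_nat_eq)
 then have "of_int c * x \<approx> of_int c' * x" using N_p by (simp add: eqv_def)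
 also have "of_int c' * x \<approx> of_int c' * x'"
  using assms(2) N_of_int by (simp add: eqv_def flip: right_diff_distrib)
 finally show ?thesis .
qed

inductive dickson :: "(int => int => 'x) => bool" where
 dickson_unit: "dickson (\<lambda>a b. if a = 0 \<and> b = 0 then y else 0)"
| dickson_diff: "dickson q ==> dickson q' ==> dickson (\<lambda>a b. q a b - q' a b)"
| dickson_sum: "dickson q ==> dickson (\<lambda>a b. q (a - 1) b + q a (b - 1))"
| dickson_prod: "dickson q ==> dickson (\<lambda>a b. q (a - int p) (b - 1))"
| dickson_eqv: "dickson q ==> (!!a b. q a b \<approx> q' a b) ==> dickson q'"

lemma dickson_0: "dickson (\<lambda>a b. 0)"
 using dickson_unit[of 0] by (simp cong: if_cong)

lemma dickson_add:
 assumes "dickson q" "dickson q'" shows "dickson (\<lambda>a b. q a b + q' a b)"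
 using dickson_diff[OF assms(1) dickson_diff[OF dickson_0 assms(2)]] by simp

lemma dickson_support: "dickson q ==> a < 0 \<or> b < 0 ==> q a b : N"
proof (induction arbitrary: a b rule: dickson.induct)
 case (dickson_eqv q q')
 then show ?case by (metis eqv_0 eqv_sym eqv_trans)
qed (auto simp: N_0 intro!: N_add N_diff)

lemma adem_unit_coeff: "a \<ge> 0 ==> [adem_coeff p a (- a) 0 = of_bool (a = 0)] (mod int p)"
proof -
 have "(if even a then 1 else -1) * psi_coeff p 0 a = adem_coeff p a (- a) 0"
  by (simp add: psi_coeff_def adem_coeff_def algebra_simps)
 moreover have "[(if even a then 1 else -1) * psi_coeff p 0 a = (if even a then 1 else -1) * of_bool (a = 0)] (mod int p)"
  by (rule cong_scalar_left[OF psi_coeff_zero])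
 moreover have "(if even a then 1 else -1) * of_bool (a = 0) = (of_bool (a = 0) :: int)" by simp
 ultimately show ?thesis by metis
qed

text \<open>The relations hold trivially for an array supported at \<open>(0,0)\<close>. They are preserved by multiplication with \<open>X + Y\<close> and \<open>X\<^sup>p Y\<close> because the Adem coefficients satisfy a Pascal rule and are invariant under \<open>(a, b, i) \<mapsto> (a - p, b - 1, i - 1)\<close>.\<close>

lemma dickson_adem:
 "dickson q ==> q a b \<approx> (\<Sum>i\<in>{0..a}. of_int (adem_coeff p a b i) * q (a + b - i) i)"
proof (induction arbitrary: a b rule: dickson.induct)
 case (dickson_unit y)
 show ?case
 proof (cases "a < 0")
  case False
  have "(\<Sum>i\<in>{0..a}. of_int (adem_coeff p a b i) * (if a + b - i = 0 \<and> i = 0 then y else 0))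
    = (\<Sum>i\<in>{0}. of_int (adem_coeff p a b i) * (if a + b - i = 0 \<and> i = 0 then y else 0))"
   using False by (intro sum.mono_neutral_right) auto
  also have "... \<approx> (if a = 0 \<and> b = 0 then y else 0)"
  proof (cases "b = - a")
   case True
   then show ?thesis using eqv_scale[OF adem_unit_coeff eqv_refl, of a y] False by auto
  qed auto
  finally show ?thesis by (rule eqv_sym)
 qed auto
next
 case (dickson_diff q q')
 then show ?case using eqv_diff[OF dickson_diff.IH(1)[of a b] dickson_diff.IH(2)[of a b]]
  by (simp add: right_diff_distrib sum_subtractf)
next
 case (dickson_sum q)
 note supp = dickson_support[OF dickson_sum.hyps]
 show ?case
 proof (cases "a < 0")
  case True
  then show ?thesis using supp by (auto simp: eqv_0 intro!: N_add)
 next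
  case False
  let ?c = "adem_coeff p"
  let ?q = "\<lambda>i. q (a + b - 1 - i) i"
  have p0: "int p > 0" using p_prime by (simp add: prime_gt_0_nat)
  have "1 * a \<le> int p * a" using False p0 by (intro mult_right_mono) auto
  then have van: "?c (a - 1) b a = 0" "?c a b (a + 1) = 0"
   using p0 by (auto intro!: adem_coeff_eq_0 simp: distrib_left)
  have "q (a - 1) b + q a (b - 1) \<approx> (\<Sum>i\<in>{0..a-1}. of_int (?c (a - 1) b i) * q (a - 1 + b - i) i)
    + (\<Sum>i\<in>{0..a}. of_int (?c a (b - 1) i) * q (a + (b - 1) - i) i)"
   by (intro eqv_add dickson_sum.IH)
  also have "(\<Sum>i\<in>{0..a-1}. of_int (?c (a - 1) b i) * q (a - 1 + b - i) i)
    = (\<Sum>i\<in>{0..a}. of_int (?c (a - 1) b i) * ?q i)"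
  proof -
   have "{0..a} = insert a {0..a-1}" using False by auto
   then show ?thesis using van by (simp add: algebra_simps)
  qed
  also have "(\<Sum>i\<in>{0..a}. of_int (?c (a - 1) b i) * ?q i)
    + (\<Sum>i\<in>{0..a}. of_int (?c a (b - 1) i) * q (a + (b - 1) - i) i)
    = (\<Sum>i\<in>{0..a}. of_int (?c (a - 1) b i + ?c a (b - 1) i) * ?q i)"
   by (simp add: sum.distrib algebra_simps)
  also have "... \<approx> (\<Sum>i\<in>{0..a}. of_int (?c a b i + ?c a b (i + 1)) * ?q i)"
   by (intro eqv_sum eqv_scale eqv_refl cong_sym[OF adem_coeff_pascal[OF p_prime]])
  also have "... = (\<Sum>i\<in>{0..a}. of_int (?c a b i) * ?q i) + (\<Sum>i\<in>{0..a}. of_int (?c a b (i + 1)) * ?q i)"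
   by (simp add: sum.distrib algebra_simps)
  also have "(\<Sum>i\<in>{0..a}. of_int (?c a b (i + 1)) * ?q i) = (\<Sum>i\<in>{1..a}. of_int (?c a b i) * q (a + b - i) (i - 1))"
  proof -
   have "{0..a} = insert a {0..a-1}" using False by auto
   then have "(\<Sum>i\<in>{0..a}. of_int (?c a b (i + 1)) * ?q i) = (\<Sum>i\<in>{0..a-1}. of_int (?c a b (i + 1)) * ?q i)"
    using van by simp
   also have "... = (\<Sum>i\<in>{1..a}. of_int (?c a b i) * q (a + b - i) (i - 1))"
    by (rule sum.reindex_bij_witness[of _ "\<lambda>i. i - 1" "\<lambda>i. i + 1"]) (auto simp: algebra_simps)
   finally show ?thesis .
  qed
  also have "(\<Sum>i\<in>{0..a}. of_int (?c a b i) * ?q i) + (\<Sum>i\<in>{1..a}. of_int (?c a b i) * q (a + b - i) (i - 1))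
    \<approx> (\<Sum>i\<in>{0..a}. of_int (?c a b i) * ?q i) + (\<Sum>i\<in>{0..a}. of_int (?c a b i) * q (a + b - i) (i - 1))"
  proof -
   have "{0..a} = insert 0 {1..a}" using False by auto
   moreover have "0 + (\<Sum>i\<in>{1..a}. of_int (?c a b i) * q (a + b - i) (i - 1))
    \<approx> of_int (?c a b 0) * q (a + b - 0) (0 - 1) + (\<Sum>i\<in>{1..a}. of_int (?c a b i) * q (a + b - i) (i - 1))"
    using supp by (intro eqv_add eqv_refl eqv_sym[OF eqv_0[THEN iffD2]] N_of_int) auto
   ultimately show ?thesis by (intro eqv_add eqv_refl) simp
  qed
  finally show ?thesis by (simp add: sum.distrib algebra_simps)
 qed
next
 case (dickson_prod q)
 let ?c = "adem_coeff p"
 note supp = dickson_support[OF dickson_prod.hyps]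
 have p0: "int p > 0" using p_prime by (simp add: prime_gt_0_nat)
 show ?case
 proof (cases "a < 0")
  case True
  then have "a < int p" using p0 by linarith
  with True show ?thesis using supp by (auto simp: eqv_0)
 next
  case False
  have van: "?c (a - int p) (b - 1) i = 0" if "i > a - int p" "i \<ge> 0" for i
  proof (rule adem_coeff_eq_0)
   have "1 * i \<le> int p * i" using that p0 by (intro mult_right_mono) auto
   then show "a - int p < int p * i" using that by linarith
  qed
  have "q (a - int p) (b - 1) \<approx> (\<Sum>i\<in>{0..a - int p}. of_int (?c (a - int p) (b - 1) i) * q (a - int p + (b - 1) - i) i)"
   by (rule dickson_prod.IH)
  also have "... = (\<Sum>i\<in>{0..a - 1}. of_int (?c (a - int p) (b - 1) i) * q (a - int p + (b - 1) - i) i)"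
   using van p0 by (intro sum.mono_neutral_left) auto
  also have "... \<approx> (\<Sum>i\<in>{0..a - 1}. of_int (?c a b (i + 1)) * q (a - int p + (b - 1) - i) i)"
   by (intro eqv_sum eqv_scale eqv_refl adem_coeff_shift[OF p_prime])
  also have "... = (\<Sum>i\<in>{1..a}. of_int (?c a b i) * q (a + b - i - int p) (i - 1))"
   by (rule sum.reindex_bij_witness[of _ "\<lambda>i. i - 1" "\<lambda>i. i + 1"]) (auto simp: algebra_simps)
  also have "... = 0 + (\<Sum>i\<in>{1..a}. of_int (?c a b i) * q (a + b - i - int p) (i - 1))" by simp
  also have "... \<approx> of_int (?c a b 0) * q (a + b - 0 - int p) (0 - 1)
    + (\<Sum>i\<in>{1..a}. of_int (?c a b i) * q (a + b - i - int p) (i - 1))"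
   using supp by (intro eqv_add eqv_refl eqv_sym[OF eqv_0[THEN iffD2]] N_of_int) auto
  also have "... = (\<Sum>i\<in>{0..a}. of_int (?c a b i) * q (a + b - i - int p) (i - 1))"
  proof -
   have "{0..a} = insert 0 {1..a}" using False by auto
   then show ?thesis by simp
  qed
  finally show ?thesis .
 qed
next
 case (dickson_eqv q q')
 have "q' a b \<approx> q a b" by (rule eqv_sym[OF dickson_eqv.hyps(2)])
 also have "... \<approx> (\<Sum>i\<in>{0..a}. of_int (adem_coeff p a b i) * q (a + b - i) i)" by (rule dickson_eqv.IH)
 also have "... \<approx> (\<Sum>i\<in>{0..a}. of_int (adem_coeff p a b i) * q' (a + b - i) i)"
  by (intro eqv_sum eqv_scale cong_refl dickson_eqv.hyps)
 finally show ?case .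
qed

lemma dickson_homogeneous: "dickson q ==> dickson (\<lambda>a b. if a + b = n then q a b else 0)"
proof (induction arbitrary: n rule: dickson.induct)
 case (dickson_unit y)
 show ?case
 proof (cases "n = 0")
  case True
  have "(\<lambda>a b. if a + b = n then if a = 0 \<and> b = 0 then y else 0 else 0) = (\<lambda>a b. if a = 0 \<and> b = 0 then y else 0)"
   using True by (auto intro!: ext)
  then show ?thesis by (metis (mono_tags) dickson.dickson_unit)
 next
  case False
  have "(\<lambda>a b. if a + b = n then if a = 0 \<and> b = 0 then y else 0 else 0) = (\<lambda>a b. 0)"
   using False by (auto intro!: ext)
  then show ?thesis using dickson_0 by simp
 qed
next
 case (dickson_diff q q')
 show ?case by (rule dickson_eqv[OF dickson.dickson_diff[OF dickson_diff.IH(1)[of n] dickson_diff.IH(2)[of n]]]) auto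
next
 case (dickson_sum q)
 show ?case by (rule dickson_eqv[OF dickson.dickson_sum[OF dickson_sum.IH[of "n - 1"]]]) (auto simp: algebra_simps)
next
 case (dickson_prod q)
 show ?case by (rule dickson_eqv[OF dickson.dickson_prod[OF dickson_prod.IH[of "n - int p - 1"]]]) (auto simp: algebra_simps)
next
 case (dickson_eqv q q')
 show ?case by (rule dickson.dickson_eqv[OF dickson_eqv.IH[of n]]) (use dickson_eqv.hyps in auto)
qed

text \<open>The array with generating function \<open>y (X + Y)\<^sup>n\<close>.\<close>

lemma dickson_power_sum:
 "\<exists>g. dickson g \<and> g (int n) 0 = y \<and> (\<forall>a b. a + b \<noteq> int n \<longrightarrow> g a b = 0) \<and> (\<forall>a b. a < 0 \<or> b < 0 \<longrightarrow> g a b = 0)"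
proof (induction n)
 case 0
 show ?case by (rule exI[of _ "\<lambda>a b. if a = 0 \<and> b = 0 then y else 0"]) (auto intro: dickson_unit)
next
 case (Suc n)
 then obtain g where g: "dickson g" "g (int n) 0 = y" "!!a b. a + b \<noteq> int n ==> g a b = 0"
  "!!a b. a < 0 \<or> b < 0 ==> g a b = 0" by blast
 show ?case
  by (rule exI[of _ "\<lambda>a b. g (a - 1) b + g a (b - 1)"]) (use g in \<open>auto intro: dickson_sum\<close>)
qed

text \<open>Subtract the array of \<open>q(n,0) (X + Y)\<^sup>n\<close>. The difference has no entry at \<open>b = 0\<close>; its Adem relations then force divisibility by \<open>X\<^sup>p Y\<close>, and the quotient is an array of lower degree which satisfies the relations again.\<close>

lemma dickson_if_adem:
 assumes "!!a b. a + b \<noteq> n ==> q a b = 0" "!!a b. a < 0 \<or> b < 0 ==> q a b = 0"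
  and "!!a b. 0 \<le> a ==> a < int p * b ==> a + b = n ==>
   q a b \<approx> (\<Sum>i\<in>{0..a}. of_int (adem_coeff p a b i) * q (a + b - i) i)"
 shows "dickson q"
 using assms
proof (induction "nat (n + 1)" arbitrary: n q rule: less_induct)
 case less
 note hom = less.prems(1) and supp = less.prems(2) and adem = less.prems(3)
 let ?c = "adem_coeff p"
 have p0: "int p > 0" using p_prime by (simp add: prime_gt_0_nat)
 show ?case
 proof (cases "n < 0")
  case True
  have "q a b = 0" for a b
  proof -
   have "a + b \<noteq> n \<or> a < 0 \<or> b < 0" using True by linarith
   then show ?thesis using hom supp by blast
  qed
  then have "q = (\<lambda>a b. 0)" by (intro ext)
  then show ?thesis using dickson_0 by simp
 next
  case False
  then have "int (nat n) = n" by simp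
  then obtain g where g: "dickson g" "g n 0 = q n 0" "!!a b. a + b \<noteq> n ==> g a b = 0"
   "!!a b. a < 0 \<or> b < 0 ==> g a b = 0" using dickson_power_sum[of "nat n" "q n 0"] by metis
  define h where "h a b = q a b - g a b" for a b
  have h0: "h n 0 = 0" and hom_h: "!!a b. a + b \<noteq> n ==> h a b = 0"
   and supp_h: "!!a b. a < 0 \<or> b < 0 ==> h a b = 0"
   using g hom supp by (auto simp: h_def)
  have adem_h: "h a b \<approx> (\<Sum>i\<in>{0..a}. of_int (?c a b i) * h (a + b - i) i)" if "0 \<le> a" "a < int p * b" "a + b = n" for a b
   unfolding h_def right_diff_distrib sum_subtractf
   by (intro eqv_diff adem that dickson_adem g)
  have low: "h a b \<approx> 0" if "a < int p" for a b
  proof (cases "0 \<le> a \<and> b > 0 \<and> a + b = n")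
   case True
   have "int p * 1 \<le> int p * b" using True by (intro mult_left_mono) auto
   then have "a < int p * b" using that by linarith
   then have "h a b \<approx> (\<Sum>i\<in>{0..a}. of_int (?c a b i) * h (a + b - i) i)"
    using True by (intro adem_h) auto
   also have "... = (\<Sum>i\<in>{0..a}. 0)"
   proof (intro sum.cong refl)
    fix i assume i: "i : {0..a}"
    show "of_int (?c a b i) * h (a + b - i) i = 0"
    proof (cases "i = 0")
     case False
     then have "int p * 1 \<le> int p * i" using i by (intro mult_left_mono) auto
     then show ?thesis using that by simp
    qed (use h0 True in auto)
   qed
   finally show ?thesis by simp
  next
   case False
   then consider "a < 0 \<or> b < 0" | "a + b \<noteq> n" | "b = 0" "a = n" by linarith
   then show ?thesis by cases (use hom_h supp_h h0 in auto)
  qed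
  define h' where "h' a b = (if 0 \<le> a \<and> 0 \<le> b then h (a + int p) (b + 1) else 0)" for a b
  have "dickson h'"
  proof (rule less.hyps[of "n - int p - 1"])
   show "nat (n - int p - 1 + 1) < nat (n + 1)" using p0 False by simp
   show "h' a b = 0" if "a + b \<noteq> n - int p - 1" for a b
    using that hom_h[of "a + int p" "b + 1"] by (auto simp: h'_def)
   show "h' a b = 0" if "a < 0 \<or> b < 0" for a b using that by (auto simp: h'_def)
  next
   fix a b assume ab: "0 \<le> a" "a < int p * b" "a + b = n - int p - 1"
   then have "0 < int p * b" by linarith
   then have b: "b > 0" using p0 by (simp add: zero_less_mult_iff)
   let ?h = "\<lambda>i. h (a + int p + b - i) (i + 1)"
   have "h (a + int p) (b + 1) \<approx> (\<Sum>i\<in>{0..a + int p}. of_int (?c (a + int p) (b + 1) i) * h (a + int p + (b + 1) - i) i)"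
    using ab p0 by (intro adem_h) (auto simp: algebra_simps)
   also have "... = (\<Sum>i\<in>{1..a + int p}. of_int (?c (a + int p) (b + 1) i) * h (a + int p + (b + 1) - i) i)"
   proof (rule sum.mono_neutral_right)
    have "a + int p + (b + 1) = n" using ab by linarith
    moreover have "i = 0" if "i : {0..a + int p} - {1..a + int p}" for i using that by auto
    ultimately show "\<forall>i\<in>{0..a + int p} - {1..a + int p}. of_int (?c (a + int p) (b + 1) i) * h (a + int p + (b + 1) - i) i = 0"
     using h0 by fastforce
   qed auto
   also have "... = (\<Sum>i\<in>{0..a + int p - 1}. of_int (?c (a + int p) (b + 1) (i + 1)) * ?h i)"
    by (rule sum.reindex_bij_witness[of _ "\<lambda>i. i + 1" "\<lambda>i. i - 1"]) (auto simp: algebra_simps)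
   also have "... \<approx> (\<Sum>i\<in>{0..a + int p - 1}. of_int (?c a b i) * ?h i)"
    using adem_coeff_shift[OF p_prime, of "a + int p" "b + 1"] by (intro eqv_sum eqv_scale eqv_refl) (simp add: cong_sym)
   also have "... = (\<Sum>i\<in>{0..a}. of_int (?c a b i) * ?h i)"
   proof (rule sum.mono_neutral_right)
    show "\<forall>i\<in>{0..a + int p - 1} - {0..a}. of_int (?c a b i) * ?h i = 0"
    proof
     fix i assume i: "i : {0..a + int p - 1} - {0..a}"
     then have "1 * i \<le> int p * i" using p0 by (intro mult_right_mono) auto
     then have "?c a b i = 0" using i by (intro adem_coeff_eq_0) auto
     then show "of_int (?c a b i) * ?h i = 0" by simp
    qed
   qed (use p0 in auto)
   also have "... = (\<Sum>i\<in>{0..a}. of_int (?c a b i) * h' (a + b - i) i)"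
    using b by (intro sum.cong) (auto simp: h'_def algebra_simps)
   finally show "h' a b \<approx> (\<Sum>i\<in>{0..a}. of_int (?c a b i) * h' (a + b - i) i)"
    using ab b by (simp add: h'_def)
  qed
  then have "dickson (\<lambda>a b. g a b + h' (a - int p) (b - 1))"
   by (intro dickson_add dickson_prod g)
  moreover have "g a b + h' (a - int p) (b - 1) \<approx> q a b" for a b
  proof -
   have "h' (a - int p) (b - 1) \<approx> h a b"
   proof (cases "a < int p \<or> b < 1")
    case True
    then have "h a b \<approx> 0" using low[of a b] supp_h[of a b] h0 hom_h[of a b]
     by (cases "b = 0"; cases "a = n") auto
    then show ?thesis using True by (auto simp: h'_def eqv_sym)
   qed (simp add: h'_def)
   then have "g a b + h' (a - int p) (b - 1) \<approx> g a b + h a b" by (intro eqv_add eqv_refl)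
   then show ?thesis by (simp add: h_def)
  qed
  ultimately show ?thesis by (rule dickson_eqv)
 qed
qed

end
section \<open>Two successive operations\<close>

context adem_arrays begin

abbreviation cc :: "int => int => int" where "cc \<equiv> psi_coeff p"

text \<open>The coefficient of the word \<open>P\<^sup>k P\<^sup>l\<close> in the composite of \<open>P\<^sup>a\<close> and \<open>P\<^sup>b\<close> on \<open>t\<^sup>r \<otimes> x\<close>.\<close>

definition two_step_coeff :: "int => int => int => int => int => int" where
 "two_step_coeff r k l a b =
   cc (r + int p * k * (int p - 1)) (a - int p * k) * cc (r + (a - k + int p * l) * (int p - 1)) (b - int p * l)"

definition two_step :: "(int => int => 'x) => int => int => int => int => 'x" where
 "two_step q r K a b = (\<Sum>k\<in>{0..K}. of_int (two_step_coeff r k (K - k) a b) * q k (K - k))"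

abbreviation hom_part :: "int => (int => int => 'x) => int => int => 'x" where
 "hom_part n q \<equiv> (\<lambda>a b. if a + b = n then q a b else 0)"

text \<open>Two applications of the Pascal rule for \<open>c\<close>. The right hand side is \<open>r + 1\<close> plus \<open>X + Y\<close> times \<open>r + p\<close> plus \<open>X\<^sup>p Y\<close> times \<open>r + p\<^sup>2\<close>, so the coefficients for all \<open>r\<close> are Dickson if those for \<open>r = 0\<close> are.\<close>

lemma two_step_coeff_rec:
 "[two_step_coeff r 0 0 a b = two_step_coeff (r + 1) 0 0 a b + two_step_coeff (r + int p) 0 0 (a - 1) b
   + two_step_coeff (r + int p) 0 0 a (b - 1) + two_step_coeff (r + int p * int p) 0 0 (a - int p) (b - 1)] (mod int p)"
proof -
 define S where "S = r + a * (int p - 1)"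
 have e: "two_step_coeff r 0 0 a b = cc r a * cc (S + 1) b + cc r a * cc (S + int p) (b - 1)"
  "two_step_coeff (r + 1) 0 0 a b = cc (r + 1) a * cc (S + 1) b"
  "two_step_coeff (r + int p) 0 0 (a - 1) b = cc (r + int p) (a - 1) * cc (S + 1) b"
  "two_step_coeff (r + int p) 0 0 a (b - 1) = cc (r + int p) a * cc (S + int p) (b - 1)"
  "two_step_coeff (r + int p * int p) 0 0 (a - int p) (b - 1) = cc (r + int p * int p) (a - int p) * cc (S + int p) (b - 1)"
  using psi_coeff_pascal[of p S b] by (simp_all add: two_step_coeff_def S_def algebra_simps)
 have "[cc r a * cc (S + int p) (b - 1)
   = (cc (r + int p) a + cc (r + int p * int p) (a - int p)) * cc (S + int p) (b - 1)] (mod int p)"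
  by (rule cong_scalar_right[OF psi_coeff_frobenius[OF p_prime]])
 moreover have "cc r a * cc (S + 1) b = (cc (r + 1) a + cc (r + int p) (a - 1)) * cc (S + 1) b"
  using psi_coeff_pascal[of p r a] by simp
 ultimately show ?thesis unfolding e by (simp add: cong_iff_dvd_diff algebra_simps)
qed

text \<open>Multiplying the array of words by \<open>X + Y\<close> multiplies the array of composites by \<open>X + Y\<close>, up to the difference of the arrays for two values of \<open>r\<close>.\<close>

lemma two_step_coeff_sum:
 "[two_step_coeff r (k + 1) l a b + two_step_coeff r k (l + 1) a b
  = two_step_coeff r k l (a - 1) b + two_step_coeff r k l a (b - 1)
   + (two_step_coeff (r - (int p - 1)) k l a b - two_step_coeff r k l a b)] (mod int p)"
proof -
 define R where "R = r + int p * k * (int p - 1)"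
 define S where "S = r + (a - k + int p * l) * (int p - 1)"
 define j where "j = a - int p * k"
 define i where "i = b - int p * l"
 have e: "two_step_coeff r (k + 1) l a b = cc (R + int p * (int p - 1)) (j - int p) * cc (S - (int p - 1)) i"
  "two_step_coeff r k (l + 1) a b = cc R j * cc (S + int p * (int p - 1)) (i - int p)"
  "two_step_coeff r k l (a - 1) b = cc R (j - 1) * cc (S - (int p - 1)) i"
  "two_step_coeff r k l a (b - 1) = cc R j * cc S (i - 1)"
  "two_step_coeff (r - (int p - 1)) k l a b = cc (R - (int p - 1)) j * cc (S - (int p - 1)) i"
  "two_step_coeff r k l a b = cc R j * cc S i"
  by (simp_all add: two_step_coeff_def R_def S_def i_def j_def algebra_simps)
 have "[cc (R + int p * (int p - 1)) (j - int p) * cc (S - (int p - 1)) i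
   + cc R j * cc (S + int p * (int p - 1)) (i - int p)
   = (cc R (j - 1) + cc (R - (int p - 1)) j - cc R j) * cc (S - (int p - 1)) i
   + cc R j * (cc S (i - 1) + cc (S - (int p - 1)) i - cc S i)] (mod int p)"
  by (intro cong_add cong_scalar_left cong_scalar_right psi_coeff_twist p_prime)
 moreover have "(cc R (j - 1) + cc (R - (int p - 1)) j - cc R j) * cc (S - (int p - 1)) i
   + cc R j * (cc S (i - 1) + cc (S - (int p - 1)) i - cc S i)
  = cc R (j - 1) * cc (S - (int p - 1)) i + cc R j * cc S (i - 1)
   + (cc (R - (int p - 1)) j * cc (S - (int p - 1)) i - cc R j * cc S i)"
  by (simp add: algebra_simps)
 ultimately show ?thesis unfolding e by simp
qed

text \<open>Multiplying the array of words by \<open>X\<^sup>p Y\<close> multiplies the array of composites by \<open>(X\<^sup>p Y)\<^sup>p\<close> and changes \<open>r\<close>.\<close>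

lemma two_step_coeff_prod:
 "two_step_coeff r (k + int p) (l + 1) a b
  = two_step_coeff (r + int p * int p * (int p - 1)) k l (a - int p * int p) (b - int p)"
 by (simp add: two_step_coeff_def algebra_simps)

lemma two_step_coeff_neg: "a < 0 \<or> b < 0 ==> k \<ge> 0 ==> l \<ge> 0 ==> two_step_coeff r k l a b = 0"
proof -
 assume "a < 0 \<or> b < 0" "k \<ge> 0" "l \<ge> 0"
 moreover have "0 \<le> int p * k" "0 \<le> int p * l" using calculation by auto
 ultimately have "a - int p * k < 0 \<or> b - int p * l < 0" by linarith
 then show ?thesis by (auto simp: two_step_coeff_def)
qed

lemma hom_part_eqv:
 assumes "dickson (hom_part n q)" "!!a b. q a b \<approx> q' a b"
 shows "dickson (hom_part n q')"
 by (rule dickson_eqv[OF assms(1)]) (use assms(2) in auto)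

lemma hom_part_diff:
 assumes "dickson (hom_part n q)" "dickson (hom_part n q')"
 shows "dickson (hom_part n (\<lambda>a b. q a b - q' a b))"
 by (rule dickson_eqv[OF dickson_diff[OF assms]]) auto

lemma hom_part_add:
 assumes "dickson (hom_part n q)" "dickson (hom_part n q')"
 shows "dickson (hom_part n (\<lambda>a b. q a b + q' a b))"
 by (rule dickson_eqv[OF dickson_add[OF assms]]) auto

lemma hom_part_sum:
 assumes "dickson (hom_part (n - 1) q)"
 shows "dickson (hom_part n (\<lambda>a b. q (a - 1) b + q a (b - 1)))"
 by (rule dickson_eqv[OF dickson_sum[OF assms]]) (auto simp: algebra_simps)

lemma hom_part_prod:
 assumes "dickson (hom_part (n - int p - 1) q)"
 shows "dickson (hom_part n (\<lambda>a b. q (a - int p) (b - 1)))"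
 by (rule dickson_eqv[OF dickson_prod[OF assms]]) (auto simp: algebra_simps)

lemma hom_part_prod_pow:
 "dickson (hom_part (n - int m * (int p + 1)) q) ==> dickson (hom_part n (\<lambda>a b. q (a - int m * int p) (b - int m)))"
proof (induction m arbitrary: n)
 case (Suc m)
 have e: "n - int (Suc m) * (int p + 1) = (n - int p - 1) - int m * (int p + 1)" by (simp add: algebra_simps)
 have "dickson (hom_part ((n - int p - 1) - int m * (int p + 1)) q)" using Suc.prems unfolding e .
 from hom_part_prod[OF Suc.IH[OF this]] show ?case by (rule dickson_eqv) (simp add: algebra_simps)
next
 case 0
 then have "dickson (hom_part n q)" by simp
 then show ?case by (rule dickson_eqv) simp
qed

lemma dickson_two_step_unit: "dickson (hom_part n (\<lambda>a b. of_int (two_step_coeff r 0 0 a b) * y))"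
proof (induction "nat (n + 1)" arbitrary: n r rule: less_induct)
 case less
 let ?G = "\<lambda>r a b. of_int (two_step_coeff r 0 0 a b) * y"
 show ?case
 proof (cases "n < 0")
  case True
  have "a < 0 \<or> b < 0" if "a + b = n" for a b using that True by linarith
  then show ?thesis by (intro dickson_eqv[OF dickson_0]) (simp add: two_step_coeff_neg)
 next
  case False
  have p0: "int p > 0" using p_prime by (simp add: prime_gt_0_nat)
  define B where "B r a b = (?G (r + int p) (a - 1) b + ?G (r + int p) a (b - 1))
    + ?G (r + int p * int p) (a - int p) (b - 1)" for r a b
  have B: "dickson (hom_part n (B r))" for r
  proof -
   have 1: "dickson (hom_part (n - 1) (?G (r + int p)))" by (rule less.hyps) (use False in auto)
   have 2: "dickson (hom_part (n - int p - 1) (?G (r + int p * int p)))"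
    by (rule less.hyps) (use False p0 in auto)
   show ?thesis unfolding B_def by (rule hom_part_add[OF hom_part_sum[OF 1] hom_part_prod[OF 2]])
  qed
  have step: "?G r a b \<approx> ?G (r + 1) a b + B r a b" for r a b
  proof -
   have "?G r a b \<approx> of_int (two_step_coeff (r + 1) 0 0 a b + two_step_coeff (r + int p) 0 0 (a - 1) b
     + two_step_coeff (r + int p) 0 0 a (b - 1) + two_step_coeff (r + int p * int p) 0 0 (a - int p) (b - 1)) * y"
    by (intro eqv_scale eqv_refl two_step_coeff_rec)
   then show ?thesis by (simp add: B_def algebra_simps)
  qed
  show ?thesis
  proof (induction r rule: int_induct[where k = 0])
   case base
   have "dickson (hom_part n (\<lambda>a b. if a = 0 \<and> b = 0 then y else 0))"
    by (rule dickson_homogeneous[OF dickson_unit])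
   then show ?case
   proof (rule hom_part_eqv)
    fix a b
    have "[two_step_coeff 0 0 0 a b = of_bool (a = 0 \<and> b = 0)] (mod int p)"
    proof (cases "a = 0")
     case True
     then show ?thesis using psi_coeff_zero[of p b] by (simp add: two_step_coeff_def)
    next
     case False
     have "[cc 0 a * cc (a * (int p - 1)) b = of_bool (a = 0) * cc (a * (int p - 1)) b] (mod int p)"
      by (rule cong_scalar_right[OF psi_coeff_zero])
     then show ?thesis using False by (simp add: two_step_coeff_def)
    qed
    from eqv_scale[OF cong_sym[OF this] eqv_refl[of y]]
    show "(if a = 0 \<and> b = 0 then y else 0) \<approx> ?G 0 a b" by (auto split: if_splits)
   qed
  next
   case (step1 i)
   show ?case
   proof (rule hom_part_eqv[OF hom_part_diff[OF step1.IH B[of i]]])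
    show "?G i a b - B i a b \<approx> ?G (i + 1) a b" for a b
     using eqv_diff[OF step[of i a b] eqv_refl[of "B i a b"]] by simp
   qed
  next
   case (step2 i)
   show ?case
   proof (rule hom_part_eqv[OF hom_part_add[OF step2.IH B[of "i - 1"]]])
    show "?G i a b + B (i - 1) a b \<approx> ?G (i - 1) a b" for a b
     using eqv_sym[OF step[of "i - 1" a b]] by simp
   qed
  qed
 qed
qed

text \<open>Induction on the construction of \<open>q\<close>, by the rules for the coefficients above.\<close>

lemma dickson_two_step: "dickson q ==> dickson (hom_part n (two_step q r K))"
proof (induction arbitrary: n r K rule: dickson.induct)
 case (dickson_unit y)
 let ?q = "\<lambda>a b. if a = 0 \<and> b = 0 then y else 0"
 show ?case
 proof (cases "K = 0")
  case True
  have "two_step ?q r K = (\<lambda>a b. of_int (two_step_coeff r 0 0 a b) * y)"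
   using True by (intro ext) (simp add: two_step_def)
  then show ?thesis by (rule ssubst) (rule dickson_two_step_unit)
 next
  case False
  have "two_step ?q r K a b = 0" for a b
   unfolding two_step_def by (rule sum.neutral) (use False in auto)
  then show ?thesis by (intro dickson_eqv[OF dickson_0]) auto
 qed
next
 case (dickson_diff q q')
 have "two_step (\<lambda>a b. q a b - q' a b) r K a b = two_step q r K a b - two_step q' r K a b" for a b
  by (simp add: two_step_def right_diff_distrib sum_subtractf)
 then show ?case
  by (intro hom_part_eqv[OF hom_part_diff[OF dickson_diff.IH(1)[of n r K] dickson_diff.IH(2)[of n r K]]]) simp
next
 case (dickson_sum q)
 note supp = dickson_support[OF dickson_sum.hyps]
 define L where "L = K - 1"
 let ?T = "\<lambda>r k l a b. of_int (two_step_coeff r k l a b)"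
 have *: "two_step (\<lambda>a b. q (a - 1) b + q a (b - 1)) r K a b \<approx>
   (two_step q r L (a - 1) b + two_step q r L a (b - 1))
   + (two_step q (r - (int p - 1)) L a b - two_step q r L a b)" for a b
 proof -
  have 1: "(\<Sum>k\<in>{0..K}. ?T r k (K - k) a b * q (k - 1) (K - k)) \<approx> (\<Sum>k\<in>{0..L}. ?T r (k + 1) (L - k) a b * q k (L - k))"
  proof -
   have "(\<Sum>k\<in>{0..K}. ?T r k (K - k) a b * q (k - 1) (K - k))
    \<approx> (\<Sum>k\<in>{0..K}. if k = 0 then 0 else ?T r k (K - k) a b * q (k - 1) (K - k))"
    by (rule eqv_sum) (auto simp: eqv_0 intro!: N_of_int supp)
   also have "... = (\<Sum>k\<in>{1..K}. ?T r k (K - k) a b * q (k - 1) (K - k))"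
    by (rule sum.mono_neutral_cong_right) auto
   also have "... = (\<Sum>k\<in>{0..L}. ?T r (k + 1) (L - k) a b * q k (L - k))"
    by (rule sum.reindex_bij_witness[of _ "\<lambda>i. i + 1" "\<lambda>i. i - 1"]) (auto simp: L_def algebra_simps)
   finally show ?thesis .
  qed
  have 2: "(\<Sum>k\<in>{0..K}. ?T r k (K - k) a b * q k (K - k - 1)) \<approx> (\<Sum>k\<in>{0..L}. ?T r k (L - k + 1) a b * q k (L - k))"
  proof -
   have "(\<Sum>k\<in>{0..K}. ?T r k (K - k) a b * q k (K - k - 1))
    \<approx> (\<Sum>k\<in>{0..K}. if k = K then 0 else ?T r k (K - k) a b * q k (K - k - 1))"
    by (rule eqv_sum) (auto simp: eqv_0 intro!: N_of_int supp)
   also have "... = (\<Sum>k\<in>{0..L}. ?T r k (L - k + 1) a b * q k (L - k))"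
    by (rule sum.mono_neutral_cong_right) (auto simp: L_def algebra_simps)
   finally show ?thesis .
  qed
  have "two_step (\<lambda>a b. q (a - 1) b + q a (b - 1)) r K a b
    = (\<Sum>k\<in>{0..K}. ?T r k (K - k) a b * q (k - 1) (K - k)) + (\<Sum>k\<in>{0..K}. ?T r k (K - k) a b * q k (K - k - 1))"
   by (simp add: two_step_def sum.distrib algebra_simps)
  also have "... \<approx> (\<Sum>k\<in>{0..L}. ?T r (k + 1) (L - k) a b * q k (L - k)) + (\<Sum>k\<in>{0..L}. ?T r k (L - k + 1) a b * q k (L - k))"
   by (intro eqv_add 1 2)
  also have "... = (\<Sum>k\<in>{0..L}. of_int (two_step_coeff r (k + 1) (L - k) a b + two_step_coeff r k (L - k + 1) a b) * q k (L - k))"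
   by (simp add: sum.distrib algebra_simps)
  also have "... \<approx> (\<Sum>k\<in>{0..L}. of_int (two_step_coeff r k (L - k) (a - 1) b + two_step_coeff r k (L - k) a (b - 1)
    + (two_step_coeff (r - (int p - 1)) k (L - k) a b - two_step_coeff r k (L - k) a b)) * q k (L - k))"
   by (intro eqv_sum eqv_scale eqv_refl two_step_coeff_sum)
  finally show ?thesis by (simp add: two_step_def sum.distrib sum_subtractf algebra_simps)
 qed
 show ?case
  by (rule hom_part_eqv[OF hom_part_add[OF hom_part_sum[OF dickson_sum.IH[of "n - 1" r L]]
     hom_part_diff[OF dickson_sum.IH[of n "r - (int p - 1)" L] dickson_sum.IH[of n r L]]]
     eqv_sym[OF *]])
next
 case (dickson_prod q)
 note supp = dickson_support[OF dickson_prod.hyps]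
 define L where "L = K - int p - 1"
 let ?r = "r + int p * int p * (int p - 1)"
 let ?T = "\<lambda>r k l a b. of_int (two_step_coeff r k l a b)"
 have *: "two_step (\<lambda>a b. q (a - int p) (b - 1)) r K a b \<approx> two_step q ?r L (a - int p * int p) (b - int p)" for a b
 proof -
  have "two_step (\<lambda>a b. q (a - int p) (b - 1)) r K a b
    \<approx> (\<Sum>k\<in>{0..K}. if k < int p \<or> k = K then 0 else ?T r k (K - k) a b * q (k - int p) (K - k - 1))"
   unfolding two_step_def by (rule eqv_sum) (auto simp: eqv_0 intro!: N_of_int supp)
  also have "... = (\<Sum>k\<in>{int p..K-1}. ?T r k (K - k) a b * q (k - int p) (K - k - 1))"
   by (rule sum.mono_neutral_cong_right) auto
  also have "... = (\<Sum>k\<in>{0..L}. ?T r (k + int p) (L - k + 1) a b * q k (L - k))"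
   by (rule sum.reindex_bij_witness[of _ "\<lambda>i. i + int p" "\<lambda>i. i - int p"]) (auto simp: L_def algebra_simps)
  also have "... = two_step q ?r L (a - int p * int p) (b - int p)"
   unfolding two_step_def two_step_coeff_prod ..
  finally show ?thesis .
 qed
 show ?case
  by (rule hom_part_eqv[OF hom_part_prod_pow[OF dickson_prod.IH[of "n - int p * (int p + 1)" ?r L]] eqv_sym[OF *]])
next
 case (dickson_eqv q q')
 show ?case
  by (rule hom_part_eqv[OF dickson_eqv.IH[of n r K]])
   (unfold two_step_def, intro eqv_sum eqv_scale cong_refl dickson_eqv.hyps)
qed

lemma two_step_adem:
 assumes "dickson q"
 shows "two_step q r K a b \<approx> (\<Sum>i\<in>{0..a}. of_int (adem_coeff p a b i) * two_step q r K (a + b - i) i)"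
 using dickson_adem[OF dickson_two_step[OF assms, of "a + b" r K], of a b] by simp

definition two_step_bock :: "(int => int => 'x) => int => int => int => int => 'x" where
 "two_step_bock q r K a b = (\<Sum>k\<in>{0..K}. of_int (cc (r + int p * k * (int p - 1)) (a - int p * k)
   * cc (r + 1 + (a - k + int p * (K - k)) * (int p - 1)) (b - int p * (K - k))) * q k (K - k))"

text \<open>Between the two operations \<open>\<beta>\<close> replaces \<open>u t\<^sup>m\<close> by \<open>t\<^bsup>m+1\<^esup>\<close>. The Pascal rule for the first factor distributes this shift over two ordinary composites.\<close>

lemma two_step_bock_eq:
 "two_step_bock q r K a b = two_step q (r + 1) K a b + two_step q (r + int p) K (a - 1) b"
 unfolding two_step_bock_def two_step_def sum.distrib[symmetric]
proof (intro sum.cong refl)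
 fix k
 have "cc (r + int p * k * (int p - 1)) (a - int p * k)
   * cc (r + 1 + (a - k + int p * (K - k)) * (int p - 1)) (b - int p * (K - k))
  = two_step_coeff (r + 1) k (K - k) a b + two_step_coeff (r + int p) k (K - k) (a - 1) b"
  by (subst psi_coeff_pascal) (simp add: two_step_coeff_def algebra_simps)
 then show "of_int (cc (r + int p * k * (int p - 1)) (a - int p * k)
   * cc (r + 1 + (a - k + int p * (K - k)) * (int p - 1)) (b - int p * (K - k))) * q k (K - k)
  = of_int (two_step_coeff (r + 1) k (K - k) a b) * q k (K - k)
   + of_int (two_step_coeff (r + int p) k (K - k) (a - 1) b) * q k (K - k)"
  by (simp add: algebra_simps)
qed

text \<open>By the splitting into two ordinary composites the claim reduces to their Adem relations.\<close>

lemma two_step_bock_adem: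
 assumes q: "dickson q"
 shows "two_step_bock q r K a b \<approx>
   (\<Sum>i\<in>{0..a}. of_int ((if even (a + i) then 1 else -1) * ibinom ((int p - 1) * (b - i)) (a - int p * i))
    * two_step q (r + 1) K (a + b - i) i)
   + (\<Sum>i\<in>{0..a - 1}. of_int (adem_coeff p (a - 1) b i) * two_step_bock q r K (a + b - i) i)"
proof (cases "a < 0")
 case True
 then have "two_step_bock q r K a b = 0"
  by (simp add: two_step_bock_eq two_step_def two_step_coeff_neg)
 then show ?thesis using True by simp
next
 case False
 let ?G = "two_step q (r + 1) K" and ?H = "two_step q (r + int p) K"
 let ?c = "adem_coeff p"
 have p0: "int p > 0" using p_prime by (simp add: prime_gt_0_nat)
 have "1 * a \<le> int p * a" using False p0 by (intro mult_right_mono) auto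
 then have van: "?c (a - 1) b a = 0" by (intro adem_coeff_eq_0) auto
 have ext: "(\<Sum>i\<in>{0..a - 1}. of_int (?c (a - 1) b i) * g i) = (\<Sum>i\<in>{0..a}. of_int (?c (a - 1) b i) * g i)"
  for g :: "int => 'x"
 proof -
  have "{0..a} = insert a {0..a-1}" using False by auto
  then show ?thesis using van by simp
 qed
 have co: "(if even (a + i) then 1 else -1) * ibinom ((int p - 1) * (b - i)) (a - int p * i) = ?c a b i - ?c (a - 1) b i" for i
  using ibinom_pascal[of "(int p - 1) * (b - i) - 1" "a - int p * i"]
  by (auto simp: adem_coeff_def algebra_simps)
 have "two_step_bock q r K a b \<approx> (\<Sum>i\<in>{0..a}. of_int (?c a b i) * ?G (a + b - i) i)
   + (\<Sum>i\<in>{0..a-1}. of_int (?c (a - 1) b i) * ?H (a - 1 + b - i) i)"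
  unfolding two_step_bock_eq by (intro eqv_add two_step_adem q)
 also have "... = (\<Sum>i\<in>{0..a}. of_int (?c a b i - ?c (a - 1) b i) * ?G (a + b - i) i)
   + (\<Sum>i\<in>{0..a - 1}. of_int (?c (a - 1) b i) * two_step_bock q r K (a + b - i) i)"
  unfolding ext two_step_bock_eq sum.distrib[symmetric]
  by (intro sum.cong refl) (simp add: algebra_simps)
 finally show ?thesis unfolding co .
qed

end
section \<open>Vector spaces over \<open>\<F>\<^sub>p\<close>\<close>

lemma Fp_simps:
 "carrier (Fp p) = {0..<int p}" "x \<oplus>\<^bsub>Fp p\<^esub> y = (x + y) mod int p"
 "x \<otimes>\<^bsub>Fp p\<^esub> y = (x * y) mod int p" "\<one>\<^bsub>Fp p\<^esub> = 1" "\<zero>\<^bsub>Fp p\<^esub> = 0"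
 by (auto simp: residue_ring_def)

lemma cring_Fp: "prime p ==> cring (Fp p)"
 by (rule residues.cring) (simp add: residues_def prime_gt_Suc_0_nat)

locale Fp_module =
 fixes p :: nat and W :: "(int, 'a, 'm) module_scheme"
 assumes p_prime: "prime p" and Fp_module: "module (Fp p) W"

sublocale Fp_module \<subseteq> module "Fp p" W by (rule Fp_module)

lemma Fp_moduleI:
 assumes "prime p" "abelian_group W"
  and "!!c x. c : {0..<int p} ==> x : carrier W ==> c \<odot>\<^bsub>W\<^esub> x : carrier W"
  and "!!c d x. c : {0..<int p} ==> d : {0..<int p} ==> x : carrier W ==>
   ((c + d) mod int p) \<odot>\<^bsub>W\<^esub> x = c \<odot>\<^bsub>W\<^esub> x \<oplus>\<^bsub>W\<^esub> d \<odot>\<^bsub>W\<^esub> x"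
  and "!!c x y. c : {0..<int p} ==> x : carrier W ==> y : carrier W ==>
   c \<odot>\<^bsub>W\<^esub> (x \<oplus>\<^bsub>W\<^esub> y) = c \<odot>\<^bsub>W\<^esub> x \<oplus>\<^bsub>W\<^esub> c \<odot>\<^bsub>W\<^esub> y"
  and "!!c d x. c : {0..<int p} ==> d : {0..<int p} ==> x : carrier W ==>
   ((c * d) mod int p) \<odot>\<^bsub>W\<^esub> x = c \<odot>\<^bsub>W\<^esub> (d \<odot>\<^bsub>W\<^esub> x)"
  and "!!x. x : carrier W ==> 1 \<odot>\<^bsub>W\<^esub> x = x"
 shows "Fp_module p W"
 using assms by (intro Fp_module.intro moduleI cring_Fp) (auto simp: Fp_simps)

context Fp_module begin

lemma zmult_closed [simp, intro]: "x : carrier W ==> zmult p W c x : carrier W"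
 using p_prime by (auto simp: zmult_def Fp_simps prime_gt_0_nat intro!: smult_closed)

lemma zmult_mod: "zmult p W (c mod int p) x = zmult p W c x" by (simp add: zmult_def)

lemma zmult_cong: "[c = c'] (mod int p) ==> zmult p W c x = zmult p W c' x"
 by (simp add: zmult_def cong_def)

lemma zmult_l_distr: "x : carrier W ==> zmult p W (c + d) x = zmult p W c x \<oplus>\<^bsub>W\<^esub> zmult p W d x"
 using smult_l_distr[of "c mod int p" "d mod int p" x] p_prime
 by (simp add: zmult_def Fp_simps mod_add_eq prime_gt_0_nat)

lemma zmult_r_distr:
 "x : carrier W ==> y : carrier W ==> zmult p W c (x \<oplus>\<^bsub>W\<^esub> y) = zmult p W c x \<oplus>\<^bsub>W\<^esub> zmult p W c y"
 using smult_r_distr[of "c mod int p" x y] p_prime by (simp add: zmult_def Fp_simps prime_gt_0_nat)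

lemma zmult_assoc: "x : carrier W ==> zmult p W (c * d) x = zmult p W c (zmult p W d x)"
 using smult_assoc1[of "c mod int p" "d mod int p" x] p_prime
 by (simp add: zmult_def Fp_simps mod_mult_eq prime_gt_0_nat)

lemma zmult_1 [simp]: "x : carrier W ==> zmult p W 1 x = x"
 using smult_one[of x] prime_gt_1_nat[OF p_prime] by (simp add: zmult_def Fp_simps)

lemma zmult_0 [simp]: "x : carrier W ==> zmult p W 0 x = \<zero>\<^bsub>W\<^esub>"
 using zmult_l_distr[of x 0 0] by (metis M.add.l_cancel_one' M.zero_closed add_0 zmult_closed)

lemma zmult_zero [simp]: "zmult p W c \<zero>\<^bsub>W\<^esub> = \<zero>\<^bsub>W\<^esub>"
 using zmult_r_distr[of "\<zero>\<^bsub>W\<^esub>" "\<zero>\<^bsub>W\<^esub>" c] by (metis M.add.l_cancel_one' M.zero_closed M.l_zero zmult_closed)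

lemma zmult_minus: "x : carrier W ==> zmult p W (- c) x = \<ominus>\<^bsub>W\<^esub> zmult p W c x"
 using zmult_l_distr[of x "- c" c] by (simp add: M.minus_equality)

lemma zmult_diff: "x : carrier W ==> zmult p W (c - d) x = zmult p W c x \<ominus>\<^bsub>W\<^esub> zmult p W d x"
 using zmult_l_distr[of x c "- d"] by (simp add: zmult_minus a_minus_def)

lemma zmult_left_commute: "x : carrier W ==> zmult p W c (zmult p W d x) = zmult p W d (zmult p W c x)"
 by (metis mult.commute zmult_assoc)

lemma diff_eq_zeroD:
 assumes "x : carrier W" "y : carrier W" "x \<ominus>\<^bsub>W\<^esub> y = \<zero>\<^bsub>W\<^esub>" shows "x = y"
 using assms by (metis a_minus_def M.add.inv_closed M.minus_equality M.minus_minus)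

lemma smult_zmult: "c : {0..<int p} ==> c \<odot>\<^bsub>W\<^esub> x = zmult p W c x"
 by (simp add: zmult_def)

lemma sgn_mult_closed [simp, intro]: "x : carrier W ==> sgn_mult W e x : carrier W"
 by (simp add: sgn_mult_def)

lemma sgn_mult_zmult: "x : carrier W ==> sgn_mult W e x = zmult p W (if even e then 1 else -1) x"
 by (simp add: sgn_mult_def zmult_minus)

lemma zmult_finsum:
 "f : A \<rightarrow> carrier W ==> zmult p W c (finsum W f A) = (\<Oplus>\<^bsub>W\<^esub>i\<in>A. zmult p W c (f i))"
proof (induction A rule: infinite_finite_induct)
 case (insert a A)
 then have f: "f a : carrier W" "f : A \<rightarrow> carrier W" by auto
 then have "(\<lambda>i. zmult p W c (f i)) : A \<rightarrow> carrier W" by auto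
 then show ?case using insert f by (simp add: M.finsum_insert zmult_r_distr M.finsum_closed)
qed (auto simp: M.finsum_infinite)

lemma zmult_sum:
 "x : carrier W ==> zmult p W (sum c A) x = (\<Oplus>\<^bsub>W\<^esub>i\<in>A. zmult p W (c i) x)"
 by (induction A rule: infinite_finite_induct) (auto simp: M.finsum_infinite M.finsum_insert zmult_l_distr)

lemma finsum_neutral: "(!!i. i : A ==> f i = \<zero>\<^bsub>W\<^esub>) ==> finsum W f A = \<zero>\<^bsub>W\<^esub>"
 by (rule M.add.finprod_one_eqI) simp

lemma finsum_swap:
 assumes "!!i j. i : A ==> j : B ==> f i j : carrier W" "finite A" "finite B"
 shows "(\<Oplus>\<^bsub>W\<^esub>i\<in>A. \<Oplus>\<^bsub>W\<^esub>j\<in>B. f i j) = (\<Oplus>\<^bsub>W\<^esub>j\<in>B. \<Oplus>\<^bsub>W\<^esub>i\<in>A. f i j)"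
 using assms(2,1)
proof (induction A rule: finite_induct)
 case empty
 show ?case by (simp add: finsum_neutral)
next
 case (insert a A)
 have "(\<Oplus>\<^bsub>W\<^esub>j\<in>B. \<Oplus>\<^bsub>W\<^esub>i\<in>insert a A. f i j) = (\<Oplus>\<^bsub>W\<^esub>j\<in>B. f a j \<oplus>\<^bsub>W\<^esub> (\<Oplus>\<^bsub>W\<^esub>i\<in>A. f i j))"
  using insert by (intro M.finsum_cong') (auto simp: M.finsum_insert Pi_def intro!: M.finsum_closed)
 also have "... = (\<Oplus>\<^bsub>W\<^esub>j\<in>B. f a j) \<oplus>\<^bsub>W\<^esub> (\<Oplus>\<^bsub>W\<^esub>j\<in>B. \<Oplus>\<^bsub>W\<^esub>i\<in>A. f i j)"
  using insert by (intro M.finsum_addf) (auto simp: Pi_def intro!: M.finsum_closed)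
 finally show ?case using insert
  by (simp add: M.finsum_insert Pi_def M.finsum_closed)
qed

lemma finsum_single:
 assumes "finite A" "i : A" "f i : carrier W" "!!j. j : A ==> j \<noteq> i ==> f j = \<zero>\<^bsub>W\<^esub>"
 shows "finsum W f A = f i"
proof -
 have "finsum W f A = f i \<oplus>\<^bsub>W\<^esub> finsum W f (A - {i})"
  using assms by (subst M.finsum_insert[symmetric]) (auto simp: insert_absorb Pi_def)
 also have "finsum W f (A - {i}) = \<zero>\<^bsub>W\<^esub>" using assms by (intro finsum_neutral) auto
 finally show ?thesis using assms by simp
qed

lemma finsum_subset:
 assumes "finite B" "A \<subseteq> B" "!!i. i : B - A ==> f i = \<zero>\<^bsub>W\<^esub>" "f : A \<rightarrow> carrier W"
 shows "finsum W f A = finsum W f B"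
 using assms by (intro M.add.finprod_mono_neutral_cong_left) auto

text \<open>Multiplication by a residue is an iterated sum, so that additive maps and subgroups are
 automatically linear over \<open>\<F>\<^sub>p\<close>.\<close>

lemma zmult_induct:
 assumes x: "x : carrier W" and 0: "P \<zero>\<^bsub>W\<^esub>" and add: "!!y. y : carrier W ==> P y ==> P (x \<oplus>\<^bsub>W\<^esub> y)"
 shows "P (zmult p W c x)"
proof -
 have "P (zmult p W (int n) x)" for n
 proof (induction n)
  case (Suc n)
  have "zmult p W (int (Suc n)) x = x \<oplus>\<^bsub>W\<^esub> zmult p W (int n) x"
   using zmult_l_distr[OF x, of 1 "int n"] x by simp
  then show ?case using Suc add x by simp
 qed (use 0 x in simp)
 from this[of "nat (c mod int p)"] show ?thesis
  using p_prime by (simp add: zmult_mod prime_gt_0_nat)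
qed

lemma additive_subgroup_zmult:
 assumes "H \<subseteq> carrier W" "\<zero>\<^bsub>W\<^esub> : H" "!!x y. x : H ==> y : H ==> x \<oplus>\<^bsub>W\<^esub> y : H" "x : H"
 shows "zmult p W c x : H"
 by (rule zmult_induct[where P = "\<lambda>y. y : H"]) (use assms in auto)

lemma submoduleI_additive:
 assumes H: "H \<subseteq> carrier W" "\<zero>\<^bsub>W\<^esub> : H" "!!x y. x : H ==> y : H ==> x \<oplus>\<^bsub>W\<^esub> y : H"
 shows "submodule H (Fp p) W"
proof (rule submoduleI)
 show "\<ominus>\<^bsub>W\<^esub> x : H" if "x : H" for x
  using additive_subgroup_zmult[OF H that, of "-1"] that H by (auto simp: zmult_minus subset_iff)
 show "c \<odot>\<^bsub>W\<^esub> x : H" if "c : carrier (Fp p)" "x : H" for c x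
  using additive_subgroup_zmult[OF H that(2), of c] that by (simp add: Fp_simps smult_zmult)
qed (use H in auto)

lemma submoduleD:
 assumes "submodule H (Fp p) W"
 shows "H \<subseteq> carrier W" "\<zero>\<^bsub>W\<^esub> : H" "!!x y. x : H ==> y : H ==> x \<oplus>\<^bsub>W\<^esub> y : H"
  "!!x. x : H ==> \<ominus>\<^bsub>W\<^esub> x : H" "!!x y. x : H ==> y : H ==> x \<ominus>\<^bsub>W\<^esub> y : H"
  "!!c x. x : H ==> zmult p W c x : H"
proof -
 show 1: "H \<subseteq> carrier W" and 2: "!!x y. x : H ==> y : H ==> x \<oplus>\<^bsub>W\<^esub> y : H"
  and 3: "!!x. x : H ==> \<ominus>\<^bsub>W\<^esub> x : H" using submoduleE[OF assms] by auto
 obtain y where "y : H" using submoduleE[OF assms] by auto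
 then show 4: "\<zero>\<^bsub>W\<^esub> : H" using 1 2 3 by (metis M.r_neg subsetD)
 show "!!x y. x : H ==> y : H ==> x \<ominus>\<^bsub>W\<^esub> y : H" using 2 3 by (simp add: a_minus_def)
 show "!!c x. x : H ==> zmult p W c x : H" using additive_subgroup_zmult[OF 1 4 2] by auto
qed

lemma finsum_submodule:
 assumes "submodule H (Fp p) W" "f : A \<rightarrow> H"
 shows "finsum W f A : H"
 using assms(2)
proof (induction A rule: infinite_finite_induct)
 case (insert a A)
 then have "f : A \<rightarrow> carrier W" "f a : carrier W" "f a : H" "finsum W f A : H"
  using submoduleD(1)[OF assms(1)] by auto
 then show ?case using insert submoduleD(3)[OF assms(1)] by (simp add: M.finsum_insert)
qed (use submoduleD(2)[OF assms(1)] in \<open>auto simp: M.finsum_infinite\<close>)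

lemma mod_span_submodule:
 assumes "S \<subseteq> carrier W"
 shows "submodule (mod_span (Fp p) W S) (Fp p) W" "S \<subseteq> mod_span (Fp p) W S"
  "!!H. submodule H (Fp p) W ==> S \<subseteq> H ==> mod_span (Fp p) W S \<subseteq> H"
proof -
 have car: "submodule (carrier W) (Fp p) W" by (rule carrier_is_submodule)
 show "submodule (mod_span (Fp p) W S) (Fp p) W"
 proof (rule submoduleI_additive)
  show "mod_span (Fp p) W S \<subseteq> carrier W" using car assms by (auto simp: mod_span_def)
  show "\<zero>\<^bsub>W\<^esub> : mod_span (Fp p) W S" using submoduleD(2) by (auto simp: mod_span_def)
  show "x \<oplus>\<^bsub>W\<^esub> y : mod_span (Fp p) W S" if "x : mod_span (Fp p) W S" "y : mod_span (Fp p) W S" for x y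
   using that submoduleD(3) by (auto simp: mod_span_def)
 qed
 show "S \<subseteq> mod_span (Fp p) W S" by (auto simp: mod_span_def)
 show "!!H. submodule H (Fp p) W ==> S \<subseteq> H ==> mod_span (Fp p) W S \<subseteq> H" by (auto simp: mod_span_def)
qed

end

text \<open>Over \<open>\<F>\<^sub>p\<close> scalar multiplication is iterated addition.\<close>

lemma mod_homI:
 assumes V: "Fp_module p V" and W: "Fp_module p W"
  and closed: "!!x. x : carrier V ==> f x : carrier W"
  and add: "!!x y. x : carrier V ==> y : carrier V ==> f (x \<oplus>\<^bsub>V\<^esub> y) = f x \<oplus>\<^bsub>W\<^esub> f y"
 shows "f : Hom p V W"
proof -
 interpret V: Fp_module p V by (rule V)
 interpret W: Fp_module p W by (rule W)
 have z: "f \<zero>\<^bsub>V\<^esub> = \<zero>\<^bsub>W\<^esub>"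
  using add[of "\<zero>\<^bsub>V\<^esub>" "\<zero>\<^bsub>V\<^esub>"] closed[of "\<zero>\<^bsub>V\<^esub>"]
  by (metis V.M.zero_closed V.M.l_zero W.M.add.l_cancel_one')
 have "f (c \<odot>\<^bsub>V\<^esub> x) = c \<odot>\<^bsub>W\<^esub> f x" if c: "c : carrier (Fp p)" and x: "x : carrier V" for c x
 proof -
  have "f (zmult p V (int n) x) = zmult p W (int n) (f x)" for n
  proof (induction n)
   case (Suc n)
   have "zmult p V (int (Suc n)) x = x \<oplus>\<^bsub>V\<^esub> zmult p V (int n) x"
    "zmult p W (int (Suc n)) (f x) = f x \<oplus>\<^bsub>W\<^esub> zmult p W (int n) (f x)"
    using V.zmult_l_distr[OF x, of 1 "int n"] W.zmult_l_distr[OF closed[OF x], of 1 "int n"] x closed by simp_all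
   then show ?case using Suc add x by simp
  qed (use z x closed in simp)
  from this[of "nat c"] show ?thesis using c by (simp add: V.smult_zmult W.smult_zmult Fp_simps)
 qed
 then show ?thesis using closed add by (simp add: mod_hom_def Fp_simps)
qed

lemma mod_hom_closed: "f : mod_hom R V W ==> x : carrier V ==> f x : carrier W"
 by (auto simp: mod_hom_def)

lemma mod_hom_add: "f : mod_hom R V W ==> x : carrier V ==> y : carrier V ==> f (x \<oplus>\<^bsub>V\<^esub> y) = f x \<oplus>\<^bsub>W\<^esub> f y"
 by (auto simp: mod_hom_def)

locale Fp_module_hom = V: Fp_module p V + W: Fp_module p W
 for p and V :: "(int, 'a, 'm) module_scheme" and W :: "(int, 'b, 'n) module_scheme" +
 fixes f :: "'a => 'b"
 assumes f_hom: "f : Hom p V W"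
begin

lemma closed [simp, intro]: "x : carrier V ==> f x : carrier W" by (rule mod_hom_closed[OF f_hom])
lemma add: "x : carrier V ==> y : carrier V ==> f (x \<oplus>\<^bsub>V\<^esub> y) = f x \<oplus>\<^bsub>W\<^esub> f y"
 by (rule mod_hom_add[OF f_hom])
lemma zero [simp]: "f \<zero>\<^bsub>V\<^esub> = \<zero>\<^bsub>W\<^esub>"
 using add[of "\<zero>\<^bsub>V\<^esub>" "\<zero>\<^bsub>V\<^esub>"] by (metis V.M.zero_closed V.M.l_zero W.M.add.l_cancel_one' closed)
lemma neg: "x : carrier V ==> f (\<ominus>\<^bsub>V\<^esub> x) = \<ominus>\<^bsub>W\<^esub> f x"
 using add[of "\<ominus>\<^bsub>V\<^esub> x" x] by (simp add: V.M.l_neg W.M.minus_equality)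
lemma diff: "x : carrier V ==> y : carrier V ==> f (x \<ominus>\<^bsub>V\<^esub> y) = f x \<ominus>\<^bsub>W\<^esub> f y"
 by (simp add: a_minus_def add neg)
lemma zmult: "x : carrier V ==> f (zmult p V c x) = zmult p W c (f x)"
 using f_hom V.p_prime by (auto simp: zmult_def mod_hom_def Fp_simps prime_gt_0_nat)
lemma sgn: "x : carrier V ==> f (sgn_mult V e x) = sgn_mult W e (f x)"
 by (simp add: sgn_mult_def neg)
lemma finsum: "g : A \<rightarrow> carrier V ==> f (finsum V g A) = (\<Oplus>\<^bsub>W\<^esub>i\<in>A. f (g i))"
proof (induction A rule: infinite_finite_induct)
 case (insert a A)
 then have "g : A \<rightarrow> carrier V" "g a : carrier V" "(\<lambda>i. f (g i)) : A \<rightarrow> carrier W" by auto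
 then show ?case using insert by (simp add: V.M.finsum_insert W.M.finsum_insert add)
qed (auto simp: V.M.finsum_infinite W.M.finsum_infinite)

end

lemmas Fp_module_homI = Fp_module_hom.intro[OF _ _ Fp_module_hom_axioms.intro]

lemma mod_hom_comp: "f : mod_hom R V W ==> g : mod_hom R W X ==> (\<lambda>x. g (f x)) : mod_hom R V X"
 by (auto simp: mod_hom_def Pi_def)
section \<open>The action of the free algebra\<close>

text \<open>Graded vector spaces with arbitrary operators for the generators: the data of a right module over the free algebra, before any relation is imposed.\<close>

locale graded_ops =
 fixes p :: nat and V :: "('a, 'z) dgmod_scheme"
 assumes p_prime: "prime p"
  and grd_module: "!!d. module (Fp p) (grd V d)"
  and sop_hom: "!!g d. sop V g d : Hom p (grd V d) (grd V (d - deg p g))"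

sublocale graded_ops \<subseteq> gr: Fp_module p "grd V d" for d
 by (rule Fp_module.intro[OF p_prime grd_module])

sublocale graded_ops \<subseteq> sp: Fp_module_hom p "grd V d" "grd V (d - deg p g)" "sop V g d" for d g
 by (intro Fp_module_homI gr.Fp_module_axioms sop_hom)

sublocale right_A_module \<subseteq> graded_ops p V
 by (rule graded_ops.intro[OF p_prime grd_module sop_hom])

lemma word_deg_simps [simp]:
 "word_deg p (Word []) = 0" "word_deg p (Word (g # gs)) = gen_deg p g + word_deg p (Word gs)"
 "word_deg p 0 = 0" "word_deg p (v + w) = word_deg p v + word_deg p w"
 by (auto simp: word_deg_def zero_word_def plus_word_def)

text \<open>The action of the part of word degree \<open>k\<close>. In contrast to \<open>free_act\<close> it is additive on the whole free algebra and so allows inhomogeneous multipliers in ideal arguments.\<close>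

definition hact :: "nat => ('a, 'z) dgmod_scheme => nat => int => free_alg => 'a => 'a" where
 "hact p V k d f x = (\<Oplus>\<^bsub>grd V (d - int k)\<^esub>w\<in>{w : Poly_Mapping.keys f. word_deg p w = k}.
   zmult p (grd V (d - int k)) (Poly_Mapping.lookup f w) (word_act p V (letters w) d x))"

lemma word_act_append:
 "word_act p V (gs @ hs) d x = word_act p V hs (d - int (word_deg p (Word gs))) (word_act p V gs d x)"
 by (induction gs arbitrary: d x) (auto simp: algebra_simps)

lemma free_act_eq_hact: "f : free_deg p k ==> free_act p V k d f x = hact p V k d f x"
proof -
 assume "f : free_deg p k"
 then have "{w : Poly_Mapping.keys f. word_deg p w = k} = Poly_Mapping.keys f" by (auto simp: free_deg_def)
 then show ?thesis by (simp add: free_act_def hact_def)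
qed

context graded_ops begin

lemma word_act_hom:
 "word_act p V gs d : Hom p (grd V d) (grd V (d - int (word_deg p (Word gs))))"
proof (induction gs arbitrary: d)
 case Nil
 show ?case by (simp add: mod_hom_def)
next
 case (Cons g gs)
 have "(\<lambda>x. word_act p V gs (d - deg p g) (sop V g d x))
  : Hom p (grd V d) (grd V (d - deg p g - int (word_deg p (Word gs))))"
  by (rule mod_hom_comp[OF sop_hom Cons.IH])
 then show ?case by (simp add: algebra_simps)
qed

sublocale wa: Fp_module_hom p "grd V d" "grd V (d - int (word_deg p (Word gs)))" "word_act p V gs d" for d gs
 by (intro Fp_module_homI gr.Fp_module_axioms word_act_hom)

lemma word_act_closed: "x : V $ d ==> word_deg p w = k ==>
  word_act p V (letters w) d x : V $ (d - int k)"
 using wa.closed[of x d "letters w"] by simp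

lemma hact_closed: "x : V $ d ==> hact p V k d f x : V $ (d - int k)"
 unfolding hact_def by (intro gr.M.finsum_closed) (auto intro!: gr.zmult_closed word_act_closed)

lemma hact_superset:
 assumes "finite A" "Poly_Mapping.keys f \<subseteq> A" "x : V $ d"
 shows "hact p V k d f x = (\<Oplus>\<^bsub>grd V (d - int k)\<^esub>w\<in>{w : A. word_deg p w = k}.
   zmult p (grd V (d - int k)) (Poly_Mapping.lookup f w) (word_act p V (letters w) d x))"
 unfolding hact_def
proof (rule gr.finsum_subset)
 show "zmult p (grd V (d - int k)) (Poly_Mapping.lookup f w) (word_act p V (letters w) d x) = \<zero>\<^bsub>grd V (d - int k)\<^esub>"
  if "w : {w : A. word_deg p w = k} - {w : Poly_Mapping.keys f. word_deg p w = k}" for w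
  using that assms by (auto simp: in_keys_iff intro!: gr.zmult_0 word_act_closed)
qed (use assms in \<open>auto intro!: gr.zmult_closed word_act_closed\<close>)

lemma hact_add:
 assumes "x : V $ d"
 shows "hact p V k d (f + g) x = hact p V k d f x \<oplus>\<^bsub>grd V (d - int k)\<^esub> hact p V k d g x"
proof -
 let ?A = "Poly_Mapping.keys f \<union> Poly_Mapping.keys g"
 have *: "hact p V k d h x = (\<Oplus>\<^bsub>grd V (d - int k)\<^esub>w\<in>{w : ?A. word_deg p w = k}.
   zmult p (grd V (d - int k)) (Poly_Mapping.lookup h w) (word_act p V (letters w) d x))"
  if "h : {f, g, f + g}" for h
  using that assms keys_add[of f g] by (intro hact_superset) auto
 let ?z = "\<lambda>h w. zmult p (grd V (d - int k)) (Poly_Mapping.lookup h w) (word_act p V (letters w) d x)"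
 let ?B = "{w : ?A. word_deg p w = k}"
 have "hact p V k d (f + g) x = (\<Oplus>\<^bsub>grd V (d - int k)\<^esub>w\<in>?B. ?z f w \<oplus>\<^bsub>grd V (d - int k)\<^esub> ?z g w)"
  unfolding *[OF insertI2[OF insertI2[OF insertI1]]] using assms
  by (intro gr.M.finsum_cong') (auto simp: lookup_add gr.zmult_l_distr word_act_closed intro!: gr.zmult_closed gr.M.a_closed)
 also have "... = hact p V k d f x \<oplus>\<^bsub>grd V (d - int k)\<^esub> hact p V k d g x"
  unfolding *[OF insertI1] *[OF insertI2[OF insertI1]] using assms
  by (intro gr.M.finsum_addf) (auto intro!: gr.zmult_closed word_act_closed)
 finally show ?thesis .
qed

lemma hact_single:
 assumes "x : V $ d"
 shows "hact p V k d (Poly_Mapping.single w c) x =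
  (if word_deg p w = k then zmult p (grd V (d - int k)) c (word_act p V (letters w) d x) else \<zero>\<^bsub>grd V (d - int k)\<^esub>)"
proof -
 have "hact p V k d (Poly_Mapping.single w c) x = (\<Oplus>\<^bsub>grd V (d - int k)\<^esub>v\<in>{v : {w}. word_deg p v = k}.
   zmult p (grd V (d - int k)) (Poly_Mapping.lookup (Poly_Mapping.single w c) v) (word_act p V (letters v) d x))"
  using assms by (intro hact_superset) auto
 also have "... = (if word_deg p w = k then zmult p (grd V (d - int k)) c (word_act p V (letters w) d x) else \<zero>\<^bsub>grd V (d - int k)\<^esub>)"
 proof (cases "word_deg p w = k")
  case True
  then have *: "{v : {w}. word_deg p v = k} = {w}" by auto
  show ?thesis unfolding * using True assms by (simp add: word_act_closed gr.M.finsum_insert)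
 next
  case False
  then have *: "{v : {w}. word_deg p v = k} = {}" by auto
  show ?thesis unfolding * using False by simp
 qed
 finally show ?thesis .
qed

lemma hact_0: "x : V $ d ==> hact p V k d 0 x = \<zero>\<^bsub>grd V (d - int k)\<^esub>"
 by (simp add: hact_def)

lemma hact_uminus: "x : V $ d ==> hact p V k d (- f) x = \<ominus>\<^bsub>grd V (d - int k)\<^esub> hact p V k d f x"
 using hact_add[of x d k "- f" f] hact_0[of x d k] by (simp add: gr.M.minus_equality hact_closed)

lemma hact_diff:
 "x : V $ d ==> hact p V k d (f - g) x = hact p V k d f x \<ominus>\<^bsub>grd V (d - int k)\<^esub> hact p V k d g x"
 using hact_add[of x d k f "- g"] by (simp add: hact_uminus a_minus_def)

lemma hact_sum:
 "x : V $ d ==> hact p V k d (sum f A) x = (\<Oplus>\<^bsub>grd V (d - int k)\<^esub>i\<in>A. hact p V k d (f i) x)"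
 by (induction A rule: infinite_finite_induct)
  (auto simp: hact_0 gr.M.finsum_infinite gr.M.finsum_insert hact_add hact_closed)

lemma hact_of_int: "x : V $ d ==> hact p V k d (of_int c * f) x = zmult p (grd V (d - int k)) c (hact p V k d f x)"
proof (induction c rule: int_induct[where k = 0])
 case base then show ?case by (simp add: hact_0 hact_closed)
next
 case (step1 i) then show ?case
  by (simp add: distrib_right hact_add gr.zmult_l_distr hact_closed)
next
 case (step2 i) then show ?case
  by (simp add: left_diff_distrib hact_diff gr.zmult_diff hact_closed)
qed

lemma hact_wmon:
 assumes "x : V $ d" "word_deg p (Word gs) = k"
 shows "hact p V k d (wmon gs) x = word_act p V gs d x"
 using hact_single[OF assms(1), of k "Word gs" 1] word_act_closed[of x d "Word gs" k] assms(2) assms(1)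
 by (simp add: wmon_def)

lemma hact_hom: "hact p V k d f : Hom p (grd V d) (grd V (d - int k))"
proof (rule mod_homI)
 fix x y assume xy: "x : V $ d" "y : V $ d"
 let ?z = "\<lambda>w x. zmult p (grd V (d - int k)) (Poly_Mapping.lookup f w) (word_act p V (letters w) d x)"
 have "?z w (x \<oplus>\<^bsub>grd V d\<^esub> y) = ?z w x \<oplus>\<^bsub>grd V (d - int k)\<^esub> ?z w y" if "word_deg p w = k" for w
  using wa.add[OF xy, of "letters w"] word_act_closed[OF xy(1) that] word_act_closed[OF xy(2) that] that
  by (simp add: gr.zmult_r_distr)
 then show "hact p V k d f (x \<oplus>\<^bsub>grd V d\<^esub> y) = hact p V k d f x \<oplus>\<^bsub>grd V (d - int k)\<^esub> hact p V k d f y"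
  unfolding hact_def using xy
  by (subst gr.M.finsum_addf[symmetric])
   (auto intro!: gr.M.finsum_cong' gr.zmult_closed gr.M.a_closed word_act_closed)
qed (auto intro!: gr.Fp_module_axioms hact_closed)

sublocale ha: Fp_module_hom p "grd V d" "grd V (d - int k)" "hact p V k d f" for d k f
 by (intro Fp_module_homI gr.Fp_module_axioms hact_hom)

end

lemma free_alg_expand: "(f :: free_alg) = (\<Sum>w\<in>Poly_Mapping.keys f. Poly_Mapping.single w (Poly_Mapping.lookup f w))"
proof (rule poly_mapping_eqI)
 fix v
 have "(\<Sum>w\<in>Poly_Mapping.keys f. Poly_Mapping.lookup (Poly_Mapping.single w (Poly_Mapping.lookup f w)) v)
   = (\<Sum>w\<in>Poly_Mapping.keys f. if w = v then Poly_Mapping.lookup f v else 0)"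
  by (intro sum.cong) (auto simp: lookup_single when_def)
 then show "Poly_Mapping.lookup f v
   = Poly_Mapping.lookup (\<Sum>w\<in>Poly_Mapping.keys f. Poly_Mapping.single w (Poly_Mapping.lookup f w)) v"
  by (simp add: lookup_sum in_keys_iff)
qed

lemma free_alg_induct [case_names zero single add]:
 fixes f :: free_alg
 assumes "P 0" "!!w c. P (Poly_Mapping.single w c)" "!!f g. P f ==> P g ==> P (f + g)"
 shows "P f"
proof -
 have "P (\<Sum>w\<in>A. Poly_Mapping.single w (Poly_Mapping.lookup f w))" if "finite A" for A
  using that by induction (auto intro: assms)
 from this[OF finite_keys[of f]] show ?thesis unfolding free_alg_expand[symmetric] .
qed

context graded_ops begin

lemma hact_mult_single:
 assumes x: "x : V $ d"
 shows "word_deg p v \<le> k ==> hact p V k d (f * Poly_Mapping.single v c) x =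
   zmult p (grd V (d - int k)) c (word_act p V (letters v) (d - int (k - word_deg p v)) (hact p V (k - word_deg p v) d f x))"
  and "\<not> word_deg p v \<le> k ==> hact p V k d (f * Poly_Mapping.single v c) x = \<zero>\<^bsub>grd V (d - int k)\<^esub>"
proof -
 let ?m = "k - word_deg p v"
 assume le: "word_deg p v \<le> k"
 then have e: "d - int ?m - int (word_deg p v) = d - int k" by simp
 show "hact p V k d (f * Poly_Mapping.single v c) x =
   zmult p (grd V (d - int k)) c (word_act p V (letters v) (d - int ?m) (hact p V ?m d f x))"
 proof (induction f rule: free_alg_induct)
  case zero
  show ?case using wa.zero[of "letters v" "d - int ?m"] e by (simp add: hact_0 x)
 next
  case (single w b)
  have a: "word_act p V (letters v) (d - int ?m) (word_act p V (letters w) d x) : V $ (d - int k)"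
   if "word_deg p w = ?m"
   using wa.closed[OF word_act_closed[OF x that], of "letters v"] e by simp
  show ?case
  proof (cases "word_deg p w = ?m")
   case True
   then have "word_deg p (w + v) = k" using le by simp
   then show ?thesis using True le
    wa.zmult[OF word_act_closed[OF x True], of "letters v" b] e a
    by (simp add: mult_single hact_single[OF x] plus_word_def word_act_append gr.zmult_assoc mult.commute[of b c])
  next
   case False
   then have "word_deg p (w + v) \<noteq> k" using le by auto
   then show ?thesis using False wa.zero[of "letters v" "d - int ?m"] e
    by (simp add: mult_single hact_single[OF x])
  qed
 next
  case (add f g)
  then show ?case using wa.add[OF hact_closed[OF x] hact_closed[OF x], of "letters v" ?m f g]
   wa.closed[OF hact_closed[OF x], of "letters v" ?m f] wa.closed[OF hact_closed[OF x], of "letters v" ?m g] e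
   by (simp add: distrib_right hact_add[OF x] gr.zmult_r_distr)
 qed
next
 assume nle: "\<not> word_deg p v \<le> k"
 show "hact p V k d (f * Poly_Mapping.single v c) x = \<zero>\<^bsub>grd V (d - int k)\<^esub>"
  by (induction f rule: free_alg_induct) (use nle in \<open>auto simp: hact_0 x mult_single hact_single[OF x] distrib_right hact_add[OF x]\<close>)
qed

lemma hact_single_mult:
 assumes x: "x : V $ d"
 shows "word_deg p v \<le> k ==> hact p V k d (Poly_Mapping.single v c * f) x =
   zmult p (grd V (d - int k)) c (hact p V (k - word_deg p v) (d - int (word_deg p v)) f (word_act p V (letters v) d x))"
  and "\<not> word_deg p v \<le> k ==> hact p V k d (Poly_Mapping.single v c * f) x = \<zero>\<^bsub>grd V (d - int k)\<^esub>"
proof -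
 let ?m = "k - word_deg p v" and ?e = "d - int (word_deg p v)"
 assume le: "word_deg p v \<le> k"
 have y: "word_act p V (letters v) d x : V $ ?e" by (rule word_act_closed[OF x refl])
 have e: "?e - int ?m = d - int k" using le by simp
 show "hact p V k d (Poly_Mapping.single v c * f) x =
   zmult p (grd V (d - int k)) c (hact p V ?m ?e f (word_act p V (letters v) d x))"
 proof (induction f rule: free_alg_induct)
  case zero
  show ?case using e by (simp add: hact_0[OF y] hact_0[OF x])
 next
  case (single w b)
  show ?case
  proof (cases "word_deg p w = ?m")
   case True
   then have "word_deg p (v + w) = k" using le by simp
   then show ?thesis using True le e word_act_closed[OF y True]
    by (simp add: mult_single hact_single[OF x] hact_single[OF y] plus_word_def word_act_append gr.zmult_assoc)
  next
   case False
   then have "word_deg p (v + w) \<noteq> k" using le by auto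
   then show ?thesis using False e
    by (simp add: mult_single hact_single[OF x] hact_single[OF y])
  qed
 next
  case (add f g)
  then show ?case using e hact_closed[OF y, of ?m f] hact_closed[OF y, of ?m g]
   by (simp add: distrib_left hact_add[OF x] hact_add[OF y] gr.zmult_r_distr)
 qed
next
 assume nle: "\<not> word_deg p v \<le> k"
 show "hact p V k d (Poly_Mapping.single v c * f) x = \<zero>\<^bsub>grd V (d - int k)\<^esub>"
  by (induction f rule: free_alg_induct) (use nle in \<open>auto simp: hact_0 x mult_single hact_single[OF x] distrib_left hact_add[OF x]\<close>)
qed

text \<open>Elements all of whose homogeneous parts act by zero. This is a two-sided ideal, since each homogeneous part of a product with a word is the product of a homogeneous part with this word.\<close>

definition annihilator :: "free_alg set" where
 "annihilator = {f. \<forall>k d x. x : V $ d \<longrightarrow> hact p V k d f x = \<zero>\<^bsub>grd V (d - int k)\<^esub>}"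

lemma annihilatorD: "f : annihilator ==> x : V $ d ==> hact p V k d f x = \<zero>\<^bsub>grd V (d - int k)\<^esub>"
 by (simp add: annihilator_def)

lemma annihilator_mult:
 assumes f: "f : annihilator"
 shows "f * g : annihilator" "g * f : annihilator"
proof -
 have add: "a + b : annihilator" if "a : annihilator" "b : annihilator" for a b
  using that by (auto simp: annihilator_def hact_add)
 have 0: "0 : annihilator" by (simp add: annihilator_def hact_0)
 have 1: "f * Poly_Mapping.single w c : annihilator" for w c
 proof -
  have "hact p V k d (f * Poly_Mapping.single w c) x = \<zero>\<^bsub>grd V (d - int k)\<^esub>" if x: "x : V $ d" for k d x
  proof (cases "word_deg p w \<le> k")
   case True
   then show ?thesis using wa.zero[of "letters w" "d - int (k - word_deg p w)"]
    by (simp add: hact_mult_single[OF x] annihilatorD[OF f x])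
  qed (simp add: hact_mult_single[OF x])
  then show ?thesis by (simp add: annihilator_def)
 qed
 have 2: "Poly_Mapping.single w c * f : annihilator" for w c
 proof -
  have "hact p V k d (Poly_Mapping.single w c * f) x = \<zero>\<^bsub>grd V (d - int k)\<^esub>" if x: "x : V $ d" for k d x
  proof (cases "word_deg p w \<le> k")
   case True
   moreover have "hact p V (k - word_deg p w) (d - int (word_deg p w)) f (word_act p V (letters w) d x)
     = \<zero>\<^bsub>grd V (d - int (word_deg p w) - int (k - word_deg p w))\<^esub>"
    by (rule annihilatorD[OF f word_act_closed[OF x refl]])
   ultimately show ?thesis by (simp add: hact_single_mult[OF x])
  qed (simp add: hact_single_mult[OF x])
  then show ?thesis by (simp add: annihilator_def)
 qed
 show "f * g : annihilator" by (induction g rule: free_alg_induct) (use 0 1 add in \<open>auto simp: distrib_left\<close>)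
 show "g * f : annihilator" by (induction g rule: free_alg_induct) (use 0 2 add in \<open>auto simp: distrib_right\<close>)
qed

end

lemma free_ring_simps [simp]:
 "carrier free_ring = UNIV" "x \<oplus>\<^bsub>free_ring\<^esub> y = x + y" "x \<otimes>\<^bsub>free_ring\<^esub> y = x * y"
 "\<one>\<^bsub>free_ring\<^esub> = 1" "\<zero>\<^bsub>free_ring\<^esub> = 0"
 by (simp_all add: free_ring_def)

lemma ring_free_ring: "ring free_ring"
 by (rule ringI) (auto intro!: abelian_groupI monoidI exI[of _ "- _"] simp: algebra_simps)

interpretation free_ring: ring free_ring by (rule ring_free_ring)

lemma free_ring_uminus [simp]: "\<ominus>\<^bsub>free_ring\<^esub> x = - x"
 using free_ring.minus_equality[of "- x" x] by simp

lemma ideal_steenrod_ideal: "ideal (steenrod_ideal p) free_ring"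
 unfolding steenrod_ideal_def by (rule free_ring.genideal_ideal) simp

lemma steenrod_ideal_closed:
 "0 : steenrod_ideal p" "x : steenrod_ideal p ==> y : steenrod_ideal p ==> x - y : steenrod_ideal p"
 "x : steenrod_ideal p ==> x * z : steenrod_ideal p" "x : steenrod_ideal p ==> z * x : steenrod_ideal p"
proof -
 interpret steenrod_ideal: ideal "steenrod_ideal p" free_ring by (rule ideal_steenrod_ideal)
 show "0 : steenrod_ideal p" using steenrod_ideal.zero_closed by simp
 show "x * z : steenrod_ideal p" "z * x : steenrod_ideal p" if "x : steenrod_ideal p"
  using steenrod_ideal.I_r_closed[OF that, of z] steenrod_ideal.I_l_closed[OF that, of z] by simp_all
 show "x - y : steenrod_ideal p" if "x : steenrod_ideal p" "y : steenrod_ideal p"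
  using steenrod_ideal.a_closed[OF that(1) steenrod_ideal.a_inv_closed[OF that(2)]] by simp
qed

lemma steenrod_rels_subset: "steenrod_rels p \<subseteq> steenrod_ideal p"
 unfolding steenrod_ideal_def by (rule free_ring.genideal_self) simp

lemma steenrod_class_eq_iff: "steenrod_class p f = steenrod_class p g \<longleftrightarrow> f - g : steenrod_ideal p"
proof -
 have m: "h : steenrod_class p f \<longleftrightarrow> h - f : steenrod_ideal p" for h f
  by (force simp: steenrod_class_def a_r_coset_def')
 have add: "x + y : steenrod_ideal p" if "x : steenrod_ideal p" "y : steenrod_ideal p" for x y
  using steenrod_ideal_closed(2)[OF that(1) steenrod_ideal_closed(2)[OF steenrod_ideal_closed(1) that(2)]] by simp
 show ?thesis
 proof
  assume "steenrod_class p f = steenrod_class p g"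
  then show "f - g : steenrod_ideal p" using m[of f f] m[of f g] steenrod_ideal_closed(1) by simp
 next
  assume fg: "f - g : steenrod_ideal p"
  have "h - f : steenrod_ideal p \<longleftrightarrow> h - g : steenrod_ideal p" for h
   using add[OF _ fg, of "h - f"] steenrod_ideal_closed(2)[OF _ fg, of "h - g"] by auto
  then show "steenrod_class p f = steenrod_class p g" using m by auto
 qed
qed

lemma free_deg_0 [simp]: "0 : free_deg p k" by (simp add: free_deg_def)

lemma free_deg_diff: "f : free_deg p k ==> g : free_deg p k ==> f - g : free_deg p k"
 unfolding free_deg_def using keys_diff[of f g] by blast

lemma wmon_free_deg: "word_deg p (Word gs) = k ==> wmon gs : free_deg p k"
 by (simp add: wmon_def free_deg_def)

lemma free_deg_of_int: "f : free_deg p k ==> of_int c * f : free_deg p k"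
proof -
 assume f: "f : free_deg p k"
 have add: "a + b : free_deg p k" if "a : free_deg p k" "b : free_deg p k" for a b
  using that keys_add[of a b] by (auto simp: free_deg_def)
 show ?thesis
  by (induction c rule: int_induct[where k = 0])
   (use f add in \<open>auto simp: distrib_right left_diff_distrib intro: free_deg_diff\<close>)
qed

lemma free_deg_sum: "(!!i. i : A ==> f i : free_deg p k) ==> sum f A : free_deg p k"
proof (induction A rule: infinite_finite_induct)
 case (insert a A)
 then show ?case using keys_add[of "f a" "sum f A"] by (auto simp: free_deg_def)
qed auto

definition steenrod_rep :: "nat => nat => free_alg set => free_alg" where
 "steenrod_rep p k a = (SOME f. f : a \<and> f : free_deg p k)"

lemma sact_rep: "sact p V k d a x = free_act p V k d (steenrod_rep p k a) x"
 by (simp add: sact_def steenrod_rep_def)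

lemma steenrod_rep:
 assumes "a : steenrod_deg p k"
 shows "steenrod_rep p k a : free_deg p k" "steenrod_class p (steenrod_rep p k a) = a"
proof -
 obtain f where f: "f : free_deg p k" "a = steenrod_class p f" using assms by (auto simp: steenrod_deg_def)
 have m: "h : steenrod_class p f \<longleftrightarrow> h - f : steenrod_ideal p" for h f
  by (force simp: steenrod_class_def a_r_coset_def')
 have "f : a \<and> f : free_deg p k" using f m steenrod_ideal_closed(1) by simp
 then have *: "steenrod_rep p k a : a \<and> steenrod_rep p k a : free_deg p k"
  unfolding steenrod_rep_def by (rule someI)
 then show "steenrod_rep p k a : free_deg p k" by simp
 show "steenrod_class p (steenrod_rep p k a) = a" using * f m by (simp add: steenrod_class_eq_iff)
qed

lemma steenrod_deg_class: "f : free_deg p k ==> steenrod_class p f : steenrod_deg p k"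
 by (auto simp: steenrod_deg_def steenrod_def steenrod_class_def FactRing_def A_RCOSETS_def'
   intro!: exI[of _ f])

context graded_ops begin

lemma annihilator_ideal: "ideal annihilator free_ring"
proof (rule idealI)
 show "subgroup annihilator (add_monoid free_ring)"
 proof (rule group.subgroupI[OF free_ring.a_group])
  show "annihilator \<noteq> {}" using hact_0 by (auto simp: annihilator_def intro!: exI[of _ 0])
  show "a \<otimes>\<^bsub>add_monoid free_ring\<^esub> b : annihilator" if "a : annihilator" "b : annihilator" for a b
   using that by (simp add: annihilator_def hact_add)
  fix a assume a: "a : annihilator"
  have "inv\<^bsub>add_monoid free_ring\<^esub> a = - a" using free_ring_uminus by (metis a_inv_def)
  then show "inv\<^bsub>add_monoid free_ring\<^esub> a : annihilator"
   using a by (simp add: annihilator_def hact_uminus)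
 qed simp
qed (auto simp: ring_free_ring annihilator_mult)

text \<open>The operators define a module over the Steenrod algebra as soon as the defining relations act by
 zero, because the elements acting by zero form a two-sided ideal.\<close>

lemma right_A_moduleI:
 assumes "!!r k d x. r : steenrod_rels p ==> r \<noteq> of_nat p ==> x : V $ d ==> hact p V k d r x = \<zero>\<^bsub>grd V (d - int k)\<^esub>"
 shows "right_A_module p V"
proof
 have "of_nat p : annihilator"
 proof -
  have "hact p V k d (of_int (int p) * 1) x = \<zero>\<^bsub>grd V (d - int k)\<^esub>" if x: "x : V $ d" for k d x
   unfolding hact_of_int[OF x] using gr.zmult_cong[of "int p" 0 "d - int k"] by (simp add: cong_0_iff hact_closed x)
  then show ?thesis by (simp add: annihilator_def)
 qed
 moreover have "r : annihilator" if "r : steenrod_rels p" "r \<noteq> of_nat p" for r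
  using assms[OF that] by (simp add: annihilator_def)
 ultimately have "steenrod_rels p \<subseteq> annihilator" by blast
 then have sub: "steenrod_ideal p \<subseteq> annihilator"
  unfolding steenrod_ideal_def by (intro free_ring.genideal_minimal annihilator_ideal)
 fix k d f g x
 assume f: "f : free_deg p k" "g : free_deg p k" and eq: "steenrod_class p f = steenrod_class p g"
  and x: "x : V $ d"
 have "f - g : annihilator" using eq sub by (auto simp: steenrod_class_eq_iff)
 then have "hact p V k d f x \<ominus>\<^bsub>grd V (d - int k)\<^esub> hact p V k d g x = \<zero>\<^bsub>grd V (d - int k)\<^esub>"
  using x by (simp add: annihilatorD flip: hact_diff)
 then show "free_act p V k d f x = free_act p V k d g x"
  using f gr.diff_eq_zeroD[OF hact_closed[OF x] hact_closed[OF x]] by (simp add: free_act_eq_hact)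
qed (use p_prime grd_module sop_hom in auto)

lemma sact_closed: "a : steenrod_deg p k ==> x : V $ d ==> sact p V k d a x : V $ (d - int k)"
 by (simp add: sact_rep free_act_eq_hact steenrod_rep hact_closed)

lemma sact_preserves:
 assumes sub: "!!d. submodule (H d) (Fp p) (grd V d)"
  and sop: "!!g d x. x : H d ==> sop V g d x : H (d - deg p g)"
  and a: "a : steenrod_deg p k" and x: "x : H d"
 shows "sact p V k d a x : H (d - int k)"
proof -
 have "word_act p V gs d x : H (d - int (word_deg p (Word gs)))" if "x : H d" for gs d x
  using that
 proof (induction gs arbitrary: d x)
  case (Cons g gs)
  show ?case using Cons.IH[OF sop[OF Cons.prems, of g]] by (simp add: algebra_simps)
 qed simp
 then have "word_act p V (letters w) d x : H (d - int (word_deg p (Word (letters w))))" for w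
  using x .
 then have "word_act p V (letters w) d x : H (d - int k)" if "word_deg p w = k" for w
  using that by (metis word.collapse)
 then show ?thesis unfolding sact_rep free_act_eq_hact[OF steenrod_rep(1)[OF a]] hact_def
  by (intro gr.finsum_submodule[OF sub]) (auto intro: gr.submoduleD(6)[OF sub])
qed

end

lemma hact_natural:
 assumes V: "graded_ops p V" and W: "graded_ops p W"
  and h: "!!d. h d : Hom p (grd V d) (grd W (d + int m))"
  and comm: "!!g d x. x : V $ d ==>
   sop W g (d + int m) (h d x) = sgn_mult (grd W (d + int m - deg p g)) (int (m * gen_deg p g)) (h (d - deg p g) (sop V g d x))"
  and x: "x : V $ d"
 shows "hact p W k (d + int m) f (h d x) = sgn_mult (grd W (d + int m - int k)) (int (m * k)) (h (d - int k) (hact p V k d f x))"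
proof -
 interpret V: graded_ops p V by (rule V)
 interpret W: graded_ops p W by (rule W)
 interpret h: Fp_module_hom p "grd V n" "grd W (n + int m)" "h n" for n
  by (intro Fp_module_homI V.gr.Fp_module_axioms W.gr.Fp_module_axioms h)
 have w: "word_act p W gs (d + int m) (h d x)
   = sgn_mult (grd W (d + int m - int (word_deg p (Word gs)))) (int (m * word_deg p (Word gs))) (h (d - int (word_deg p (Word gs))) (word_act p V gs d x))"
  if "x : V $ d" for gs d x
  using that
 proof (induction gs arbitrary: d x)
  case Nil then show ?case by (simp add: sgn_mult_def)
 next
  case (Cons g gs)
  let ?d = "d - deg p g"
  have y: "sop V g d x : V $ ?d" using Cons.prems by simp
  have e: "d + int m - deg p g = ?d + int m" by simp
  have c: "h ?d (sop V g d x) : W $ (?d + int m)" using y by simp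
  have "word_act p W (g # gs) (d + int m) (h d x)
   = word_act p W gs (?d + int m) (sgn_mult (grd W (?d + int m)) (int (m * gen_deg p g)) (h ?d (sop V g d x)))"
   by (simp only: word_act.simps comm[OF Cons.prems] e)
  also have "... = sgn_mult (grd W (?d + int m - int (word_deg p (Word gs)))) (int (m * gen_deg p g))
    (word_act p W gs (?d + int m) (h ?d (sop V g d x)))"
   by (rule W.wa.sgn[OF c])
  also have "word_act p W gs (?d + int m) (h ?d (sop V g d x)) =
    sgn_mult (grd W (?d + int m - int (word_deg p (Word gs)))) (int (m * word_deg p (Word gs)))
    (h (?d - int (word_deg p (Word gs))) (word_act p V gs ?d (sop V g d x)))"
   by (rule Cons.IH[OF y])
  finally show ?case
   using h.closed[OF V.wa.closed[OF y, of gs]]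
   by (auto simp: sgn_mult_def algebra_simps W.gr.M.minus_minus)
 qed
 let ?W = "grd W (d + int m - int k)"
 have e: "d - int k + int m = d + int m - int k" by simp
 have cl: "word_act p V (letters v) d x : V $ (d - int k)" if "word_deg p v = k" for v
  by (rule V.word_act_closed[OF x that])
 have hcl: "h (d - int k) y : carrier ?W" if "y : V $ (d - int k)" for y
  using h.closed[OF that] e by simp
 have "hact p W k (d + int m) f (h d x) = (\<Oplus>\<^bsub>?W\<^esub>v\<in>{v : Poly_Mapping.keys f. word_deg p v = k}.
   zmult p ?W (if even (m * k) then 1 else -1) (h (d - int k) (zmult p (grd V (d - int k)) (Poly_Mapping.lookup f v) (word_act p V (letters v) d x))))"
  unfolding hact_def
 proof (rule W.gr.M.finsum_cong')
  fix v assume "v : {v : Poly_Mapping.keys f. word_deg p v = k}"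
  then have v: "word_deg p v = k" by simp
  then have "word_act p W (letters v) (d + int m) (h d x) = sgn_mult ?W (int (m * k)) (h (d - int k) (word_act p V (letters v) d x))"
   using w[OF x, of "letters v"] by simp
  then show "zmult p ?W (Poly_Mapping.lookup f v) (word_act p W (letters v) (d + int m) (h d x))
   = zmult p ?W (if even (m * k) then 1 else -1) (h (d - int k) (zmult p (grd V (d - int k)) (Poly_Mapping.lookup f v) (word_act p V (letters v) d x)))"
   using h.zmult[OF cl[OF v]] e hcl[OF cl[OF v]]
   by (simp add: W.gr.sgn_mult_zmult W.gr.zmult_left_commute)
 qed (auto intro!: W.gr.zmult_closed hcl V.gr.zmult_closed cl)
 also have "... = zmult p ?W (if even (m * k) then 1 else -1) (h (d - int k) (hact p V k d f x))"
  unfolding hact_def using h.finsum[of "\<lambda>v. zmult p (grd V (d - int k)) (Poly_Mapping.lookup f v) (word_act p V (letters v) d x)"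
    "{v : Poly_Mapping.keys f. word_deg p v = k}" "d - int k"] e cl
  by (subst W.gr.zmult_finsum[symmetric]) (auto intro!: hcl)
 finally show ?thesis using hcl[OF V.hact_closed[OF x]]
  by (simp add: W.gr.sgn_mult_zmult)
qed

text \<open>A map that commutes with the generators up to the sign of an operator of degree \<open>m\<close> does so with all words, the signs being multiplicative in the degrees.\<close>

lemma sact_natural:
 assumes V: "graded_ops p V" and W: "graded_ops p W"
  and h: "!!d. h d : Hom p (grd V d) (grd W (d + int m))"
  and comm: "!!g d x. x : V $ d ==>
   sop W g (d + int m) (h d x) = sgn_mult (grd W (d + int m - deg p g)) (int (m * gen_deg p g)) (h (d - deg p g) (sop V g d x))"
  and a: "a : steenrod_deg p k" and x: "x : V $ d"
 shows "sact p W k (d + int m) a (h d x) = sgn_mult (grd W (d + int m - int k)) (int (m * k)) (h (d - int k) (sact p V k d a x))"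
 using hact_natural[OF V W h comm x] a
 by (simp add: sact_rep free_act_eq_hact steenrod_rep)

context right_A_module begin

lemma sact_gen:
 assumes x: "x : V $ d"
 shows "sact p V (gen_deg p g) d (steenrod_class p (wmon [g])) x = sop V g d x"
proof -
 let ?a = "steenrod_class p (wmon [g])"
 have f: "wmon [g] : free_deg p (gen_deg p g)" by (rule wmon_free_deg) simp
 then have a: "?a : steenrod_deg p (gen_deg p g)" by (rule steenrod_deg_class)
 have "sact p V (gen_deg p g) d ?a x = free_act p V (gen_deg p g) d (wmon [g]) x"
  unfolding sact_rep by (rule act_descends[OF steenrod_rep(1)[OF a] f steenrod_rep(2)[OF a] x])
 then show ?thesis using f hact_wmon[OF x, of "[g]"] by (simp add: free_act_eq_hact)
qed

lemma hact_ideal: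
 assumes "f : free_deg p k" "f : steenrod_ideal p" "x : V $ d"
 shows "hact p V k d f x = \<zero>\<^bsub>grd V (d - int k)\<^esub>"
 using act_descends[of f k 0 x d] assms by (simp add: steenrod_class_eq_iff free_act_eq_hact hact_0)

end

lemma steenrod_gen_deg: "steenrod_class p (wmon [g]) : steenrod_deg p (gen_deg p g)"
 by (rule steenrod_deg_class, rule wmon_free_deg) simp
section \<open>The operators of \<open>r\<^sub>+(M)\<close> in coordinates\<close>

text \<open>Raising \<open>s - k\<close> by one raises the exponent \<open>e\<close> of \<open>u\<^sub>e\<close> by this amount, which is the exponent of \<open>t\<^bsup>p-1\<^esup>\<close>.\<close>

definition tate_step :: "nat => int" where "tate_step p = (if p = 2 then 1 else 2 * (int p - 1))"
text \<open>The exponent of \<open>t\<close> (of \<open>u\<close> if \<open>p = 2\<close>) in \<open>u\<^sub>e\<close>.\<close>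

definition tate_exp :: "nat => int => int" where "tate_exp p e = (if p = 2 then e else e div 2)"

lemma gen_deg_Pow: "p > 0 ==> deg p (Pow s) = tate_step p * int s"
 by (simp add: gen_deg_def tate_step_def of_nat_diff)

lemma gen_deg_Bock [simp]: "gen_deg p Bock = 1" by (simp add: gen_deg_def)

lemma tate_step_pos: "prime p ==> tate_step p > 0"
 using prime_ge_2_nat[of p] by (auto simp: tate_step_def)

lemma even_tate_step: "p \<noteq> 2 ==> even (tate_step p)" by (simp add: tate_step_def)

lemma tate_exp_step: "tate_exp p (e + tate_step p * m) = tate_exp p e + (int p - 1) * m"
proof (cases "p = 2")
 case False
 then have "e + tate_step p * m = e + 2 * ((int p - 1) * m)" by (simp add: tate_step_def)
 moreover have "(e + 2 * ((int p - 1) * m)) div 2 = e div 2 + (int p - 1) * m" by simp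
 ultimately show ?thesis using False by (simp only: tate_exp_def if_False)
qed (simp add: tate_step_def tate_exp_def)

context Fp_module begin

lemma uminus_zero [simp]: "\<ominus>\<^bsub>W\<^esub> \<zero>\<^bsub>W\<^esub> = \<zero>\<^bsub>W\<^esub>"
 using zmult_minus[of "\<zero>\<^bsub>W\<^esub>" 1] by simp

end

context graded_ops begin

lemma p_pos: "p > 0" using p_prime by (simp add: prime_gt_0_nat)

lemma rgrd_simps:
 "V $$ d = {x. (\<forall>e. x e : V $ (d + e)) \<and> finite {e. x e \<noteq> \<zero>\<^bsub>grd V (d + e)\<^esub>}}"
 "\<zero>\<^bsub>rgrd V d\<^esub> = (\<lambda>e. \<zero>\<^bsub>grd V (d + e)\<^esub>)"
 "x \<oplus>\<^bsub>rgrd V d\<^esub> y = (\<lambda>e. x e \<oplus>\<^bsub>grd V (d + e)\<^esub> y e)"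
 "c \<odot>\<^bsub>rgrd V d\<^esub> x = (\<lambda>e. c \<odot>\<^bsub>grd V (d + e)\<^esub> x e)"
 by (simp_all add: rgrd_def)

lemma rgrd_coord: "x : V $$ d ==> x e : V $ (d + e)"
 by (simp add: rgrd_simps)

lemma rgrd_coord': "x : V $$ d ==> d + e = d' ==> x e : V $ d'"
 using rgrd_coord by auto

lemma rgrd_carrierI:
 assumes "!!e. x e : V $ (d + e)" "finite A" "!!e. e \<notin> A ==> x e = \<zero>\<^bsub>grd V (d + e)\<^esub>"
 shows "x : V $$ d"
proof -
 have "{e. x e \<noteq> \<zero>\<^bsub>grd V (d + e)\<^esub>} \<subseteq> A" using assms(3) by auto
 then show ?thesis using assms by (auto simp: rgrd_simps intro: finite_subset)
qed

lemma finite_rsupp: "x : V $$ d ==> finite (rsupp V d x)"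
 by (simp add: rgrd_simps rsupp_def)

lemma rgrd_add_closed:
 assumes "x : V $$ d" "y : V $$ d"
 shows "x \<oplus>\<^bsub>rgrd V d\<^esub> y : V $$ d"
proof (rule rgrd_carrierI)
 show "finite (rsupp V d x \<union> rsupp V d y)" using assms finite_rsupp by simp
 show "(x \<oplus>\<^bsub>rgrd V d\<^esub> y) e : V $ (d + e)" for e
  using assms by (simp add: rgrd_simps)
qed (simp add: rgrd_simps rsupp_def)

lemma Fp_module_rgrd: "Fp_module p (rgrd V d)"
proof (rule Fp_moduleI)
 have smult: "(\<lambda>e. zmult p (grd V (d + e)) c (x e)) : V $$ d" if "x : V $$ d" for c x
  by (rule rgrd_carrierI[OF _ finite_rsupp[OF that]]) (use that in \<open>auto simp: rgrd_coord rsupp_def\<close>)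
 show "abelian_group (rgrd V d)"
 proof (rule abelian_groupI)
  show "\<exists>y\<in>V $$ d. y \<oplus>\<^bsub>rgrd V d\<^esub> x = \<zero>\<^bsub>rgrd V d\<^esub>" if x: "x : V $$ d" for x
  proof (rule bexI[OF _ smult[OF x, of "-1"]])
   show "(\<lambda>e. zmult p (grd V (d + e)) (-1) (x e)) \<oplus>\<^bsub>rgrd V d\<^esub> x = \<zero>\<^bsub>rgrd V d\<^esub>"
    using rgrd_coord[OF x] by (simp add: rgrd_simps gr.zmult_minus gr.M.l_neg)
  qed
  show "\<zero>\<^bsub>rgrd V d\<^esub> : V $$ d" by (simp add: rgrd_simps)
 next
  fix x y z assume xyz: "x : V $$ d" "y : V $$ d" "z : V $$ d"
  note c = xyz[THEN rgrd_coord]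
  show "x \<oplus>\<^bsub>rgrd V d\<^esub> y \<oplus>\<^bsub>rgrd V d\<^esub> z = x \<oplus>\<^bsub>rgrd V d\<^esub> (y \<oplus>\<^bsub>rgrd V d\<^esub> z)"
   using c by (simp add: rgrd_simps gr.M.a_assoc)
 next
  fix x y assume xyz: "x : V $$ d" "y : V $$ d"
  note c = xyz[THEN rgrd_coord]
  show "x \<oplus>\<^bsub>rgrd V d\<^esub> y = y \<oplus>\<^bsub>rgrd V d\<^esub> x" using c by (simp add: rgrd_simps gr.M.a_comm)
 next
  fix x assume "x : V $$ d"
  then show "\<zero>\<^bsub>rgrd V d\<^esub> \<oplus>\<^bsub>rgrd V d\<^esub> x = x" by (simp add: rgrd_simps)
 qed (rule rgrd_add_closed)
 fix c x assume c: "c : {0..<int p}" and x: "x : V $$ d"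
 note cx = rgrd_coord[OF x]
 show "c \<odot>\<^bsub>rgrd V d\<^esub> x : V $$ d" using smult[OF x, of c] c by (simp add: rgrd_simps(4) gr.smult_zmult)
 show "((c + c') mod int p) \<odot>\<^bsub>rgrd V d\<^esub> x = c \<odot>\<^bsub>rgrd V d\<^esub> x \<oplus>\<^bsub>rgrd V d\<^esub> c' \<odot>\<^bsub>rgrd V d\<^esub> x"
  "((c * c') mod int p) \<odot>\<^bsub>rgrd V d\<^esub> x = c \<odot>\<^bsub>rgrd V d\<^esub> (c' \<odot>\<^bsub>rgrd V d\<^esub> x)"
  if "c' : {0..<int p}" for c'
  using c that cx p_pos by (simp_all add: rgrd_simps gr.smult_zmult gr.zmult_mod gr.zmult_l_distr gr.zmult_assoc)
 show "c \<odot>\<^bsub>rgrd V d\<^esub> (x \<oplus>\<^bsub>rgrd V d\<^esub> y) = c \<odot>\<^bsub>rgrd V d\<^esub> x \<oplus>\<^bsub>rgrd V d\<^esub> c \<odot>\<^bsub>rgrd V d\<^esub> y"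
  if "y : V $$ d" for y
  using c cx rgrd_coord[OF that] by (simp add: rgrd_simps gr.smult_zmult gr.zmult_r_distr)
next
 fix x assume x: "x : V $$ d"
 show "1 \<odot>\<^bsub>rgrd V d\<^esub> x = x" 
  using gr.zmult_1[OF rgrd_coord[OF x]] gr.smult_zmult[of 1] prime_gt_1_nat[OF p_prime] by (simp add: rgrd_simps)
qed (rule p_prime)

sublocale rg: Fp_module p "rgrd V d" for d by (rule Fp_module_rgrd)

lemma rgrd_zmult: "zmult p (rgrd V d) c x e = zmult p (grd V (d + e)) c (x e)"
 by (simp add: zmult_def rgrd_simps)

lemma rgrd_uminus: "x : V $$ d ==> (\<ominus>\<^bsub>rgrd V d\<^esub> x) e = \<ominus>\<^bsub>grd V (d + e)\<^esub> x e"
 using rg.zmult_minus[of x d 1] rgrd_zmult[of d "-1" x e] by (simp add: gr.zmult_minus rgrd_coord)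

lemma rgrd_finsum:
 "f : A \<rightarrow> V $$ d ==> finsum (rgrd V d) f A e = finsum (grd V (d + e)) (\<lambda>i. f i e) A"
proof (induction A rule: infinite_finite_induct)
 case (insert a A)
 then have "f : A \<rightarrow> V $$ d" "f a : V $$ d" by auto
 moreover from this have "(\<lambda>i. f i e) : A \<rightarrow> V $ (d + e)" using rgrd_coord by auto
 ultimately show ?case using insert rgrd_coord
  by (simp add: rg.M.finsum_insert gr.M.finsum_insert rgrd_simps(3))
qed (auto simp: rg.M.finsum_infinite gr.M.finsum_infinite rgrd_simps(2))

lemma rmon_closed [simp, intro]: "x : V $ (d + e) ==> rmon V d e x : V $$ d"
 by (rule rgrd_carrierI[where A = "{e}"]) (auto simp: rmon_def)

lemma rmon_hom: "rmon V d e : Hom p (grd V (d + e)) (rgrd V d)"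
proof (rule mod_homI)
 show "rmon V d e x : V $$ d" if "x : V $ (d + e)" for x
  using that by (rule rmon_closed)
qed (auto simp: gr.Fp_module_axioms rg.Fp_module_axioms rgrd_simps(3) rmon_def)

sublocale rm: Fp_module_hom p "grd V (d + e)" "rgrd V d" "rmon V d e" for d e
 by (intro Fp_module_homI gr.Fp_module_axioms rg.Fp_module_axioms rmon_hom)

lemma rgrd_expand:
 assumes x: "x : V $$ d" and A: "finite A" "rsupp V d x \<subseteq> A"
 shows "x = (\<Oplus>\<^bsub>rgrd V d\<^esub>e\<in>A. rmon V d e (x e))"
proof (rule ext)
 fix e
 have "(\<Oplus>\<^bsub>rgrd V d\<^esub>e\<in>A. rmon V d e (x e)) e = (\<Oplus>\<^bsub>grd V (d + e)\<^esub>i\<in>A. rmon V d i (x i) e)"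
  by (rule rgrd_finsum) (use rgrd_coord[OF x] in auto)
 also have "... = x e"
 proof (cases "e : A")
  case True
  then have "(\<Oplus>\<^bsub>grd V (d + e)\<^esub>i\<in>A. rmon V d i (x i) e) = rmon V d e (x e) e"
   using A rgrd_coord[OF x] by (intro gr.finsum_single) (auto simp: rmon_def)
  then show ?thesis by (simp add: rmon_def)
 next
  case False
  then have "(\<Oplus>\<^bsub>grd V (d + e)\<^esub>i\<in>A. rmon V d i (x i) e) = \<zero>\<^bsub>grd V (d + e)\<^esub>"
   by (intro gr.finsum_neutral) (auto simp: rmon_def)
  moreover have "e \<notin> rsupp V d x" using False A by blast
  ultimately show ?thesis by (simp add: rsupp_def)
 qed
 finally show "x e = (\<Oplus>\<^bsub>rgrd V d\<^esub>e\<in>A. rmon V d e (x e)) e" ..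
qed

lemma rgrd_induct [consumes 1, case_names mon add]:
 assumes x: "x : V $$ d"
  and mon: "!!e y. y : V $ (d + e) ==> P (rmon V d e y)"
  and add: "!!x y. x : V $$ d ==> y : V $$ d ==> P x ==> P y ==> P (x \<oplus>\<^bsub>rgrd V d\<^esub> y)"
 shows "P x"
proof -
 have "P (\<Oplus>\<^bsub>rgrd V d\<^esub>e\<in>A. rmon V d e (x e)) \<and> (\<Oplus>\<^bsub>rgrd V d\<^esub>e\<in>A. rmon V d e (x e)) : V $$ d" if "finite A" for A
  using that
 proof induction
  case empty
  have "P (rmon V d 0 \<zero>\<^bsub>grd V (d + 0)\<^esub>)" by (rule mon) (rule gr.M.zero_closed)
  then show ?case using rm.zero[of d 0] by (simp only: rg.M.finsum_empty) simp
 next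
  case (insert e A)
  have "(\<lambda>e. rmon V d e (x e)) : A \<rightarrow> V $$ d" using rgrd_coord[OF x] by auto
  then show ?case using insert rgrd_coord[OF x] by (auto simp: rg.M.finsum_insert intro!: add mon)
 qed
 from this[OF finite_rsupp[OF x]] show ?thesis
  unfolding rgrd_expand[OF x finite_rsupp[OF x] subset_refl, symmetric] by simp
qed

lemma rgrd_hom_eqI:
 assumes x: "x : V $$ d" and f: "f : Hom p (rgrd V d) W" and g: "g : Hom p (rgrd V d) W"
  and eq: "!!e y. y : V $ (d + e) ==> f (rmon V d e y) = g (rmon V d e y)"
 shows "f x = g x"
 using x by (induction rule: rgrd_induct) (auto simp: eq mod_hom_add[OF f] mod_hom_add[OF g])

lemma rext_eq:
 assumes x: "x : V $$ d" and H: "H : Hom p (rgrd V d) (rgrd V d')"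
  and T: "!!e y. y : V $ (d + e) ==> T e y = H (rmon V d e y)"
 shows "rext V d d' T x = H x"
proof -
 interpret H: Fp_module_hom p "rgrd V d" "rgrd V d'" H
  by (intro Fp_module_homI rg.Fp_module_axioms H)
 have "rext V d d' T x = (\<Oplus>\<^bsub>rgrd V d'\<^esub>e\<in>rsupp V d x. H (rmon V d e (x e)))"
  unfolding rext_def using rgrd_coord[OF x] by (intro rg.M.finsum_cong') (auto simp: T)
 also have "... = H (\<Oplus>\<^bsub>rgrd V d\<^esub>e\<in>rsupp V d x. rmon V d e (x e))"
  using rgrd_coord[OF x] by (intro H.finsum[symmetric]) auto
 finally show ?thesis unfolding rgrd_expand[OF x finite_rsupp[OF x] subset_refl, symmetric] .
qed

definition pow_coeff :: "nat => int => int => int" where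
 "pow_coeff s r k = psi_coeff p (r + int p * k * (int p - 1)) (int s - int p * k)"

text \<open>The coordinate of \<open>u\<^sub>e\<close> receives the \<open>k\<close>-th term from the coordinate \<open>tate_step * (s - k)\<close> below.\<close>

definition pow_op :: "nat => int => (int => 'a) => int => 'a" where
 "pow_op s d x e = (\<Oplus>\<^bsub>grd V (d - deg p (Pow s) + e)\<^esub>k\<in>{0..s}.
   zmult p (grd V (d - deg p (Pow s) + e)) (pow_coeff s (tate_exp p e - (int p - 1) * (int s - int k)) (int k))
    (sop V (Pow k) (d + (e - tate_step p * (int s - int k))) (x (e - tate_step p * (int s - int k)))))"

lemma pow_op_deg: "d + (e - tate_step p * (int s - int k)) - deg p (Pow k) = d - deg p (Pow s) + e"
 using p_pos by (simp add: gen_deg_Pow algebra_simps)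

lemma pow_op_term:
 assumes "x : V $$ d"
 shows "sop V (Pow k) (d + (e - tate_step p * (int s - int k))) (x (e - tate_step p * (int s - int k)))
  : V $ (d - deg p (Pow s) + e)"
 using sp.closed[OF rgrd_coord[OF assms, of "e - tate_step p * (int s - int k)"], of "Pow k"]
 unfolding pow_op_deg .

lemma pow_op_hom: "pow_op s d : Hom p (rgrd V d) (rgrd V (d - deg p (Pow s)))"
proof (rule mod_homI)
 let ?W = "\<lambda>e. grd V (d - deg p (Pow s) + e)"
 let ?e = "\<lambda>e k. e - tate_step p * (int s - int k)"
 fix x assume x: "x : V $$ d"
 show "pow_op s d x : V $$ (d - deg p (Pow s))"
 proof (rule rgrd_carrierI)
  show "finite (\<Union>k\<in>{0..s}. (\<lambda>e. e + tate_step p * (int s - int k)) ` rsupp V d x)"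
   using finite_rsupp[OF x] by auto
  fix e
  show "pow_op s d x e : carrier (?W e)"
   unfolding pow_op_def by (intro gr.M.finsum_closed) (auto intro!: gr.zmult_closed pow_op_term x)
  assume e: "e \<notin> (\<Union>k\<in>{0..s}. (\<lambda>e. e + tate_step p * (int s - int k)) ` rsupp V d x)"
  show "pow_op s d x e = \<zero>\<^bsub>?W e\<^esub>"
   unfolding pow_op_def
  proof (rule gr.finsum_neutral)
   fix k assume k: "k : {0..s}"
   have "?e e k \<notin> rsupp V d x"
   proof
    assume "?e e k : rsupp V d x"
    then have "?e e k + tate_step p * (int s - int k) : (\<lambda>e. e + tate_step p * (int s - int k)) ` rsupp V d x" by blast
    then show False using e k by auto
   qed
   then have "x (?e e k) = \<zero>\<^bsub>grd V (d + ?e e k)\<^esub>" by (simp add: rsupp_def)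
   then show "zmult p (?W e) (pow_coeff s (tate_exp p e - (int p - 1) * (int s - int k)) (int k))
     (sop V (Pow k) (d + ?e e k) (x (?e e k))) = \<zero>\<^bsub>?W e\<^esub>"
    using sp.zero[of "Pow k" "d + ?e e k"] unfolding pow_op_deg by (simp only: gr.zmult_zero)
  qed
 qed
 fix y assume y: "y : V $$ d"
 show "pow_op s d (x \<oplus>\<^bsub>rgrd V d\<^esub> y) = pow_op s d x \<oplus>\<^bsub>rgrd V (d - deg p (Pow s))\<^esub> pow_op s d y"
 proof (rule ext, unfold rgrd_simps(3))
  fix e
  let ?t = "\<lambda>x k. zmult p (?W e) (pow_coeff s (tate_exp p e - (int p - 1) * (int s - int k)) (int k))
    (sop V (Pow k) (d + ?e e k) (x (?e e k)))"
  have "?t (\<lambda>e. x e \<oplus>\<^bsub>grd V (d + e)\<^esub> y e) k = ?t x k \<oplus>\<^bsub>?W e\<^esub> ?t y k" for k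
   using sp.add[OF rgrd_coord[OF x, of "?e e k"] rgrd_coord[OF y, of "?e e k"], of "Pow k"]
    pow_op_term[OF x, of k e s] pow_op_term[OF y, of k e s]
   unfolding pow_op_deg by (simp only: gr.zmult_r_distr)
  then show "pow_op s d (\<lambda>e. x e \<oplus>\<^bsub>grd V (d + e)\<^esub> y e) e = pow_op s d x e \<oplus>\<^bsub>?W e\<^esub> pow_op s d y e"
   unfolding pow_op_def using pow_op_term[OF x] pow_op_term[OF y]
   by (subst gr.M.finsum_addf[symmetric]) (auto intro!: gr.M.finsum_cong')
 qed
qed (auto simp: rg.Fp_module_axioms)

lemma pow_op_rmon:
 assumes y: "y : V $ (d + e)"
 shows "pow_op s d (rmon V d e y) = (\<Oplus>\<^bsub>rgrd V (d - deg p (Pow s))\<^esub>k\<in>{0..s}.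
   zmult p (rgrd V (d - deg p (Pow s))) (pow_coeff s (tate_exp p e) (int k))
    (rmon V (d - deg p (Pow s)) (e + tate_step p * (int s - int k)) (sop V (Pow k) (d + e) y)))"
proof (rule ext)
 fix e'
 let ?d = "d - deg p (Pow s)"
 have c: "sop V (Pow k) (d + e) y : V $ (?d + (e + tate_step p * (int s - int k)))" for k
 proof -
  have "d + e - deg p (Pow k) = ?d + (e + tate_step p * (int s - int k))"
   using p_pos by (simp add: gen_deg_Pow algebra_simps)
  then show ?thesis using sp.closed[OF y, of "Pow k"] by (simp only:)
 qed
 let ?t = "\<lambda>k. zmult p (rgrd V ?d) (pow_coeff s (tate_exp p e) (int k))
    (rmon V ?d (e + tate_step p * (int s - int k)) (sop V (Pow k) (d + e) y))"
 have "(\<Oplus>\<^bsub>rgrd V ?d\<^esub>k\<in>{0..s}. ?t k) e' = (\<Oplus>\<^bsub>grd V (?d + e')\<^esub>k\<in>{0..s}. ?t k e')"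
  by (rule rgrd_finsum) (auto intro!: rg.zmult_closed rmon_closed c)
 also have "... = pow_op s d (rmon V d e y) e'"
  unfolding pow_op_def
 proof (rule gr.M.finsum_cong'[OF refl])
  show "(\<lambda>k. zmult p (grd V (?d + e')) (pow_coeff s (tate_exp p e' - (int p - 1) * (int s - int k)) (int k))
    (sop V (Pow k) (d + (e' - tate_step p * (int s - int k))) (rmon V d e y (e' - tate_step p * (int s - int k)))))
   : {0..s} \<rightarrow> V $ (?d + e')"
   by (auto intro!: gr.zmult_closed pow_op_term y)
  fix k
  let ?e0 = "e' - tate_step p * (int s - int k)"
  show "?t k e' = zmult p (grd V (?d + e')) (pow_coeff s (tate_exp p e' - (int p - 1) * (int s - int k)) (int k))
    (sop V (Pow k) (d + ?e0) (rmon V d e y ?e0))"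
  proof (cases "?e0 = e")
   case True
   then have e': "e' = e + tate_step p * (int s - int k)" by simp
   show ?thesis unfolding e' tate_exp_step by (simp add: rgrd_zmult rmon_def)
  next
   case False
   then have "e' \<noteq> e + tate_step p * (int s - int k)" by auto
   then show ?thesis using False sp.zero[of "Pow k" "d + ?e0"] unfolding pow_op_deg
    by (simp add: rgrd_zmult rmon_def)
  qed
 qed
 finally show "pow_op s d (rmon V d e y) e' = (\<Oplus>\<^bsub>rgrd V ?d\<^esub>k\<in>{0..s}. ?t k) e'" ..
qed

definition bock_op :: "int => (int => 'a) => int => 'a" where
 "bock_op d x e = (if even e then x (e - 1) else \<zero>\<^bsub>grd V (d - 1 + e)\<^esub>)"

lemma bock_op_hom: "bock_op d : Hom p (rgrd V d) (rgrd V (d - 1))"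
proof (rule mod_homI)
 fix x assume x: "x : V $$ d"
 show "bock_op d x : V $$ (d - 1)"
 proof (rule rgrd_carrierI)
  show "finite ((\<lambda>e. e + 1) ` rsupp V d x)" using finite_rsupp[OF x] by simp
  fix e
  show "bock_op d x e : V $ (d - 1 + e)"
   using rgrd_coord[OF x, of "e - 1"] by (simp add: bock_op_def algebra_simps)
  assume "e \<notin> (\<lambda>e. e + 1) ` rsupp V d x"
  then have "e - 1 \<notin> rsupp V d x" by (metis diff_add_cancel image_eqI)
  then show "bock_op d x e = \<zero>\<^bsub>grd V (d - 1 + e)\<^esub>" by (simp add: bock_op_def rsupp_def algebra_simps)
 qed
 fix y assume y: "y : V $$ d"
 show "bock_op d (x \<oplus>\<^bsub>rgrd V d\<^esub> y) = bock_op d x \<oplus>\<^bsub>rgrd V (d - 1)\<^esub> bock_op d y"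
  by (rule ext) (simp add: bock_op_def rgrd_simps(3) algebra_simps)
qed (auto simp: rg.Fp_module_axioms)

lemma bock_op_rmon:
 "bock_op d (rmon V d e y) = (if even e then \<zero>\<^bsub>rgrd V (d - 1)\<^esub> else rmon V (d - 1) (e + 1) y)"
 by (rule ext) (auto simp: bock_op_def rmon_def rgrd_simps(2) algebra_simps)

lemma minus_eq_self_char_2: "p = 2 ==> x : V $ d ==> \<ominus>\<^bsub>grd V d\<^esub> x = x"
proof -
 assume "p = 2" and x: "x : V $ d"
 then have "[-1 = 1] (mod int p)" by (simp add: cong_def)
 from gr.zmult_cong[OF this, of d x] show ?thesis
  using gr.zmult_minus[OF x, of 1] gr.zmult_1[OF x] by (simp only:)
qed

end

definition dif_op :: "('a, 'z) dgmod_scheme => int => (int => 'a) => int => 'a" where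
 "dif_op V d x e = (if even e then dif V (d + e) (x e) \<oplus>\<^bsub>grd V (d + 1 + e)\<^esub> x (e + 1)
   else \<ominus>\<^bsub>grd V (d + 1 + e)\<^esub> dif V (d + e) (x e))"

context dg_right_A_module begin

sublocale df: Fp_module_hom p "grd V d" "grd V (d + 1)" "dif V d" for d
 by (intro Fp_module_homI gr.Fp_module_axioms dif_hom)

lemma dif_closed': "x : V $ d ==> d + 1 = d' ==> dif V d x : V $ d'"
 using df.closed by auto

lemma dif_op_coord:
 assumes "x : V $$ d"
 shows "dif V (d + e) (x e) : V $ (d + 1 + e)" "x (e + 1) : V $ (d + 1 + e)"
 by (rule dif_closed'[OF rgrd_coord[OF assms]], simp) (rule rgrd_coord'[OF assms], simp)

lemma dif_op_hom: "dif_op V d : Hom p (rgrd V d) (rgrd V (d + 1))"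
proof (rule mod_homI)
 have z: "dif V (d + e) \<zero>\<^bsub>grd V (d + e)\<^esub> = \<zero>\<^bsub>grd V (d + 1 + e)\<^esub>" for e
  using df.zero[of "d + e"] by (simp add: algebra_simps)
 fix x assume x: "x : V $$ d"
 show "dif_op V d x : V $$ (d + 1)"
 proof (rule rgrd_carrierI)
  show "finite (rsupp V d x \<union> (\<lambda>e. e - 1) ` rsupp V d x)" using finite_rsupp[OF x] by simp
  fix e
  show "dif_op V d x e : V $ (d + 1 + e)"
   using dif_op_coord[OF x] by (simp add: dif_op_def)
  assume e: "e \<notin> rsupp V d x \<union> (\<lambda>e. e - 1) ` rsupp V d x"
  have "e + 1 \<notin> rsupp V d x"
  proof
   assume "e + 1 : rsupp V d x"
   then have "e + 1 - 1 : (\<lambda>e. e - 1) ` rsupp V d x" by (rule imageI)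
   then show False using e by simp
  qed
  then have "x e = \<zero>\<^bsub>grd V (d + e)\<^esub>" "x (e + 1) = \<zero>\<^bsub>grd V (d + 1 + e)\<^esub>"
   using e by (auto simp: rsupp_def algebra_simps)
  then show "dif_op V d x e = \<zero>\<^bsub>grd V (d + 1 + e)\<^esub>" using z by (simp add: dif_op_def)
 qed
 fix y assume y: "y : V $$ d"
 show "dif_op V d (x \<oplus>\<^bsub>rgrd V d\<^esub> y) = dif_op V d x \<oplus>\<^bsub>rgrd V (d + 1)\<^esub> dif_op V d y"
 proof (rule ext)
  fix e
  have 1: "dif V (d + e) (x e \<oplus>\<^bsub>grd V (d + e)\<^esub> y e) = dif V (d + e) (x e) \<oplus>\<^bsub>grd V (d + 1 + e)\<^esub> dif V (d + e) (y e)"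
   using df.add[OF rgrd_coord[OF x, of e] rgrd_coord[OF y, of e]]
   by (simp add: algebra_simps)
  have 2: "d + (e + 1) = d + 1 + e" by simp
  show "dif_op V d (x \<oplus>\<^bsub>rgrd V d\<^esub> y) e = (dif_op V d x \<oplus>\<^bsub>rgrd V (d + 1)\<^esub> dif_op V d y) e"
   using dif_op_coord[OF x, of e] dif_op_coord[OF y, of e]
   by (simp add: dif_op_def rgrd_simps(3) 1 2 gr.M.a_ac gr.M.minus_add)
 qed
qed (auto simp: rg.Fp_module_axioms)

lemma rdif_eq_dif_op:
 assumes y: "y : V $ (d + e)"
 shows "rdif p V d e y = dif_op V d (rmon V d e y)"
proof (rule ext)
 fix e'
 have z: "dif V (d + e') \<zero>\<^bsub>grd V (d + e')\<^esub> = \<zero>\<^bsub>grd V (d + 1 + e')\<^esub>"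
  using df.zero[of "d + e'"] by (simp add: algebra_simps)
 have y1: "y : V $ (d + 1 + (e - 1))" and y2: "dif V (d + e) y : V $ (d + 1 + e)"
  using y by (simp, intro dif_closed'[OF y]) simp
 have a: "d + (e' + 1) = d + 1 + e'" for e' :: int by simp
 let ?R = "rgrd V (d + 1)"
 show "rdif p V d e y e' = dif_op V d (rmon V d e y) e'"
 proof (cases "even e")
  case True
  then show ?thesis using z y2 by (auto simp: rdif_def dif_op_def rmon_def a)
 next
  case False
  have "rdif p V d e y e' = (rmon V (d + 1) (e - 1) y \<ominus>\<^bsub>?R\<^esub> rmon V (d + 1) e (dif V (d + e) y)) e'"
  proof (cases "p = 2")
   case True
   have "\<ominus>\<^bsub>?R\<^esub> rmon V (d + 1) e (dif V (d + e) y) = rmon V (d + 1) e (dif V (d + e) y)"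
    using rm.neg[OF y2] minus_eq_self_char_2[OF True y2] by simp
   then show ?thesis using True False by (simp add: rdif_def a_minus_def Let_def)
  qed (use False in \<open>simp add: rdif_def Let_def\<close>)
  also have "... = rmon V (d + 1) (e - 1) y e' \<oplus>\<^bsub>grd V (d + 1 + e')\<^esub> (\<ominus>\<^bsub>grd V (d + 1 + e')\<^esub> rmon V (d + 1) e (dif V (d + e) y) e')"
   using rgrd_uminus[OF rmon_closed[OF y2], of e'] by (simp add: a_minus_def rgrd_simps(3))
  also have "... = dif_op V d (rmon V d e y) e'"
   using False z y1 y2 by (auto simp: dif_op_def rmon_def a)
  finally show ?thesis .
 qed
qed

end
section \<open>Words in the powers\<close>

lemma (in Fp_module) finsum_triangle:
 fixes a b :: nat
 assumes F: "!!k l. F k l : carrier W" and z: "!!k l. k > a \<or> l > b ==> F k l = \<zero>\<^bsub>W\<^esub>"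
 shows "(\<Oplus>\<^bsub>W\<^esub>k\<in>{0..a}. \<Oplus>\<^bsub>W\<^esub>l\<in>{0..b}. F k l) = (\<Oplus>\<^bsub>W\<^esub>K\<in>{0..a + b}. \<Oplus>\<^bsub>W\<^esub>k\<in>{0..K}. F k (K - k))"
proof -
 let ?n = "a + b"
 have "(\<Oplus>\<^bsub>W\<^esub>K\<in>{0..?n}. \<Oplus>\<^bsub>W\<^esub>k\<in>{0..K}. F k (K - k))
   = (\<Oplus>\<^bsub>W\<^esub>K\<in>{0..?n}. \<Oplus>\<^bsub>W\<^esub>k\<in>{0..?n}. if k \<le> K then F k (K - k) else \<zero>\<^bsub>W\<^esub>)"
 proof (rule M.finsum_cong'[OF refl])
  fix K assume K: "K : {0..?n}"
  have "(\<Oplus>\<^bsub>W\<^esub>k\<in>{0..K}. F k (K - k)) = (\<Oplus>\<^bsub>W\<^esub>k\<in>{0..K}. if k \<le> K then F k (K - k) else \<zero>\<^bsub>W\<^esub>)"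
   by (intro M.finsum_cong') (auto simp: F)
  also have "... = (\<Oplus>\<^bsub>W\<^esub>k\<in>{0..?n}. if k \<le> K then F k (K - k) else \<zero>\<^bsub>W\<^esub>)"
   by (rule finsum_subset) (use K F in auto)
  finally show "(\<Oplus>\<^bsub>W\<^esub>k\<in>{0..K}. F k (K - k)) = (\<Oplus>\<^bsub>W\<^esub>k\<in>{0..?n}. if k \<le> K then F k (K - k) else \<zero>\<^bsub>W\<^esub>)" .
 qed (auto intro!: M.finsum_closed F)
 also have "... = (\<Oplus>\<^bsub>W\<^esub>k\<in>{0..?n}. \<Oplus>\<^bsub>W\<^esub>K\<in>{0..?n}. if k \<le> K then F k (K - k) else \<zero>\<^bsub>W\<^esub>)"
  by (rule finsum_swap) (auto simp: F)
 also have "... = (\<Oplus>\<^bsub>W\<^esub>k\<in>{0..?n}. \<Oplus>\<^bsub>W\<^esub>l\<in>{0..b}. F k l)"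
 proof (rule M.finsum_cong'[OF refl])
  fix k assume k: "k : {0..?n}"
  show "(\<Oplus>\<^bsub>W\<^esub>K\<in>{0..?n}. if k \<le> K then F k (K - k) else \<zero>\<^bsub>W\<^esub>) = (\<Oplus>\<^bsub>W\<^esub>l\<in>{0..b}. F k l)"
  proof (cases "k \<le> a")
   case True
   have "(\<Oplus>\<^bsub>W\<^esub>l\<in>{0..b}. F k l) = (\<Oplus>\<^bsub>W\<^esub>l\<in>{0..b}. if k \<le> k + l then F k (k + l - k) else \<zero>\<^bsub>W\<^esub>)"
    by (intro M.finsum_cong') (auto simp: F)
   also have "... = (\<Oplus>\<^bsub>W\<^esub>K\<in>(\<lambda>l. k + l) ` {0..b}. if k \<le> K then F k (K - k) else \<zero>\<^bsub>W\<^esub>)"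
    by (rule M.finsum_reindex[symmetric]) (auto simp: F)
   also have "... = (\<Oplus>\<^bsub>W\<^esub>K\<in>{0..?n}. if k \<le> K then F k (K - k) else \<zero>\<^bsub>W\<^esub>)"
   proof (rule finsum_subset)
    fix K assume K: "K : {0..?n} - (\<lambda>l. k + l) ` {0..b}"
    show "(if k \<le> K then F k (K - k) else \<zero>\<^bsub>W\<^esub>) = \<zero>\<^bsub>W\<^esub>"
    proof (cases "k \<le> K")
     case kK: True
     have "\<not> K - k \<le> b"
     proof
      assume "K - k \<le> b"
      then have "k + (K - k) : (\<lambda>l. k + l) ` {0..b}" by (intro imageI) simp
      then show False using K kK by simp
     qed
     then show ?thesis using z[of k "K - k"] by simp
    qed simp
   qed (use True F in auto)
   finally show ?thesis ..
  next
   case False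
   then show ?thesis by (simp add: z finsum_neutral)
  qed
 qed (auto intro!: M.finsum_closed F)
 also have "... = (\<Oplus>\<^bsub>W\<^esub>k\<in>{0..a}. \<Oplus>\<^bsub>W\<^esub>l\<in>{0..b}. F k l)"
  by (rule finsum_subset[symmetric]) (auto intro!: M.finsum_closed F finsum_neutral simp: z)
 finally show ?thesis ..
qed

lemma mod_hom_cong:
 assumes "f : Hom p V W" "Fp_module p V" "!!x. x : carrier V ==> g x = f x"
 shows "g : Hom p V W"
proof -
 interpret Fp_module p V by fact
 show ?thesis using assms(1,3) by (auto simp: mod_hom_def)
qed

lemma wmon_Nil: "wmon [] = 1"
 by (simp add: wmon_def zero_word_def[symmetric])

lemma wmon_append: "wmon (gs @ hs) = wmon gs * wmon hs"
 by (simp add: wmon_def mult_single plus_word_def)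

text \<open>The words of length two and total exponent \<open>n\<close>, extended by zero to an array on all integers.\<close>

definition pow_words :: "int => int => int => free_alg" where
 "pow_words n a b = (if a + b = n then if a \<ge> 0 \<and> b \<ge> 0 then wmon [Pow (nat a), Pow (nat b)] else 0 else 0)"

lemma adem_arrays_steenrod: "prime p ==> adem_arrays p (steenrod_ideal p)"
proof (rule adem_arrays.intro)
 have "of_nat p : steenrod_ideal p" using steenrod_rels_subset by (auto simp: steenrod_rels_def)
 then show "of_nat p * x : steenrod_ideal p" for x by (rule steenrod_ideal_closed)
qed (auto simp: steenrod_ideal_closed)

lemma sum_adem_range:
 fixes g :: "int => 'x::comm_monoid_add"
 assumes "p > 0" "!!i. int A < int p * i ==> g i = 0"
 shows "(\<Sum>i\<in>{0..int A}. g i) = (\<Sum>i\<in>{0..A div p}. g (int i))"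
proof -
 have "(\<Sum>i\<in>{0..int A}. g i) = (\<Sum>i\<in>{0..A}. g (int i))"
  by (rule sum.reindex_bij_witness[of _ int nat]) auto
 also have "... = (\<Sum>i\<in>{0..A div p}. g (int i))"
 proof (rule sum.mono_neutral_right)
  show "\<forall>i\<in>{0..A} - {0..A div p}. g (int i) = 0"
  proof
   fix i assume "i : {0..A} - {0..A div p}"
   then have "A < p * i" using assms(1) by (simp add: not_le div_less_iff_less_mult mult.commute)
   then have "int A < int p * int i" by (metis of_nat_less_iff of_nat_mult)
   then show "g (int i) = 0" by (rule assms(2))
  qed
 qed (auto simp: div_le_dividend intro: order_trans)
 finally show ?thesis .
qed

lemma le_if_le_div: "i : {0..a div q} ==> i \<le> (a :: nat)"
 by (metis atLeastAtMost_iff div_le_dividend le_trans)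

text \<open>In the range of the defining relations these are the generators of the ideal; at \<open>a = 0\<close>, which they exclude, the relation reads \<open>P\<^sup>0 P\<^sup>b = P\<^sup>b P\<^sup>0\<close>.\<close>

lemma pow_words_adem:
 assumes p: "prime p"
 shows "adem_arrays.dickson p (steenrod_ideal p) (pow_words n)"
proof -
 interpret adem_arrays p "steenrod_ideal p" by (rule adem_arrays_steenrod[OF p])
 show ?thesis
 proof (rule dickson_if_adem)
  fix a b :: int assume ab: "0 \<le> a" "a < int p * b" "a + b = n"
  have p0: "int p > 0" using p by (simp add: prime_gt_0_nat)
  have "0 < int p * b" using ab by linarith
  then have b: "b > 0" using p0 by (simp add: zero_less_mult_iff)
  define A B where "A = nat a" and "B = nat b"
  have AB: "a = int A" "b = int B" using ab b by (auto simp: A_def B_def)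
  have lt: "A < p * B" using ab(2) unfolding AB by (metis of_nat_less_iff of_nat_mult)
  have "(\<Sum>i\<in>{0..a}. of_int (adem_coeff p a b i) * pow_words n (a + b - i) i)
    = (\<Sum>i\<in>{0..A div p}. of_int (adem_coeff p a b (int i)) * pow_words n (a + b - int i) (int i))"
   unfolding AB by (rule sum_adem_range) (use p0 in simp_all)
  also have "... = (\<Sum>i\<in>{0..A div p}. of_int (adem_coeff p a b (int i)) * wmon [Pow (A + B - i), Pow i])"
  proof (intro sum.cong refl)
   fix i assume "i : {0..A div p}"
   then have "i \<le> A" by (rule le_if_le_div)
   then have "pow_words n (a + b - int i) (int i) = wmon [Pow (A + B - i), Pow i]"
   proof -
    have "nat (a + b - int i) = A + B - i" "a + b - int i \<ge> 0" using \<open>i \<le> A\<close> unfolding AB by linarith+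
    then show ?thesis unfolding pow_words_def using ab(3) by simp
   qed
   then show "of_int (adem_coeff p a b (int i)) * pow_words n (a + b - int i) (int i)
    = of_int (adem_coeff p a b (int i)) * wmon [Pow (A + B - i), Pow i]" by simp
  qed
  finally have sum: "(\<Sum>i\<in>{0..a}. of_int (adem_coeff p a b i) * pow_words n (a + b - i) i)
    = (\<Sum>i\<in>{0..A div p}. of_int (adem_coeff p a b (int i)) * wmon [Pow (A + B - i), Pow i])" .
  have q: "pow_words n a b = wmon [Pow A, Pow B]" using ab b by (simp add: pow_words_def AB)
  show "eqv (pow_words n a b) (\<Sum>i\<in>{0..a}. of_int (adem_coeff p a b i) * pow_words n (a + b - i) i)"
  proof (cases "A = 0")
   case True
   have P0: "wmon [Pow 0] - 1 : steenrod_ideal p" using steenrod_rels_subset by (auto simp: steenrod_rels_def)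
   have "wmon [Pow 0, Pow B] - wmon [Pow B, Pow 0]
    = (wmon [Pow 0] - 1) * wmon [Pow B] - wmon [Pow B] * (wmon [Pow 0] - 1)"
    using wmon_append[of "[Pow 0]" "[Pow B]"] wmon_append[of "[Pow B]" "[Pow 0]"] by (simp add: algebra_simps)
   also have "... : steenrod_ideal p" by (rule steenrod_ideal_closed(2)[OF steenrod_ideal_closed(3)[OF P0] steenrod_ideal_closed(4)[OF P0]])
   finally show ?thesis unfolding sum q using True by (simp add: eqv_def AB adem_coeff_def)
  next
   case False
   show ?thesis
   proof (cases "p = 2")
    case True
    let ?r = "wmon [Pow A, Pow B] - (\<Sum>c = 0..A div 2. of_int (ibinom (int B - int c - 1) (int A - 2 * int c)) * wmon [Pow (A + B - c), Pow c])"
    have "?r : adem_even" using False lt True by (auto simp: adem_even_def)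
    then have "?r : steenrod_ideal p" using steenrod_rels_subset[of p] True by (auto simp: steenrod_rels_def)
    then have "eqv (wmon [Pow A, Pow B]) (\<Sum>c = 0..A div 2. of_int (ibinom (int B - int c - 1) (int A - 2 * int c)) * wmon [Pow (A + B - c), Pow c])"
     by (simp add: eqv_def)
    also have "eqv ... (\<Sum>i\<in>{0..A div 2}. of_int (adem_coeff p a b (int i)) * wmon [Pow (A + B - i), Pow i])"
     by (intro eqv_sum eqv_scale eqv_refl) (auto simp: adem_coeff_def True AB cong_iff_dvd_diff)
    finally have "eqv (wmon [Pow A, Pow B]) (\<Sum>i\<in>{0..A div 2}. of_int (adem_coeff p a b (int i)) * wmon [Pow (A + B - i), Pow i])" .
    moreover have "{0..A div p} = {0..A div 2}" using True by simp
    ultimately show ?thesis unfolding sum q by (simp only:)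
   next
    case p2: False
    let ?r = "wmon [Pow A, Pow B] - (\<Sum>i = 0..A div p. of_int ((-1) ^ (A + i)
       * ibinom ((int p - 1) * (int B - int i) - 1) (int A - int p * int i))
      * wmon [Pow (A + B - i), Pow i])"
    have "?r : adem_odd p" unfolding adem_odd_def using False lt by blast
    then have "?r : steenrod_ideal p" using steenrod_rels_subset[of p] p2 by (auto simp: steenrod_rels_def)
    moreover have "(-1) ^ (A + i) * ibinom ((int p - 1) * (int B - int i) - 1) (int A - int p * int i) = adem_coeff p a b (int i)" for i
     by (simp add: adem_coeff_def AB)
    ultimately show ?thesis unfolding sum q by (simp add: eqv_def)
   qed
  qed
 qed (auto simp: pow_words_def)
qed

locale bock_trivial = dg_A_algebra p M for p and M :: "('a, 'z) dgalg_scheme" +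
 assumes Bock_trivial: "!!d x. x : M $ d ==> sop M Bock d x = \<zero>\<^bsub>grd M (d - 1)\<^esub>"
begin

abbreviation "RM \<equiv> r_plus p M"
abbreviation "pdeg s \<equiv> gen_deg p (Pow s)"

lemma r_plus_simps [simp]:
 "grd RM = rgrd M" "gunit RM = rmon M 0 0 (gunit M)"
 by (simp_all add: r_plus_def)

lemma rpow_eq:
 assumes y: "y : M $ (d + e)"
 shows "rpow p M s d e y = pow_op s d (rmon M d e y)"
proof -
 let ?d = "d - int (pdeg s)"
 let ?R = "rgrd M ?d"
 let ?g = "\<lambda>k. zmult p ?R (pow_coeff s (tate_exp p e) (int k))
    (rmon M ?d (e + tate_step p * (int s - int k)) (sop M (Pow k) (d + e) y))"
 have c: "sop M (Pow k) (d + e) y : M $ (?d + (e + tate_step p * (int s - int k)))" for k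
 proof -
  have "d + e - int (pdeg k) = ?d + (e + tate_step p * (int s - int k))"
   using p_pos by (simp add: gen_deg_Pow algebra_simps)
  then show ?thesis using sp.closed[OF y, of "Pow k"] by (simp only:)
 qed
 have g: "?g k : carrier ?R" for k by (intro rg.zmult_closed rmon_closed c)
 have coeff: "pow_coeff s r k = ibinom (- 1 - r - int s * (int p - 1)) (int s - int p * k)" for r k
  by (simp add: pow_coeff_def psi_coeff_def algebra_simps)
 have "rpow p M s d e y = (\<Oplus>\<^bsub>?R\<^esub>k\<in>{0..s}. ?g k)"
 proof (cases "p = 2")
  case True
  have t: "tate_exp p e = e" "tate_step p = 1" using True by (simp_all add: tate_exp_def tate_step_def)
  have "rpow p M s d e y = (\<Oplus>\<^bsub>?R\<^esub>k\<in>{0..s}. zmult p ?R (ibinom (- 1 - e - int s) (int s - 2 * int k))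
       (rmon M ?d (e + int s - int k) (sop M (Pow k) (d + e) y)))"
   using True by (simp add: rpow_def Let_def)
  also have "... = (\<Oplus>\<^bsub>?R\<^esub>k\<in>{0..s}. ?g k)"
  proof (intro rg.M.finsum_cong' refl)
   show "?g : {0..s} \<rightarrow> carrier ?R" using g by auto
   show "zmult p ?R (ibinom (- 1 - e - int s) (int s - 2 * int k))
       (rmon M ?d (e + int s - int k) (sop M (Pow k) (d + e) y)) = ?g k" for k
    unfolding coeff t by (simp add: True algebra_simps)
  qed
  finally show ?thesis .
 next
  case False
  have st: "tate_exp p e = e div 2" "tate_step p = 2 * (int p - 1)" using False by (simp_all add: tate_exp_def tate_step_def)
  have cong: "(\<Oplus>\<^bsub>?R\<^esub>k\<in>{0..s}. zmult p ?R (ibinom (- 1 - e div 2 - int s * (int p - 1)) (int s - int p * int k)) (rmon M ?d (ee k) (sop M (Pow k) (d + e) y)))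
    = (\<Oplus>\<^bsub>?R\<^esub>k\<in>{0..s}. ?g k)" if "!!k. ee k = e + tate_step p * (int s - int k)" for ee
   by (intro rg.M.finsum_cong' refl) (use g in \<open>auto simp: that coeff st\<close>)
  have fcl: "(\<Oplus>\<^bsub>?R\<^esub>k\<in>{0..s}. ?g k) : carrier ?R" using g by (intro rg.M.finsum_closed) auto
  show ?thesis
  proof (cases "even e")
   case True
   have z: "(\<Oplus>\<^bsub>?R\<^esub>k\<in>{0..s}. zmult p ?R (ibinom (- 1 - e div 2 - int s * (int p - 1)) (int s - int p * int k - 1))
       (rmon M ?d (1 + 2 * (- 1 + e div 2 + (int s - int k) * (int p - 1)))
        (sop M (Pow k) (d + e - 1) (sop M Bock (d + e) y)))) = \<zero>\<^bsub>?R\<^esub>"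
   proof (rule rg.finsum_neutral)
    fix k
    let ?e = "1 + 2 * (- 1 + e div 2 + (int s - int k) * (int p - 1))"
    have "int (pdeg k) = 2 * (int p - 1) * int k" "int (pdeg s) = 2 * (int p - 1) * int s"
     using p_pos st by (simp_all add: gen_deg_Pow)
    moreover have "2 * (e div 2) = e" using True by simp
    ultimately have "d + e - 1 - int (pdeg k) = ?d + ?e" by (simp add: algebra_simps)
    then have "sop M (Pow k) (d + e - 1) (sop M Bock (d + e) y) = \<zero>\<^bsub>grd M (?d + ?e)\<^esub>"
     using sp.zero[of "Pow k" "d + e - 1"] by (simp only: Bock_trivial[OF y])
    then show "zmult p ?R (ibinom (- 1 - e div 2 - int s * (int p - 1)) (int s - int p * int k - 1))
       (rmon M ?d ?e (sop M (Pow k) (d + e - 1) (sop M Bock (d + e) y))) = \<zero>\<^bsub>?R\<^esub>"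
     by (simp only: rm.zero rg.zmult_zero)
   qed
   have ee: "2 * (e div 2 + (int s - int k) * (int p - 1)) = e + tate_step p * (int s - int k)" for k
    unfolding st(2) using True by (simp add: algebra_simps)
   show ?thesis
    by (simp only: rpow_def Let_def False True if_True if_False z cong[OF ee] a_minus_def rg.uminus_zero rg.M.r_zero[OF fcl])
  next
   case odd: False
   then have ee: "1 + 2 * (e div 2 + (int s - int k) * (int p - 1)) = e + tate_step p * (int s - int k)" for k
    unfolding st(2) using odd_two_times_div_two_succ[of e] by (simp add: algebra_simps)
   show ?thesis by (simp only: rpow_def Let_def False odd if_False cong[OF ee])
  qed
 qed
 also have "... = pow_op s d (rmon M d e y)" by (rule pow_op_rmon[OF y, symmetric])
 finally show ?thesis .
qed

lemma r_plus_Pow: "x : M $$ d ==> sop RM (Pow s) d x = pow_op s d x"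
 by (simp add: r_plus_def) (rule rext_eq[OF _ pow_op_hom rpow_eq])

lemma r_plus_Bock_2:
 assumes "p = 2" "x : M $$ d"
 shows "sop RM Bock d x = pow_op 1 d x"
proof -
 have d: "d - deg p Bock = d - int (pdeg 1)" using assms by (simp add: gen_deg_def)
 have "sop RM Bock d x = rext M d (d - deg p Bock) (rbock p M d) x"
  by (simp add: r_plus_def)
 also have "... = pow_op 1 d x"
  unfolding d by (rule rext_eq[OF assms(2) pow_op_hom]) (use rpow_eq assms(1) in \<open>auto simp: rbock_def\<close>)
 finally show ?thesis .
qed

lemma r_plus_Bock:
 assumes "p \<noteq> 2" "x : M $$ d"
 shows "sop RM Bock d x = bock_op d x"
proof -
 have "sop RM Bock d x = rext M d (d - 1) (rbock p M d) x" by (simp add: r_plus_def)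
 also have "... = bock_op d x"
 proof (rule rext_eq[OF assms(2) bock_op_hom])
  fix e :: int and y :: 'a
  show "rbock p M d e y = bock_op d (rmon M d e y)"
  proof (cases "even e")
   case False
   then have "2 * (e div 2 + 1) = e + 1" by presburger
   then show ?thesis using False assms(1) by (simp only: rbock_def bock_op_rmon if_False)
  qed (use assms(1) in \<open>simp add: rbock_def bock_op_rmon\<close>)
 qed
 finally show ?thesis .
qed

lemma r_plus_dif: "x : M $$ d ==> dif RM d x = dif_op M d x"
 by (simp add: r_plus_def) (rule rext_eq[OF _ dif_op_hom rdif_eq_dif_op])

lemma r_plus_graded_ops: "graded_ops p RM"
proof (rule graded_ops.intro[OF p_prime])
 show "module (Fp p) (grd RM d)" for d using rg.Fp_module by simp
 fix g d
 show "sop RM g d : Hom p (grd RM d) (grd RM (d - deg p g))"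
 proof (cases g)
  case (Pow s)
  then show ?thesis using mod_hom_cong[OF pow_op_hom rg.Fp_module_axioms r_plus_Pow] by simp
 next
  case Bock
  show ?thesis
  proof (cases "p = 2")
   case True
   then have "deg p Bock = int (pdeg 1)" by (simp add: gen_deg_def)
   then show ?thesis using mod_hom_cong[OF pow_op_hom rg.Fp_module_axioms r_plus_Bock_2[OF True]] Bock
    by (simp only: r_plus_simps)
  next
   case False
   then show ?thesis using mod_hom_cong[OF bock_op_hom rg.Fp_module_axioms r_plus_Bock[OF False]] Bock
    by simp
  qed
 qed
qed

sublocale rp: graded_ops p RM by (rule r_plus_graded_ops)

end
section \<open>The Steenrod action on \<open>r\<^sub>+(M)\<close>\<close>

lemma (in graded_ops) hact_wrong_deg:
 assumes "f : free_deg p k" "k \<noteq> k'" "x : V $ d"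
 shows "hact p V k' d f x = \<zero>\<^bsub>grd V (d - int k')\<^esub>"
proof -
 have "{w : Poly_Mapping.keys f. word_deg p w = k'} = {}" using assms by (auto simp: free_deg_def)
 then show ?thesis unfolding hact_def by (simp only: gr.M.finsum_empty)
qed

lemma pow_deg_add: "p > 0 ==> gen_deg p (Pow a) + gen_deg p (Pow b) = gen_deg p (Pow (a + b))"
 by (simp add: gen_deg_def algebra_simps)

context bock_trivial begin

text \<open>The element \<open>\<Sum>\<^sub>K u \<otimes> y \<cdot> G\<^sub>K\<close> of \<open>r\<^sub>+\<close> in which the exponents are determined by the degrees.\<close>

definition spread :: "int => nat => int => int => 'a => (nat => free_alg) => int => 'a" where
 "spread d n e m y G = (\<Oplus>\<^bsub>rgrd M d\<^esub>K\<in>{0..n}. rmon M d (e + tate_step p * (int n - int K)) (hact p M (pdeg K) m (G K) y))"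

lemma spread_deg: "d + e + tate_step p * int n = m ==> m - int (pdeg K) = d + (e + tate_step p * (int n - int K))"
 using p_pos by (auto simp: gen_deg_Pow algebra_simps)

lemma spread_term:
 assumes "d + e + tate_step p * int n = m" "y : M $ m"
 shows "hact p M (pdeg K) m f y : M $ (d + (e + tate_step p * (int n - int K)))"
 using hact_closed[OF assms(2), of "pdeg K" f] unfolding spread_deg[OF assms(1)] .

lemma spread_closed:
 assumes "d + e + tate_step p * int n = m" "y : M $ m"
 shows "spread d n e m y G : M $$ d"
 unfolding spread_def by (intro rg.M.finsum_closed) (auto intro!: rmon_closed spread_term assms)

lemma spread_diff:
 assumes "d + e + tate_step p * int n = m" "y : M $ m"
 shows "spread d n e m y (\<lambda>K. G K - H K) = spread d n e m y G \<ominus>\<^bsub>rgrd M d\<^esub> spread d n e m y H"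
proof -
 let ?r = "\<lambda>G K. rmon M d (e + tate_step p * (int n - int K)) (hact p M (pdeg K) m (G K) y)"
 have r: "?r G K : M $$ d" for G K by (intro rmon_closed spread_term assms)
 have "?r (\<lambda>K. G K - H K) K = ?r G K \<oplus>\<^bsub>rgrd M d\<^esub> zmult p (rgrd M d) (-1) (?r H K)" for K
  using rm.diff[OF spread_term[OF assms, of K "G K"] spread_term[OF assms, of K "H K"]]
   hact_diff[OF assms(2), of "pdeg K" "G K" "H K"] rg.zmult_minus[OF r[where G = H and K = K], of 1] rg.zmult_1[OF r[where G = H and K = K]]
  unfolding spread_deg[OF assms(1)] by (simp only: a_minus_def)
 then have "spread d n e m y (\<lambda>K. G K - H K) = (\<Oplus>\<^bsub>rgrd M d\<^esub>K\<in>{0..n}. ?r G K \<oplus>\<^bsub>rgrd M d\<^esub> zmult p (rgrd M d) (-1) (?r H K))"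
  by (simp only: spread_def)
 also have "... = spread d n e m y G \<oplus>\<^bsub>rgrd M d\<^esub> zmult p (rgrd M d) (-1) (spread d n e m y H)"
  unfolding spread_def using r
  by (subst rg.zmult_finsum) (auto intro!: rg.M.finsum_addf)
 finally show ?thesis using rg.zmult_minus[OF spread_closed[OF assms], of 1 H] spread_closed[OF assms]
  by (simp add: a_minus_def)
qed

lemma spread_of_int:
 assumes "d + e + tate_step p * int n = m" "y : M $ m"
 shows "spread d n e m y (\<lambda>K. of_int c * G K) = zmult p (rgrd M d) c (spread d n e m y G)"
proof -
 let ?r = "\<lambda>G K. rmon M d (e + tate_step p * (int n - int K)) (hact p M (pdeg K) m (G K) y)"
 have r: "?r G K : M $$ d" for G K by (intro rmon_closed spread_term assms)
 have "?r (\<lambda>K. of_int c * G K) K = zmult p (rgrd M d) c (?r G K)" for K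
  using rm.zmult[OF spread_term[OF assms, of K "G K"]] hact_of_int[OF assms(2), of "pdeg K" c "G K"]
  unfolding spread_deg[OF assms(1)] by (simp only:)
 then show ?thesis unfolding spread_def using r by (subst rg.zmult_finsum) auto
qed

lemma spread_0:
 assumes "d + e + tate_step p * int n = m" "y : M $ m"
  "!!K. K \<le> n ==> hact p M (pdeg K) m (G K) y = \<zero>\<^bsub>grd M (m - int (pdeg K))\<^esub>"
 shows "spread d n e m y G = \<zero>\<^bsub>rgrd M d\<^esub>"
 unfolding spread_def
proof (rule rg.finsum_neutral)
 fix K assume "K : {0..n}"
 then have "hact p M (pdeg K) m (G K) y = \<zero>\<^bsub>grd M (d + (e + tate_step p * (int n - int K)))\<^esub>"
  using assms(3)[of K] unfolding spread_deg[OF assms(1)] by simp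
 then show "rmon M d (e + tate_step p * (int n - int K)) (hact p M (pdeg K) m (G K) y) = \<zero>\<^bsub>rgrd M d\<^esub>"
  by (simp only: rm.zero)
qed

lemma spread_sum:
 assumes "d + e + tate_step p * int n = m" "y : M $ m" "finite A"
 shows "spread d n e m y (\<lambda>K. \<Sum>i\<in>A. G i K) = (\<Oplus>\<^bsub>rgrd M d\<^esub>i\<in>A. spread d n e m y (G i))"
 using assms(3)
proof (induction A rule: finite_induct)
 case empty
 then show ?case by (simp add: spread_0[OF assms(1,2)] hact_0[OF assms(2)])
next
 case (insert i A)
 have "spread d n e m y (\<lambda>K. \<Sum>i\<in>insert i A. G i K)
  = spread d n e m y (\<lambda>K. G i K - (0 - (\<Sum>i\<in>A. G i K)))" using insert by simp
 also have "... = spread d n e m y (G i) \<ominus>\<^bsub>rgrd M d\<^esub> (\<zero>\<^bsub>rgrd M d\<^esub> \<ominus>\<^bsub>rgrd M d\<^esub> spread d n e m y (\<lambda>K. \<Sum>i\<in>A. G i K))"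
  unfolding spread_diff[OF assms(1,2)] by (simp add: spread_0[OF assms(1,2)] hact_0[OF assms(2)])
 also have "... = spread d n e m y (G i) \<oplus>\<^bsub>rgrd M d\<^esub> spread d n e m y (\<lambda>K. \<Sum>i\<in>A. G i K)"
  using spread_closed[OF assms(1,2)] by (simp add: a_minus_def rg.M.minus_minus)
 finally show ?case using insert spread_closed[OF assms(1,2)] by (simp add: rg.M.finsum_insert Pi_def)
qed

text \<open>Collecting the terms with \<open>k + l = K\<close> turns the double sum over the two operations into a sum over \<open>K\<close> of combinations of words of length two, which for fixed \<open>K\<close> all raise the exponent of \<open>t\<close> by the same amount.\<close>

lemma pow_op_after_pow:
 fixes \<alpha> :: "nat => int" and a b :: nat
 assumes deg: "d + e + tate_step p * int (a + b) = m" and y: "y : M $ m"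
  and \<alpha>: "!!k. k > a ==> \<alpha> k = 0" and d1: "d1 = d + int (pdeg b)"
 shows "pow_op b d1 (\<Oplus>\<^bsub>rgrd M d1\<^esub>k\<in>{0..a}. zmult p (rgrd M d1) (\<alpha> k)
    (rmon M d1 (e + tate_step p * (int a - int k)) (sop M (Pow k) m y)))
  = spread d (a + b) e m y (\<lambda>K. \<Sum>k\<in>{0..K}. of_int (\<alpha> k *
    pow_coeff b (tate_exp p e + (int p - 1) * (int a - int k)) (int (K - k))) * wmon [Pow k, Pow (K - k)])"
proof -
 interpret P: Fp_module_hom p "rgrd M d1" "rgrd M d" "pow_op b d1"
  using pow_op_hom[of b d1] d1 by (intro Fp_module_homI rg.Fp_module_axioms) simp
 let ?e = "\<lambda>k l. e + tate_step p * (int (a + b) - int k - int l)"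
 define z where "z k l = sop M (Pow l) (m - int (pdeg k)) (sop M (Pow k) m y)" for k l
 define \<gamma> where "\<gamma> k l = \<alpha> k * pow_coeff b (tate_exp p e + (int p - 1) * (int a - int k)) (int l)" for k l
 define F where "F k l = zmult p (rgrd M d) (\<gamma> k l) (rmon M d (?e k l) (z k l))" for k l
 have y1: "sop M (Pow k) m y : M $ (d1 + (e + tate_step p * (int a - int k)))" for k
 proof -
  have "m - int (pdeg k) = d1 + (e + tate_step p * (int a - int k))"
   using deg d1 p_pos by (auto simp: gen_deg_Pow algebra_simps)
  then show ?thesis using sp.closed[OF y, of "Pow k"] by (simp only:)
 qed
 have zc: "z k l : M $ (d + ?e k l)" for k l
 proof -
  have "m - int (pdeg k) - int (pdeg l) = d + ?e k l"
   using deg p_pos by (auto simp: gen_deg_Pow algebra_simps)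
  then show ?thesis using sp.closed[OF sp.closed[OF y, of "Pow k"], of "Pow l"] unfolding z_def by (simp only:)
 qed
 have Fc: "F k l : M $$ d" for k l unfolding F_def by (intro rg.zmult_closed rmon_closed zc)
 have F0: "F k l = \<zero>\<^bsub>rgrd M d\<^esub>" if "k > a \<or> l > b" for k l
 proof -
  have "\<gamma> k l = 0"
  proof (cases "k > a")
   case False
   then have "int b < 1 * int l" using that by simp
   also have "1 * int l \<le> int p * int l" using p_pos by (intro mult_right_mono) auto
   finally show ?thesis by (simp add: \<gamma>_def pow_coeff_def)
  qed (simp add: \<gamma>_def \<alpha>)
  then show ?thesis using rg.zmult_0[OF rmon_closed[OF zc]] by (simp only: F_def)
 qed
 have inner: "pow_op b d1 (zmult p (rgrd M d1) (\<alpha> k) (rmon M d1 (e + tate_step p * (int a - int k)) (sop M (Pow k) m y)))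
   = (\<Oplus>\<^bsub>rgrd M d\<^esub>l\<in>{0..b}. F k l)" for k
 proof -
  let ?e1 = "e + tate_step p * (int a - int k)"
  have dd: "d1 - int (pdeg b) = d" using d1 by simp
  have m1: "d1 + ?e1 = m - int (pdeg k)" using deg d1 p_pos by (auto simp: gen_deg_Pow algebra_simps)
  have "pow_op b d1 (rmon M d1 ?e1 (sop M (Pow k) m y))
    = (\<Oplus>\<^bsub>rgrd M d\<^esub>l\<in>{0..b}. zmult p (rgrd M d) (pow_coeff b (tate_exp p ?e1) (int l))
      (rmon M d (?e1 + tate_step p * (int b - int l)) (z k l)))"
   using pow_op_rmon[OF y1, of b k] unfolding dd m1 z_def .
  also have "... = (\<Oplus>\<^bsub>rgrd M d\<^esub>l\<in>{0..b}. zmult p (rgrd M d) (pow_coeff b (tate_exp p ?e1) (int l)) (rmon M d (?e k l) (z k l)))"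
  proof -
   have "?e1 + tate_step p * (int b - int l) = ?e k l" for l by (simp add: algebra_simps)
   then show ?thesis by (simp only:)
  qed
  finally have 1: "pow_op b d1 (rmon M d1 ?e1 (sop M (Pow k) m y)) = ..." .
  have "pow_op b d1 (zmult p (rgrd M d1) (\<alpha> k) (rmon M d1 ?e1 (sop M (Pow k) m y)))
   = (\<Oplus>\<^bsub>rgrd M d\<^esub>l\<in>{0..b}. zmult p (rgrd M d) (\<alpha> k) (zmult p (rgrd M d) (pow_coeff b (tate_exp p ?e1) (int l)) (rmon M d (?e k l) (z k l))))"
   unfolding P.zmult[OF rmon_closed[OF y1]] 1 by (rule rg.zmult_finsum) (intro Pi_I rg.zmult_closed rmon_closed zc)
  also have "... = (\<Oplus>\<^bsub>rgrd M d\<^esub>l\<in>{0..b}. F k l)"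
   unfolding F_def \<gamma>_def tate_exp_step by (simp only: rg.zmult_assoc[OF rmon_closed[OF zc]])
  finally show ?thesis .
 qed
 have "pow_op b d1 (\<Oplus>\<^bsub>rgrd M d1\<^esub>k\<in>{0..a}. zmult p (rgrd M d1) (\<alpha> k)
    (rmon M d1 (e + tate_step p * (int a - int k)) (sop M (Pow k) m y)))
   = (\<Oplus>\<^bsub>rgrd M d\<^esub>k\<in>{0..a}. \<Oplus>\<^bsub>rgrd M d\<^esub>l\<in>{0..b}. F k l)"
  unfolding inner[symmetric] by (rule P.finsum) (auto intro!: rg.zmult_closed rmon_closed y1)
 also have "... = (\<Oplus>\<^bsub>rgrd M d\<^esub>K\<in>{0..a + b}. \<Oplus>\<^bsub>rgrd M d\<^esub>k\<in>{0..K}. F k (K - k))"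
  by (rule rg.finsum_triangle[OF Fc F0])
 also have "... = spread d (a + b) e m y (\<lambda>K. \<Sum>k\<in>{0..K}. of_int (\<gamma> k (K - k)) * wmon [Pow k, Pow (K - k)])"
  unfolding spread_def
 proof (rule rg.M.finsum_cong'[OF refl])
  fix K assume "K : {0..a + b}"
  let ?ee = "e + tate_step p * (int (a + b) - int K)"
  have mK: "m - int (pdeg K) = d + ?ee" by (rule spread_deg[OF deg])
  have ee: "?e k (K - k) = ?ee" if "k \<le> K" for k using that by (simp add: of_nat_diff)
  have zc': "z k (K - k) : M $ (d + ?ee)" if "k \<le> K" for k
   using zc[of k "K - k"] unfolding ee[OF that] .
  have z: "hact p M (pdeg K) m (wmon [Pow k, Pow (K - k)]) y = z k (K - k)" if "k \<le> K" for k
   using that hact_wmon[OF y, of "[Pow k, Pow (K - k)]" "pdeg K"] pow_deg_add[OF p_pos, of k "K - k"]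
   by (simp add: z_def)
  have "hact p M (pdeg K) m (\<Sum>k\<in>{0..K}. of_int (\<gamma> k (K - k)) * wmon [Pow k, Pow (K - k)]) y
   = (\<Oplus>\<^bsub>grd M (d + ?ee)\<^esub>k\<in>{0..K}. zmult p (grd M (d + ?ee)) (\<gamma> k (K - k)) (z k (K - k)))"
   unfolding hact_sum[OF y] hact_of_int[OF y] mK
  proof (rule gr.M.finsum_cong'[OF refl])
   show "(\<lambda>k. zmult p (grd M (d + ?ee)) (\<gamma> k (K - k)) (z k (K - k))) : {0..K} \<rightarrow> M $ (d + ?ee)"
    by (intro Pi_I gr.zmult_closed zc') simp
   fix k assume "k : {0..K}"
   then have "k \<le> K" by simp
   then show "zmult p (grd M (d + ?ee)) (\<gamma> k (K - k)) (hact p M (pdeg K) m (wmon [Pow k, Pow (K - k)]) y)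
     = zmult p (grd M (d + ?ee)) (\<gamma> k (K - k)) (z k (K - k))" by (simp only: z)
  qed
  then have "rmon M d ?ee (hact p M (pdeg K) m (\<Sum>k\<in>{0..K}. of_int (\<gamma> k (K - k)) * wmon [Pow k, Pow (K - k)]) y)
   = (\<Oplus>\<^bsub>rgrd M d\<^esub>k\<in>{0..K}. rmon M d ?ee (zmult p (grd M (d + ?ee)) (\<gamma> k (K - k)) (z k (K - k))))"
   by (simp only:) (rule rm.finsum, intro Pi_I gr.zmult_closed zc', simp)
  also have "... = (\<Oplus>\<^bsub>rgrd M d\<^esub>k\<in>{0..K}. F k (K - k))"
  proof (rule rg.M.finsum_cong'[OF refl])
   fix k assume "k : {0..K}"
   then have k: "k \<le> K" by simp
   show "rmon M d ?ee (zmult p (grd M (d + ?ee)) (\<gamma> k (K - k)) (z k (K - k))) = F k (K - k)"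
    unfolding F_def ee[OF k] by (rule rm.zmult[OF zc'[OF k]])
  qed (use Fc in auto)
  finally show "(\<Oplus>\<^bsub>rgrd M d\<^esub>k\<in>{0..K}. F k (K - k)) = rmon M d ?ee
    (hact p M (pdeg K) m (\<Sum>k\<in>{0..K}. of_int (\<gamma> k (K - k)) * wmon [Pow k, Pow (K - k)]) y)" ..
 qed (intro Pi_I rmon_closed spread_term deg y)
 finally show ?thesis unfolding \<gamma>_def .
qed

end

lemma adem_coeff_2: "p = 2 ==> [adem_coeff p a b i = ibinom (b - i - 1) (a - 2 * i)] (mod int p)"
 by (simp add: adem_coeff_def cong_iff_dvd_diff algebra_simps)

lemma adem_coeff_nat: "adem_coeff p (int a) (int b) (int i)
  = (-1) ^ (a + i) * ibinom ((int p - 1) * (int b - int i) - 1) (int a - int p * int i)"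
 by (simp add: adem_coeff_def)

context bock_trivial begin

interpretation AA: adem_arrays p "steenrod_ideal p" by (rule adem_arrays_steenrod[OF p_prime])

abbreviation "TS K r \<equiv> adem_arrays.two_step p (pow_words (int K)) r (int K)"
abbreviation "TB K r \<equiv> adem_arrays.two_step_bock p (pow_words (int K)) r (int K)"

lemma sum_pow_words:
 "(\<Sum>k\<in>{0..int K}. of_int (c k) * pow_words (int K) k (int K - k)) = (\<Sum>k\<in>{0..K}. of_int (c (int k)) * wmon [Pow k, Pow (K - k)])"
 by (rule sum.reindex_bij_witness[of _ int nat]) (auto simp: pow_words_def nat_diff_distrib)

lemma TS_words:
 "TS K r (int a) (int b) = (\<Sum>k\<in>{0..K}. of_int (pow_coeff a r (int k) *
   pow_coeff b (r + (int p - 1) * (int a - int k)) (int (K - k))) * wmon [Pow k, Pow (K - k)])"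
 unfolding AA.two_step_def sum_pow_words
 by (intro sum.cong refl) (auto simp: AA.two_step_coeff_def pow_coeff_def of_nat_diff algebra_simps)

lemma TB_words:
 "TB K r (int a) (int b) = (\<Sum>k\<in>{0..K}. of_int (pow_coeff a r (int k) *
   pow_coeff b (r + 1 + (int p - 1) * (int a - int k)) (int (K - k))) * wmon [Pow k, Pow (K - k)])"
 unfolding AA.two_step_bock_def sum_pow_words
 by (intro sum.cong refl) (auto simp: pow_coeff_def of_nat_diff algebra_simps)

lemma words_free_deg: "(\<Sum>k\<in>{0..K}. of_int (c k) * wmon [Pow k, Pow (K - k)]) : free_deg p (pdeg K)"
 by (intro free_deg_sum free_deg_of_int wmon_free_deg) (use pow_deg_add[OF p_pos] in simp)

lemma TS_free_deg: "TS K r (int a) (int b) : free_deg p (pdeg K)"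
 unfolding TS_words by (rule words_free_deg)

lemma TB_free_deg: "TB K r (int a) (int b) : free_deg p (pdeg K)"
 unfolding TB_words by (rule words_free_deg)

lemma pow_coeff_eq_0: "k > a ==> pow_coeff a r (int k) = 0"
proof -
 assume "k > a"
 then have "int a < 1 * int k" by simp
 also have "1 * int k \<le> int p * int k" using p_pos by (intro mult_right_mono) auto
 finally show ?thesis by (simp add: pow_coeff_def)
qed

lemma word_two:
 assumes y: "y : M $ (d + e)"
 shows "word_act p RM [Pow a, Pow b] d (rmon M d e y)
  = spread (d - int (pdeg (a + b))) (a + b) e (d + e) y (\<lambda>K. TS K (tate_exp p e) (int a) (int b))"
proof -
 let ?d1 = "d - int (pdeg a)" and ?d = "d - int (pdeg (a + b))"
 have z: "rmon M d e y : M $$ d" using y by (rule rmon_closed)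
 have z1: "pow_op a d (rmon M d e y) : M $$ ?d1" by (rule mod_hom_closed[OF pow_op_hom z])
 have "word_act p RM [Pow a, Pow b] d (rmon M d e y) = pow_op b ?d1 (pow_op a d (rmon M d e y))"
  using z z1 by (simp add: r_plus_Pow)
 also have "... = spread ?d (a + b) e (d + e) y (\<lambda>K. \<Sum>k\<in>{0..K}. of_int (pow_coeff a (tate_exp p e) (int k) *
   pow_coeff b (tate_exp p e + (int p - 1) * (int a - int k)) (int (K - k))) * wmon [Pow k, Pow (K - k)])"
  unfolding pow_op_rmon[OF y]
 proof (rule pow_op_after_pow[OF _ y])
  show "?d + e + tate_step p * int (a + b) = d + e" using p_pos by (simp add: gen_deg_Pow)
  show "?d1 = ?d + int (pdeg b)" using pow_deg_add[OF p_pos, of a b] by simp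
 qed (rule pow_coeff_eq_0)
 finally show ?thesis unfolding TS_words .
qed

lemma spread_ideal:
 assumes "d + e + tate_step p * int n = m" "y : M $ m"
  and "!!K. K \<le> n ==> G K : free_deg p (pdeg K) \<and> G K : steenrod_ideal p"
 shows "spread d n e m y G = \<zero>\<^bsub>rgrd M d\<^esub>"
 by (rule spread_0[OF assms(1,2)]) (use assms(3) hact_ideal[OF _ _ assms(2)] in blast)

text \<open>The relation for composites, with the summation range of the defining relations of the Steenrod algebra.\<close>

lemma two_step_adem_nat:
 "TS K r (int a) (int b) - (\<Sum>i\<in>{0..a div p}. of_int (adem_coeff p (int a) (int b) (int i)) * TS K r (int (a + b - i)) (int i))
  : steenrod_ideal p"
proof -
 have "AA.eqv (TS K r (int a) (int b)) (\<Sum>i\<in>{0..int a}. of_int (adem_coeff p (int a) (int b) i) * TS K r (int a + int b - i) i)"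
  by (rule AA.two_step_adem[OF pow_words_adem[OF p_prime]])
 also have "(\<Sum>i\<in>{0..int a}. of_int (adem_coeff p (int a) (int b) i) * TS K r (int a + int b - i) i)
   = (\<Sum>i\<in>{0..a div p}. of_int (adem_coeff p (int a) (int b) (int i)) * TS K r (int a + int b - int i) (int i))"
  by (rule sum_adem_range) (simp_all add: p_pos)
 also have "... = (\<Sum>i\<in>{0..a div p}. of_int (adem_coeff p (int a) (int b) (int i)) * TS K r (int (a + b - i)) (int i))"
 proof (intro sum.cong refl)
  fix i assume "i : {0..a div p}"
  then have "i \<le> a" by (rule le_if_le_div)
  then show "of_int (adem_coeff p (int a) (int b) (int i)) * TS K r (int a + int b - int i) (int i)
   = of_int (adem_coeff p (int a) (int b) (int i)) * TS K r (int (a + b - i)) (int i)" by (simp add: of_nat_diff)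
 qed
 finally show ?thesis by (simp add: AA.eqv_def)
qed

text \<open>Monomials span \<open>r\<^sub>+(M)\<close>.\<close>

lemma hact_r_plus_zeroI:
 assumes f: "f : free_deg p k0"
  and mon: "!!e y. y : M $ (d + e) ==> hact p RM k0 d f (rmon M d e y) = \<zero>\<^bsub>rgrd M (d - int k0)\<^esub>"
  and x: "x : RM $ d"
 shows "hact p RM k d f x = \<zero>\<^bsub>grd RM (d - int k)\<^esub>"
proof (cases "k = k0")
 case True
 have x': "x : M $$ d" using x by simp
 have "hact p RM k0 d f x = \<zero>\<^bsub>rgrd M (d - int k0)\<^esub>"
  using x'
 proof (induction rule: rgrd_induct)
  case (mon e y)
  then show ?case by (rule assms(2))
 next
  case (add x y)
  then show ?case using rp.ha.add[of x d y k0 f] by simp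
 qed
 then show ?thesis using True by simp
next
 case False
 then show ?thesis using rp.hact_wrong_deg[OF f _ x, of k] by auto
qed

lemma words_adem_free_deg:
 assumes "finite A" "!!i. i : A ==> i \<le> a"
 shows "(\<Sum>i\<in>A. of_int (c i) * wmon [Pow (a + b - i), Pow i]) : free_deg p (pdeg (a + b))"
 using assms pow_deg_add[OF p_pos] by (intro free_deg_sum free_deg_of_int wmon_free_deg) (auto simp: trans_le_add1)

lemma adem_acts_zero:
 assumes c: "!!i. [c i = adem_coeff p (int a) (int b) (int i)] (mod int p)" and x: "x : RM $ d"
 shows "hact p RM k d (wmon [Pow a, Pow b] - (\<Sum>i\<in>{0..a div p}. of_int (c i) * wmon [Pow (a + b - i), Pow i])) x
  = \<zero>\<^bsub>grd RM (d - int k)\<^esub>"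
proof (rule hact_r_plus_zeroI[OF _ _ x])
 let ?f = "wmon [Pow a, Pow b] - (\<Sum>i\<in>{0..a div p}. of_int (c i) * wmon [Pow (a + b - i), Pow i])"
 let ?k = "pdeg (a + b)"
 have le: "i \<le> a" if "i : {0..a div p}" for i using that by (rule le_if_le_div)
 show "?f : free_deg p ?k"
  by (intro free_deg_diff words_adem_free_deg wmon_free_deg) (use le pow_deg_add[OF p_pos] in auto)
 fix e y assume y: "y : M $ (d + e)"
 define z where "z = rmon M d e y"
 have z: "z : RM $ d" using y by (simp add: z_def rmon_closed)
 let ?d = "d - int ?k" and ?r = "tate_exp p e"
 have deg: "?d + e + tate_step p * int (a + b) = d + e" using p_pos by (simp add: gen_deg_Pow)
 have w: "hact p RM ?k d (wmon [Pow i, Pow j]) z = spread ?d (a + b) e (d + e) y (\<lambda>K. TS K ?r (int i) (int j))"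
  if "i + j = a + b" for i j
  using rp.hact_wmon[OF z, of "[Pow i, Pow j]" ?k] that pow_deg_add[OF p_pos, of i j] word_two[OF y, of i j]
  by (simp add: z_def)
 have w': "hact p RM ?k d (of_int (c i) * wmon [Pow (a + b - i), Pow i]) z
   = spread ?d (a + b) e (d + e) y (\<lambda>K. of_int (adem_coeff p (int a) (int b) (int i)) * TS K ?r (int (a + b - i)) (int i))"
  if "i : {0..a div p}" for i
 proof -
  have i: "a + b - i + i = a + b" using le[OF that] by simp
  show ?thesis
   unfolding rp.hact_of_int[OF z] w[OF i] spread_of_int[OF deg y]
   using rg.zmult_cong[OF c[of i]] by simp
 qed
 have "(\<Oplus>\<^bsub>rgrd M ?d\<^esub>i\<in>{0..a div p}. hact p RM ?k d (of_int (c i) * wmon [Pow (a + b - i), Pow i]) z)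
   = (\<Oplus>\<^bsub>rgrd M ?d\<^esub>i\<in>{0..a div p}. spread ?d (a + b) e (d + e) y (\<lambda>K. of_int (adem_coeff p (int a) (int b) (int i)) * TS K ?r (int (a + b - i)) (int i)))"
  by (rule rg.M.finsum_cong'[OF refl]) (intro Pi_I spread_closed[OF deg y], simp only: w')
 then have "hact p RM ?k d ?f z = spread ?d (a + b) e (d + e) y (\<lambda>K. TS K ?r (int a) (int b))
   \<ominus>\<^bsub>rgrd M ?d\<^esub> (\<Oplus>\<^bsub>rgrd M ?d\<^esub>i\<in>{0..a div p}. spread ?d (a + b) e (d + e) y (\<lambda>K. of_int (adem_coeff p (int a) (int b) (int i)) * TS K ?r (int (a + b - i)) (int i)))"
  unfolding rp.hact_diff[OF z] rp.hact_sum[OF z] w[OF refl] r_plus_simps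
  by (simp only:)
 also have "... = spread ?d (a + b) e (d + e) y (\<lambda>K. TS K ?r (int a) (int b) - (\<Sum>i\<in>{0..a div p}. of_int (adem_coeff p (int a) (int b) (int i)) * TS K ?r (int (a + b - i)) (int i)))"
  unfolding spread_diff[OF deg y] spread_sum[OF deg y finite_atLeastAtMost] ..
 also have "... = \<zero>\<^bsub>rgrd M ?d\<^esub>"
  by (rule spread_ideal[OF deg y]) (intro conjI two_step_adem_nat free_deg_diff free_deg_sum free_deg_of_int TS_free_deg)
 finally show "hact p RM ?k d ?f (rmon M d e y) = \<zero>\<^bsub>rgrd M ?d\<^esub>" unfolding z_def .
qed

text \<open>On \<open>u\<^sub>e\<close> with \<open>e\<close> even \<open>\<beta>\<close> vanishes, and the powers preserve the parity of \<open>e\<close>; for odd \<open>e\<close> it raises \<open>e\<close> by one.\<close>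

lemma bock_op_word_two:
 assumes p2: "p \<noteq> 2" and y: "y : M $ (d + e)"
 shows "even e ==> word_act p RM [Pow a, Bock, Pow b] d (rmon M d e y) = \<zero>\<^bsub>rgrd M (d - int (1 + pdeg (a + b)))\<^esub>"
  and "odd e ==> word_act p RM [Pow a, Bock, Pow b] d (rmon M d e y)
   = spread (d - int (1 + pdeg (a + b))) (a + b) (e + 1) (d + e) y (\<lambda>K. TB K (tate_exp p e) (int a) (int b))"
  and "even e ==> word_act p RM [Bock, Pow a, Pow b] d (rmon M d e y) = \<zero>\<^bsub>rgrd M (d - int (1 + pdeg (a + b)))\<^esub>"
  and "odd e ==> word_act p RM [Bock, Pow a, Pow b] d (rmon M d e y)
   = spread (d - int (1 + pdeg (a + b))) (a + b) (e + 1) (d + e) y (\<lambda>K. TS K (tate_exp p e + 1) (int a) (int b))"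
proof -
 let ?d1 = "d - int (pdeg a)" and ?d = "d - int (1 + pdeg (a + b))"
 let ?d2 = "?d1 - 1"
 have z: "rmon M d e y : M $$ d" using y by (rule rmon_closed)
 have z1: "pow_op a d (rmon M d e y) : M $$ ?d1" by (rule mod_hom_closed[OF pow_op_hom z])
 have z2: "bock_op ?d1 (pow_op a d (rmon M d e y)) : M $$ ?d2" by (rule mod_hom_closed[OF bock_op_hom z1])
 have dd: "?d2 - int (pdeg b) = ?d" "d - 1 - int (pdeg (a + b)) = ?d" using pow_deg_add[OF p_pos, of a b] by auto
 have w: "word_act p RM [Pow a, Bock, Pow b] d (rmon M d e y) = pow_op b ?d2 (bock_op ?d1 (pow_op a d (rmon M d e y)))"
  using z z1 z2 by (simp add: r_plus_Pow r_plus_Bock[OF p2])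
 interpret B: Fp_module_hom p "rgrd M ?d1" "rgrd M ?d2" "bock_op ?d1"
  by (intro Fp_module_homI rg.Fp_module_axioms bock_op_hom)
 interpret P: Fp_module_hom p "rgrd M ?d2" "rgrd M (?d2 - int (pdeg b))" "pow_op b ?d2"
  by (intro Fp_module_homI rg.Fp_module_axioms pow_op_hom)
 let ?e = "\<lambda>k. e + tate_step p * (int a - int k)"
 have y1: "sop M (Pow k) (d + e) y : M $ (?d1 + ?e k)" for k
 proof -
  have "d + e - int (pdeg k) = ?d1 + ?e k" using p_pos by (simp add: gen_deg_Pow algebra_simps)
  then show ?thesis using sp.closed[OF y, of "Pow k"] by (simp only:)
 qed
 have ev: "even (?e k) = even e" for k using even_tate_step[OF p2] by simp
 have "bock_op ?d1 (pow_op a d (rmon M d e y)) = (\<Oplus>\<^bsub>rgrd M ?d2\<^esub>k\<in>{0..a}. bock_op ?d1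
   (zmult p (rgrd M ?d1) (pow_coeff a (tate_exp p e) (int k)) (rmon M ?d1 (?e k) (sop M (Pow k) (d + e) y))))"
  unfolding pow_op_rmon[OF y] by (rule B.finsum) (intro Pi_I rg.zmult_closed rmon_closed y1)
 also have "... = (\<Oplus>\<^bsub>rgrd M ?d2\<^esub>k\<in>{0..a}. zmult p (rgrd M ?d2) (pow_coeff a (tate_exp p e) (int k))
   (if even e then \<zero>\<^bsub>rgrd M ?d2\<^esub> else rmon M ?d2 (?e k + 1) (sop M (Pow k) (d + e) y)))"
  unfolding B.zmult[OF rmon_closed[OF y1]] bock_op_rmon ev ..
 finally have b: "bock_op ?d1 (pow_op a d (rmon M d e y)) = ..." .
 show "word_act p RM [Pow a, Bock, Pow b] d (rmon M d e y) = \<zero>\<^bsub>rgrd M ?d\<^esub>" if "even e"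
 proof -
  have "bock_op ?d1 (pow_op a d (rmon M d e y)) = \<zero>\<^bsub>rgrd M ?d2\<^esub>"
   unfolding b using that by (intro rg.finsum_neutral) simp
  then show ?thesis unfolding w using P.zero unfolding dd(1) by (simp only:)
 qed
 show "word_act p RM [Pow a, Bock, Pow b] d (rmon M d e y)
   = spread ?d (a + b) (e + 1) (d + e) y (\<lambda>K. TB K (tate_exp p e) (int a) (int b))" if "odd e"
 proof -
  have t: "tate_exp p (e + 1) = tate_exp p e + 1" using that p2 by (simp add: tate_exp_def)
  have ee: "?e k + 1 = e + 1 + tate_step p * (int a - int k)" for k by simp
  have "pow_op b ?d2 (\<Oplus>\<^bsub>rgrd M ?d2\<^esub>k\<in>{0..a}. zmult p (rgrd M ?d2) (pow_coeff a (tate_exp p e) (int k))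
    (rmon M ?d2 (e + 1 + tate_step p * (int a - int k)) (sop M (Pow k) (d + e) y)))
   = spread ?d (a + b) (e + 1) (d + e) y (\<lambda>K. \<Sum>k\<in>{0..K}. of_int (pow_coeff a (tate_exp p e) (int k) *
    pow_coeff b (tate_exp p (e + 1) + (int p - 1) * (int a - int k)) (int (K - k))) * wmon [Pow k, Pow (K - k)])"
  proof (rule pow_op_after_pow[OF _ y])
   show "?d + (e + 1) + tate_step p * int (a + b) = d + e" using p_pos by (simp add: gen_deg_Pow)
   show "?d2 = ?d + int (pdeg b)" using dd by simp
  qed (rule pow_coeff_eq_0)
  then show ?thesis unfolding w b TB_words t ee using that by (simp add: algebra_simps)
 qed
 have wb: "word_act p RM [Bock, Pow a, Pow b] d (rmon M d e y) = word_act p RM [Pow a, Pow b] (d - 1) (bock_op d (rmon M d e y))"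
  using z by (simp add: r_plus_Bock[OF p2])
 show "word_act p RM [Bock, Pow a, Pow b] d (rmon M d e y) = \<zero>\<^bsub>rgrd M ?d\<^esub>" if "even e"
 proof -
  have E: "d - 1 - int (word_deg p (Word [Pow a, Pow b])) = ?d" using pow_deg_add[OF p_pos, of a b] by simp
  have "word_act p RM [Pow a, Pow b] (d - 1) \<zero>\<^bsub>rgrd M (d - 1)\<^esub> = \<zero>\<^bsub>rgrd M ?d\<^esub>"
   using rp.wa.zero[of "[Pow a, Pow b]" "d - 1"] unfolding E r_plus_simps .
  then show ?thesis unfolding wb bock_op_rmon using that by (simp only: if_True)
 qed
 show "word_act p RM [Bock, Pow a, Pow b] d (rmon M d e y)
   = spread ?d (a + b) (e + 1) (d + e) y (\<lambda>K. TS K (tate_exp p e + 1) (int a) (int b))" if "odd e"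
 proof -
  have t: "tate_exp p (e + 1) = tate_exp p e + 1" using that p2 by (simp add: tate_exp_def)
  have m: "d - 1 + (e + 1) = d + e" by simp
  have y': "y : M $ (d - 1 + (e + 1))" using y by simp
  show ?thesis using word_two[OF y', of a b] that unfolding wb bock_op_rmon t m dd by simp
 qed
qed

lemma two_step_bock_adem_nat:
 assumes "0 < a"
 shows "TB K r (int a) (int b)
   - (\<Sum>i\<in>{0..a div p}. of_int (bock_coeff p a b i) * TS K (r + 1) (int (a + b - i)) (int i))
   - (\<Sum>i\<in>{0..(a - 1) div p}. of_int (bock_coeff' p a b i) * TB K r (int (a + b - i)) (int i))
  : steenrod_ideal p"
proof -
 let ?c1 = "\<lambda>i. (if even (int a + i) then 1 else -1) * ibinom ((int p - 1) * (int b - i)) (int a - int p * i)"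
 let ?c2 = "adem_coeff p (int a - 1) (int b)"
 have a1: "int a - 1 = int (a - 1)" using assms by (simp add: of_nat_diff)
 have "AA.eqv (TB K r (int a) (int b)) ((\<Sum>i\<in>{0..int a}. of_int (?c1 i) * TS K (r + 1) (int a + int b - i) i)
   + (\<Sum>i\<in>{0..int a - 1}. of_int (?c2 i) * TB K r (int a + int b - i) i))"
  by (rule AA.two_step_bock_adem[OF pow_words_adem[OF p_prime]])
 also have "(\<Sum>i\<in>{0..int a}. of_int (?c1 i) * TS K (r + 1) (int a + int b - i) i)
   = (\<Sum>i\<in>{0..a div p}. of_int (?c1 (int i)) * TS K (r + 1) (int a + int b - int i) (int i))"
  by (rule sum_adem_range) (simp_all add: p_pos)
 also have "... = (\<Sum>i\<in>{0..a div p}. of_int (bock_coeff p a b i) * TS K (r + 1) (int (a + b - i)) (int i))"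
 proof (intro sum.cong refl)
  fix i assume "i : {0..a div p}"
  then have "i \<le> a" by (rule le_if_le_div)
  then have "int a + int b - int i = int (a + b - i)" by (simp add: of_nat_diff)
  moreover have "?c1 (int i) = (-1) ^ (a + i) * ibinom ((int p - 1) * (int b - int i)) (int a - int p * int i)"
   by (auto simp: minus_one_power_iff)
  ultimately show "of_int (?c1 (int i)) * TS K (r + 1) (int a + int b - int i) (int i)
   = of_int (bock_coeff p a b i) * TS K (r + 1) (int (a + b - i)) (int i)"
   by (simp only:)
 qed
 also have "(\<Sum>i\<in>{0..int a - 1}. of_int (?c2 i) * TB K r (int a + int b - i) i)
   = (\<Sum>i\<in>{0..(a - 1) div p}. of_int (?c2 (int i)) * TB K r (int a + int b - int i) (int i))"
  unfolding a1 by (rule sum_adem_range) (simp_all add: p_pos)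
 also have "... = (\<Sum>i\<in>{0..(a - 1) div p}. of_int (bock_coeff' p a b i) * TB K r (int (a + b - i)) (int i))"
 proof (intro sum.cong refl)
  fix i assume "i : {0..(a - 1) div p}"
  then have "i \<le> a" using le_if_le_div[of i "a - 1" p] by simp
  then have "int a + int b - int i = int (a + b - i)" by (simp add: of_nat_diff)
  moreover have "?c2 (int i) = (-1) ^ (a + i + 1) * ibinom ((int p - 1) * (int b - int i) - 1) (int a - int p * int i - 1)"
   by (auto simp: adem_coeff_def minus_one_power_iff algebra_simps)
  ultimately show "of_int (?c2 (int i)) * TB K r (int a + int b - int i) (int i)
   = of_int (bock_coeff' p a b i) * TB K r (int (a + b - i)) (int i)"
   by (simp only:)
 qed
 finally show ?thesis by (simp add: AA.eqv_def diff_diff_eq)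
qed

lemma adem_bock_acts_zero:
 assumes p2: "p \<noteq> 2" and a: "0 < a" and x: "x : RM $ d"
 shows "hact p RM k d (wmon [Pow a, Bock, Pow b]
   - (\<Sum>i\<in>{0..a div p}. of_int (bock_coeff p a b i) * wmon [Bock, Pow (a + b - i), Pow i])
   - (\<Sum>i\<in>{0..(a - 1) div p}. of_int (bock_coeff' p a b i) * wmon [Pow (a + b - i), Bock, Pow i])) x
  = \<zero>\<^bsub>grd RM (d - int k)\<^esub>"
 (is "hact p RM k d (?w - (\<Sum>i\<in>?A. of_int (?c1 i) * ?w1 i) - (\<Sum>i\<in>?B. of_int (?c2 i) * ?w2 i)) x = _")
proof (rule hact_r_plus_zeroI[OF _ _ x])
 let ?f = "?w - (\<Sum>i\<in>?A. of_int (?c1 i) * ?w1 i) - (\<Sum>i\<in>?B. of_int (?c2 i) * ?w2 i)"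
 let ?k = "1 + pdeg (a + b)"
 have A: "i \<le> a" if "i : ?A" for i using that by (rule le_if_le_div)
 have B: "i \<le> a" if "i : ?B" for i using le_if_le_div[OF that] by simp
 have wd: "word_deg p (Word [Bock, Pow (a + b - i), Pow i]) = ?k" "word_deg p (Word [Pow (a + b - i), Bock, Pow i]) = ?k"
  if "i \<le> a" for i using that pow_deg_add[OF p_pos, of "a + b - i" i] by auto
 have wd0: "word_deg p (Word [Pow a, Bock, Pow b]) = ?k" using pow_deg_add[OF p_pos, of a b] by simp
 show "?f : free_deg p ?k"
  by (intro free_deg_diff free_deg_sum free_deg_of_int wmon_free_deg wd wd0 A B)
 fix e y assume y: "y : M $ (d + e)"
 define z where "z = rmon M d e y"
 have z: "z : RM $ d" using y by (simp add: z_def rmon_closed)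
 let ?d = "d - int ?k" and ?r = "tate_exp p e"
 note h = rp.hact_wmon[OF z, of _ ?k]
 show "hact p RM ?k d ?f (rmon M d e y) = \<zero>\<^bsub>rgrd M ?d\<^esub>"
 proof (cases "even e")
  case True
  have w0: "hact p RM ?k d ?w z = \<zero>\<^bsub>rgrd M ?d\<^esub>"
   unfolding h[OF wd0] unfolding z_def by (rule bock_op_word_two(1)[OF p2 y True])
  have w1: "hact p RM ?k d (?w1 i) z = \<zero>\<^bsub>rgrd M ?d\<^esub>" and w2: "hact p RM ?k d (?w2 i) z = \<zero>\<^bsub>rgrd M ?d\<^esub>"
   if "i \<le> a" for i
   unfolding h[OF wd(1)[OF that]] h[OF wd(2)[OF that]] unfolding z_def
   using bock_op_word_two(3)[OF p2 y True, of "a + b - i" i] bock_op_word_two(1)[OF p2 y True, of "a + b - i" i] that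
   by simp_all
  have s1: "(\<Oplus>\<^bsub>rgrd M ?d\<^esub>i\<in>?A. zmult p (rgrd M ?d) (?c1 i) (hact p RM ?k d (?w1 i) z)) = \<zero>\<^bsub>rgrd M ?d\<^esub>"
   by (rule rg.finsum_neutral) (simp only: w1[OF A] rg.zmult_zero)
  have s2: "(\<Oplus>\<^bsub>rgrd M ?d\<^esub>i\<in>?B. zmult p (rgrd M ?d) (?c2 i) (hact p RM ?k d (?w2 i) z)) = \<zero>\<^bsub>rgrd M ?d\<^esub>"
   by (rule rg.finsum_neutral) (simp only: w2[OF B] rg.zmult_zero)
  have "hact p RM ?k d ?f z = \<zero>\<^bsub>rgrd M ?d\<^esub>"
   unfolding rp.hact_diff[OF z] rp.hact_sum[OF z] rp.hact_of_int[OF z] r_plus_simps w0 s1 s2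
   by (simp only: a_minus_def rg.uminus_zero rg.M.l_zero rg.M.zero_closed)
  then show ?thesis unfolding z_def .
 next
  case odd: False
  have deg: "?d + (e + 1) + tate_step p * int (a + b) = d + e" using p_pos by (simp add: gen_deg_Pow)
  let ?S = "spread ?d (a + b) (e + 1) (d + e) y"
  have w0: "hact p RM ?k d ?w z = ?S (\<lambda>K. TB K ?r (int a) (int b))"
   unfolding h[OF wd0] unfolding z_def by (rule bock_op_word_two(2)[OF p2 y odd])
  have w1: "hact p RM ?k d (of_int c * ?w1 i) z = ?S (\<lambda>K. of_int c * TS K (?r + 1) (int (a + b - i)) (int i))"
   and w2: "hact p RM ?k d (of_int c * ?w2 i) z = ?S (\<lambda>K. of_int c * TB K ?r (int (a + b - i)) (int i))" if "i \<le> a" for i c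
  proof -
   have n: "a + b - i + i = a + b" using that by simp
   show "hact p RM ?k d (of_int c * ?w1 i) z = ?S (\<lambda>K. of_int c * TS K (?r + 1) (int (a + b - i)) (int i))"
    unfolding rp.hact_of_int[OF z] h[OF wd(1)[OF that]] spread_of_int[OF deg y] unfolding z_def r_plus_simps
    using bock_op_word_two(4)[OF p2 y odd, of "a + b - i" i] unfolding n by (simp only:)
   show "hact p RM ?k d (of_int c * ?w2 i) z = ?S (\<lambda>K. of_int c * TB K ?r (int (a + b - i)) (int i))"
    unfolding rp.hact_of_int[OF z] h[OF wd(2)[OF that]] spread_of_int[OF deg y] unfolding z_def r_plus_simps
    using bock_op_word_two(2)[OF p2 y odd, of "a + b - i" i] unfolding n by (simp only:)
  qed
  have "(\<Oplus>\<^bsub>rgrd M ?d\<^esub>i\<in>?A. hact p RM ?k d (of_int (?c1 i) * ?w1 i) z) = (\<Oplus>\<^bsub>rgrd M ?d\<^esub>i\<in>?A. ?S (\<lambda>K. of_int (?c1 i) * TS K (?r + 1) (int (a + b - i)) (int i)))"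
   by (rule rg.M.finsum_cong'[OF refl]) (intro Pi_I spread_closed[OF deg y], simp only: w1[OF A])
  moreover have "(\<Oplus>\<^bsub>rgrd M ?d\<^esub>i\<in>?B. hact p RM ?k d (of_int (?c2 i) * ?w2 i) z) = (\<Oplus>\<^bsub>rgrd M ?d\<^esub>i\<in>?B. ?S (\<lambda>K. of_int (?c2 i) * TB K ?r (int (a + b - i)) (int i)))"
   by (rule rg.M.finsum_cong'[OF refl]) (intro Pi_I spread_closed[OF deg y], simp only: w2[OF B])
  ultimately have "hact p RM ?k d ?f z = ?S (\<lambda>K. TB K ?r (int a) (int b)
    - (\<Sum>i\<in>?A. of_int (?c1 i) * TS K (?r + 1) (int (a + b - i)) (int i))
    - (\<Sum>i\<in>?B. of_int (?c2 i) * TB K ?r (int (a + b - i)) (int i)))"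
   unfolding rp.hact_diff[OF z] rp.hact_sum[OF z] w0 r_plus_simps
    spread_diff[OF deg y] spread_sum[OF deg y finite_atLeastAtMost] by (simp only:)
  also have "... = \<zero>\<^bsub>rgrd M ?d\<^esub>"
   by (rule spread_ideal[OF deg y])
    (intro conjI two_step_bock_adem_nat a free_deg_diff free_deg_sum free_deg_of_int TS_free_deg TB_free_deg)
  finally show ?thesis unfolding z_def .
 qed
qed

lemma Pow_0: "x : M $ d ==> sop M (Pow 0) d x = x"
proof -
 assume x: "x : M $ d"
 have d0: "gen_deg p (Pow 0) = 0" by (simp add: gen_deg_def)
 have "wmon [Pow 0] - wmon [] : steenrod_ideal p" using steenrod_rels_subset[of p] by (auto simp: steenrod_rels_def wmon_Nil)
 moreover have f: "wmon [Pow 0] : free_deg p 0" "wmon [] : free_deg p 0" by (auto intro!: wmon_free_deg simp: d0)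
 ultimately have "hact p M 0 d (wmon [Pow 0] - wmon []) x = \<zero>\<^bsub>grd M d\<^esub>"
  using hact_ideal[OF free_deg_diff[OF f] _ x] by simp
 then have "sop M (Pow 0) d x \<ominus>\<^bsub>grd M d\<^esub> x = \<zero>\<^bsub>grd M d\<^esub>"
  using hact_wmon[OF x, of "[Pow 0]" 0] hact_wmon[OF x, of "[]" 0] by (simp add: hact_diff[OF x] d0)
 then show ?thesis using gr.diff_eq_zeroD[of "sop M (Pow 0) d x" d x] sp.closed[OF x, of "Pow 0"] x by (simp add: d0)
qed

lemma r_plus_Pow_0:
 assumes x: "x : M $$ d"
 shows "pow_op 0 d x = x"
proof (rule ext)
 fix e
 have g: "gen_deg p (Pow 0) = 0" by (simp add: gen_deg_def)
 have c: "pow_coeff 0 r 0 = 1" for r by (simp add: pow_coeff_def)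
 show "pow_op 0 d x e = x e"
  using rgrd_coord[OF x, of e] by (simp add: pow_op_def g c Pow_0 gr.M.finsum_insert)
qed

theorem r_plus_right_A_module: "right_A_module p RM"
proof (rule rp.right_A_moduleI)
 fix r k d x assume r: "r : steenrod_rels p" "r \<noteq> of_nat p" and x: "x : RM $ d"
 have P0: "hact p RM k d (wmon [Pow 0] - 1) x = \<zero>\<^bsub>grd RM (d - int k)\<^esub>"
 proof (rule hact_r_plus_zeroI[OF _ _ x])
  have d0: "gen_deg p (Pow 0) = 0" by (simp add: gen_deg_def)
  show "wmon [Pow 0] - 1 : free_deg p 0" unfolding wmon_Nil[symmetric] by (intro free_deg_diff wmon_free_deg) (auto simp: d0)
  fix e y assume y: "y : M $ (d + e)"
  let ?z = "rmon M d e y"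
  have z: "?z : M $$ d" using y by (rule rmon_closed)
  then have "hact p RM 0 d (wmon [Pow 0]) ?z = ?z" "hact p RM 0 d 1 ?z = ?z"
   using rp.hact_wmon[of ?z d "[Pow 0]" 0] rp.hact_wmon[of ?z d "[]" 0] by (simp_all add: d0 r_plus_Pow r_plus_Pow_0 wmon_Nil)
  then show "hact p RM 0 d (wmon [Pow 0] - 1) ?z = \<zero>\<^bsub>rgrd M (d - int 0)\<^esub>"
   using rp.hact_diff[of ?z d 0 "wmon [Pow 0]" 1] z by (simp add: a_minus_def rg.M.r_neg)
 qed
 show "hact p RM k d r x = \<zero>\<^bsub>grd RM (d - int k)\<^esub>"
 proof (cases "p = 2")
  case True
  then have "r = wmon [Pow 0] - 1 \<or> r = wmon [Bock] - wmon [Pow 1] \<or> r : adem_even" using r by (auto simp: steenrod_rels_def)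
  then consider "r = wmon [Pow 0] - 1" | "r = wmon [Bock] - wmon [Pow 1]" | "r : adem_even" by blast
  then show ?thesis
  proof cases
   case 1 then show ?thesis using P0 by simp
  next
   case 2
   have g: "gen_deg p (Pow 1) = 1" using True by (simp add: gen_deg_def)
   show ?thesis unfolding 2
   proof (rule hact_r_plus_zeroI[OF _ _ x])
    show "wmon [Bock] - wmon [Pow 1] : free_deg p 1" by (intro free_deg_diff wmon_free_deg) (use g in auto)
    fix e y assume y: "y : M $ (d + e)"
    let ?z = "rmon M d e y"
    have z: "?z : RM $ d" using y by (simp add: rmon_closed)
    have "hact p RM 1 d (wmon [Bock]) ?z = hact p RM 1 d (wmon [Pow 1]) ?z"
     using rp.hact_wmon[OF z, of "[Bock]" 1] rp.hact_wmon[OF z, of "[Pow 1]" 1] z g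
     by (simp add: r_plus_Bock_2[OF True] r_plus_Pow)
    then show "hact p RM 1 d (wmon [Bock] - wmon [Pow 1]) ?z = \<zero>\<^bsub>rgrd M (d - int 1)\<^esub>"
     using rp.hact_diff[OF z, of 1 "wmon [Bock]" "wmon [Pow 1]"] rp.hact_closed[OF z, of 1 "wmon [Pow 1]"]
     by (simp add: a_minus_def rg.M.r_neg)
   qed
  next
   case 3
   then obtain a b where "r = wmon [Pow a, Pow b]
    - (\<Sum>c = 0..a div 2. of_int (ibinom (int b - int c - 1) (int a - 2 * int c)) * wmon [Pow (a + b - c), Pow c])"
    unfolding adem_even_def by blast
   moreover have "a div p = a div 2" using True by simp
   ultimately show ?thesis
    using adem_acts_zero[where c = "\<lambda>i. ibinom (int b - int i - 1) (int a - 2 * int i)" and a = a and b = b and k = k,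
      OF cong_sym[OF adem_coeff_2[OF True]] x] by (simp only:)
  qed
 next
  case False
  then consider "r = wmon [Pow 0] - 1" | "r = wmon [Bock, Bock]" | "r : adem_odd p" using r by (auto simp: steenrod_rels_def)
  then show ?thesis
  proof cases
   case 1 then show ?thesis using P0 by simp
  next
   case 2
   show ?thesis unfolding 2
   proof (rule hact_r_plus_zeroI[OF _ _ x])
    show "wmon [Bock, Bock] : free_deg p 2" by (rule wmon_free_deg) simp
    fix e y assume y: "y : M $ (d + e)"
    let ?z = "rmon M d e y"
    have z: "?z : M $$ d" using y by (simp add: rmon_closed)
    have z1: "bock_op d ?z : M $$ (d - 1)" by (rule mod_hom_closed[OF bock_op_hom z])
    have "hact p RM 2 d (wmon [Bock, Bock]) ?z = bock_op (d - 1) (bock_op d ?z)"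
     using rp.hact_wmon[of ?z d "[Bock, Bock]" 2] z z1 by (simp add: r_plus_Bock[OF False])
    also have "... = \<zero>\<^bsub>rgrd M (d - int 2)\<^esub>"
     by (rule ext) (auto simp: bock_op_def rgrd_simps(2) algebra_simps)
    finally show "hact p RM 2 d (wmon [Bock, Bock]) ?z = \<zero>\<^bsub>rgrd M (d - int 2)\<^esub>" .
   qed
  next
   case 3
   then consider a b where "r = wmon [Pow a, Pow b]
    - (\<Sum>i = 0..a div p. of_int ((-1) ^ (a + i) * ibinom ((int p - 1) * (int b - int i) - 1) (int a - int p * int i))
      * wmon [Pow (a + b - i), Pow i])"
   | a b where "0 < a" "r = wmon [Pow a, Bock, Pow b]
    - (\<Sum>i = 0..a div p. of_int (bock_coeff p a b i)
      * wmon [Bock, Pow (a + b - i), Pow i])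
    - (\<Sum>i = 0..(a - 1) div p. of_int (bock_coeff' p a b i)
      * wmon [Pow (a + b - i), Bock, Pow i])"
    unfolding adem_odd_def by blast
   then show ?thesis
   proof cases
    case 1
    show ?thesis unfolding 1 by (rule adem_acts_zero[OF _ x]) (simp add: adem_coeff_nat)
   next
    case 2
    show ?thesis unfolding 2(2) by (rule adem_bock_acts_zero[OF False 2(1) x])
   qed
  qed
 qed
qed

end
section \<open>The differential of \<open>r\<^sub>+(M)\<close>\<close>

definition sg :: "int => int" where "sg e = (if even e then 1 else -1)"

lemma (in Fp_module) sgn_mult_sg: "x : carrier W ==> sgn_mult W e x = zmult p W (sg e) x"
 by (simp add: sgn_mult_zmult sg_def)

lemma sg_cong_2: "[sg a = sg b] (mod 2)" by (auto simp: sg_def cong_iff_dvd_diff)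

lemma ibinom_absorb: "b * ibinom a b = a * ibinom (a - 1) (b - 1)"
proof (cases "b \<le> 0")
 case False
 then have "b = int (Suc (nat (b - 1)))" by simp
 then obtain n where b: "b = int (Suc n)" ..
 have "(b * ibinom a b) * fact n = ibinom a (int (Suc n)) * fact (Suc n)" by (simp add: b)
 also have "... = a * (\<Prod>i<n. (a - 1) - int i)"
  unfolding ibinom_fact by (subst prod.lessThan_Suc_shift) (simp add: algebra_simps)
 also have "... = (a * ibinom (a - 1) (b - 1)) * fact n"
  using ibinom_fact[of "a - 1" n] b by simp
 finally show ?thesis by simp
next
 case True
 then show ?thesis by (cases "b = 0") auto
qed

lemma even_ibinom: "even a ==> odd b ==> even (ibinom a b)"
 using ibinom_absorb[of b a] by (metis dvd_mult2 even_mult_iff)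

context dg_right_A_module begin

lemma sgn_mult_char_2: "p = 2 ==> x : V $ d ==> sgn_mult (grd V d) e x = x"
 by (simp add: sgn_mult_def minus_eq_self_char_2)

lemma dif_sop:
 assumes x: "x : V $ d"
 shows "sop V g (d + 1) (dif V d x) = sgn_mult (grd V (d - deg p g + 1)) (deg p g)
   (dif V (d - deg p g) (sop V g d x))"
 using dif_act[OF steenrod_gen_deg x, of g] by (simp add: sact_gen x)

lemma dif_Pow:
 assumes x: "x : V $ d"
 shows "sop V (Pow k) (d + 1) (dif V d x) = dif V (d - deg p (Pow k)) (sop V (Pow k) d x)"
proof (cases "p = 2")
 case True
 have "dif V (d - deg p (Pow k)) (sop V (Pow k) d x) : V $ (d - deg p (Pow k) + 1)"
  using x by simp
 then show ?thesis unfolding dif_sop[OF x] by (rule sgn_mult_char_2[OF True])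
next
 case False
 then have "even (gen_deg p (Pow k))" by (simp add: gen_deg_def)
 then show ?thesis unfolding dif_sop[OF x] by (simp add: sgn_mult_def)
qed

lemma dif_op_rmon:
 assumes y: "y : V $ (d + e)"
 shows "dif_op V d (rmon V d e y) = zmult p (rgrd V (d + 1)) (of_bool (odd e)) (rmon V (d + 1) (e - 1) y)
   \<oplus>\<^bsub>rgrd V (d + 1)\<^esub> zmult p (rgrd V (d + 1)) (sg e) (rmon V (d + 1) e (dif V (d + e) y))"
proof (rule ext)
 fix e'
 have a: "d + (e' + 1) = d + 1 + e'" "d + e' + 1 = d + 1 + e'" for e' :: int by simp_all
 have z: "dif V (d + e') \<zero>\<^bsub>grd V (d + e')\<^esub> = \<zero>\<^bsub>grd V (d + 1 + e')\<^esub>" for e'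
  using df.zero[of "d + e'"] by (simp add: algebra_simps)
 have y1: "y : V $ (d + 1 + (e - 1))" using y by simp
 have y2: "dif V (d + e) y : V $ (d + 1 + e)" by (rule dif_closed'[OF y]) simp
 show "dif_op V d (rmon V d e y) e' = (zmult p (rgrd V (d + 1)) (of_bool (odd e)) (rmon V (d + 1) (e - 1) y)
   \<oplus>\<^bsub>rgrd V (d + 1)\<^esub> zmult p (rgrd V (d + 1)) (sg e) (rmon V (d + 1) e (dif V (d + e) y))) e'"
  using y1 y2 by (auto simp: dif_op_def rgrd_simps(3) rgrd_zmult rmon_def z a sg_def gr.zmult_minus)
qed

lemma dif_op_dif_op:
 assumes x: "x : V $$ d"
 shows "dif_op V (d + 1) (dif_op V d x) = \<zero>\<^bsub>rgrd V (d + 2)\<^esub>"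
proof (rule ext)
 fix e
 have c: "dif V (d + e) (x e) : V $ (d + 1 + e)" "x (e + 1) : V $ (d + 1 + e)" for e
  by (rule dif_op_coord[OF x])+
 have i: "d + 2 + e = d + 1 + 1 + e" "d + 1 + (e + 1) = d + 1 + 1 + e" "d + (e + 1) = d + 1 + e" by simp_all
 have dd: "dif V (d + 1 + e) (dif V (d + e) (x e)) = \<zero>\<^bsub>grd V (d + 1 + 1 + e)\<^esub>" for e
  using dif_dif[OF rgrd_coord[OF x, of e]] by (simp add: algebra_simps)
 have c2: "dif V (d + 1 + e) (x (e + 1)) : V $ (d + 1 + 1 + e)"
  by (rule dif_closed'[OF c(2)]) simp
 have add: "dif V (d + 1 + e) (u \<oplus>\<^bsub>grd V (d + 1 + e)\<^esub> v) = dif V (d + 1 + e) u \<oplus>\<^bsub>grd V (d + 1 + 1 + e)\<^esub> dif V (d + 1 + e) v"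
  if "u : V $ (d + 1 + e)" "v : V $ (d + 1 + e)" for u v
  using df.add[OF that] by (simp add: algebra_simps)
 have neg: "dif V (d + 1 + e) (\<ominus>\<^bsub>grd V (d + 1 + e)\<^esub> u) = \<ominus>\<^bsub>grd V (d + 1 + 1 + e)\<^esub> dif V (d + 1 + e) u"
  if "u : V $ (d + 1 + e)" for u
  using df.neg[OF that] by (simp add: algebra_simps)
 show "dif_op V (d + 1) (dif_op V d x) e = \<zero>\<^bsub>rgrd V (d + 2)\<^esub> e"
 proof (cases "even e")
  case True
  then show ?thesis using c[of e] c2
   by (simp add: dif_op_def rgrd_simps(2) add dd i gr.M.r_neg)
 next
  case False
  then show ?thesis using c[of e] by (simp add: dif_op_def rgrd_simps(2) neg dd i)
 qed
qed

end

context bock_trivial begin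

lemma sop_Bock_Pow_1:
 assumes p2: "p = 2" and x: "x : M $ d"
 shows "sop M (Pow 1) d x = \<zero>\<^bsub>grd M (d - int (pdeg 1))\<^esub>"
proof -
 have g: "gen_deg p (Pow 1) = 1" using p2 by (simp add: gen_deg_def)
 have "wmon [Bock] - wmon [Pow 1] : steenrod_ideal p" using steenrod_rels_subset[of p] p2 by (auto simp: steenrod_rels_def)
 moreover have "wmon [Bock] : free_deg p 1" "wmon [Pow 1] : free_deg p 1" using g by (auto intro!: wmon_free_deg)
 ultimately have "hact p M 1 d (wmon [Bock]) x \<ominus>\<^bsub>grd M (d - int 1)\<^esub> hact p M 1 d (wmon [Pow 1]) x = \<zero>\<^bsub>grd M (d - int 1)\<^esub>"
  unfolding hact_diff[OF x, symmetric] by (intro hact_ideal free_deg_diff x)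
 then have "hact p M 1 d (wmon [Bock]) x = hact p M 1 d (wmon [Pow 1]) x"
  by (rule gr.diff_eq_zeroD[OF hact_closed[OF x] hact_closed[OF x]])
 then show ?thesis using hact_wmon[OF x, of "[Bock]" 1] hact_wmon[OF x, of "[Pow 1]" 1] g Bock_trivial[OF x] by simp
qed

text \<open>The Adem relation for \<open>Sq\<^sup>1\<close> and an even square expresses the next odd square through \<open>Sq\<^sup>1 = \<beta>\<close>.\<close>

lemma odd_squares_trivial:
 assumes p2: "p = 2" and k: "odd k" and x: "x : M $ d"
 shows "sop M (Pow k) d x = \<zero>\<^bsub>grd M (d - int (pdeg k))\<^esub>"
proof (cases "k = 1")
 case True then show ?thesis using sop_Bock_Pow_1[OF p2 x] by simp
next
 case False
 define b where "b = k - 1"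
 have b: "k = b + 1" "even b" "b > 0" using k False by (auto simp: b_def elim!: oddE)
 have g: "gen_deg p (Pow s) = s" for s using p2 by (simp add: gen_deg_def)
 let ?f = "wmon [Pow 1, Pow b] - of_int (int b - 1) * wmon [Pow k, Pow 0]"
 have "wmon [Pow 1, Pow b] - (\<Sum>c = 0..1 div 2. of_int (ibinom (int b - int c - 1) (int 1 - 2 * int c)) * wmon [Pow (1 + b - c), Pow c]) : adem_even"
  unfolding adem_even_def using b(3) by (intro CollectI exI[of _ 1] exI[of _ b]) simp
 moreover have "ibinom (int b - 1) 1 = int b - 1" by (simp add: ibinom_def)
 ultimately have "?f : steenrod_ideal p" using steenrod_rels_subset[of p] p2 b(1) by (auto simp: steenrod_rels_def)
 moreover have f: "wmon [Pow 1, Pow b] : free_deg p k" "wmon [Pow k, Pow 0] : free_deg p k"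
  using g b(1) by (auto intro!: wmon_free_deg)
 ultimately have "hact p M k d ?f x = \<zero>\<^bsub>grd M (d - int k)\<^esub>"
  by (intro hact_ideal free_deg_diff free_deg_of_int x)
 then have "hact p M k d (wmon [Pow 1, Pow b]) x \<ominus>\<^bsub>grd M (d - int k)\<^esub> zmult p (grd M (d - int k)) (int b - 1) (hact p M k d (wmon [Pow k, Pow 0]) x) = \<zero>\<^bsub>grd M (d - int k)\<^esub>"
  unfolding hact_diff[OF x] hact_of_int[OF x] .
 then have "hact p M k d (wmon [Pow 1, Pow b]) x = zmult p (grd M (d - int k)) (int b - 1) (hact p M k d (wmon [Pow k, Pow 0]) x)"
  by (rule gr.diff_eq_zeroD[OF hact_closed[OF x] gr.zmult_closed[OF hact_closed[OF x]]])
 also have "... = zmult p (grd M (d - int k)) 1 (hact p M k d (wmon [Pow k, Pow 0]) x)"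
  by (rule gr.zmult_cong) (use b(2) p2 in \<open>auto simp: cong_iff_dvd_diff\<close>)
 also have "... = sop M (Pow k) d x"
 proof -
  have "sop M (Pow k) d x : M $ (d - int k)" using sp.closed[OF x, of "Pow k"] by (simp only: g)
  moreover have "hact p M k d (wmon [Pow k, Pow 0]) x = sop M (Pow 0) (d - int k) (sop M (Pow k) d x)"
   using hact_wmon[OF x, of "[Pow k, Pow 0]" k] by (simp add: g)
  ultimately show ?thesis by (simp add: Pow_0)
 qed
 also have "hact p M k d (wmon [Pow 1, Pow b]) x = \<zero>\<^bsub>grd M (d - int k)\<^esub>"
 proof -
  have "hact p M k d (wmon [Pow 1, Pow b]) x = sop M (Pow b) (d - int 1) (sop M (Pow 1) d x)"
   using hact_wmon[OF x, of "[Pow 1, Pow b]" k] b(1) by (simp add: g)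
  also have "... = \<zero>\<^bsub>grd M (d - int 1 - int b)\<^esub>"
   using sop_Bock_Pow_1[OF p2 x] sp.zero[of "Pow b" "d - int 1"] by (simp add: g)
  finally show ?thesis using b(1) by (simp add: algebra_simps)
 qed
 finally show ?thesis by (simp add: g)
qed

text \<open>The coefficients on \<open>u t\<^sup>r\<close> and on \<open>t\<^sup>r\<close> agree for odd \<open>p\<close>. For \<open>p = 2\<close> the exponents differ by one and the parity of \<open>k\<close>, even by the vanishing of odd squares, enters.\<close>

lemma pow_coeff_dif:
 assumes "p = 2 ==> even k"
 shows "[of_bool (odd e) * pow_coeff s (tate_exp p (e - 1)) (int k)
  = of_bool (odd (e + tate_step p * (int s - int k))) * pow_coeff s (tate_exp p e) (int k)] (mod int p)"
proof (cases "p = 2")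
 case False
 then have "odd (e + tate_step p * (int s - int k)) = odd e" using even_tate_step[of p] by simp
 moreover have "tate_exp p (e - 1) = tate_exp p e" if "odd e" using that False
  by (auto simp: tate_exp_def elim!: oddE)
 ultimately show ?thesis by simp
next
 case True
 then have k: "even k" using assms by simp
 have t: "tate_exp p e = e" "tate_step p = 1" for e using True by (simp_all add: tate_exp_def tate_step_def)
 have o: "odd (e + tate_step p * (int s - int k)) = odd (e + int s)" using k by (simp add: t)
 define T where "T = - 1 - e - int s"
 define j where "j = int s - 2 * int k"
 have c: "pow_coeff s (tate_exp p (e - 1)) (int k) = ibinom (T + 1) j" "pow_coeff s (tate_exp p e) (int k) = ibinom T j"
 proof -
  have "pow_coeff s r (int k) = ibinom (- 1 - r - int s) j" for r
   unfolding pow_coeff_def psi_coeff_def j_def by (simp add: True algebra_simps)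
  then show "pow_coeff s (tate_exp p (e - 1)) (int k) = ibinom (T + 1) j" "pow_coeff s (tate_exp p e) (int k) = ibinom T j"
   unfolding t T_def by (simp_all add: algebra_simps)
 qed
 have pa: "ibinom (T + 1) j = ibinom T j + ibinom T (j - 1)" by (rule ibinom_pascal)
 have j: "odd j = odd s" by (simp add: j_def)
 have T: "even T = odd (e + int s)" by (auto simp: T_def)
 show ?thesis
  unfolding o c
  using even_ibinom[of "T + 1" j] even_ibinom[of T j] even_ibinom[of T "j - 1"] pa j T True
  by (cases "odd e"; cases "odd s") (auto simp: cong_iff_dvd_diff)
qed

lemma dif_op_pow_op:
 assumes x: "x : M $$ d"
 shows "pow_op s (d + 1) (dif_op M d x) = dif_op M (d - int (pdeg s)) (pow_op s d x)"
proof (rule rgrd_hom_eqI[OF x, where W = "rgrd M (d - int (pdeg s) + 1)"])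
 have d: "d + 1 - int (pdeg s) = d - int (pdeg s) + 1" by simp
 show "(\<lambda>x. pow_op s (d + 1) (dif_op M d x)) : Hom p (rgrd M d) (rgrd M (d - int (pdeg s) + 1))"
  by (rule mod_hom_comp[OF dif_op_hom pow_op_hom[of s "d + 1", unfolded d]])
 show "(\<lambda>x. dif_op M (d - int (pdeg s)) (pow_op s d x)) : Hom p (rgrd M d) (rgrd M (d - int (pdeg s) + 1))"
  by (rule mod_hom_comp[OF pow_op_hom dif_op_hom])
 fix e y assume y: "y : M $ (d + e)"
 let ?D = "d - int (pdeg s)"
 interpret P: Fp_module_hom p "rgrd M (d + 1)" "rgrd M (?D + 1)" "pow_op s (d + 1)"
  using pow_op_hom[of s "d + 1"] unfolding d by (intro Fp_module_homI rg.Fp_module_axioms)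
 interpret D: Fp_module_hom p "rgrd M ?D" "rgrd M (?D + 1)" "dif_op M ?D"
  by (intro Fp_module_homI rg.Fp_module_axioms dif_op_hom)
 let ?e = "\<lambda>k. e + tate_step p * (int s - int k)"
 let ?R = "rgrd M (?D + 1)"
 define Y where "Y k = sop M (Pow k) (d + e) y" for k
 define Z where "Z k = dif M (?D + ?e k) (Y k)" for k
 have dk: "d + e - int (pdeg k) = ?D + ?e k" for k using p_pos by (simp add: gen_deg_Pow algebra_simps)
 have Y: "Y k : M $ (?D + ?e k)" for k
  using sp.closed[OF y, of "Pow k"] unfolding dk Y_def .
 have Y': "Y k : M $ (?D + 1 + (?e k - 1))" for k using Y[of k] by (simp add: algebra_simps)
 have Z: "Z k : M $ (?D + 1 + ?e k)" for k
  unfolding Z_def by (rule dif_closed'[OF Y]) simp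
 have y1: "y : M $ (d + 1 + (e - 1))" using y by simp
 have y2: "dif M (d + e) y : M $ (d + 1 + e)" by (rule dif_closed'[OF y]) simp
 let ?a = "\<lambda>k. rmon M (?D + 1) (?e k - 1) (Y k)" and ?b = "\<lambda>k. rmon M (?D + 1) (?e k) (Z k)"
 have a: "?a k : carrier ?R" and b: "?b k : carrier ?R" for k by (rule rmon_closed[OF Y'], rule rmon_closed[OF Z])
 let ?c = "\<lambda>e k. pow_coeff s (tate_exp p e) (int k)"
 have "pow_op s (d + 1) (dif_op M d (rmon M d e y))
   = zmult p ?R (of_bool (odd e)) (pow_op s (d + 1) (rmon M (d + 1) (e - 1) y))
    \<oplus>\<^bsub>?R\<^esub> zmult p ?R (sg e) (pow_op s (d + 1) (rmon M (d + 1) e (dif M (d + e) y)))"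
  unfolding dif_op_rmon[OF y] using rmon_closed[OF y1] rmon_closed[OF y2] by (simp add: P.add P.zmult)
 also have "pow_op s (d + 1) (rmon M (d + 1) (e - 1) y) = (\<Oplus>\<^bsub>?R\<^esub>k\<in>{0..s}. zmult p ?R (?c (e - 1) k) (?a k))"
 proof -
  have i: "d + 1 + (e - 1) = d + e" "e - 1 + tate_step p * (int s - int k) = ?e k - 1" for k by simp_all
  show ?thesis using pow_op_rmon[OF y1, of s] unfolding d i Y_def .
 qed
 also have "pow_op s (d + 1) (rmon M (d + 1) e (dif M (d + e) y)) = (\<Oplus>\<^bsub>?R\<^esub>k\<in>{0..s}. zmult p ?R (?c e k) (?b k))"
 proof -
  have "sop M (Pow k) (d + 1 + e) (dif M (d + e) y) = Z k" for k
   using dif_Pow[OF y, of k] unfolding dk Z_def Y_def by (simp add: algebra_simps)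
  then show ?thesis using pow_op_rmon[OF y2, of s] unfolding d by (simp only:)
 qed
 also have "zmult p ?R (of_bool (odd e)) (\<Oplus>\<^bsub>?R\<^esub>k\<in>{0..s}. zmult p ?R (?c (e - 1) k) (?a k))
   \<oplus>\<^bsub>?R\<^esub> zmult p ?R (sg e) (\<Oplus>\<^bsub>?R\<^esub>k\<in>{0..s}. zmult p ?R (?c e k) (?b k))
  = (\<Oplus>\<^bsub>?R\<^esub>k\<in>{0..s}. zmult p ?R (of_bool (odd e)) (zmult p ?R (?c (e - 1) k) (?a k)))
   \<oplus>\<^bsub>?R\<^esub> (\<Oplus>\<^bsub>?R\<^esub>k\<in>{0..s}. zmult p ?R (sg e) (zmult p ?R (?c e k) (?b k)))"
  by (intro arg_cong2[where f = "add ?R"] rg.zmult_finsum) (intro Pi_I rg.zmult_closed a b)+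
 also have "... = (\<Oplus>\<^bsub>?R\<^esub>k\<in>{0..s}. zmult p ?R (of_bool (odd e)) (zmult p ?R (?c (e - 1) k) (?a k))
   \<oplus>\<^bsub>?R\<^esub> zmult p ?R (sg e) (zmult p ?R (?c e k) (?b k)))"
  by (rule rg.M.finsum_addf[symmetric]) (intro Pi_I rg.zmult_closed a b)+
 also have "... = (\<Oplus>\<^bsub>?R\<^esub>k\<in>{0..s}. dif_op M ?D (zmult p (rgrd M ?D) (?c e k) (rmon M ?D (?e k) (Y k))))"
 proof (rule rg.M.finsum_cong'[OF refl])
  fix k
  have 1: "zmult p ?R (of_bool (odd e)) (zmult p ?R (?c (e - 1) k) (?a k)) = zmult p ?R (of_bool (odd (?e k))) (zmult p ?R (?c e k) (?a k))"
  proof (cases "p = 2 \<and> odd k")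
   case True
   have "Y k = \<zero>\<^bsub>grd M (?D + 1 + (?e k - 1))\<^esub>"
    using odd_squares_trivial[OF _ _ y, of k] True unfolding dk Y_def by (simp add: algebra_simps)
   then have "?a k = \<zero>\<^bsub>?R\<^esub>" by (simp only: rm.zero)
   then show ?thesis by simp
  next
   case False
   show ?thesis unfolding rg.zmult_assoc[OF a, symmetric]
    by (rule rg.zmult_cong) (rule pow_coeff_dif, use False in auto)
  qed
  have 2: "zmult p ?R (sg e) (zmult p ?R (?c e k) (?b k)) = zmult p ?R (sg (?e k)) (zmult p ?R (?c e k) (?b k))"
  proof (rule rg.zmult_cong)
   show "[sg e = sg (?e k)] (mod int p)"
   proof (cases "p = 2")
    case True then show ?thesis using sg_cong_2 by simp
   next
    case False then show ?thesis using even_tate_step[OF False] by (simp add: sg_def)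
   qed
  qed
  show "zmult p ?R (of_bool (odd e)) (zmult p ?R (?c (e - 1) k) (?a k)) \<oplus>\<^bsub>?R\<^esub> zmult p ?R (sg e) (zmult p ?R (?c e k) (?b k))
   = dif_op M ?D (zmult p (rgrd M ?D) (?c e k) (rmon M ?D (?e k) (Y k)))"
   unfolding 1 2 D.zmult[OF rmon_closed[OF Y]] dif_op_rmon[OF Y]
   using a[of k] b[of k] by (simp add: rg.zmult_r_distr rg.zmult_left_commute Z_def)
 next
  show "(\<lambda>k. dif_op M ?D (zmult p (rgrd M ?D) (?c e k) (rmon M ?D (?e k) (Y k)))) : {0..s} \<rightarrow> carrier ?R"
   by (intro Pi_I D.closed rg.zmult_closed rmon_closed Y)
 qed
 also have "... = dif_op M ?D (pow_op s d (rmon M d e y))"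
  unfolding pow_op_rmon[OF y] Y_def[symmetric] by (rule D.finsum[symmetric]) (intro Pi_I rg.zmult_closed rmon_closed Y)
 finally show "pow_op s (d + 1) (dif_op M d (rmon M d e y)) = dif_op M ?D (pow_op s d (rmon M d e y))" .
qed

lemma bock_op_dif_op:
 assumes p2: "p \<noteq> 2" and x: "x : M $$ d"
 shows "bock_op (d + 1) (dif_op M d x) = \<ominus>\<^bsub>rgrd M (d - 1 + 1)\<^esub> dif_op M (d - 1) (bock_op d x)"
proof (rule ext)
 fix e
 have "dif_op M (d - 1) (bock_op d x) : M $$ (d - 1 + 1)"
  by (rule mod_hom_closed[OF dif_op_hom mod_hom_closed[OF bock_op_hom x]])
 then have n: "(\<ominus>\<^bsub>rgrd M (d - 1 + 1)\<^esub> dif_op M (d - 1) (bock_op d x)) e = \<ominus>\<^bsub>grd M (d + e)\<^esub> dif_op M (d - 1) (bock_op d x) e"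
  by (simp add: rgrd_uminus)
 have i: "d + (e - 1) = d - 1 + e" "d + 1 + (e - 1) = d + e" "d - 1 + 1 + e = d + e" "d + 1 - 1 + e = d + e" "d - 1 + (e + 1) = d + e"
  by simp_all
 have c: "dif M (d - 1 + e) (x (e - 1)) : M $ (d + e)"
  using dif_op_coord(1)[OF x, of "e - 1"] unfolding i .
 have z: "dif M (d - 1 + e) \<zero>\<^bsub>grd M (d - 1 + e)\<^esub> = \<zero>\<^bsub>grd M (d + e)\<^esub>"
  using df.zero[of "d - 1 + e"] by (simp add: algebra_simps)
 show "bock_op (d + 1) (dif_op M d x) e = (\<ominus>\<^bsub>rgrd M (d - 1 + 1)\<^esub> dif_op M (d - 1) (bock_op d x)) e"
  unfolding n using c z by (cases "even e") (auto simp: bock_op_def dif_op_def i)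
qed

lemma r_plus_dif_sop:
 assumes x: "x : M $$ d"
 shows "sop RM g (d + 1) (dif RM d x) = sgn_mult (rgrd M (d + 1 - deg p g)) (deg p g)
  (dif RM (d - deg p g) (sop RM g d x))"
proof -
 have dx: "dif_op M d x : M $$ (d + 1)" by (rule mod_hom_closed[OF dif_op_hom x])
 have sgn2: "sgn_mult (rgrd M n) e z = z" if "p = 2" "z : M $$ n" for n e z
 proof -
  have "sgn_mult (rgrd M n) e z = zmult p (rgrd M n) 1 z"
   unfolding rg.sgn_mult_sg[OF that(2)] by (rule rg.zmult_cong) (use that(1) in \<open>auto simp: sg_def cong_iff_dvd_diff\<close>)
  then show ?thesis using that(2) by simp
 qed
 have P: "sop RM (Pow s) (d + 1) (dif RM d x) = dif RM (d - int (pdeg s)) (sop RM (Pow s) d x)"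
  and Pc: "dif RM (d - int (pdeg s)) (sop RM (Pow s) d x) : M $$ (d + 1 - int (pdeg s))" for s
 proof -
  have px: "pow_op s d x : M $$ (d - int (pdeg s))" by (rule mod_hom_closed[OF pow_op_hom x])
  show "sop RM (Pow s) (d + 1) (dif RM d x) = dif RM (d - int (pdeg s)) (sop RM (Pow s) d x)"
   by (simp add: r_plus_Pow r_plus_dif x dx px dif_op_pow_op)
  have "dif_op M (d - int (pdeg s)) (pow_op s d x) : M $$ (d - int (pdeg s) + 1)"
   by (rule mod_hom_closed[OF dif_op_hom px])
  then show "dif RM (d - int (pdeg s)) (sop RM (Pow s) d x) : M $$ (d + 1 - int (pdeg s))"
   by (simp add: r_plus_Pow r_plus_dif x px algebra_simps)
 qed
 show ?thesis
 proof (cases g)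
  case (Pow s)
  show ?thesis
  proof (cases "p = 2")
   case True
   show ?thesis unfolding Pow P sgn2[OF True Pc] ..
  next
   case False
   then have "even (gen_deg p (Pow s))" by (simp add: gen_deg_def)
   then show ?thesis unfolding Pow P by (simp add: sgn_mult_def)
  qed
 next
  case Bock
  show ?thesis
  proof (cases "p = 2")
   case True
   have g: "deg p Bock = int (pdeg 1)" using True by (simp add: gen_deg_def)
   have b: "sop RM Bock n z = sop RM (Pow 1) n z" if "z : M $$ n" for n z
    using that by (simp add: r_plus_Bock_2[OF True] r_plus_Pow)
   have dx': "dif RM d x : M $$ (d + 1)" using dx x by (simp add: r_plus_dif)
   show ?thesis unfolding Bock g b[OF x] b[OF dx'] P[of 1] sgn2[OF True Pc[of 1]] ..
  next
   case False
   have bx: "bock_op d x : M $$ (d - 1)" by (rule mod_hom_closed[OF bock_op_hom x])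
   have "d - 1 + 1 = d + 1 - 1" by simp
   then show ?thesis unfolding Bock using bock_op_dif_op[OF False x] dx bx x
    by (simp add: r_plus_Bock[OF False] r_plus_dif sgn_mult_def)
  qed
 qed
qed

theorem r_plus_dg_right_A_module: "dg_right_A_module p RM"
proof (intro dg_right_A_module.intro dg_right_A_module_axioms.intro r_plus_right_A_module)
 show h: "dif RM d : Hom p (grd RM d) (grd RM (d + 1))" for d
  using mod_hom_cong[OF dif_op_hom rg.Fp_module_axioms r_plus_dif] by simp
 fix d x assume x: "x : RM $ d"
 then have "dif_op M d x : M $$ (d + 1)" using mod_hom_closed[OF dif_op_hom] by simp
 then show "dif RM (d + 1) (dif RM d x) = \<zero>\<^bsub>grd RM (d + 2)\<^esub>"
  using x by (simp add: r_plus_dif dif_op_dif_op)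
 fix k a assume a: "a : steenrod_deg p k"
 have "sact p RM k (d + int 1) a (dif RM d x) = sgn_mult (grd RM (d + int 1 - int k)) (int (1 * k)) (dif RM (d - int k) (sact p RM k d a x))"
  by (rule sact_natural[OF r_plus_graded_ops r_plus_graded_ops _ _ a x])
   (use h r_plus_dif_sop in simp_all)
 moreover have "d + int 1 - int k = d - int k + 1" "d + int 1 = d + 1" "1 * k = k" by simp_all
 ultimately show "sact p RM k (d + 1) a (dif RM d x) = sgn_mult (grd RM (d - int k + 1)) (int k) (dif RM (d - int k) (sact p RM k d a x))"
  by (simp only:)
qed

end
section \<open>The product of \<open>r\<^sub>+(M)\<close>\<close>

context dg_A_algebra begin

lemma mul_left_hom: "y : M $ e ==> Fp_module_hom p (grd M d) (grd M (d + e)) (\<lambda>x. gmul M d e x y)"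
 by (intro Fp_module_homI gr.Fp_module_axioms mul_left)

lemma mul_right_hom: "x : M $ d ==> Fp_module_hom p (grd M e) (grd M (d + e)) (gmul M d e x)"
 by (intro Fp_module_homI gr.Fp_module_axioms mul_right)

lemma mul_closed: "x : M $ d ==> y : M $ e ==> gmul M d e x y : M $ (d + e)"
 using Fp_module_hom.closed[OF mul_right_hom] .

lemmas mul_add_left = Fp_module_hom.add[OF mul_left_hom]
lemmas mul_add_right = Fp_module_hom.add[OF mul_right_hom]
lemmas mul_zmult_left = Fp_module_hom.zmult[OF mul_left_hom]
lemmas mul_zmult_right = Fp_module_hom.zmult[OF mul_right_hom]
lemmas mul_zero_left = Fp_module_hom.zero[OF mul_left_hom]
lemmas mul_zero_right = Fp_module_hom.zero[OF mul_right_hom]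
lemmas mul_finsum_left = Fp_module_hom.finsum[OF mul_left_hom]
lemmas mul_finsum_right = Fp_module_hom.finsum[OF mul_right_hom]

end

context bock_trivial begin

text \<open>The coefficient of \<open>u\<^bsub>a+b\<^esub> \<otimes> xy\<close> in \<open>(u\<^sub>a \<otimes> x)(u\<^sub>b \<otimes> y)\<close> for \<open>|x| = n\<close>; it is zero if \<open>u\<^sup>2 = 0\<close> occurs.\<close>

definition mon_sign :: "int => int => int => int" where
 "mon_sign n a b = (if p = 2 then 1 else if odd a \<and> odd b then 0 else if odd n \<and> odd b then -1 else 1)"

abbreviation "rmul d e x y \<equiv> gmul RM d e x y"

lemma rgrd_add_coord: "(x \<oplus>\<^bsub>rgrd M d\<^esub> y) e = x e \<oplus>\<^bsub>grd M (d + e)\<^esub> y e"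
 by (simp add: rgrd_simps(3))

lemma rmul_mon_eq:
 assumes x: "x : M $ (d + a)" and y: "y : M $ (e + b)"
 shows "gmul M (d + a) (e + b) x y : M $ (d + e + (a + b))"
  "rmul_mon p M d e a b x y
   = zmult p (rgrd M (d + e)) (mon_sign (d + a) a b) (rmon M (d + e) (a + b) (gmul M (d + a) (e + b) x y))"
proof -
 have "d + a + (e + b) = d + e + (a + b)" by simp
 then show c: "gmul M (d + a) (e + b) x y : M $ (d + e + (a + b))"
  using mul_closed[OF x y] by (simp only:)
 let ?R = "rgrd M (d + e)" and ?z = "rmon M (d + e) (a + b) (gmul M (d + a) (e + b) x y)"
 have z: "zmult p ?R 1 ?z = ?z" "zmult p ?R 0 ?z = \<zero>\<^bsub>?R\<^esub>" "zmult p ?R (-1) ?z = \<ominus>\<^bsub>?R\<^esub> ?z"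
  using rmon_closed[OF c] by (simp_all add: rg.zmult_minus)
 show "rmul_mon p M d e a b x y = zmult p ?R (mon_sign (d + a) a b) ?z"
 proof (cases "p = 2")
  case True
  show ?thesis unfolding rmul_mon_def mon_sign_def Let_def if_P[OF True] z ..
 next
  case False
  have "odd ((d + a) * (b mod 2)) \<longleftrightarrow> odd (d + a) \<and> odd b" by simp
  then show ?thesis using False z by (auto simp: rmul_mon_def mon_sign_def Let_def sgn_mult_def)
 qed
qed

lemma rmul_mon_closed:
 "x : M $ (d + a) ==> y : M $ (e + b) ==> rmul_mon p M d e a b x y : M $$ (d + e)"
 unfolding rmul_mon_eq(2) by (intro rg.zmult_closed rmon_closed rmul_mon_eq(1))

lemma rmul_mon_left_hom:
 assumes y: "y : M $ (e + b)"
 shows "(\<lambda>x. rmul_mon p M d e a b x y) : Hom p (grd M (d + a)) (rgrd M (d + e))"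
proof (rule mod_homI)
 fix x x' assume x: "x : M $ (d + a)" "x' : M $ (d + a)"
 have i: "d + a + (e + b) = d + e + (a + b)" by simp
 show "rmul_mon p M d e a b (x \<oplus>\<^bsub>grd M (d + a)\<^esub> x') y
   = rmul_mon p M d e a b x y \<oplus>\<^bsub>rgrd M (d + e)\<^esub> rmul_mon p M d e a b x' y"
  using rmul_mon_eq(1)[OF x(1) y] rmul_mon_eq(1)[OF x(2) y] mul_add_left[OF y x] x unfolding i
  by (simp add: rmul_mon_eq(2)[OF _ y] rm.add rg.zmult_r_distr)
qed (auto intro!: gr.Fp_module_axioms rg.Fp_module_axioms rmul_mon_closed y)

lemma rmul_mon_right_hom:
 assumes x: "x : M $ (d + a)"
 shows "rmul_mon p M d e a b x : Hom p (grd M (e + b)) (rgrd M (d + e))"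
proof (rule mod_homI)
 fix y y' assume y: "y : M $ (e + b)" "y' : M $ (e + b)"
 have i: "d + a + (e + b) = d + e + (a + b)" by simp
 show "rmul_mon p M d e a b x (y \<oplus>\<^bsub>grd M (e + b)\<^esub> y')
   = rmul_mon p M d e a b x y \<oplus>\<^bsub>rgrd M (d + e)\<^esub> rmul_mon p M d e a b x y'"
  using rmul_mon_eq(1)[OF x y(1)] rmul_mon_eq(1)[OF x y(2)] mul_add_right[OF x y] y unfolding i
  by (simp add: rmul_mon_eq(2)[OF x] rm.add rg.zmult_r_distr)
qed (auto intro!: gr.Fp_module_axioms rg.Fp_module_axioms rmul_mon_closed x)

lemma rmul_mon_zero:
 "y : M $ (e + b) ==> rmul_mon p M d e a b \<zero>\<^bsub>grd M (d + a)\<^esub> y = \<zero>\<^bsub>rgrd M (d + e)\<^esub>"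
 "x : M $ (d + a) ==> rmul_mon p M d e a b x \<zero>\<^bsub>grd M (e + b)\<^esub> = \<zero>\<^bsub>rgrd M (d + e)\<^esub>"
 using Fp_module_hom.zero[OF Fp_module_homI[OF gr.Fp_module_axioms rg.Fp_module_axioms rmul_mon_left_hom]]
  Fp_module_hom.zero[OF Fp_module_homI[OF gr.Fp_module_axioms rg.Fp_module_axioms rmul_mon_right_hom]] by auto

lemma rmul_superset:
 assumes x: "x : M $$ d" and y: "y : M $$ e"
  and A: "finite A" "rsupp M d x \<subseteq> A" and B: "finite B" "rsupp M e y \<subseteq> B"
 shows "rmul d e x y = (\<Oplus>\<^bsub>rgrd M (d + e)\<^esub>a\<in>A. \<Oplus>\<^bsub>rgrd M (d + e)\<^esub>b\<in>B. rmul_mon p M d e a b (x a) (y b))"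
proof -
 let ?R = "rgrd M (d + e)"
 let ?t = "\<lambda>a b. rmul_mon p M d e a b (x a) (y b)"
 have c: "?t a b : carrier ?R" for a b by (intro rmul_mon_closed rgrd_coord x y)
 have zb: "?t a b = \<zero>\<^bsub>?R\<^esub>" if "b \<notin> rsupp M e y" for a b
  using that rmul_mon_zero(2)[OF rgrd_coord[OF x]] by (simp add: rsupp_def)
 have za: "?t a b = \<zero>\<^bsub>?R\<^esub>" if "a \<notin> rsupp M d x" for a b
  using that rmul_mon_zero(1)[OF rgrd_coord[OF y]] by (simp add: rsupp_def)
 have "rmul d e x y = (\<Oplus>\<^bsub>?R\<^esub>a\<in>rsupp M d x. \<Oplus>\<^bsub>?R\<^esub>b\<in>rsupp M e y. ?t a b)" by (simp add: r_plus_def)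
 also have "... = (\<Oplus>\<^bsub>?R\<^esub>a\<in>rsupp M d x. \<Oplus>\<^bsub>?R\<^esub>b\<in>B. ?t a b)"
  by (rule rg.M.finsum_cong'[OF refl]) (use B c zb in \<open>auto intro!: rg.M.finsum_closed rg.finsum_subset\<close>)
 also have "... = (\<Oplus>\<^bsub>?R\<^esub>a\<in>A. \<Oplus>\<^bsub>?R\<^esub>b\<in>B. ?t a b)"
  by (rule rg.finsum_subset) (use A c za in \<open>auto intro!: rg.M.finsum_closed rg.finsum_neutral\<close>)
 finally show ?thesis .
qed

lemma rmul_closed: "x : M $$ d ==> y : M $$ e ==> rmul d e x y : M $$ (d + e)"
 by (simp add: r_plus_def) (intro rg.M.finsum_closed Pi_I rmul_mon_closed rgrd_coord)

lemma rmul_mod_hom: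
 assumes y: "y : M $$ e"
 shows "(\<lambda>x. rmul d e x y) : Hom p (rgrd M d) (rgrd M (d + e))"
  and "rmul e d y : Hom p (rgrd M d) (rgrd M (e + d))"
proof -
 show "(\<lambda>x. rmul d e x y) : Hom p (rgrd M d) (rgrd M (d + e))"
 proof (rule mod_homI)
  fix x x' assume x: "x : M $$ d" "x' : M $$ d"
  let ?R = "rgrd M (d + e)"
  let ?A = "rsupp M d x \<union> rsupp M d x'" and ?B = "rsupp M e y"
  let ?t = "\<lambda>x a b. rmul_mon p M d e a b (x a) (y b)"
  have f: "finite ?A" "finite ?B" using finite_rsupp x y by auto
  have s: "rsupp M d (x \<oplus>\<^bsub>rgrd M d\<^esub> x') \<subseteq> ?A" by (auto simp: rsupp_def rgrd_simps(3))
  have c: "?t z a b : carrier ?R" if "z : M $$ d" for z a b by (intro rmul_mon_closed rgrd_coord that y)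
  have add: "?t (x \<oplus>\<^bsub>rgrd M d\<^esub> x') a b = ?t x a b \<oplus>\<^bsub>?R\<^esub> ?t x' a b" for a b
   by (subst rgrd_add_coord) (intro mod_hom_add[OF rmul_mon_left_hom[OF rgrd_coord[OF y]]] rgrd_coord x)
  have "rmul d e (x \<oplus>\<^bsub>rgrd M d\<^esub> x') y = (\<Oplus>\<^bsub>?R\<^esub>a\<in>?A. \<Oplus>\<^bsub>?R\<^esub>b\<in>?B. ?t x a b \<oplus>\<^bsub>?R\<^esub> ?t x' a b)"
   unfolding rmul_superset[OF rg.M.a_closed[OF x] y f(1) s f(2) subset_refl] add ..
  also have "... = (\<Oplus>\<^bsub>?R\<^esub>a\<in>?A. (\<Oplus>\<^bsub>?R\<^esub>b\<in>?B. ?t x a b) \<oplus>\<^bsub>?R\<^esub> (\<Oplus>\<^bsub>?R\<^esub>b\<in>?B. ?t x' a b))"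
   by (rule rg.M.finsum_cong'[OF refl]) (use c x in \<open>auto intro!: rg.M.finsum_closed rg.M.finsum_addf rg.M.a_closed\<close>)
  also have "... = (\<Oplus>\<^bsub>?R\<^esub>a\<in>?A. \<Oplus>\<^bsub>?R\<^esub>b\<in>?B. ?t x a b) \<oplus>\<^bsub>?R\<^esub> (\<Oplus>\<^bsub>?R\<^esub>a\<in>?A. \<Oplus>\<^bsub>?R\<^esub>b\<in>?B. ?t x' a b)"
   by (rule rg.M.finsum_addf) (intro Pi_I rg.M.finsum_closed c x)+
  finally show "rmul d e (x \<oplus>\<^bsub>rgrd M d\<^esub> x') y = rmul d e x y \<oplus>\<^bsub>?R\<^esub> rmul d e x' y"
   unfolding rmul_superset[OF x(1) y f(1) Un_upper1 f(2) subset_refl] rmul_superset[OF x(2) y f(1) Un_upper2 f(2) subset_refl] .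
 qed (auto intro!: rg.Fp_module_axioms rmul_closed y)
 show "rmul e d y : Hom p (rgrd M d) (rgrd M (e + d))"
 proof (rule mod_homI)
  fix x x' assume x: "x : M $$ d" "x' : M $$ d"
  let ?R = "rgrd M (e + d)"
  let ?A = "rsupp M d x \<union> rsupp M d x'" and ?B = "rsupp M e y"
  let ?t = "\<lambda>x b a. rmul_mon p M e d b a (y b) (x a)"
  have f: "finite ?A" "finite ?B" using finite_rsupp x y by auto
  have s: "rsupp M d (x \<oplus>\<^bsub>rgrd M d\<^esub> x') \<subseteq> ?A" by (auto simp: rsupp_def rgrd_simps(3))
  have c: "?t z b a : carrier ?R" if "z : M $$ d" for z a b by (intro rmul_mon_closed rgrd_coord that y)
  have add: "?t (x \<oplus>\<^bsub>rgrd M d\<^esub> x') b a = ?t x b a \<oplus>\<^bsub>?R\<^esub> ?t x' b a" for a b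
   by (subst rgrd_add_coord) (intro mod_hom_add[OF rmul_mon_right_hom[OF rgrd_coord[OF y]]] rgrd_coord x)
  have "rmul e d y (x \<oplus>\<^bsub>rgrd M d\<^esub> x') = (\<Oplus>\<^bsub>?R\<^esub>b\<in>?B. \<Oplus>\<^bsub>?R\<^esub>a\<in>?A. ?t x b a \<oplus>\<^bsub>?R\<^esub> ?t x' b a)"
   unfolding rmul_superset[OF y rg.M.a_closed[OF x] f(2) subset_refl f(1) s] add ..
  also have "... = (\<Oplus>\<^bsub>?R\<^esub>b\<in>?B. (\<Oplus>\<^bsub>?R\<^esub>a\<in>?A. ?t x b a) \<oplus>\<^bsub>?R\<^esub> (\<Oplus>\<^bsub>?R\<^esub>a\<in>?A. ?t x' b a))"
   by (rule rg.M.finsum_cong'[OF refl]) (use c x in \<open>auto intro!: rg.M.finsum_closed rg.M.finsum_addf rg.M.a_closed\<close>)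
  also have "... = (\<Oplus>\<^bsub>?R\<^esub>b\<in>?B. \<Oplus>\<^bsub>?R\<^esub>a\<in>?A. ?t x b a) \<oplus>\<^bsub>?R\<^esub> (\<Oplus>\<^bsub>?R\<^esub>b\<in>?B. \<Oplus>\<^bsub>?R\<^esub>a\<in>?A. ?t x' b a)"
   by (rule rg.M.finsum_addf) (intro Pi_I rg.M.finsum_closed c x)+
  finally show "rmul e d y (x \<oplus>\<^bsub>rgrd M d\<^esub> x') = rmul e d y x \<oplus>\<^bsub>?R\<^esub> rmul e d y x'"
   unfolding rmul_superset[OF y x(1) f(2) subset_refl f(1) Un_upper1] rmul_superset[OF y x(2) f(2) subset_refl f(1) Un_upper2] .
 qed (auto intro!: rg.Fp_module_axioms rmul_closed y)
qed

lemma rmul_left_hom: "y : M $$ e ==> Fp_module_hom p (rgrd M d) (rgrd M (d + e)) (\<lambda>x. rmul d e x y)"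
 by (intro Fp_module_homI rg.Fp_module_axioms rmul_mod_hom)

lemma rmul_right_hom: "x : M $$ d ==> Fp_module_hom p (rgrd M e) (rgrd M (d + e)) (rmul d e x)"
 by (intro Fp_module_homI rg.Fp_module_axioms rmul_mod_hom)

lemmas rmul_add_left = Fp_module_hom.add[OF rmul_left_hom]
lemmas rmul_add_right = Fp_module_hom.add[OF rmul_right_hom]
lemmas rmul_zmult_left = Fp_module_hom.zmult[OF rmul_left_hom]
lemmas rmul_zmult_right = Fp_module_hom.zmult[OF rmul_right_hom]
lemmas rmul_finsum_left = Fp_module_hom.finsum[OF rmul_left_hom]
lemmas rmul_finsum_right = Fp_module_hom.finsum[OF rmul_right_hom]

lemma rmul_rmon:
 assumes x: "x : M $ (d + a)" and y: "y : M $ (e + b)"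
 shows "rmul d e (rmon M d a x) (rmon M e b y)
  = zmult p (rgrd M (d + e)) (mon_sign (d + a) a b) (rmon M (d + e) (a + b) (gmul M (d + a) (e + b) x y))"
proof -
 have "rmul d e (rmon M d a x) (rmon M e b y) = (\<Oplus>\<^bsub>rgrd M (d + e)\<^esub>a'\<in>{a}. \<Oplus>\<^bsub>rgrd M (d + e)\<^esub>b'\<in>{b}.
   rmul_mon p M d e a' b' (rmon M d a x a') (rmon M e b y b'))"
  by (rule rmul_superset) (auto simp: rsupp_def rmon_def intro!: rmon_closed[unfolded rmon_def] x y split: if_splits)
 also have "... = rmul_mon p M d e a b x y"
  using rmul_mon_closed[OF x y] by (simp add: rg.M.finsum_insert rmon_def)
 finally show ?thesis unfolding rmul_mon_eq(2)[OF x y] .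
qed

text \<open>Additive identities need only be checked on monomials.\<close>

lemma rgrd_bilinear_eqI:
 assumes x: "x : M $$ d" and y: "y : M $$ e"
  and f: "!!y. y : M $$ e ==> (\<lambda>x. f x y) : Hom p (rgrd M d) W"
   "!!x. x : M $$ d ==> f x : Hom p (rgrd M e) W"
  and g: "!!y. y : M $$ e ==> (\<lambda>x. g x y) : Hom p (rgrd M d) W"
   "!!x. x : M $$ d ==> g x : Hom p (rgrd M e) W"
  and mon: "!!a b u v. u : M $ (d + a) ==> v : M $ (e + b) ==>
   f (rmon M d a u) (rmon M e b v) = g (rmon M d a u) (rmon M e b v)"
 shows "f x y = g x y"
proof (rule rgrd_hom_eqI[OF x f(1)[OF y] g(1)[OF y]])
 fix a u assume u: "u : M $ (d + a)"
 show "f (rmon M d a u) y = g (rmon M d a u) y"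
  by (rule rgrd_hom_eqI[OF y f(2)[OF rmon_closed[OF u]] g(2)[OF rmon_closed[OF u]]]) (rule mon[OF u])
qed

end

context bock_trivial begin

lemma mon_sign_assoc: "mon_sign n a b * mon_sign (n + m) (a + b) c = mon_sign n a (b + c) * mon_sign m b c"
 by (auto simp: mon_sign_def)

lemma mon_sign_unit: "mon_sign 0 0 b = 1" "mon_sign n a 0 = 1"
 unfolding mon_sign_def by auto

lemma mon_sign_2: "p = 2 ==> mon_sign n a b = 1"
 unfolding mon_sign_def by simp

lemma rmul_assoc_mon:
 assumes x: "x : M $ (d + a)" and y: "y : M $ (e + b)" and z: "z : M $ (f + c)"
 shows "rmul (d + e) f (rmul d e (rmon M d a x) (rmon M e b y)) (rmon M f c z)
  = rmul d (e + f) (rmon M d a x) (rmul e f (rmon M e b y) (rmon M f c z))"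
proof -
 let ?R = "rgrd M (d + e + f)"
 have i: "d + a + (e + b) = d + e + (a + b)" "e + b + (f + c) = e + f + (b + c)" "d + (e + f) = d + e + f" "a + (b + c) = a + b + c" by simp_all
 note xy = rmul_mon_eq(1)[OF x y] and yz = rmul_mon_eq(1)[OF y z]
 let ?w = "gmul M (d + e + (a + b)) (f + c) (gmul M (d + a) (e + b) x y) z"
 have w: "?w : M $ (d + e + f + (a + b + c))" by (rule rmul_mon_eq(1)[OF xy z])
 have w': "gmul M (d + a) (e + f + (b + c)) x (gmul M (e + b) (f + c) y z) = ?w"
  using mul_assoc[OF x y z] unfolding i by simp
 have rw: "rmon M (d + e + f) (a + b + c) ?w : carrier ?R" by (rule rmon_closed[OF w])
 have "rmul (d + e) f (rmul d e (rmon M d a x) (rmon M e b y)) (rmon M f c z)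
   = zmult p ?R (mon_sign (d + a) a b) (zmult p ?R (mon_sign (d + e + (a + b)) (a + b) c) (rmon M (d + e + f) (a + b + c) ?w))"
  unfolding rmul_rmon[OF x y] rmul_zmult_left[OF rmon_closed[OF z] rmon_closed[OF xy]] rmul_rmon[OF xy z] ..
 also have "... = zmult p ?R (mon_sign (d + a) a b * mon_sign (d + a + (e + b)) (a + b) c) (rmon M (d + e + f) (a + b + c) ?w)"
  unfolding i rg.zmult_assoc[OF rw] ..
 also have "... = zmult p ?R (mon_sign (e + b) b c) (zmult p ?R (mon_sign (d + a) a (b + c)) (rmon M (d + e + f) (a + b + c) ?w))"
  unfolding mon_sign_assoc mult.commute[of "mon_sign (d + a) a (b + c)"] rg.zmult_assoc[OF rw] ..
 also have "... = rmul d (e + f) (rmon M d a x) (rmul e f (rmon M e b y) (rmon M f c z))"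
  unfolding rmul_rmon[OF y z] rmul_zmult_right[OF rmon_closed[OF x] rmon_closed[OF yz]] rmul_rmon[OF x yz] w' i(3,4) ..
 finally show ?thesis .
qed

lemma rmul_assoc:
 assumes x: "x : M $$ d" and y: "y : M $$ e" and z: "z : M $$ f"
 shows "rmul (d + e) f (rmul d e x y) z = rmul d (e + f) x (rmul e f y z)"
proof -
 let ?R = "rgrd M (d + e + f)"
 have i: "d + (e + f) = d + e + f" by simp
 have mono: "rmul (d + e) f (rmul d e (rmon M d a u) (rmon M e b v)) z = rmul d (e + f) (rmon M d a u) (rmul e f (rmon M e b v) z)"
  if u: "u : M $ (d + a)" and v: "v : M $ (e + b)" for a b u v
 proof (rule rgrd_hom_eqI[OF z, where W = ?R])
  show "rmul (d + e) f (rmul d e (rmon M d a u) (rmon M e b v)) : Hom p (rgrd M f) ?R"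
   by (intro rmul_mod_hom rmul_closed rmon_closed u v)
  show "(\<lambda>z. rmul d (e + f) (rmon M d a u) (rmul e f (rmon M e b v) z)) : Hom p (rgrd M f) ?R"
   using mod_hom_comp[OF rmul_mod_hom(2)[OF rmon_closed[OF v], of f] rmul_mod_hom(2)[OF rmon_closed[OF u]]] unfolding i .
 qed (rule rmul_assoc_mon[OF u v])
 show ?thesis
 proof (rule rgrd_bilinear_eqI[OF x y, where W = ?R])
  fix y assume y: "y : M $$ e"
  show "(\<lambda>x. rmul (d + e) f (rmul d e x y) z) : Hom p (rgrd M d) ?R"
   by (rule mod_hom_comp[OF rmul_mod_hom(1)[OF y] rmul_mod_hom(1)[OF z]])
  show "(\<lambda>x. rmul d (e + f) x (rmul e f y z)) : Hom p (rgrd M d) ?R"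
   using rmul_mod_hom(1)[OF rmul_closed[OF y z], of d] unfolding i .
 next
  fix x assume x: "x : M $$ d"
  show "(\<lambda>y. rmul (d + e) f (rmul d e x y) z) : Hom p (rgrd M e) ?R"
   by (rule mod_hom_comp[OF rmul_mod_hom(2)[OF x] rmul_mod_hom(1)[OF z]])
  show "(\<lambda>y. rmul d (e + f) x (rmul e f y z)) : Hom p (rgrd M e) ?R"
   using mod_hom_comp[OF rmul_mod_hom(1)[OF z, of e] rmul_mod_hom(2)[OF x]] unfolding i .
 qed (rule mono)
qed

lemma runit_closed: "gunit RM : M $$ 0"
 using unit_closed by (simp add: rmon_closed)

lemma rmul_unit_left:
 assumes x: "x : M $$ d"
 shows "rmul 0 d (gunit RM) x = x"
proof (rule rgrd_hom_eqI[OF x, where W = "rgrd M d"])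
 show "rmul 0 d (gunit RM) : Hom p (rgrd M d) (rgrd M d)"
  using rmul_mod_hom(2)[OF runit_closed, of d] by simp
 show "(\<lambda>x. x) : Hom p (rgrd M d) (rgrd M d)" by (simp add: mod_hom_def)
 fix e y assume y: "y : M $ (d + e)"
 have u: "gunit M : M $ (0 + 0)" using unit_closed by simp
 show "rmul 0 d (gunit RM) (rmon M d e y) = rmon M d e y"
  using rmul_rmon[OF u y] unit_left[OF y] y by (simp add: mon_sign_unit)
qed

lemma rmul_unit_right:
 assumes x: "x : M $$ d"
 shows "rmul d 0 x (gunit RM) = x"
proof (rule rgrd_hom_eqI[OF x, where W = "rgrd M d"])
 show "(\<lambda>x. rmul d 0 x (gunit RM)) : Hom p (rgrd M d) (rgrd M d)"
  using rmul_mod_hom(1)[OF runit_closed, of d] by simp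
 show "(\<lambda>x. x) : Hom p (rgrd M d) (rgrd M d)" by (simp add: mod_hom_def)
 fix e y assume y: "y : M $ (d + e)"
 have u: "gunit M : M $ (0 + 0)" using unit_closed by simp
 show "rmul d 0 (rmon M d e y) (gunit RM) = rmon M d e y"
  using rmul_rmon[OF y u] unit_right[OF y] y by (simp add: mon_sign_unit)
qed

lemma pow_op_unit:
 assumes s: "s > 0"
 shows "pow_op s 0 (gunit RM) = \<zero>\<^bsub>rgrd M (- int (pdeg s))\<^esub>"
proof -
 have u: "gunit M : M $ (0 + 0)" using unit_closed by simp
 have "pow_op s 0 (rmon M 0 0 (gunit M)) = \<zero>\<^bsub>rgrd M (0 - int (pdeg s))\<^esub>"
  unfolding pow_op_rmon[OF u]
 proof (rule rg.finsum_neutral)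
  fix k
  let ?R = "rgrd M (0 - int (pdeg s))" and ?e = "0 + tate_step p * (int s - int k)"
  have i: "- int (pdeg k) = 0 - int (pdeg s) + ?e" "0 + 0 - int (pdeg k) = 0 - int (pdeg s) + ?e"
   using p_pos by (simp_all add: gen_deg_Pow algebra_simps)
  show "zmult p ?R (pow_coeff s (tate_exp p 0) (int k)) (rmon M (0 - int (pdeg s)) ?e (sop M (Pow k) (0 + 0) (gunit M))) = \<zero>\<^bsub>?R\<^esub>"
  proof (cases "k = 0")
   case True
   have "[pow_coeff s (tate_exp p 0) (int k) = 0] (mod int p)"
   proof -
    have "tate_exp p 0 = 0" by (auto simp: tate_exp_def)
    then show ?thesis using psi_coeff_zero[of p "int s"] s True by (simp add: pow_coeff_def)
   qed
   moreover have "rmon M (0 - int (pdeg s)) ?e (sop M (Pow k) (0 + 0) (gunit M)) : carrier ?R"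
    using sp.closed[OF u, of "Pow k"] unfolding i(2) by (rule rmon_closed)
   ultimately show ?thesis using rg.zmult_cong rg.zmult_0 by metis
  next
   case False
   then have "sop M (Pow k) (0 + 0) (gunit M) = \<zero>\<^bsub>grd M (0 - int (pdeg s) + ?e)\<^esub>"
    using unit_Pow[of k] unfolding i(1) by simp
   then show ?thesis by (simp only: rm.zero rg.zmult_zero)
  qed
 qed
 then show ?thesis by simp
qed

text \<open>A derivation-like operator on monomials: lowering or raising an odd exponent by one is compatible
 with products up to the sign of the degree.\<close>

lemma mon_sign_derivation:
 assumes j: "odd j"
 shows "[of_bool (odd (a + b)) * mon_sign (d + a) a b
  = of_bool (odd a) * mon_sign (d + a) (a + j) b + sg d * of_bool (odd b) * mon_sign (d + a) a (b + j)] (mod int p)"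
proof (cases "p = 2")
 case True
 have "[of_bool (odd (a + b)) = of_bool (odd a) + sg d * of_bool (odd b)] (mod (2::int))"
  by (cases "odd a"; cases "odd b") (auto simp: sg_def cong_iff_dvd_diff)
 then show ?thesis unfolding mon_sign_2[OF True] by (simp add: True)
next
 case False
 have "of_bool (odd (a + b)) * mon_sign (d + a) a b
  = of_bool (odd a) * mon_sign (d + a) (a + j) b + sg d * of_bool (odd b) * mon_sign (d + a) a (b + j)"
  using j False by (cases "odd a"; cases "odd b"; cases "odd d") (auto simp: mon_sign_def sg_def)
 then show ?thesis by simp
qed

lemma rmul_derivation_mon:
 assumes j: "odd j" and x: "x : M $ (d + a)" and y: "y : M $ (e + b)"
 shows "zmult p (rgrd M (d + e - j)) (of_bool (odd (a + b)) * mon_sign (d + a) a b) (rmon M (d + e - j) (a + b + j) (gmul M (d + a) (e + b) x y))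
  = zmult p (rgrd M (d + e - j)) (of_bool (odd a)) (rmul (d - j) e (rmon M (d - j) (a + j) x) (rmon M e b y))
   \<oplus>\<^bsub>rgrd M (d + e - j)\<^esub> zmult p (rgrd M (d + e - j)) (sg d * of_bool (odd b)) (rmul d (e - j) (rmon M d a x) (rmon M (e - j) (b + j) y))"
proof -
 let ?R = "rgrd M (d + e - j)"
 have i: "d - j + (a + j) = d + a" "e - j + (b + j) = e + b" "d - j + e = d + e - j" "d + (e - j) = d + e - j"
  "a + j + b = a + b + j" "a + (b + j) = a + b + j" "d + e - j + (a + b + j) = d + e + (a + b)" by simp_all
 have x': "x : M $ (d - j + (a + j))" and y': "y : M $ (e - j + (b + j))"
  unfolding i by (rule x, rule y)
 let ?w = "rmon M (d + e - j) (a + b + j) (gmul M (d + a) (e + b) x y)"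
 have w: "?w : carrier ?R" by (rule rmon_closed) (unfold i, rule rmul_mon_eq(1)[OF x y])
 have 1: "rmul (d - j) e (rmon M (d - j) (a + j) x) (rmon M e b y) = zmult p ?R (mon_sign (d + a) (a + j) b) ?w"
  using rmul_rmon[OF x' y] unfolding i .
 have 2: "rmul d (e - j) (rmon M d a x) (rmon M (e - j) (b + j) y) = zmult p ?R (mon_sign (d + a) a (b + j)) ?w"
  using rmul_rmon[OF x y'] unfolding i .
 show ?thesis
  unfolding 1 2 rg.zmult_assoc[OF w, symmetric] rg.zmult_l_distr[OF w, symmetric]
  by (rule rg.zmult_cong[OF mon_sign_derivation[OF j]])
qed

lemma bock_op_mul:
 assumes p2: "p \<noteq> 2" and x: "x : M $$ d" and y: "y : M $$ e"
 shows "bock_op (d + e) (rmul d e x y) = rmul (d - 1) e (bock_op d x) y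
   \<oplus>\<^bsub>rgrd M (d + e - 1)\<^esub> zmult p (rgrd M (d + e - 1)) (sg d) (rmul d (e - 1) x (bock_op e y))"
proof (rule rgrd_bilinear_eqI[OF x y, where W = "rgrd M (d + e - 1)"])
 let ?R = "rgrd M (d + e - 1)"
 have i: "d - 1 + e = d + e - 1" "d + (e - 1) = d + e - 1" by simp_all
 have add: "(\<lambda>x. f x \<oplus>\<^bsub>?R\<^esub> zmult p ?R (sg d) (g x)) : Hom p (rgrd M n) ?R"
  if f: "f : Hom p (rgrd M n) ?R" and g: "g : Hom p (rgrd M n) ?R" for f g n
  by (rule mod_homI) (use mod_hom_closed[OF f] mod_hom_closed[OF g] mod_hom_add[OF f] mod_hom_add[OF g] in
    \<open>auto simp: rg.Fp_module_axioms rg.zmult_r_distr rg.M.a_ac\<close>)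
 fix z
 show "(\<lambda>x. bock_op (d + e) (rmul d e x z)) : Hom p (rgrd M d) ?R" if z: "z : M $$ e"
  by (rule mod_hom_comp[OF rmul_mod_hom(1)[OF z] bock_op_hom])
 show "(\<lambda>y. bock_op (d + e) (rmul d e z y)) : Hom p (rgrd M e) ?R" if z: "z : M $$ d"
  by (rule mod_hom_comp[OF rmul_mod_hom(2)[OF z] bock_op_hom])
 show "(\<lambda>x. rmul (d - 1) e (bock_op d x) z \<oplus>\<^bsub>?R\<^esub> zmult p ?R (sg d) (rmul d (e - 1) x (bock_op e z)))
   : Hom p (rgrd M d) ?R" if z: "z : M $$ e"
  using mod_hom_comp[OF bock_op_hom rmul_mod_hom(1)[OF z], of d] rmul_mod_hom(1)[OF mod_hom_closed[OF bock_op_hom z], of d]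
  unfolding i by (rule add)
 show "(\<lambda>y. rmul (d - 1) e (bock_op d z) y \<oplus>\<^bsub>?R\<^esub> zmult p ?R (sg d) (rmul d (e - 1) z (bock_op e y)))
   : Hom p (rgrd M e) ?R" if z: "z : M $$ d"
  using rmul_mod_hom(2)[OF mod_hom_closed[OF bock_op_hom z], of e] mod_hom_comp[OF bock_op_hom rmul_mod_hom(2)[OF z], of e]
  unfolding i by (rule add)
next
 let ?R = "rgrd M (d + e - 1)"
 fix a b u v assume u: "u : M $ (d + a)" and v: "v : M $ (e + b)"
 interpret B: Fp_module_hom p "rgrd M (d + e)" ?R "bock_op (d + e)"
  by (intro Fp_module_homI rg.Fp_module_axioms bock_op_hom)
 have bm: "bock_op n (rmon M n c w) = zmult p (rgrd M (n - 1)) (of_bool (odd c)) (rmon M (n - 1) (c + 1) w)"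
  if "w : M $ (n + c)" for n c w
 proof -
  have "rmon M (n - 1) (c + 1) w : M $$ (n - 1)" by (rule rmon_closed) (use that in simp)
  then show ?thesis by (simp add: bock_op_rmon)
 qed
 have i: "d - 1 + e = d + e - 1" "d + (e - 1) = d + e - 1" by simp_all
 have w: "gmul M (d + a) (e + b) u v : M $ (d + e + (a + b))" by (rule rmul_mon_eq(1)[OF u v])
 have w': "rmon M (d + e - 1) (a + b + 1) (gmul M (d + a) (e + b) u v) : carrier ?R"
  by (rule rmon_closed) (use w in \<open>simp add: algebra_simps\<close>)
 have u1: "rmon M (d - 1) (a + 1) u : M $$ (d - 1)" by (rule rmon_closed) (use u in simp)
 have v1: "rmon M (e - 1) (b + 1) v : M $$ (e - 1)" by (rule rmon_closed) (use v in simp)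
 have r1: "rmul d (e - 1) (rmon M d a u) (rmon M (e - 1) (b + 1) v) : carrier ?R"
  using rmul_closed[OF rmon_closed[OF u] v1] unfolding i .
 have "bock_op (d + e) (rmul d e (rmon M d a u) (rmon M e b v))
   = zmult p ?R (of_bool (odd (a + b)) * mon_sign (d + a) a b) (rmon M (d + e - 1) (a + b + 1) (gmul M (d + a) (e + b) u v))"
  unfolding rmul_rmon[OF u v] B.zmult[OF rmon_closed[OF w]] bm[OF w] using w' by (simp add: rg.zmult_assoc rg.zmult_left_commute)
 also have "... = zmult p ?R (of_bool (odd a)) (rmul (d - 1) e (rmon M (d - 1) (a + 1) u) (rmon M e b v))
   \<oplus>\<^bsub>?R\<^esub> zmult p ?R (sg d * of_bool (odd b)) (rmul d (e - 1) (rmon M d a u) (rmon M (e - 1) (b + 1) v))"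
  by (rule rmul_derivation_mon[OF _ u v]) simp
 also have "... = rmul (d - 1) e (bock_op d (rmon M d a u)) (rmon M e b v)
   \<oplus>\<^bsub>?R\<^esub> zmult p ?R (sg d) (rmul d (e - 1) (rmon M d a u) (bock_op e (rmon M e b v)))"
  unfolding bm[OF u] bm[OF v] rmul_zmult_left[OF rmon_closed[OF v] u1] rmul_zmult_right[OF rmon_closed[OF u] v1] i
   rg.zmult_assoc[OF r1] ..
 finally show "bock_op (d + e) (rmul d e (rmon M d a u) (rmon M e b v)) = ..." .
qed

lemma mon_sign_dif:
 "[sg (a + b) * mon_sign n a b = sg a * mon_sign (n + 1) a b] (mod int p)"
 "[sg (a + b) * sg (d + a) * mon_sign n a b = sg d * sg b * mon_sign n a b] (mod int p)"
proof -
 have s2: "[sg c = 1] (mod 2)" for c by (auto simp: sg_def cong_iff_dvd_diff)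
 show "[sg (a + b) * mon_sign n a b = sg a * mon_sign (n + 1) a b] (mod int p)"
 proof (cases "p = 2")
  case True
  then show ?thesis unfolding mon_sign_2[OF True] using sg_cong_2 by simp
 next
  case False
  then have "sg (a + b) * mon_sign n a b = sg a * mon_sign (n + 1) a b" by (auto simp: sg_def mon_sign_def)
  then show ?thesis by simp
 qed
 have "sg (a + b) * sg (d + a) = sg d * sg b" by (auto simp: sg_def)
 then show "[sg (a + b) * sg (d + a) * mon_sign n a b = sg d * sg b * mon_sign n a b] (mod int p)" by simp
qed

lemma dif_op_mul:
 assumes x: "x : M $$ d" and y: "y : M $$ e"
 shows "dif_op M (d + e) (rmul d e x y) = rmul (d + 1) e (dif_op M d x) y
   \<oplus>\<^bsub>rgrd M (d + e + 1)\<^esub> zmult p (rgrd M (d + e + 1)) (sg d) (rmul d (e + 1) x (dif_op M e y))"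
proof (rule rgrd_bilinear_eqI[OF x y, where W = "rgrd M (d + e + 1)"])
 let ?R = "rgrd M (d + e + 1)"
 have i: "d + 1 + e = d + e + 1" "d + (e + 1) = d + e + 1" by simp_all
 have add: "(\<lambda>x. f x \<oplus>\<^bsub>?R\<^esub> zmult p ?R (sg d) (g x)) : Hom p (rgrd M n) ?R"
  if f: "f : Hom p (rgrd M n) ?R" and g: "g : Hom p (rgrd M n) ?R" for f g n
  by (rule mod_homI) (use mod_hom_closed[OF f] mod_hom_closed[OF g] mod_hom_add[OF f] mod_hom_add[OF g] in
    \<open>auto simp: rg.Fp_module_axioms rg.zmult_r_distr rg.M.a_ac\<close>)
 fix z
 show "(\<lambda>x. dif_op M (d + e) (rmul d e x z)) : Hom p (rgrd M d) ?R" if z: "z : M $$ e"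
  by (rule mod_hom_comp[OF rmul_mod_hom(1)[OF z] dif_op_hom])
 show "(\<lambda>y. dif_op M (d + e) (rmul d e z y)) : Hom p (rgrd M e) ?R" if z: "z : M $$ d"
  by (rule mod_hom_comp[OF rmul_mod_hom(2)[OF z] dif_op_hom])
 show "(\<lambda>x. rmul (d + 1) e (dif_op M d x) z \<oplus>\<^bsub>?R\<^esub> zmult p ?R (sg d) (rmul d (e + 1) x (dif_op M e z)))
   : Hom p (rgrd M d) ?R" if z: "z : M $$ e"
  using mod_hom_comp[OF dif_op_hom rmul_mod_hom(1)[OF z], of d] rmul_mod_hom(1)[OF mod_hom_closed[OF dif_op_hom z], of d]
  unfolding i by (rule add)
 show "(\<lambda>y. rmul (d + 1) e (dif_op M d z) y \<oplus>\<^bsub>?R\<^esub> zmult p ?R (sg d) (rmul d (e + 1) z (dif_op M e y)))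
   : Hom p (rgrd M e) ?R" if z: "z : M $$ d"
  using rmul_mod_hom(2)[OF mod_hom_closed[OF dif_op_hom z], of e] mod_hom_comp[OF dif_op_hom rmul_mod_hom(2)[OF z], of e]
  unfolding i by (rule add)
next
 let ?R = "rgrd M (d + e + 1)"
 fix a b u v assume u: "u : M $ (d + a)" and v: "v : M $ (e + b)"
 interpret D: Fp_module_hom p "rgrd M (d + e)" ?R "dif_op M (d + e)"
  by (intro Fp_module_homI rg.Fp_module_axioms dif_op_hom)
 let ?n = "d + a" and ?m = "e + b" and ?uv = "gmul M (d + a) (e + b) u v"
 have i: "d + 1 + e = d + e + 1" "d + (e + 1) = d + e + 1" by simp_all
 have w: "?uv : M $ (d + e + (a + b))" by (rule rmul_mon_eq(1)[OF u v])
 have du: "dif M ?n u : M $ (d + 1 + a)" by (rule dif_closed'[OF u]) simp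
 have dv: "dif M ?m v : M $ (e + 1 + b)" by (rule dif_closed'[OF v]) simp
 let ?P = "gmul M (d + 1 + a) (e + b) (dif M ?n u) v" and ?Q = "gmul M (d + a) (e + 1 + b) u (dif M ?m v)"
 have P: "?P : M $ (d + e + 1 + (a + b))" using rmul_mon_eq(1)[OF du v] unfolding i .
 have Q: "?Q : M $ (d + e + 1 + (a + b))" using rmul_mon_eq(1)[OF u dv] unfolding i .
 let ?rP = "rmon M (d + e + 1) (a + b) ?P" and ?rQ = "rmon M (d + e + 1) (a + b) ?Q"
 have rP: "?rP : carrier ?R" and rQ: "?rQ : carrier ?R" by (rule rmon_closed[OF P], rule rmon_closed[OF Q])
 let ?w1 = "rmon M (d + e + 1) (a + b - 1) ?uv"
 have w1: "?w1 : carrier ?R" by (rule rmon_closed) (use w in \<open>simp add: algebra_simps\<close>)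
 have u1: "rmon M (d + 1) (a - 1) u : M $$ (d + 1)" by (rule rmon_closed) (use u in simp)
 have v1: "rmon M (e + 1) (b - 1) v : M $$ (e + 1)" by (rule rmon_closed) (use v in simp)
 have duv: "dif M (d + e + (a + b)) ?uv = ?P \<oplus>\<^bsub>grd M (d + e + 1 + (a + b))\<^esub> zmult p (grd M (d + e + 1 + (a + b))) (sg ?n) ?Q"
 proof -
  have j: "d + a + (e + b) = d + e + (a + b)" "d + a + 1 = d + 1 + a" "e + b + 1 = e + 1 + b"
   "d + e + (a + b) + 1 = d + e + 1 + (a + b)" by simp_all
  show ?thesis using dif_mul[OF u v] Q by (simp only: j gr.sgn_mult_sg)
 qed
 have A: "zmult p ?R (of_bool (odd (a + b)) * mon_sign ?n a b) ?w1
   = zmult p ?R (of_bool (odd a)) (rmul (d + 1) e (rmon M (d + 1) (a - 1) u) (rmon M e b v))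
   \<oplus>\<^bsub>?R\<^esub> zmult p ?R (sg d * of_bool (odd b)) (rmul d (e + 1) (rmon M d a u) (rmon M (e + 1) (b - 1) v))"
  using rmul_derivation_mon[of "-1", OF _ u v] by simp
 let ?A1 = "rmul (d + 1) e (rmon M (d + 1) (a - 1) u) (rmon M e b v)"
 let ?A2 = "rmul d (e + 1) (rmon M d a u) (rmon M (e + 1) (b - 1) v)"
 have A1: "?A1 : carrier ?R" using rmul_closed[OF u1 rmon_closed[OF v]] unfolding i .
 have A2: "?A2 : carrier ?R" using rmul_closed[OF rmon_closed[OF u] v1] unfolding i .
 have B: "rmul (d + 1) e (rmon M (d + 1) a (dif M ?n u)) (rmon M e b v) = zmult p ?R (mon_sign (?n + 1) a b) ?rP"
  using rmul_rmon[OF du v] by (simp add: algebra_simps)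
 have C: "rmul d (e + 1) (rmon M d a u) (rmon M (e + 1) b (dif M ?m v)) = zmult p ?R (mon_sign ?n a b) ?rQ"
  using rmul_rmon[OF u dv] by (simp add: algebra_simps)
 let ?z = "zmult p ?R" and ?s = "mon_sign ?n a b"
 have "dif_op M (d + e) (rmul d e (rmon M d a u) (rmon M e b v))
  = ?z ?s (?z (of_bool (odd (a + b))) ?w1 \<oplus>\<^bsub>?R\<^esub> ?z (sg (a + b)) (rmon M (d + e + 1) (a + b) (dif M (d + e + (a + b)) ?uv)))"
  unfolding rmul_rmon[OF u v] D.zmult[OF rmon_closed[OF w]] dif_op_rmon[OF w] ..
 also have "rmon M (d + e + 1) (a + b) (dif M (d + e + (a + b)) ?uv) = ?rP \<oplus>\<^bsub>?R\<^esub> ?z (sg ?n) ?rQ"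
  unfolding duv using P Q by (simp add: rm.add rm.zmult)
 also have "?z ?s (?z (of_bool (odd (a + b))) ?w1 \<oplus>\<^bsub>?R\<^esub> ?z (sg (a + b)) (?rP \<oplus>\<^bsub>?R\<^esub> ?z (sg ?n) ?rQ))
  = ?z (of_bool (odd (a + b)) * ?s) ?w1 \<oplus>\<^bsub>?R\<^esub> (?z (sg (a + b) * ?s) ?rP \<oplus>\<^bsub>?R\<^esub> ?z (sg (a + b) * sg ?n * ?s) ?rQ)"
  using w1 rP rQ by (simp add: rg.zmult_r_distr rg.zmult_assoc[symmetric] mult.commute mult.left_commute)
 also have "?z (sg (a + b) * ?s) ?rP = ?z (sg a * mon_sign (?n + 1) a b) ?rP" by (rule rg.zmult_cong[OF mon_sign_dif(1)])
 also have "?z (sg (a + b) * sg ?n * ?s) ?rQ = ?z (sg d * sg b * ?s) ?rQ" by (rule rg.zmult_cong[OF mon_sign_dif(2)])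
 also have "?z (of_bool (odd (a + b)) * ?s) ?w1 \<oplus>\<^bsub>?R\<^esub> (?z (sg a * mon_sign (?n + 1) a b) ?rP \<oplus>\<^bsub>?R\<^esub> ?z (sg d * sg b * ?s) ?rQ)
  = (?z (of_bool (odd a)) ?A1 \<oplus>\<^bsub>?R\<^esub> ?z (sg a) (?z (mon_sign (?n + 1) a b) ?rP))
   \<oplus>\<^bsub>?R\<^esub> ?z (sg d) (?z (of_bool (odd b)) ?A2 \<oplus>\<^bsub>?R\<^esub> ?z (sg b) (?z ?s ?rQ))"
  unfolding A using A1 A2 rP rQ by (simp add: rg.zmult_r_distr rg.zmult_assoc mult.assoc rg.M.a_ac)
 also have "?z (of_bool (odd a)) ?A1 \<oplus>\<^bsub>?R\<^esub> ?z (sg a) (?z (mon_sign (?n + 1) a b) ?rP) = rmul (d + 1) e (dif_op M d (rmon M d a u)) (rmon M e b v)"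
  unfolding B[symmetric] dif_op_rmon[OF u]
  using rmul_add_left[OF rmon_closed[OF v] rg.zmult_closed[OF u1] rg.zmult_closed[OF rmon_closed[OF du]]]
   rmul_zmult_left[OF rmon_closed[OF v] u1] rmul_zmult_left[OF rmon_closed[OF v] rmon_closed[OF du]]
  unfolding i by simp
 also have "?z (of_bool (odd b)) ?A2 \<oplus>\<^bsub>?R\<^esub> ?z (sg b) (?z ?s ?rQ) = rmul d (e + 1) (rmon M d a u) (dif_op M e (rmon M e b v))"
  unfolding C[symmetric] dif_op_rmon[OF v]
  using rmul_add_right[OF rmon_closed[OF u] rg.zmult_closed[OF v1] rg.zmult_closed[OF rmon_closed[OF dv]]]
   rmul_zmult_right[OF rmon_closed[OF u] v1] rmul_zmult_right[OF rmon_closed[OF u] rmon_closed[OF dv]]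
  unfolding i by simp
 finally show "dif_op M (d + e) (rmul d e (rmon M d a u) (rmon M e b v)) = rmul (d + 1) e (dif_op M d (rmon M d a u)) (rmon M e b v)
   \<oplus>\<^bsub>?R\<^esub> zmult p ?R (sg d) (rmul d (e + 1) (rmon M d a u) (dif_op M e (rmon M e b v)))" .
qed

end
section \<open>The Cartan formula and the filtration\<close>

lemma mod_hom_sum:
 assumes V: "Fp_module p V" and W: "Fp_module p W"
  and "f : Hom p V W" "g : Hom p V W"
 shows "(\<lambda>x. f x \<oplus>\<^bsub>W\<^esub> g x) : Hom p V W"
proof -
 interpret W: Fp_module p W by (rule W)
 show ?thesis
  by (rule mod_homI[OF V W])
   (simp_all add: mod_hom_closed[OF assms(3)] mod_hom_closed[OF assms(4)] mod_hom_add[OF assms(3)] mod_hom_add[OF assms(4)] W.M.a_ac)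
qed

lemma mod_hom_finsum:
 assumes V: "Fp_module p V" and W: "Fp_module p W" and "!!i. i : A ==> f i : Hom p V W"
 shows "(\<lambda>x. \<Oplus>\<^bsub>W\<^esub>i\<in>A. f i x) : Hom p V W"
proof -
 interpret W: Fp_module p W by (rule W)
 have z: "(\<lambda>x. \<zero>\<^bsub>W\<^esub>) : Hom p V W" by (rule mod_homI[OF V W]) simp_all
 show ?thesis using assms(3)
 proof (induction A rule: infinite_finite_induct)
  case (insert a A)
  have c: "x : carrier V ==> i : insert a A ==> f i x : carrier W" for x i using mod_hom_closed[OF insert.prems] by blast
  have "(\<lambda>x. f a x \<oplus>\<^bsub>W\<^esub> (\<Oplus>\<^bsub>W\<^esub>i\<in>A. f i x)) : Hom p V W"
   by (rule mod_hom_sum[OF V W]) (use insert in auto)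
  from mod_hom_cong[OF this V] show ?case using insert.hyps c by (simp add: W.M.finsum_insert Pi_def)
 qed (simp_all add: z W.M.finsum_infinite)
qed

context bock_trivial begin

text \<open>This is \<open>psi_coeff_convolution\<close>; the powers not in the range contribute zero.\<close>

lemma pow_coeff_convolution:
 assumes "k \<ge> 0" "l \<ge> 0"
 shows "[(\<Sum>i\<in>{0..s}. pow_coeff i r k * pow_coeff (s - i) r' l) = pow_coeff s (r + r') (k + l)] (mod int p)"
proof -
 let ?R = "r + int p * k * (int p - 1)" and ?S = "r' + int p * l * (int p - 1)"
 let ?J = "int s - int p * k - int p * l"
 have pk: "int p * k \<ge> 0" "int p * l \<ge> 0" using assms by auto
 have "(\<Sum>i\<in>{0..s}. pow_coeff i r k * pow_coeff (s - i) r' l)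
   = (\<Sum>i\<in>{0..int s}. psi_coeff p ?R (i - int p * k) * psi_coeff p ?S (int s - i - int p * l))"
  by (rule sum.reindex_bij_witness[of _ nat int]) (auto simp: pow_coeff_def of_nat_diff)
 also have "... = (\<Sum>i\<in>{int p * k..int s - int p * l}. psi_coeff p ?R (i - int p * k) * psi_coeff p ?S (int s - i - int p * l))"
  by (rule sum.mono_neutral_right) (use pk in auto)
 also have "... = (\<Sum>i\<in>{0..?J}. psi_coeff p ?R i * psi_coeff p ?S (?J - i))"
  by (rule sum.reindex_bij_witness[of _ "\<lambda>i. i + int p * k" "\<lambda>i. i - int p * k"]) (auto simp: algebra_simps)
 finally have e: "(\<Sum>i\<in>{0..s}. pow_coeff i r k * pow_coeff (s - i) r' l) = ..." .
 have "pow_coeff s (r + r') (k + l) = psi_coeff p (?R + ?S) ?J"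
  by (simp add: pow_coeff_def algebra_simps)
 then show ?thesis unfolding e using cong_sym[OF psi_coeff_convolution[of p ?R ?S ?J]] by simp
qed

lemma mon_sign_step: "mon_sign (n - int (pdeg k)) (a + tate_step p * i) (b + tate_step p * j) = mon_sign n a b"
proof (cases "p = 2")
 case False
 then have "even (int (pdeg k))" by (simp add: gen_deg_def)
 then show ?thesis using even_tate_step[OF False] unfolding mon_sign_def by simp
next
 case True
 show ?thesis unfolding mon_sign_2[OF True] ..
qed

lemma mon_sign_tate_exp: "mon_sign n a b * pow_coeff s (tate_exp p (a + b)) k = mon_sign n a b * pow_coeff s (tate_exp p a + tate_exp p b) k"
proof (cases "p = 2 \<or> \<not> (odd a \<and> odd b)")
 case True
 then have "tate_exp p (a + b) = tate_exp p a + tate_exp p b"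
  by (auto simp: tate_exp_def elim!: evenE oddE)
 then show ?thesis by simp
next
 case False
 then have "mon_sign n a b = 0" by (simp add: mon_sign_def)
 then show ?thesis by simp
qed

text \<open>Both sides are sums over \<open>P\<^sup>k x\<close> and \<open>P\<^sup>l y\<close> with \<open>k, l \<le> s\<close>. On the left, the Cartan formula in \<open>M\<close> is followed by one coefficient; on the right, the coefficients of the two factors are summed over all splittings of \<open>s\<close>, a convolution.\<close>

lemma pow_op_rmul_mon:
 assumes x: "x : M $ (d + a)" and y: "y : M $ (e + b)"
 shows "pow_op s (d + e) (rmul d e (rmon M d a x) (rmon M e b y))
  = (\<Oplus>\<^bsub>rgrd M (d + e - int (pdeg s))\<^esub>i\<in>{0..s}. rmul (d - int (pdeg i)) (e - int (pdeg (s - i)))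
    (pow_op i d (rmon M d a x)) (pow_op (s - i) e (rmon M e b y)))"
proof -
 let ?D = "d + e - int (pdeg s)"
 let ?R = "rgrd M ?D" and ?n = "d + a" and ?m = "e + b"
 let ?e = "\<lambda>K. a + b + tate_step p * (int s - K)"
 define X where "X k = sop M (Pow k) ?n x" for k
 define Y where "Y l = sop M (Pow l) ?m y" for l
 define Z where "Z k l = gmul M (?n - int (pdeg k)) (?m - int (pdeg l)) (X k) (Y l)" for k l
 define T where "T k l = rmon M ?D (?e (int k + int l)) (Z k l)" for k l
 define \<epsilon> where "\<epsilon> = mon_sign ?n a b"
 let ?r = "tate_exp p a" and ?r' = "tate_exp p b"
 have Xc: "X k : M $ (?n - int (pdeg k))" for k unfolding X_def by (rule sp.closed[OF x])
 have Yc: "Y k : M $ (?m - int (pdeg k))" for k unfolding Y_def by (rule sp.closed[OF y])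
 have deg: "?n - int (pdeg k) + (?m - int (pdeg l)) = ?D + ?e (int k + int l)" for k l
  using p_pos by (simp add: gen_deg_Pow algebra_simps)
 have Zc: "Z k l : M $ (?D + ?e (int k + int l))" for k l
  using mul_closed[OF Xc Yc] unfolding Z_def deg .
 have Tc: "T k l : carrier ?R" for k l unfolding T_def by (rule rmon_closed[OF Zc])
 define F where "F k l = zmult p ?R (\<epsilon> * pow_coeff s (?r + ?r') (int k + int l)) (T k l)" for k l
 have Fc: "F k l : carrier ?R" for k l unfolding F_def by (rule rg.zmult_closed[OF Tc])
 have F0: "F k l = \<zero>\<^bsub>?R\<^esub>" if "k + l > s" for k l
  using pow_coeff_eq_0[OF that, of "?r + ?r'"] rg.zmult_0[OF Tc] by (simp add: F_def)
 have w: "gmul M ?n ?m x y : M $ (d + e + (a + b))" by (rule rmul_mon_eq(1)[OF x y])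
 interpret P: Fp_module_hom p "rgrd M (d + e)" ?R "pow_op s (d + e)"
  by (intro Fp_module_homI rg.Fp_module_axioms pow_op_hom)
 \<comment> \<open>the operation on the product\<close>
 have PZ: "sop M (Pow K) (d + e + (a + b)) (gmul M ?n ?m x y) = (\<Oplus>\<^bsub>grd M (?D + ?e (int K))\<^esub>k\<in>{0..K}. Z k (K - k))" for K
 proof -
  have i: "?n + ?m = d + e + (a + b)" by simp
  have j: "d + e + (a + b) - int (pdeg K) = ?D + ?e (int K)" using p_pos by (simp add: gen_deg_Pow algebra_simps)
  show ?thesis using mul_Pow[OF x y, of K] unfolding i j Z_def X_def Y_def .
 qed
 have L: "zmult p ?R \<epsilon> (zmult p ?R (pow_coeff s (tate_exp p (a + b)) (int K)) (rmon M ?D (?e (int K)) (sop M (Pow K) (d + e + (a + b)) (gmul M ?n ?m x y))))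
   = (\<Oplus>\<^bsub>?R\<^esub>k\<in>{0..K}. F k (K - k))" for K
 proof -
  have ZK: "Z k (K - k) : M $ (?D + ?e (int K))" if "k \<le> K" for k
   using Zc[of k "K - k"] that by (simp add: of_nat_diff)
  have TK: "rmon M ?D (?e (int K)) (Z k (K - k)) = T k (K - k)" if "k \<le> K" for k
   using that by (simp add: T_def of_nat_diff)
  have "rmon M ?D (?e (int K)) (sop M (Pow K) (d + e + (a + b)) (gmul M ?n ?m x y)) = (\<Oplus>\<^bsub>?R\<^esub>k\<in>{0..K}. T k (K - k))"
  proof -
   have "rmon M ?D (?e (int K)) (\<Oplus>\<^bsub>grd M (?D + ?e (int K))\<^esub>k\<in>{0..K}. Z k (K - k)) = (\<Oplus>\<^bsub>?R\<^esub>k\<in>{0..K}. rmon M ?D (?e (int K)) (Z k (K - k)))"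
    by (rule rm.finsum) (use ZK in simp)
   also have "... = (\<Oplus>\<^bsub>?R\<^esub>k\<in>{0..K}. T k (K - k))"
    by (rule rg.M.finsum_cong'[OF refl]) (use Tc TK in auto)
   finally show ?thesis unfolding PZ .
  qed
  then have "zmult p ?R \<epsilon> (zmult p ?R (pow_coeff s (tate_exp p (a + b)) (int K)) (rmon M ?D (?e (int K)) (sop M (Pow K) (d + e + (a + b)) (gmul M ?n ?m x y))))
   = zmult p ?R (\<epsilon> * pow_coeff s (tate_exp p (a + b)) (int K)) (\<Oplus>\<^bsub>?R\<^esub>k\<in>{0..K}. T k (K - k))"
   using rg.M.finsum_closed[of "\<lambda>k. T k (K - k)" "{0..K}" ?D] Tc by (simp add: rg.zmult_assoc)
  also have "... = (\<Oplus>\<^bsub>?R\<^esub>k\<in>{0..K}. zmult p ?R (\<epsilon> * pow_coeff s (?r + ?r') (int K)) (T k (K - k)))"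
   unfolding \<epsilon>_def mon_sign_tate_exp by (rule rg.zmult_finsum) (use Tc in auto)
  also have "... = (\<Oplus>\<^bsub>?R\<^esub>k\<in>{0..K}. F k (K - k))"
   by (rule rg.M.finsum_cong'[OF refl]) (use Fc in \<open>auto simp: F_def of_nat_diff\<close>)
  finally show ?thesis .
 qed
 have "pow_op s (d + e) (rmul d e (rmon M d a x) (rmon M e b y))
   = zmult p ?R \<epsilon> (\<Oplus>\<^bsub>?R\<^esub>K\<in>{0..s}. zmult p ?R (pow_coeff s (tate_exp p (a + b)) (int K)) (rmon M ?D (?e (int K)) (sop M (Pow K) (d + e + (a + b)) (gmul M ?n ?m x y))))"
  unfolding rmul_rmon[OF x y] P.zmult[OF rmon_closed[OF w]] pow_op_rmon[OF w] \<epsilon>_def ..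
 also have "... = (\<Oplus>\<^bsub>?R\<^esub>K\<in>{0..s}. \<Oplus>\<^bsub>?R\<^esub>k\<in>{0..K}. F k (K - k))"
 proof (subst rg.zmult_finsum)
  show "(\<lambda>K. zmult p ?R (pow_coeff s (tate_exp p (a + b)) (int K)) (rmon M ?D (?e (int K)) (sop M (Pow K) (d + e + (a + b)) (gmul M ?n ?m x y)))) : {0..s} \<rightarrow> carrier ?R"
   unfolding PZ
  proof (intro Pi_I rg.zmult_closed rmon_closed gr.M.finsum_closed)
   fix K k :: nat assume "k : {0..K}"
   then show "Z k (K - k) : M $ (?D + ?e (int K))" using Zc[of k "K - k"] by (simp add: of_nat_diff)
  qed
 qed (simp only: L)
 also have "... = (\<Oplus>\<^bsub>?R\<^esub>K\<in>{0..s + s}. \<Oplus>\<^bsub>?R\<^esub>k\<in>{0..K}. F k (K - k))"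
  by (rule rg.finsum_subset) (use Fc F0 in \<open>auto intro!: rg.finsum_neutral rg.M.finsum_closed\<close>)
 also have "... = (\<Oplus>\<^bsub>?R\<^esub>k\<in>{0..s}. \<Oplus>\<^bsub>?R\<^esub>l\<in>{0..s}. F k l)"
  by (rule rg.finsum_triangle[symmetric]) (use Fc F0 in auto)
 finally have lhs: "pow_op s (d + e) (rmul d e (rmon M d a x) (rmon M e b y)) = ..." .
 \<comment> \<open>the products of operations\<close>
 define G where "G i k l = zmult p ?R (\<epsilon> * (pow_coeff i ?r (int k) * pow_coeff (s - i) ?r' (int l))) (T k l)" for i k l
 have Gc: "G i k l : carrier ?R" for i k l unfolding G_def by (rule rg.zmult_closed[OF Tc])
 have R: "rmul (d - int (pdeg i)) (e - int (pdeg (s - i))) (pow_op i d (rmon M d a x)) (pow_op (s - i) e (rmon M e b y))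
   = (\<Oplus>\<^bsub>?R\<^esub>k\<in>{0..s}. \<Oplus>\<^bsub>?R\<^esub>l\<in>{0..s}. G i k l)" if i: "i \<le> s" for i
 proof -
  let ?d = "d - int (pdeg i)" and ?f = "e - int (pdeg (s - i))"
  let ?a = "\<lambda>k. a + tate_step p * (int i - int k)" and ?b = "\<lambda>l. b + tate_step p * (int (s - i) - int l)"
  have da: "?d + ?a k = ?n - int (pdeg k)" for k using p_pos by (simp add: gen_deg_Pow algebra_simps)
  have fb: "?f + ?b l = ?m - int (pdeg l)" for l using p_pos by (simp add: gen_deg_Pow algebra_simps)
  have df: "?d + ?f = ?D" using pow_deg_add[OF p_pos, of i "s - i"] i by simp
  have ab: "?a k + ?b l = ?e (int k + int l)" for k l using i by (simp add: of_nat_diff algebra_simps)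
  have X': "X k : M $ (?d + ?a k)" and Y': "Y k : M $ (?f + ?b k)" for k
   unfolding da fb by (rule Xc, rule Yc)
  have rX: "rmon M ?d (?a k) (X k) : M $$ ?d" and rY: "rmon M ?f (?b k) (Y k) : M $$ ?f" for k
   by (rule rmon_closed[OF X'], rule rmon_closed[OF Y'])
  let ?u = "\<lambda>k. zmult p (rgrd M ?d) (pow_coeff i ?r (int k)) (rmon M ?d (?a k) (X k))"
  let ?v = "\<lambda>l. zmult p (rgrd M ?f) (pow_coeff (s - i) ?r' (int l)) (rmon M ?f (?b l) (Y l))"
  have uc: "?u k : M $$ ?d" and vc: "?v k : M $$ ?f" for k
   by (rule rg.zmult_closed[OF rX], rule rg.zmult_closed[OF rY])
  have vs: "(\<Oplus>\<^bsub>rgrd M ?f\<^esub>l\<in>{0..s - i}. ?v l) : M $$ ?f" using vc by (intro rg.M.finsum_closed) auto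
  have uv: "rmul ?d ?f (?u k) (?v l) = G i k l" for k l
  proof -
   have "rmul ?d ?f (rmon M ?d (?a k) (X k)) (rmon M ?f (?b l) (Y l)) = zmult p ?R \<epsilon> (T k l)"
    using rmul_rmon[OF X' Y', of k l] unfolding da fb df ab mon_sign_step \<epsilon>_def T_def Z_def .
   then have "rmul ?d ?f (?u k) (?v l) = zmult p ?R (pow_coeff i ?r (int k)) (zmult p ?R (pow_coeff (s - i) ?r' (int l)) (zmult p ?R \<epsilon> (T k l)))"
    unfolding rmul_zmult_left[OF vc rX] rmul_zmult_right[OF rX rY] df by simp
   also have "... = G i k l" using Tc[of k l] by (simp add: G_def rg.zmult_assoc[symmetric] mult.commute mult.left_commute)
   finally show ?thesis .
  qed
  have "rmul ?d ?f (pow_op i d (rmon M d a x)) (pow_op (s - i) e (rmon M e b y))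
   = rmul ?d ?f (\<Oplus>\<^bsub>rgrd M ?d\<^esub>k\<in>{0..i}. ?u k) (\<Oplus>\<^bsub>rgrd M ?f\<^esub>l\<in>{0..s - i}. ?v l)"
   unfolding pow_op_rmon[OF x] pow_op_rmon[OF y] X_def Y_def ..
  also have "... = (\<Oplus>\<^bsub>?R\<^esub>k\<in>{0..i}. rmul ?d ?f (?u k) (\<Oplus>\<^bsub>rgrd M ?f\<^esub>l\<in>{0..s - i}. ?v l))"
   using rmul_finsum_left[OF vs, of ?u "{0..i}" ?d] uc unfolding df by auto
  also have "... = (\<Oplus>\<^bsub>?R\<^esub>k\<in>{0..i}. \<Oplus>\<^bsub>?R\<^esub>l\<in>{0..s - i}. G i k l)"
  proof (rule rg.M.finsum_cong'[OF refl])
   show "(\<lambda>k. \<Oplus>\<^bsub>?R\<^esub>l\<in>{0..s - i}. G i k l) : {0..i} \<rightarrow> carrier ?R" by (intro Pi_I rg.M.finsum_closed Gc)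
   show "rmul ?d ?f (?u k) (\<Oplus>\<^bsub>rgrd M ?f\<^esub>l\<in>{0..s - i}. ?v l) = (\<Oplus>\<^bsub>?R\<^esub>l\<in>{0..s - i}. G i k l)" for k
    using rmul_finsum_right[OF uc, of ?v "{0..s - i}" ?f k] vc unfolding df uv by auto
  qed
  also have "... = (\<Oplus>\<^bsub>?R\<^esub>k\<in>{0..s}. \<Oplus>\<^bsub>?R\<^esub>l\<in>{0..s - i}. G i k l)"
  proof (rule rg.finsum_subset)
   fix k assume "k : {0..s} - {0..i}"
   then have "k > i" by auto
   then have "G i k l = \<zero>\<^bsub>?R\<^esub>" for l using pow_coeff_eq_0[of i k ?r] rg.zmult_0[OF Tc] by (simp add: G_def)
   then show "(\<Oplus>\<^bsub>?R\<^esub>l\<in>{0..s - i}. G i k l) = \<zero>\<^bsub>?R\<^esub>" by (simp add: rg.finsum_neutral)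
  qed (use i Gc in \<open>auto intro!: rg.M.finsum_closed\<close>)
  also have "... = (\<Oplus>\<^bsub>?R\<^esub>k\<in>{0..s}. \<Oplus>\<^bsub>?R\<^esub>l\<in>{0..s}. G i k l)"
  proof (rule rg.M.finsum_cong'[OF refl])
   fix k
   show "(\<Oplus>\<^bsub>?R\<^esub>l\<in>{0..s - i}. G i k l) = (\<Oplus>\<^bsub>?R\<^esub>l\<in>{0..s}. G i k l)"
   proof (rule rg.finsum_subset)
    fix l assume "l : {0..s} - {0..s - i}"
    then have "l > s - i" by auto
    then show "G i k l = \<zero>\<^bsub>?R\<^esub>" using pow_coeff_eq_0[of "s - i" l ?r'] rg.zmult_0[OF Tc] by (simp add: G_def)
   qed (use Gc in auto)
  qed (intro Pi_I rg.M.finsum_closed Gc)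
  finally show ?thesis .
 qed
 have "(\<Oplus>\<^bsub>?R\<^esub>i\<in>{0..s}. rmul (d - int (pdeg i)) (e - int (pdeg (s - i))) (pow_op i d (rmon M d a x)) (pow_op (s - i) e (rmon M e b y)))
  = (\<Oplus>\<^bsub>?R\<^esub>i\<in>{0..s}. \<Oplus>\<^bsub>?R\<^esub>k\<in>{0..s}. \<Oplus>\<^bsub>?R\<^esub>l\<in>{0..s}. G i k l)"
  by (rule rg.M.finsum_cong'[OF refl]) (intro Pi_I rg.M.finsum_closed Gc, simp add: R)
 also have "... = (\<Oplus>\<^bsub>?R\<^esub>k\<in>{0..s}. \<Oplus>\<^bsub>?R\<^esub>i\<in>{0..s}. \<Oplus>\<^bsub>?R\<^esub>l\<in>{0..s}. G i k l)"
  by (rule rg.finsum_swap) (auto intro!: rg.M.finsum_closed Gc)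
 also have "... = (\<Oplus>\<^bsub>?R\<^esub>k\<in>{0..s}. \<Oplus>\<^bsub>?R\<^esub>l\<in>{0..s}. F k l)"
 proof (rule rg.M.finsum_cong'[OF refl])
  fix k
  have "(\<Oplus>\<^bsub>?R\<^esub>i\<in>{0..s}. \<Oplus>\<^bsub>?R\<^esub>l\<in>{0..s}. G i k l) = (\<Oplus>\<^bsub>?R\<^esub>l\<in>{0..s}. \<Oplus>\<^bsub>?R\<^esub>i\<in>{0..s}. G i k l)"
   by (rule rg.finsum_swap) (auto intro!: Gc)
  also have "... = (\<Oplus>\<^bsub>?R\<^esub>l\<in>{0..s}. F k l)"
  proof (rule rg.M.finsum_cong'[OF refl])
   fix l
   have "(\<Oplus>\<^bsub>?R\<^esub>i\<in>{0..s}. G i k l) = zmult p ?R (\<Sum>i\<in>{0..s}. \<epsilon> * (pow_coeff i ?r (int k) * pow_coeff (s - i) ?r' (int l))) (T k l)"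
    unfolding G_def by (rule rg.zmult_sum[OF Tc, symmetric])
   also have "... = F k l"
    unfolding F_def sum_distrib_left[symmetric]
    by (rule rg.zmult_cong, rule cong_scalar_left, rule pow_coeff_convolution) auto
   finally show "(\<Oplus>\<^bsub>?R\<^esub>i\<in>{0..s}. G i k l) = F k l" .
  qed (use Fc in auto)
  finally show "(\<Oplus>\<^bsub>?R\<^esub>i\<in>{0..s}. \<Oplus>\<^bsub>?R\<^esub>l\<in>{0..s}. G i k l) = (\<Oplus>\<^bsub>?R\<^esub>l\<in>{0..s}. F k l)" .
 qed (intro Pi_I rg.M.finsum_closed Fc)
 finally show ?thesis unfolding lhs ..
qed

lemma pow_op_rmul:
 assumes x: "x : M $$ d" and y: "y : M $$ e"
 shows "pow_op s (d + e) (rmul d e x y)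
  = (\<Oplus>\<^bsub>rgrd M (d + e - int (pdeg s))\<^esub>i\<in>{0..s}. rmul (d - int (pdeg i)) (e - int (pdeg (s - i)))
    (pow_op i d x) (pow_op (s - i) e y))"
proof (rule rgrd_bilinear_eqI[OF x y, where W = "rgrd M (d + e - int (pdeg s))"])
 have df: "d - int (pdeg i) + (e - int (pdeg (s - i))) = d + e - int (pdeg s)" if "i : {0..s}" for i
  using pow_deg_add[OF p_pos, of i "s - i"] that by simp
 fix z
 show "(\<lambda>x. pow_op s (d + e) (rmul d e x z)) : Hom p (rgrd M d) (rgrd M (d + e - int (pdeg s)))" if z: "z : M $$ e"
  by (rule mod_hom_comp[OF rmul_mod_hom(1)[OF z] pow_op_hom])
 show "(\<lambda>y. pow_op s (d + e) (rmul d e z y)) : Hom p (rgrd M e) (rgrd M (d + e - int (pdeg s)))" if z: "z : M $$ d"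
  by (rule mod_hom_comp[OF rmul_mod_hom(2)[OF z] pow_op_hom])
 show "(\<lambda>x. \<Oplus>\<^bsub>rgrd M (d + e - int (pdeg s))\<^esub>i\<in>{0..s}. rmul (d - int (pdeg i)) (e - int (pdeg (s - i))) (pow_op i d x) (pow_op (s - i) e z))
   : Hom p (rgrd M d) (rgrd M (d + e - int (pdeg s)))" if z: "z : M $$ e"
 proof (rule mod_hom_finsum[OF rg.Fp_module_axioms rg.Fp_module_axioms])
  fix i assume "i : {0..s}"
  then show "(\<lambda>x. rmul (d - int (pdeg i)) (e - int (pdeg (s - i))) (pow_op i d x) (pow_op (s - i) e z)) : Hom p (rgrd M d) (rgrd M (d + e - int (pdeg s)))"
   using mod_hom_comp[OF pow_op_hom[of i d] rmul_mod_hom(1)[OF mod_hom_closed[OF pow_op_hom[of "s - i" e] z]]] df[of i] by simp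
 qed
 show "(\<lambda>y. \<Oplus>\<^bsub>rgrd M (d + e - int (pdeg s))\<^esub>i\<in>{0..s}. rmul (d - int (pdeg i)) (e - int (pdeg (s - i))) (pow_op i d z) (pow_op (s - i) e y))
   : Hom p (rgrd M e) (rgrd M (d + e - int (pdeg s)))" if z: "z : M $$ d"
 proof (rule mod_hom_finsum[OF rg.Fp_module_axioms rg.Fp_module_axioms])
  fix i assume "i : {0..s}"
  then show "(\<lambda>y. rmul (d - int (pdeg i)) (e - int (pdeg (s - i))) (pow_op i d z) (pow_op (s - i) e y)) : Hom p (rgrd M e) (rgrd M (d + e - int (pdeg s)))"
   using mod_hom_comp[OF pow_op_hom[of "s - i" e] rmul_mod_hom(2)[OF mod_hom_closed[OF pow_op_hom[of i d] z]]] df[of i] by simp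
 qed
qed (rule pow_op_rmul_mon)

theorem r_plus_dg_A_algebra: "dg_A_algebra p RM"
proof (intro dg_A_algebra.intro dg_A_algebra_axioms.intro r_plus_dg_right_A_module)
 fix d e x y assume x: "x : RM $ d" and y: "y : RM $ e"
 then have x': "x : M $$ d" and y': "y : M $$ e" by simp_all
 note xy = rmul_closed[OF x' y']
 have P: "sop RM (Pow s) (d + e) (rmul d e x y) = (\<Oplus>\<^bsub>grd RM (d + e - int (pdeg s))\<^esub>i\<in>{0..s}.
   rmul (d - int (pdeg i)) (e - int (pdeg (s - i))) (sop RM (Pow i) d x) (sop RM (Pow (s - i)) e y))" for s
  using pow_op_rmul[OF x' y', of s] by (simp add: r_plus_Pow xy x' y')
 then show "sop RM (Pow s) (d + e) (rmul d e x y) = (\<Oplus>\<^bsub>grd RM (d + e - int (pdeg s))\<^esub>i\<in>{0..s}.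
   rmul (d - int (pdeg i)) (e - int (pdeg (s - i))) (sop RM (Pow i) d x) (sop RM (Pow (s - i)) e y))" for s .
 show "dif RM (d + e) (rmul d e x y) = rmul (d + 1) e (dif RM d x) y
   \<oplus>\<^bsub>grd RM (d + e + 1)\<^esub> sgn_mult (grd RM (d + e + 1)) d (rmul d (e + 1) x (dif RM e y))"
 proof -
  have i: "d + (e + 1) = d + e + 1" by simp
  have "rmul d (e + 1) x (dif_op M e y) : M $$ (d + e + 1)"
   using rmul_closed[OF x' mod_hom_closed[OF dif_op_hom y']] unfolding i .
  then show ?thesis using dif_op_mul[OF x' y'] by (simp add: r_plus_dif xy x' y' rg.sgn_mult_sg)
 qed
 have i: "d + (e - 1) = d + e - 1" by simp
 show "sop RM Bock (d + e) (rmul d e x y) = rmul (d - 1) e (sop RM Bock d x) y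
   \<oplus>\<^bsub>grd RM (d + e - 1)\<^esub> sgn_mult (grd RM (d + e - 1)) d (rmul d (e - 1) x (sop RM Bock e y))"
 proof (cases "p = 2")
  case False
  have "rmul d (e - 1) x (bock_op e y) : M $$ (d + e - 1)"
   using rmul_closed[OF x' mod_hom_closed[OF bock_op_hom y']] unfolding i .
  then show ?thesis using bock_op_mul[OF False x' y'] by (simp add: r_plus_Bock[OF False] xy x' y' rg.sgn_mult_sg)
 next
  case True
  have g: "int (pdeg 1) = 1" "pdeg 0 = 0" using True by (simp_all add: gen_deg_def)
  have b: "sop RM Bock n z = pow_op 1 n z" if "z : M $$ n" for n z using that by (rule r_plus_Bock_2[OF True])
  have py: "pow_op 1 n z : M $$ (n - 1)" if "z : M $$ n" for n z
   using mod_hom_closed[OF pow_op_hom that, of 1] unfolding g .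
  let ?u = "rmul d (e - 1) x (pow_op 1 e y)" and ?v = "rmul (d - 1) e (pow_op 1 d x) y"
  have u: "?u : M $$ (d + e - 1)" using rmul_closed[OF x' py[OF y']] unfolding i .
  have v: "?v : M $$ (d + e - 1)" using rmul_closed[OF py[OF x'] y'] by (simp add: algebra_simps)
  have "pow_op 1 (d + e) (rmul d e x y) = (\<Oplus>\<^bsub>rgrd M (d + e - 1)\<^esub>i\<in>{0, 1}. rmul (d - int (pdeg i)) (e - int (pdeg (1 - i)))
    (pow_op i d x) (pow_op (1 - i) e y))"
   using pow_op_rmul[OF x' y', of 1] unfolding g by (simp add: atLeast0_atMost_Suc insert_commute)
  also have "... = ?u \<oplus>\<^bsub>rgrd M (d + e - 1)\<^esub> ?v"
   using u v g by (simp add: rg.M.finsum_insert Pi_def r_plus_Pow_0 x' y')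
  finally have 1: "pow_op 1 (d + e) (rmul d e x y) = ?v \<oplus>\<^bsub>rgrd M (d + e - 1)\<^esub> ?u" using u v by (simp add: rg.M.a_comm)
  have "[sg d = 1] (mod int p)" using True by (auto simp: sg_def cong_iff_dvd_diff)
  then have "sgn_mult (rgrd M (d + e - 1)) d ?u = ?u" unfolding rg.sgn_mult_sg[OF u] using rg.zmult_cong rg.zmult_1[OF u] by metis
  then show ?thesis unfolding r_plus_simps b[OF xy] b[OF x'] b[OF y'] 1 by simp
 qed
next
 show "gunit RM : RM $ 0" using runit_closed by simp
 show "sop RM (Pow s) 0 (gunit RM) = \<zero>\<^bsub>grd RM (- int (pdeg s))\<^esub>" if "s > 0" for s
  using pow_op_unit[OF that] runit_closed by (simp add: r_plus_Pow)
 show "sop RM Bock 0 (gunit RM) = \<zero>\<^bsub>grd RM (- 1)\<^esub>"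
 proof (cases "p = 2")
  case True
  have g: "int (pdeg 1) = 1" using True by (simp add: gen_deg_def)
  show ?thesis using pow_op_unit[of 1] unfolding g r_plus_Bock_2[OF True runit_closed] by simp
 next
  case False
  show ?thesis unfolding r_plus_Bock[OF False runit_closed] using bock_op_rmon[of 0 0 "gunit M"] by simp
 qed
qed (simp_all only: r_plus_simps(1) rmul_mod_hom rmul_assoc rmul_unit_left rmul_unit_right)

definition weight :: "int => int => int" where "weight d e = - e - (d + e) * (int p - 1)"

lemma r_fil_eq: "r_fil p M n d = {x : M $$ d. \<forall>e. x e \<noteq> \<zero>\<^bsub>grd M (d + e)\<^esub> \<longrightarrow> weight d e \<le> n}"
 (is "_ = ?F")
proof
 let ?S = "{rmon M d e x | e x. x : M $ (d + e) \<and> - e - (d + e) * (int p - 1) \<le> n}"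
 have S: "?S \<subseteq> M $$ d" by (auto intro: rmon_closed)
 have "submodule ?F (Fp p) (rgrd M d)"
 proof (rule rg.submoduleI_additive)
  fix x y assume "x : ?F" "y : ?F"
  moreover from this have "x e \<noteq> \<zero>\<^bsub>grd M (d + e)\<^esub> \<or> y e \<noteq> \<zero>\<^bsub>grd M (d + e)\<^esub>"
   if "(x \<oplus>\<^bsub>rgrd M d\<^esub> y) e \<noteq> \<zero>\<^bsub>grd M (d + e)\<^esub>" for e
   using that by (auto simp: rgrd_simps(3))
  ultimately show "x \<oplus>\<^bsub>rgrd M d\<^esub> y : ?F" by blast
 qed (auto simp: rgrd_simps(2), simp add: rgrd_simps(2)[symmetric])
 moreover have "?S \<subseteq> ?F" using S by (auto simp: rmon_def weight_def split: if_splits)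
 ultimately show "r_fil p M n d \<subseteq> ?F" unfolding r_fil_def by (intro rg.mod_span_submodule(3)[OF S])
 show "?F \<subseteq> r_fil p M n d"
 proof
  fix x assume x: "x : ?F"
  then have xc: "x : M $$ d" by simp
  have "(\<Oplus>\<^bsub>rgrd M d\<^esub>e\<in>rsupp M d x. rmon M d e (x e)) : r_fil p M n d"
   unfolding r_fil_def
  proof (rule rg.finsum_submodule[OF rg.mod_span_submodule(1)[OF S]], intro Pi_I)
   fix e assume "e : rsupp M d x"
   then have "rmon M d e (x e) : ?S" using x rgrd_coord[OF xc] by (auto simp: rsupp_def weight_def)
   then show "rmon M d e (x e) : mod_span (Fp p) (rgrd M d) ?S" using rg.mod_span_submodule(2)[OF S] by blast
  qed
  then show "x : r_fil p M n d" using rgrd_expand[OF xc finite_rsupp[OF xc] subset_refl] by simp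
 qed
qed

lemma r_filD: "x : r_fil p M n d ==> x : M $$ d"
 "x : r_fil p M n d ==> x e \<noteq> \<zero>\<^bsub>grd M (d + e)\<^esub> ==> weight d e \<le> n"
 by (auto simp: r_fil_eq)

lemma r_fil_submodule: "submodule (r_fil p M n d) (Fp p) (rgrd M d)"
 unfolding r_fil_def by (rule rg.mod_span_submodule) (auto intro: rmon_closed)

lemma rmon_r_fil: "y : M $ (d + e) ==> weight d e \<le> n ==> rmon M d e y : r_fil p M n d"
 unfolding r_fil_eq by (auto intro: rmon_closed) (auto simp: rmon_def split: if_splits)

lemma r_fil_mul:
 assumes x: "x : r_fil p M m d" and y: "y : r_fil p M n e"
 shows "rmul d e x y : r_fil p M (m + n) (d + e)"
proof -
 note xc = r_filD(1)[OF x] and yc = r_filD(1)[OF y]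
 have "(\<Oplus>\<^bsub>rgrd M (d + e)\<^esub>a\<in>rsupp M d x. \<Oplus>\<^bsub>rgrd M (d + e)\<^esub>b\<in>rsupp M e y. rmul_mon p M d e a b (x a) (y b)) : r_fil p M (m + n) (d + e)"
 proof (intro rg.finsum_submodule[OF r_fil_submodule] Pi_I)
  fix a b assume "a : rsupp M d x" "b : rsupp M e y"
  then have "weight d a \<le> m" "weight e b \<le> n" using r_filD(2)[OF x] r_filD(2)[OF y] by (auto simp: rsupp_def)
  moreover have "weight (d + e) (a + b) = weight d a + weight e b" by (simp add: weight_def algebra_simps)
  ultimately have "weight (d + e) (a + b) \<le> m + n" by simp
  then show "rmul_mon p M d e a b (x a) (y b) : r_fil p M (m + n) (d + e)"
   unfolding rmul_mon_eq(2)[OF rgrd_coord[OF xc] rgrd_coord[OF yc]]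
   by (intro rg.submoduleD(6)[OF r_fil_submodule] rmon_r_fil rmul_mon_eq(1) rgrd_coord xc yc)
 qed
 then show ?thesis by (simp add: r_plus_def)
qed

text \<open>A term with \<open>P\<^sup>k\<close> has a nonzero coefficient only if \<open>pk \<le> s\<close>, and it lowers the weight by \<open>tate_step * (s - pk)\<close>.\<close>

lemma r_fil_pow_op:
 assumes x: "x : r_fil p M n d"
 shows "pow_op s d x : r_fil p M n (d - int (pdeg s))"
proof -
 note xc = r_filD(1)[OF x]
 have "weight (d - int (pdeg s)) e \<le> n" if e: "pow_op s d x e \<noteq> \<zero>\<^bsub>grd M (d - int (pdeg s) + e)\<^esub>" for e
 proof -
  let ?e = "\<lambda>k. e - tate_step p * (int s - int k)"
  have "\<exists>k\<in>{0..s}. pow_coeff s (tate_exp p e - (int p - 1) * (int s - int k)) (int k) \<noteq> 0 \<and> x (?e k) \<noteq> \<zero>\<^bsub>grd M (d + ?e k)\<^esub>"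
  proof (rule ccontr)
   assume none: "\<not> ?thesis"
   have "pow_op s d x e = \<zero>\<^bsub>grd M (d - int (pdeg s) + e)\<^esub>"
    unfolding pow_op_def
   proof (rule gr.finsum_neutral)
    fix k assume "k : {0..s}"
    then consider "pow_coeff s (tate_exp p e - (int p - 1) * (int s - int k)) (int k) = 0" | "x (?e k) = \<zero>\<^bsub>grd M (d + ?e k)\<^esub>"
     using none by blast
    then show "zmult p (grd M (d - int (pdeg s) + e)) (pow_coeff s (tate_exp p e - (int p - 1) * (int s - int k)) (int k))
     (sop M (Pow k) (d + ?e k) (x (?e k))) = \<zero>\<^bsub>grd M (d - int (pdeg s) + e)\<^esub>"
    proof cases
     case 1 then show ?thesis using gr.zmult_0[OF pow_op_term[OF xc]] by (simp only:)
    next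
     case 2 then show ?thesis using sp.zero[of "Pow k" "d + ?e k"] unfolding pow_op_deg by (simp only: gr.zmult_zero)
    qed
   qed
   then show False using e by simp
  qed
  then obtain k where k: "pow_coeff s (tate_exp p e - (int p - 1) * (int s - int k)) (int k) \<noteq> 0" "x (?e k) \<noteq> \<zero>\<^bsub>grd M (d + ?e k)\<^esub>" by blast
  have "int s - int p * int k \<ge> 0" using k(1) by (auto simp: pow_coeff_def not_less[symmetric])
  then have "tate_step p * (int s - int p * int k) \<ge> 0" using tate_step_pos[OF p_prime] by simp
  moreover have "weight (d - int (pdeg s)) e = weight d (?e k) - tate_step p * (int s - int p * int k)"
   using p_pos by (simp add: weight_def gen_deg_Pow algebra_simps)
  moreover have "weight d (?e k) \<le> n" by (rule r_filD(2)[OF x k(2)])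
  ultimately show ?thesis by linarith
 qed
 then show ?thesis using mod_hom_closed[OF pow_op_hom xc] by (auto simp: r_fil_eq)
qed

lemma r_fil_bock_op:
 assumes x: "x : r_fil p M n d"
 shows "bock_op d x : r_fil p M n (d - 1)"
proof -
 note xc = r_filD(1)[OF x]
 have "weight (d - 1) e \<le> n" if e: "bock_op d x e \<noteq> \<zero>\<^bsub>grd M (d - 1 + e)\<^esub>" for e
 proof -
  have "x (e - 1) \<noteq> \<zero>\<^bsub>grd M (d + (e - 1))\<^esub>" using e by (auto simp: bock_op_def algebra_simps split: if_splits)
  then have "weight d (e - 1) \<le> n" by (rule r_filD(2)[OF x])
  moreover have "weight (d - 1) e = weight d (e - 1) - 1" by (simp add: weight_def algebra_simps)
  ultimately show ?thesis by linarith
 qed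
 then show ?thesis using mod_hom_closed[OF bock_op_hom xc] by (auto simp: r_fil_eq)
qed

lemma r_fil_dif_op:
 assumes x: "x : r_fil p M n d"
 shows "dif_op M d x : r_fil p M (n + 1) (d + 1)"
proof -
 note xc = r_filD(1)[OF x]
 have p2: "int p \<ge> 2" using p_prime prime_ge_2_nat by force
 have "weight (d + 1) e \<le> n + 1" if e: "dif_op M d x e \<noteq> \<zero>\<^bsub>grd M (d + 1 + e)\<^esub>" for e
 proof -
  have z: "dif M (d + e) \<zero>\<^bsub>grd M (d + e)\<^esub> = \<zero>\<^bsub>grd M (d + 1 + e)\<^esub>" using df.zero[of "d + e"] by (simp add: algebra_simps)
  have i: "d + (e + 1) = d + 1 + e" and j: "d + e + 1 = d + 1 + e" by simp_all
  have "x e \<noteq> \<zero>\<^bsub>grd M (d + e)\<^esub> \<or> x (e + 1) \<noteq> \<zero>\<^bsub>grd M (d + (e + 1))\<^esub>"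
   using e unfolding i by (auto simp: dif_op_def z j split: if_splits)
  then have "weight d e \<le> n \<or> weight d (e + 1) \<le> n" using r_filD(2)[OF x] by blast
  moreover have "weight (d + 1) e = weight d e - (int p - 1)" "weight (d + 1) e = weight d (e + 1) + 1"
   by (simp_all add: weight_def algebra_simps)
  ultimately show ?thesis using p2 by linarith
 qed
 then show ?thesis using mod_hom_closed[OF dif_op_hom xc] by (auto simp: r_fil_eq)
qed

lemma r_fil_sop:
 assumes x: "x : r_fil p M n d"
 shows "sop RM g d x : r_fil p M n (d - deg p g)"
proof (cases g)
 case (Pow s)
 then show ?thesis using r_fil_pow_op[OF x] by (simp add: r_plus_Pow r_filD(1)[OF x])
next
 case Bock
 show ?thesis
 proof (cases "p = 2")
  case True
  then have g: "deg p Bock = int (pdeg 1)" by (simp add: gen_deg_def)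
  show ?thesis unfolding Bock g r_plus_Bock_2[OF True r_filD(1)[OF x]] by (rule r_fil_pow_op[OF x])
 next
  case False
  then show ?thesis using r_fil_bock_op[OF x] Bock by (simp add: r_plus_Bock[OF False] r_filD(1)[OF x])
 qed
qed

theorem r_plus_filtered: "filtered_dg_A_algebra p RM (r_fil p M) 1"
proof -
 have mono: "r_fil p M m d \<subseteq> r_fil p M n d" if "m \<le> n" for m n d
  using that order_trans by (auto simp: r_fil_eq)
 have F: "filtered_dg_right_A_module p RM (r_fil p M) 1"
 proof (intro filtered_dg_right_A_module.intro filtered_dg_right_A_module_axioms.intro r_plus_dg_right_A_module)
  show "submodule (r_fil p M n d) (Fp p) (grd RM d)" for n d using r_fil_submodule by simp
  show "sact p RM k d a x : r_fil p M n (d - int k)" if "a : steenrod_deg p k" "x : r_fil p M n d" for n k d a x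
   by (rule rp.sact_preserves[where H = "r_fil p M n"]) (use that r_fil_submodule r_fil_sop in auto)
  show "dif RM d x : r_fil p M (n + 1) (d + 1)" if "x : r_fil p M n d" for n d x
   using r_fil_dif_op[OF that] by (simp add: r_plus_dif r_filD(1)[OF that])
 qed (rule mono)
 show ?thesis
  by (intro filtered_dg_A_algebra.intro filtered_dg_A_algebra_axioms.intro r_plus_dg_A_algebra F) (rule r_fil_mul)
qed

lemma r_fil_exhaustive:
 assumes x: "x : M $$ d"
 shows "\<exists>n. x : r_fil p M n d"
proof -
 have "finite (weight d ` rsupp M d x)" using finite_rsupp[OF x] by simp
 then obtain n where "\<forall>w\<in>weight d ` rsupp M d x. w \<le> n" by (metis bdd_above_def bdd_above_finite)
 then have "x : r_fil p M n d" using x by (auto simp: r_fil_eq rsupp_def)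
 then show ?thesis ..
qed

text \<open>The weight is \<open>d - p|x|\<close>, hence at most \<open>d - pk\<close>.\<close>

lemma r_fil_bounded_below:
 assumes "!!d. d < k ==> M $ d = {\<zero>\<^bsub>grd M d\<^esub>}" and d: "d \<le> n + int p * k"
 shows "r_fil p M n d = M $$ d"
proof
 show "r_fil p M n d \<subseteq> M $$ d" using r_filD(1) by auto
 show "M $$ d \<subseteq> r_fil p M n d"
 proof
  fix x assume x: "x : M $$ d"
  have "weight d e \<le> n" if "x e \<noteq> \<zero>\<^bsub>grd M (d + e)\<^esub>" for e
  proof -
   have "k \<le> d + e" using assms(1)[of "d + e"] rgrd_coord[OF x, of e] that by force
   then have "int p * k \<le> int p * (d + e)" by (intro mult_left_mono) auto
   moreover have "weight d e = d - int p * (d + e)" by (simp add: weight_def algebra_simps)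
   ultimately show ?thesis using d by linarith
  qed
  then show "x : r_fil p M n d" using x by (simp add: r_fil_eq)
 qed
qed

end

section \<open>Quotient modules\<close>

locale Fp_quotient = Fp_module p W for p and W :: "(int, 'a, 'm) module_scheme" +
 fixes H :: "'a set"
 assumes H: "submodule H (Fp p) W"
begin

abbreviation "Q \<equiv> quot_mod W H"

lemma diff_trans: "x : carrier W ==> y : carrier W ==> z : carrier W ==>
  (x \<ominus>\<^bsub>W\<^esub> y) \<oplus>\<^bsub>W\<^esub> (y \<ominus>\<^bsub>W\<^esub> z) = x \<ominus>\<^bsub>W\<^esub> z"
 by (simp add: a_minus_def M.a_assoc M.r_neg1)

lemma minus_diff: "x : carrier W ==> y : carrier W ==> \<ominus>\<^bsub>W\<^esub> (x \<ominus>\<^bsub>W\<^esub> y) = y \<ominus>\<^bsub>W\<^esub> x"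
 by (simp add: a_minus_def M.minus_add M.a_comm)

text \<open>Cosets are handled through their elements, so that computations in a quotient are computations with representatives.\<close>

lemma coset_iff: "y : carrier W ==> z : H +>\<^bsub>W\<^esub> y \<longleftrightarrow> z : carrier W \<and> z \<ominus>\<^bsub>W\<^esub> y : H"
proof -
 assume y: "y : carrier W"
 have "h \<oplus>\<^bsub>W\<^esub> y \<ominus>\<^bsub>W\<^esub> y = h" if "h : carrier W" for h
  using that y by (simp add: a_minus_def M.a_assoc M.r_neg)
 moreover have "z \<ominus>\<^bsub>W\<^esub> y \<oplus>\<^bsub>W\<^esub> y = z" if "z : carrier W" using that y by (simp add: a_minus_def M.a_assoc M.l_neg)
 ultimately show ?thesis using y submoduleD(1)[OF H] unfolding a_r_coset_def' by (auto 4 4 intro: sym)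
qed

lemma coset_self: "x : carrier W ==> x : H +>\<^bsub>W\<^esub> x"
 using submoduleD(2)[OF H] by (simp add: coset_iff a_minus_def M.r_neg)

lemma coset_eq:
 assumes x: "x : carrier W" and y: "y : carrier W"
 shows "H +>\<^bsub>W\<^esub> x = H +>\<^bsub>W\<^esub> y \<longleftrightarrow> x \<ominus>\<^bsub>W\<^esub> y : H"
proof
 assume "H +>\<^bsub>W\<^esub> x = H +>\<^bsub>W\<^esub> y"
 then show "x \<ominus>\<^bsub>W\<^esub> y : H" using coset_self[OF x] coset_iff[OF y] by blast
next
 assume h: "x \<ominus>\<^bsub>W\<^esub> y : H"
 have "z \<ominus>\<^bsub>W\<^esub> y : H \<longleftrightarrow> z \<ominus>\<^bsub>W\<^esub> x : H" if z: "z : carrier W" for z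
 proof -
  have "y \<ominus>\<^bsub>W\<^esub> x : H" using submoduleD(4)[OF H h] by (simp add: minus_diff x y)
  then show ?thesis using h submoduleD(3)[OF H] diff_trans[OF z x y] diff_trans[OF z y x] by metis
 qed
 then show "H +>\<^bsub>W\<^esub> x = H +>\<^bsub>W\<^esub> y" using coset_iff[OF x] coset_iff[OF y] by blast
qed

lemma quot_carrier: "carrier Q = {H +>\<^bsub>W\<^esub> x | x. x : carrier W}"
 by (auto simp: quot_mod_def A_RCOSETS_def')

lemma coset_closed [simp, intro]: "x : carrier W ==> H +>\<^bsub>W\<^esub> x : carrier Q" by (auto simp: quot_carrier)

lemma quotE:
 assumes "X : carrier Q" obtains x where "x : carrier W" "x : X" "X = H +>\<^bsub>W\<^esub> x"
 using assms coset_self by (auto simp: quot_carrier)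

lemma quot_rep:
 assumes "X : carrier Q" "x : X" shows "x : carrier W" "X = H +>\<^bsub>W\<^esub> x"
proof -
 obtain y where y: "y : carrier W" "X = H +>\<^bsub>W\<^esub> y" by (rule quotE[OF assms(1)])
 then show x: "x : carrier W" using assms(2) by (simp add: coset_iff)
 show "X = H +>\<^bsub>W\<^esub> x" using assms(2) coset_iff[OF y(1)] coset_eq[OF x y(1)] unfolding y(2) by blast
qed

lemma quot_diff: "X : carrier Q ==> x : X ==> y : X ==> x \<ominus>\<^bsub>W\<^esub> y : H"
 using quot_rep coset_eq by metis

lemma quot_zero: "\<zero>\<^bsub>Q\<^esub> = H" by (simp add: quot_mod_def)

lemma coset_zero: "H +>\<^bsub>W\<^esub> \<zero>\<^bsub>W\<^esub> = H"
 using submoduleD(1)[OF H] by (auto simp: coset_iff a_minus_def)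

lemma set_add_coset:
 assumes x: "x : carrier W" and Z: "Z \<subseteq> carrier W" "x : Z" "!!z. z : Z ==> z \<ominus>\<^bsub>W\<^esub> x : H"
 shows "Z <+>\<^bsub>W\<^esub> H = H +>\<^bsub>W\<^esub> x"
proof
 show "Z <+>\<^bsub>W\<^esub> H \<subseteq> H +>\<^bsub>W\<^esub> x"
 proof
  fix w assume "w : Z <+>\<^bsub>W\<^esub> H"
  then obtain z h where w: "z : Z" "h : H" "w = z \<oplus>\<^bsub>W\<^esub> h" by (auto simp: set_add_def')
  then have c: "z : carrier W" "h : carrier W" using Z submoduleD(1)[OF H] by auto
  have "w \<ominus>\<^bsub>W\<^esub> x = (z \<ominus>\<^bsub>W\<^esub> x) \<oplus>\<^bsub>W\<^esub> h" using c x by (simp add: w a_minus_def M.a_ac)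
  then show "w : H +>\<^bsub>W\<^esub> x" using Z(3)[OF w(1)] w submoduleD(3)[OF H] c by (simp add: coset_iff[OF x])
 qed
 show "H +>\<^bsub>W\<^esub> x \<subseteq> Z <+>\<^bsub>W\<^esub> H"
  using Z(2) x submoduleD(1)[OF H] by (auto simp: a_r_coset_def' set_add_def' intro!: bexI[of _ x] M.a_comm)
qed

lemma coset_add:
 assumes x: "x : carrier W" and y: "y : carrier W"
 shows "(H +>\<^bsub>W\<^esub> x) \<oplus>\<^bsub>Q\<^esub> (H +>\<^bsub>W\<^esub> y) = H +>\<^bsub>W\<^esub> (x \<oplus>\<^bsub>W\<^esub> y)"
proof -
 interpret abelian_subgroup H W
  by (rule abelian_subgroupI3[OF _ M.abelian_group_axioms]) (use H in \<open>simp add: submodule_def additive_subgroup_def\<close>)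
 show ?thesis using a_rcos_sum[OF x y] by (simp add: quot_mod_def)
qed

lemma coset_smult:
 assumes c: "c : carrier (Fp p)" and x: "x : carrier W"
 shows "c \<odot>\<^bsub>Q\<^esub> (H +>\<^bsub>W\<^esub> x) = H +>\<^bsub>W\<^esub> (c \<odot>\<^bsub>W\<^esub> x)"
proof -
 have d: "c \<odot>\<^bsub>W\<^esub> z \<ominus>\<^bsub>W\<^esub> c \<odot>\<^bsub>W\<^esub> x : H" if "z : H +>\<^bsub>W\<^esub> x" for z
 proof -
  have z: "z : carrier W" "z \<ominus>\<^bsub>W\<^esub> x : H" using that by (auto simp: coset_iff[OF x])
  then have "c \<odot>\<^bsub>W\<^esub> (z \<ominus>\<^bsub>W\<^esub> x) : H" using submoduleE(4)[OF H] c by blast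
  then show ?thesis using c x z(1) by (simp add: a_minus_def smult_r_distr smult_r_minus)
 qed
 have "((\<odot>\<^bsub>W\<^esub>) c ` (H +>\<^bsub>W\<^esub> x)) <+>\<^bsub>W\<^esub> H = H +>\<^bsub>W\<^esub> (c \<odot>\<^bsub>W\<^esub> x)"
  by (rule set_add_coset) (use c x d coset_self[OF x] in \<open>auto simp: coset_iff\<close>)
 then show ?thesis by (simp add: quot_mod_def)
qed

lemma Fp_module_quot: "Fp_module p Q"
proof (rule Fp_moduleI[OF p_prime])
 have cs: "c \<odot>\<^bsub>Q\<^esub> (H +>\<^bsub>W\<^esub> x) = H +>\<^bsub>W\<^esub> zmult p W c x" if "0 \<le> c" "c < int p" "x : carrier W" for c x
  using coset_smult[of c x] that by (simp add: Fp_simps smult_zmult)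
 show "abelian_group Q"
 proof (rule abelian_groupI)
  show "\<zero>\<^bsub>Q\<^esub> : carrier Q" using coset_closed[of "\<zero>\<^bsub>W\<^esub>"] by (simp add: coset_zero quot_zero)
  fix X assume "X : carrier Q"
  then obtain x where x: "x : carrier W" "X = H +>\<^bsub>W\<^esub> x" by (rule quotE)
  have 0: "\<zero>\<^bsub>Q\<^esub> = H +>\<^bsub>W\<^esub> \<zero>\<^bsub>W\<^esub>" by (simp add: coset_zero quot_zero)
  show "\<zero>\<^bsub>Q\<^esub> \<oplus>\<^bsub>Q\<^esub> X = X" unfolding 0 x(2) by (simp add: coset_add x)
  show "\<exists>Y\<in>carrier Q. Y \<oplus>\<^bsub>Q\<^esub> X = \<zero>\<^bsub>Q\<^esub>" unfolding 0 x(2)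
   by (rule bexI[of _ "H +>\<^bsub>W\<^esub> (\<ominus>\<^bsub>W\<^esub> x)"]) (simp_all add: coset_add x M.l_neg)
 qed (auto elim!: quotE simp: coset_add M.a_ac)
 have p: "1 < int p" using p_prime prime_gt_1_nat by simp
 show "1 \<odot>\<^bsub>Q\<^esub> X = X" if X: "X : carrier Q" for X
  using p by (rule_tac quotE[OF X]) (simp add: cs)
 show "c \<odot>\<^bsub>Q\<^esub> X : carrier Q" if "c : {0..<int p}" and X: "X : carrier Q" for c X
  using that(1) by (rule_tac quotE[OF X]) (simp add: cs)
 show "((c + d) mod int p) \<odot>\<^bsub>Q\<^esub> X = c \<odot>\<^bsub>Q\<^esub> X \<oplus>\<^bsub>Q\<^esub> d \<odot>\<^bsub>Q\<^esub> X"
  if "c : {0..<int p}" "d : {0..<int p}" and X: "X : carrier Q" for c d X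
  using that(1,2) p by (rule_tac quotE[OF X]) (simp add: cs coset_add zmult_mod zmult_l_distr)
 show "((c * d) mod int p) \<odot>\<^bsub>Q\<^esub> X = c \<odot>\<^bsub>Q\<^esub> (d \<odot>\<^bsub>Q\<^esub> X)"
  if "c : {0..<int p}" "d : {0..<int p}" and X: "X : carrier Q" for c d X
  using that(1,2) p by (rule_tac quotE[OF X]) (simp add: cs zmult_mod zmult_assoc)
 show "c \<odot>\<^bsub>Q\<^esub> (X \<oplus>\<^bsub>Q\<^esub> Y) = c \<odot>\<^bsub>Q\<^esub> X \<oplus>\<^bsub>Q\<^esub> c \<odot>\<^bsub>Q\<^esub> Y"
  if "c : {0..<int p}" and X: "X : carrier Q" and Y: "Y : carrier Q" for c X Y
  using that(1) by (rule_tac quotE[OF X], rule_tac quotE[OF Y]) (simp add: cs coset_add zmult_r_distr)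
qed

lemma coset_hom: "(\<lambda>x. H +>\<^bsub>W\<^esub> x) : Hom p W Q"
 by (rule mod_homI[OF Fp_module_axioms Fp_module_quot]) (auto simp: coset_add)

end

sublocale Fp_quotient \<subseteq> qt: Fp_module p Q by (rule Fp_module_quot)
sublocale Fp_quotient \<subseteq> co: Fp_module_hom p W Q "\<lambda>x. H +>\<^bsub>W\<^esub> x"
 by (rule Fp_module_homI[OF Fp_module_axioms Fp_module_quot coset_hom])

lemma quot_map_coset:
 assumes V: "Fp_quotient p V K" and W: "Fp_quotient p W H"
  and f: "f : Hom p V W" and KH: "!!x. x : K ==> f x : H"
  and X: "X : carrier (quot_mod V K)" and x: "x : X"
 shows "quot_map W H f X = H +>\<^bsub>W\<^esub> f x"
proof -
 interpret V: Fp_quotient p V K by (rule V)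
 interpret W: Fp_quotient p W H by (rule W)
 interpret f: Fp_module_hom p V W f by (rule Fp_module_homI[OF V.Fp_module_axioms W.Fp_module_axioms f])
 have c: "z : carrier V" if "z : X" for z by (rule V.quot_rep(1)[OF X that])
 have "f z \<ominus>\<^bsub>W\<^esub> f x : H" if "z : X" for z
  using KH[OF V.quot_diff[OF X that x]] c x that by (simp add: f.diff)
 then show ?thesis unfolding quot_map_def using c x by (intro W.set_add_coset) auto
qed

section \<open>Completion\<close>

text \<open>Exactly what is needed to complete: the tensor square is completed before anything about an action of the Steenrod algebra on it is known.\<close>

locale filtered_ops = graded_ops p V for p and V :: "('a, 'z) dgmod_scheme" +
 fixes Fl :: "int => int => 'a set" and s :: int
 assumes Fl_submodule: "!!n d. submodule (Fl n d) (Fp p) (grd V d)"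
  and Fl_mono: "!!m n d. m \<le> n ==> Fl m d \<subseteq> Fl n d"
  and Fl_sop: "!!n g d x. x : Fl n d ==> sop V g d x : Fl n (d - deg p g)"
  and dif_hom: "!!d. dif V d : Hom p (grd V d) (grd V (d + 1))"
  and Fl_dif: "!!n d x. x : Fl n d ==> dif V d x : Fl (n + s) (d + 1)"

sublocale filtered_ops \<subseteq> q: Fp_quotient p "grd V d" "Fl n d" for n d
 by (intro Fp_quotient.intro Fp_quotient_axioms.intro gr.Fp_module_axioms Fl_submodule)

context filtered_ops begin

abbreviation "C \<equiv> completion s p V Fl"
abbreviation "CF \<equiv> compl_fil s p V Fl"

lemma C_simps:
 "\<zero>\<^bsub>grd C d\<^esub> = (\<lambda>n. Fl n d)"
 "X \<oplus>\<^bsub>grd C d\<^esub> Y = (\<lambda>n. X n \<oplus>\<^bsub>quot_mod (grd V d) (Fl n d)\<^esub> Y n)"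
 "c \<odot>\<^bsub>grd C d\<^esub> X = (\<lambda>n. c \<odot>\<^bsub>quot_mod (grd V d) (Fl n d)\<^esub> X n)"
 by (simp_all add: completion_def q.quot_zero)

text \<open>Compatibility under the projections means that the cosets increase with the level.\<close>

lemma C_iff: "X : C $ d \<longleftrightarrow>
  (\<forall>n. X n : carrier (quot_mod (grd V d) (Fl n d))) \<and> (\<forall>m n. m \<le> n \<longrightarrow> X m \<subseteq> X n)"
proof -
 have key: "quot_map (grd V d) (Fl n d) id (X m) = X n \<longleftrightarrow> X m \<subseteq> X n"
  if c: "!!n. X n : carrier (quot_mod (grd V d) (Fl n d))" and mn: "m \<le> n" for m n
 proof -
  have "id : Hom p (grd V d) (grd V d)" by (auto simp: mod_hom_def)
  have *: "quot_map (grd V d) (Fl n d) id (X m) = Fl n d +>\<^bsub>grd V d\<^esub> id x" if "x : X m" for x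
   by (rule quot_map_coset[OF q.Fp_quotient_axioms q.Fp_quotient_axioms \<open>id \<in> _\<close> _ c that]) (use Fl_mono[OF mn] in auto)
  obtain x where x: "x : V $ d" "x : X m" by (rule q.quotE[OF c])
  show ?thesis
  proof
   assume "quot_map (grd V d) (Fl n d) id (X m) = X n"
   then have "X n = Fl n d +>\<^bsub>grd V d\<^esub> z" if "z : X m" for z using *[OF that] by simp
   then show "X m \<subseteq> X n" using q.coset_self q.quot_rep(1)[OF c] by blast
  next
   assume "X m \<subseteq> X n"
   then have "X n = Fl n d +>\<^bsub>grd V d\<^esub> x" using q.quot_rep(2)[OF c] x(2) by blast
   then show "quot_map (grd V d) (Fl n d) id (X m) = X n" using *[OF x(2)] by simp
  qed
 qed
 have C: "X : C $ d \<longleftrightarrow> (\<forall>n. X n : carrier (quot_mod (grd V d) (Fl n d))) \<and>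
   (\<forall>m n. m \<le> n \<longrightarrow> quot_map (grd V d) (Fl n d) id (X m) = X n)"
  by (simp add: completion_def)
 show ?thesis
 proof (cases "\<forall>n. X n : carrier (quot_mod (grd V d) (Fl n d))")
  case True
  then have "quot_map (grd V d) (Fl n d) id (X m) = X n \<longleftrightarrow> X m \<subseteq> X n" if "m \<le> n" for m n using key[OF _ that] by blast
  then show ?thesis unfolding C by (simp only: True cong: imp_cong)
 qed (simp only: C, blast)
qed

lemma C_quot: "X : C $ d ==> X n : carrier (quot_mod (grd V d) (Fl n d))"
 by (simp add: C_iff)

lemma C_mono: "X : C $ d ==> x : X m ==> m \<le> n ==> x : X n"
 by (auto simp: C_iff)

lemma C_rep: "X : C $ d ==> x : X n ==> x : V $ d"
 "X : C $ d ==> x : X n ==> X n = Fl n d +>\<^bsub>grd V d\<^esub> x"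
 by (rule q.quot_rep(1)[OF C_quot], assumption+) (rule q.quot_rep(2)[OF C_quot], assumption+)

lemma C_obtain: assumes "X : C $ d" obtains x where "x : X n" "x : V $ d"
 by (rule q.quotE[OF C_quot[OF assms, of n]]) (rule that)

lemma C_diff: "X : C $ d ==> x : X m ==> y : X n ==> m \<le> n ==> x \<ominus>\<^bsub>grd V d\<^esub> y : Fl n d"
 by (rule q.quot_diff[OF C_quot C_mono])

lemma C_memI:
 assumes X: "X : C $ d" "x : X n" and y: "y : V $ d" "y \<ominus>\<^bsub>grd V d\<^esub> x : Fl n d"
 shows "y : X n"
proof -
 have "y : Fl n d +>\<^bsub>grd V d\<^esub> x" unfolding q.coset_iff[OF C_rep(1)[OF X]] using y by blast
 then show ?thesis by (subst C_rep(2)[OF X])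
qed

text \<open>Cosets that meet are equal.\<close>

lemma C_eqI:
 assumes "X : C $ d" "Y : C $ d" "!!n. \<exists>x. x : X n \<and> x : Y n"
 shows "X = Y"
proof
 fix n
 obtain x where x: "x : X n" "x : Y n" using assms(3) by blast
 show "X n = Y n" by (simp only: C_rep(2)[OF assms(1) x(1)] C_rep(2)[OF assms(2) x(2)])
qed

lemma C_I:
 assumes x: "!!n. x n : V $ d" and "!!m n. m \<le> n ==> x m \<ominus>\<^bsub>grd V d\<^esub> x n : Fl n d"
 shows "(\<lambda>n. Fl n d +>\<^bsub>grd V d\<^esub> x n) : C $ d"
proof -
 have "Fl m d +>\<^bsub>grd V d\<^esub> x m \<subseteq> Fl n d +>\<^bsub>grd V d\<^esub> x n" if mn: "m \<le> n" for m n
 proof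
  fix z assume "z : Fl m d +>\<^bsub>grd V d\<^esub> x m"
  then have "z : V $ d" "z \<ominus>\<^bsub>grd V d\<^esub> x m : Fl n d" using Fl_mono[OF mn] by (auto simp: q.coset_iff[OF x])
  then have "z : Fl n d +>\<^bsub>grd V d\<^esub> x m" by (simp add: q.coset_iff[OF x])
  then show "z : Fl n d +>\<^bsub>grd V d\<^esub> x n" using q.coset_eq[OF x x] assms(2)[OF mn] by blast
 qed
 then show ?thesis using x by (auto simp: C_iff)
qed

lemma add_mem:
 assumes "X : C $ d" "Y : C $ d" "x : X n" "y : Y n"
 shows "x \<oplus>\<^bsub>grd V d\<^esub> y : (X \<oplus>\<^bsub>grd C d\<^esub> Y) n"
 using assms C_rep(1)[OF assms(1,3)] C_rep(1)[OF assms(2,4)] C_rep(2)[OF assms(1,3)] C_rep(2)[OF assms(2,4)]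
 by (simp add: C_simps q.coset_add q.coset_self)

lemma zero_mem: "\<zero>\<^bsub>grd V d\<^esub> : \<zero>\<^bsub>grd C d\<^esub> n"
 using gr.submoduleD(2)[OF Fl_submodule] by (simp add: C_simps)

text \<open>Cosets at two levels that meet are compatible.\<close>

lemma C_closedI:
 assumes "!!n. Z n : carrier (quot_mod (grd V d) (Fl n d))" "!!m n. m \<le> n ==> \<exists>z. z : Z m \<and> z : Z n"
 shows "Z : C $ d"
proof -
 define z where "z n = (SOME x. x : Z n)" for n
 have z: "z n : Z n" for n unfolding z_def using q.quotE[OF assms(1), of n] someI by metis
 note zc = q.quot_rep[OF assms(1) z]
 have "z m \<ominus>\<^bsub>grd V d\<^esub> z n : Fl n d" if mn: "m \<le> n" for m n
 proof -
  obtain w where w: "w : Z m" "w : Z n" using assms(2)[OF mn] by blast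
  have "z m \<ominus>\<^bsub>grd V d\<^esub> w : Fl n d" using q.quot_diff[OF assms(1) z w(1)] Fl_mono[OF mn] by blast
  moreover have "w \<ominus>\<^bsub>grd V d\<^esub> z n : Fl n d" by (rule q.quot_diff[OF assms(1) w(2) z])
  moreover have "z m \<ominus>\<^bsub>grd V d\<^esub> z n = (z m \<ominus>\<^bsub>grd V d\<^esub> w) \<oplus>\<^bsub>grd V d\<^esub> (w \<ominus>\<^bsub>grd V d\<^esub> z n)"
   using zc(1) q.quot_rep(1)[OF assms(1) w(1)] by (simp add: a_minus_def gr.M.a_ac gr.M.r_neg1 gr.M.r_neg2)
  ultimately show ?thesis using gr.submoduleD(3)[OF Fl_submodule] by simp
 qed
 from C_I[OF zc(1) this] have "(\<lambda>n. Fl n d +>\<^bsub>grd V d\<^esub> z n) : C $ d" .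
 moreover have "(\<lambda>n. Fl n d +>\<^bsub>grd V d\<^esub> z n) = Z" by (rule ext) (rule zc(2)[symmetric])
 ultimately show ?thesis by simp
qed

lemma smult_mem:
 assumes "c : carrier (Fp p)" "X : C $ d" "x : X n"
 shows "c \<odot>\<^bsub>grd V d\<^esub> x : (c \<odot>\<^bsub>grd C d\<^esub> X) n"
 using C_rep[OF assms(2,3)] assms(1) by (simp add: C_simps q.coset_smult q.coset_self)

lemma C_closed:
 "\<zero>\<^bsub>grd C d\<^esub> : C $ d"
 "X : C $ d ==> Y : C $ d ==> X \<oplus>\<^bsub>grd C d\<^esub> Y : C $ d"
 "c : carrier (Fp p) ==> X : C $ d ==> c \<odot>\<^bsub>grd C d\<^esub> X : C $ d"
proof -
 show "\<zero>\<^bsub>grd C d\<^esub> : C $ d"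
  using q.qt.M.zero_closed Fl_mono unfolding C_iff C_simps q.quot_zero by blast
 assume X: "X : C $ d"
 show "X \<oplus>\<^bsub>grd C d\<^esub> Y : C $ d" if Y: "Y : C $ d"
 proof (rule C_closedI)
  show "(X \<oplus>\<^bsub>grd C d\<^esub> Y) n : carrier (quot_mod (grd V d) (Fl n d))" for n
   unfolding C_simps by (intro q.qt.M.a_closed C_quot X Y)
  fix m n :: int assume mn: "m \<le> n"
  obtain x where x: "x : X m" by (rule C_obtain[OF X])
  obtain y where y: "y : Y m" by (rule C_obtain[OF Y])
  show "\<exists>z. z : (X \<oplus>\<^bsub>grd C d\<^esub> Y) m \<and> z : (X \<oplus>\<^bsub>grd C d\<^esub> Y) n"
   using add_mem[OF X Y x y] add_mem[OF X Y C_mono[OF X x mn] C_mono[OF Y y mn]] by blast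
 qed
 show "c \<odot>\<^bsub>grd C d\<^esub> X : C $ d" if c: "c : carrier (Fp p)"
 proof (rule C_closedI)
  show "(c \<odot>\<^bsub>grd C d\<^esub> X) n : carrier (quot_mod (grd V d) (Fl n d))" for n
   unfolding C_simps by (intro q.qt.smult_closed C_quot X c)
  fix m n :: int assume mn: "m \<le> n"
  obtain x where x: "x : X m" by (rule C_obtain[OF X])
  show "\<exists>z. z : (c \<odot>\<^bsub>grd C d\<^esub> X) m \<and> z : (c \<odot>\<^bsub>grd C d\<^esub> X) n"
   using smult_mem[OF c X x] smult_mem[OF c X C_mono[OF X x mn]] by blast
 qed
qed

lemma C_module: "Fp_module p (grd C d)"
proof (rule Fp_moduleI[OF p_prime])
 show "abelian_group (grd C d)"
 proof (rule abelian_groupI)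
  fix X assume X: "X : C $ d"
  define Y where "Y n = \<ominus>\<^bsub>quot_mod (grd V d) (Fl n d)\<^esub> X n" for n
  have "Y = (- 1 mod int p) \<odot>\<^bsub>grd C d\<^esub> X"
  proof
   fix n
   show "Y n = ((- 1 mod int p) \<odot>\<^bsub>grd C d\<^esub> X) n"
    using q.qt.zmult_minus[OF C_quot[OF X], of n 1] q.qt.zmult_1[OF C_quot[OF X]] by (simp add: Y_def C_simps zmult_def)
  qed
  then have "Y : C $ d" using C_closed(3)[OF _ X] p_prime by (simp add: Fp_simps prime_gt_0_nat)
  moreover have "Y \<oplus>\<^bsub>grd C d\<^esub> X = \<zero>\<^bsub>grd C d\<^esub>"
   using q.qt.M.l_neg[OF C_quot[OF X]] by (simp add: C_simps Y_def q.quot_zero)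
  ultimately show "\<exists>Y\<in>C $ d. Y \<oplus>\<^bsub>grd C d\<^esub> X = \<zero>\<^bsub>grd C d\<^esub>" by blast
  show "\<zero>\<^bsub>grd C d\<^esub> \<oplus>\<^bsub>grd C d\<^esub> X = X" using q.qt.M.l_zero[OF C_quot[OF X]] by (simp add: C_simps q.quot_zero)
 qed (auto simp: C_closed, auto simp: C_simps q.qt.M.a_ac C_quot)
 have p: "1 < int p" using p_prime prime_gt_1_nat by simp
 note smult = q.qt.smult_zmult q.qt.zmult_mod
 show "1 \<odot>\<^bsub>grd C d\<^esub> X = X" if X: "X : C $ d" for X
  using p C_quot[OF X] by (simp add: C_simps smult)
 show "c \<odot>\<^bsub>grd C d\<^esub> X : C $ d" if "c : {0..<int p}" "X : C $ d" for c X
  using C_closed(3)[OF _ that(2)] that(1) p by (simp add: Fp_simps)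
 have r: "c mod int p : {0..<int p}" for c using p by simp
 show "((c + e) mod int p) \<odot>\<^bsub>grd C d\<^esub> X = c \<odot>\<^bsub>grd C d\<^esub> X \<oplus>\<^bsub>grd C d\<^esub> e \<odot>\<^bsub>grd C d\<^esub> X"
  if "c : {0..<int p}" "e : {0..<int p}" "X : C $ d" for c e X
  using C_quot[OF that(3)] by (simp only: C_simps smult that(1,2) r q.qt.zmult_l_distr)
 show "((c * e) mod int p) \<odot>\<^bsub>grd C d\<^esub> X = c \<odot>\<^bsub>grd C d\<^esub> (e \<odot>\<^bsub>grd C d\<^esub> X)"
  if "c : {0..<int p}" "e : {0..<int p}" "X : C $ d" for c e X
  using C_quot[OF that(3)] by (simp only: C_simps smult that(1,2) r q.qt.zmult_assoc)
 show "c \<odot>\<^bsub>grd C d\<^esub> (X \<oplus>\<^bsub>grd C d\<^esub> Y) = c \<odot>\<^bsub>grd C d\<^esub> X \<oplus>\<^bsub>grd C d\<^esub> c \<odot>\<^bsub>grd C d\<^esub> Y"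
  if "c : {0..<int p}" "X : C $ d" "Y : C $ d" for c X Y
  using C_quot[OF that(2)] C_quot[OF that(3)] by (simp only: C_simps smult that(1) q.qt.zmult_r_distr)
qed

end

sublocale filtered_ops \<subseteq> cm: Fp_module p "grd (completion s p V Fl) d" for d by (rule C_module)

context filtered_ops begin

lemma zmult_mem: "X : C $ d ==> x : X n ==> zmult p (grd V d) c x : zmult p (grd C d) c X n"
proof -
 assume X: "X : C $ d" and x: "x : X n"
 have "zmult p (grd C d) c X n = Fl n d +>\<^bsub>grd V d\<^esub> zmult p (grd V d) c x"
  unfolding q.co.zmult[OF C_rep(1)[OF X x]] using C_rep(2)[OF X x] by (simp add: zmult_def C_simps)
 then show ?thesis using q.coset_self C_rep(1)[OF X x] by simp
qed

lemma sgn_mem: "X : C $ d ==> x : X n ==> sgn_mult (grd V d) e x : sgn_mult (grd C d) e X n"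
 using zmult_mem by (simp add: gr.sgn_mult_zmult cm.sgn_mult_zmult C_rep(1))

lemma diff_mem:
 assumes "X : C $ d" "Y : C $ d" "x : X n" "y : Y n"
 shows "x \<ominus>\<^bsub>grd V d\<^esub> y : (X \<ominus>\<^bsub>grd C d\<^esub> Y) n"
proof -
 have "\<ominus>\<^bsub>grd V d\<^esub> y : (\<ominus>\<^bsub>grd C d\<^esub> Y) n" using sgn_mem[OF assms(2,4), of 1] by (simp add: sgn_mult_def)
 then show ?thesis unfolding a_minus_def using assms by (intro add_mem) auto
qed

lemma finsum_mem:
 assumes "!!i. i : A ==> X i : C $ d" "!!i. i : A ==> x i : X i n"
 shows "finsum (grd V d) x A : finsum (grd C d) X A n"
 using assms
proof (induction A rule: infinite_finite_induct)
 case (insert a A)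
 then have "x i : V $ d" if "i : insert a A" for i using C_rep(1) that by blast
 then show ?case using insert
  by (simp add: gr.M.finsum_insert cm.M.finsum_insert Pi_def) (rule add_mem, auto simp: cm.M.finsum_closed Pi_def)
qed (simp_all add: zero_mem gr.M.finsum_infinite cm.M.finsum_infinite)

text \<open>Covers operations (\<open>c = 0\<close>) and the differential (\<open>c = s\<close>).\<close>

lemma compl_hom:
 assumes f: "f : Hom p (grd V d) (grd V e)" and Fl: "!!n x. x : Fl (n - c) d ==> f x : Fl n e"
  and F: "!!X n. F X n = quot_map (grd V e) (Fl n e) f (X (n - c))"
 shows "X : C $ d ==> x : X (n - c) ==> f x : F X n"
  and "F : Hom p (grd C d) (grd C e)"
proof -
 have coset: "F X n = Fl n e +>\<^bsub>grd V e\<^esub> f x" if "X : C $ d" "x : X (n - c)" for X x n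
  unfolding F by (rule quot_map_coset[OF q.Fp_quotient_axioms q.Fp_quotient_axioms f Fl C_quot[OF that(1)] that(2)])
 show mem: "f x : F X n" if "X : C $ d" "x : X (n - c)" for X x n
  unfolding coset[OF that] by (rule q.coset_self[OF mod_hom_closed[OF f C_rep(1)[OF that]]])
 have closed: "F X : C $ e" if X: "X : C $ d" for X
 proof (rule C_closedI)
  fix m n :: int
  obtain x where x: "x : X (m - c)" by (rule C_obtain[OF X])
  show "\<exists>z. z : F X m \<and> z : F X n" if "m \<le> n"
   using mem[OF X x] mem[OF X C_mono[OF X x]] that by auto
  obtain x where x: "x : X (n - c)" by (rule C_obtain[OF X])
  show "F X n : carrier (quot_mod (grd V e) (Fl n e))"
   unfolding coset[OF X x] by (rule q.coset_closed[OF mod_hom_closed[OF f C_rep(1)[OF X x]]])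
 qed
 show "F : Hom p (grd C d) (grd C e)"
 proof (rule mod_homI[OF C_module C_module closed])
  fix X Y assume X: "X : C $ d" and Y: "Y : C $ d"
  show "F (X \<oplus>\<^bsub>grd C d\<^esub> Y) = F X \<oplus>\<^bsub>grd C e\<^esub> F Y"
  proof (rule C_eqI[OF closed[OF C_closed(2)[OF X Y]] C_closed(2)[OF closed[OF X] closed[OF Y]]])
   fix n
   obtain x where x: "x : X (n - c)" by (rule C_obtain[OF X])
   obtain y where y: "y : Y (n - c)" by (rule C_obtain[OF Y])
   show "\<exists>z. z : F (X \<oplus>\<^bsub>grd C d\<^esub> Y) n \<and> z : (F X \<oplus>\<^bsub>grd C e\<^esub> F Y) n"
    using mem[OF C_closed(2)[OF X Y] add_mem[OF X Y x y]] add_mem[OF closed[OF X] closed[OF Y] mem[OF X x] mem[OF Y y]]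
    unfolding mod_hom_add[OF f C_rep(1)[OF X x] C_rep(1)[OF Y y]] by blast
  qed
 qed
qed

lemma sop_mem: "X : C $ d ==> x : X n ==> sop V g d x : sop C g d X n"
 and sop_C_hom: "sop C g d : Hom p (grd C d) (grd C (d - deg p g))"
proof -
 have Fl: "sop V g d x : Fl n (d - deg p g)" if "x : Fl (n - 0) d" for n x using Fl_sop[of x n d g] that by simp
 have F: "sop C g d X n = quot_map (grd V (d - deg p g)) (Fl n (d - deg p g)) (sop V g d) (X (n - 0))" for X n
  by (simp add: completion_def)
 show "X : C $ d ==> x : X n ==> sop V g d x : sop C g d X n"
  and "sop C g d : Hom p (grd C d) (grd C (d - deg p g))"
  using compl_hom[where c = 0 and F = "sop C g d", OF sop_hom Fl F] by simp_all
qed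

lemma dif_mem: "X : C $ d ==> x : X (n - s) ==> dif V d x : dif C d X n"
 and dif_C_hom: "dif C d : Hom p (grd C d) (grd C (d + 1))"
proof -
 have Fl: "dif V d x : Fl n (d + 1)" if "x : Fl (n - s) d" for n x using Fl_dif[OF that] by simp
 have F: "dif C d X n = quot_map (grd V (d + 1)) (Fl n (d + 1)) (dif V d) (X (n - s))" for X n by (simp add: completion_def)
 show "X : C $ d ==> x : X (n - s) ==> dif V d x : dif C d X n"
  and "dif C d : Hom p (grd C d) (grd C (d + 1))"
  using compl_hom[where c = s and F = "dif C d", OF dif_hom Fl F] by simp_all
qed

lemmas sop_C_closed = mod_hom_closed[OF sop_C_hom]
lemmas dif_C_closed = mod_hom_closed[OF dif_C_hom]

lemma C_graded_ops: "graded_ops p C"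
 by (intro graded_ops.intro p_prime cm.Fp_module sop_C_hom)

end

sublocale filtered_ops \<subseteq> cg: graded_ops p "completion s p V Fl" by (rule C_graded_ops)

context filtered_ops begin

text \<open>Representatives of \<open>X\<close> are mapped to representatives of its image, at every level. Hence relations between words pass to the completion.\<close>

lemma hact_mem:
 assumes X: "X : C $ d" and x: "x : X n"
 shows "hact p V k d f x : hact p C k d f X n"
proof -
 have w: "word_act p V gs d x : word_act p C gs d X n" for gs
  using X x
 proof (induction gs arbitrary: d x X)
  case (Cons g gs) then show ?case using Cons.IH[OF sop_C_closed[OF Cons.prems(1)] sop_mem[OF Cons.prems]] by simp
 qed simp
 show ?thesis unfolding hact_def
  by (rule finsum_mem) (use w zmult_mem[OF cg.word_act_closed[OF X]] cg.word_act_closed[OF X] in auto)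
qed

lemma sact_mem:
 assumes "a : steenrod_deg p k" "X : C $ d" "x : X n"
 shows "sact p V k d a x : sact p C k d a X n"
 using hact_mem[OF assms(2,3)] assms(1) by (simp add: sact_rep free_act_eq_hact steenrod_rep)

lemma CF_iff: "X : CF n d \<longleftrightarrow> X : C $ d \<and> \<zero>\<^bsub>grd V d\<^esub> : X n"
proof -
 have "X n = Fl n d \<longleftrightarrow> \<zero>\<^bsub>grd V d\<^esub> : X n" if "X : C $ d"
  using C_rep(2)[OF that, of "\<zero>\<^bsub>grd V d\<^esub>" n] gr.submoduleD(2)[OF Fl_submodule] by (auto simp: q.quot_zero)
 then show ?thesis unfolding compl_fil_def q.quot_zero by auto
qed

lemma CF_rep: "X : CF n d ==> m \<le> n ==> x : X m ==> x : Fl n d"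
proof -
 assume X: "X : CF n d" and "m \<le> n" "x : X m"
 then have "x \<ominus>\<^bsub>grd V d\<^esub> \<zero>\<^bsub>grd V d\<^esub> : Fl n d" "x : V $ d"
  using C_diff C_rep(1) by (auto simp: CF_iff)
 moreover have "\<ominus>\<^bsub>grd V d\<^esub> \<zero>\<^bsub>grd V d\<^esub> = \<zero>\<^bsub>grd V d\<^esub>" by (rule gr.M.minus_equality) auto
 ultimately show ?thesis by (simp add: a_minus_def)
qed

lemma CF_submodule: "submodule (CF n d) (Fp p) (grd C d)"
proof (rule cm.submoduleI_additive)
 fix X Y assume "X : CF n d" "Y : CF n d"
 then show "X \<oplus>\<^bsub>grd C d\<^esub> Y : CF n d"
  using add_mem[of X d Y "\<zero>\<^bsub>grd V d\<^esub>" n "\<zero>\<^bsub>grd V d\<^esub>"] C_closed(2) by (auto simp: CF_iff)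
qed (use zero_mem C_closed(1) in \<open>auto simp: CF_iff\<close>)

lemma CF_sop: "X : CF n d ==> sop C g d X : CF n (d - deg p g)"
 using sop_mem[of X d "\<zero>\<^bsub>grd V d\<^esub>" n g] sop_C_closed by (auto simp: CF_iff)

lemma C_filtered_ops: "filtered_ops p C CF s"
proof (intro filtered_ops.intro filtered_ops_axioms.intro C_graded_ops CF_submodule dif_C_hom CF_sop)
 interpret df: Fp_module_hom p "grd V n" "grd V (n + 1)" "dif V n" for n by (rule Fp_module_homI[OF gr.Fp_module_axioms gr.Fp_module_axioms dif_hom])
 show "CF m d \<subseteq> CF n d" if "m \<le> n" for m n d using that C_mono by (auto simp: CF_iff)
 show "dif C d X : CF (n + s) (d + 1)" if "X : CF n d" for n d X
  using that dif_mem[of X d "\<zero>\<^bsub>grd V d\<^esub>" "n + s"] dif_C_closed by (auto simp: CF_iff)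
qed

lemma compl_map_closed: "x : V $ d ==> compl_map V Fl d x : C $ d"
 unfolding compl_map_def by (rule C_I) (auto simp: a_minus_def gr.M.r_neg gr.submoduleD(2)[OF Fl_submodule])

lemma compl_map_mem: "x : V $ d ==> x : compl_map V Fl d x n"
 by (simp add: compl_map_def q.coset_self)

lemma compl_map_eq_iff:
 assumes "x : V $ d" "X : C $ d"
 shows "compl_map V Fl d x = X \<longleftrightarrow> (\<forall>n. x : X n)"
 using compl_map_mem[OF assms(1)] C_eqI[OF compl_map_closed[OF assms(1)] assms(2)] by blast

text \<open>A family of cosets modulo the filtration of the completion is the image of its diagonal: at level \<open>n\<close> take the \<open>n\<close>-th coordinate of a representative at level \<open>n\<close>.\<close>

lemma completion_complete: "complete_Hausdorff s p C CF"
 unfolding complete_Hausdorff_def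
proof
 fix d
 interpret CC: filtered_ops p C CF s by (rule C_filtered_ops)
 show "bij_betw (compl_map C CF d) (C $ d) (CC.C $ d)"
 proof (rule bij_betwI')
  fix X Y assume XY: "X : C $ d" "Y : C $ d"
  have "X = Y" if e: "compl_map C CF d X = compl_map C CF d Y"
  proof (rule C_eqI[OF XY])
   fix n
   have "Y : compl_map C CF d X n" unfolding e by (rule CC.compl_map_mem[OF XY(2)])
   then have D: "Y \<ominus>\<^bsub>grd C d\<^esub> X : CF n d" by (simp add: compl_map_def CC.q.coset_iff[OF XY(1)])
   obtain x y where x: "x : X n" and y: "y : Y n" using C_obtain[OF XY(1)] C_obtain[OF XY(2)] by metis
   have "y \<ominus>\<^bsub>grd V d\<^esub> x : Fl n d" by (rule CF_rep[OF D order_refl diff_mem[OF XY(2,1) y x]])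
   then show "\<exists>x. x : X n \<and> x : Y n" using C_memI[OF XY(1) x C_rep(1)[OF XY(2) y]] y by blast
  qed
  then show "compl_map C CF d X = compl_map C CF d Y \<longleftrightarrow> X = Y" by blast
 next
  fix Z assume Z: "Z : CC.C $ d"
  define X where "X n = (SOME X. X : Z n)" for n
  have X: "X n : Z n" for n unfolding X_def using CC.C_obtain[OF Z, of n] someI by metis
  note Xc = CC.C_rep(1)[OF Z X]
  have meet: "\<exists>z. z : X m n \<and> z : X n n" if mn: "m \<le> n" for m n
  proof -
   obtain x y where x: "x : X m n" and y: "y : X n n" using C_obtain[OF Xc] by metis
   have "X m \<ominus>\<^bsub>grd C d\<^esub> X n : CF n d" by (rule CC.C_diff[OF Z X X mn])
   from CF_rep[OF this order_refl diff_mem[OF Xc Xc x y]]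
   have "x : X n n" by (rule C_memI[OF Xc y C_rep(1)[OF Xc x]])
   then show ?thesis using x by blast
  qed
  have D: "(\<lambda>n. X n n) : C $ d"
  proof (rule C_closedI)
   show "X n n : carrier (quot_mod (grd V d) (Fl n d))" for n by (rule C_quot[OF Xc])
   fix m n :: int assume mn: "m \<le> n"
   have "X m m \<subseteq> X m n" using C_mono[OF Xc _ mn] by blast
   moreover have "X m n = X n n" using meet[OF mn] C_rep(2)[OF Xc] by metis
   moreover obtain x where "x : X m m" using C_obtain[OF Xc] .
   ultimately show "\<exists>z. z : X m m \<and> z : X n n" by blast
  qed
  have "compl_map C CF d (\<lambda>n. X n n) = Z"
   unfolding CC.compl_map_eq_iff[OF D Z]
  proof
   fix n
   have "(\<lambda>n. X n n) \<ominus>\<^bsub>grd C d\<^esub> X n : CF n d"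
   proof -
    obtain x where x: "x : X n n" using C_obtain[OF Xc] .
    have "x \<ominus>\<^bsub>grd V d\<^esub> x : ((\<lambda>n. X n n) \<ominus>\<^bsub>grd C d\<^esub> X n) n" by (rule diff_mem[OF D Xc x x])
    then show ?thesis using D Xc C_rep(1)[OF Xc x] by (simp add: CF_iff a_minus_def gr.M.r_neg)
   qed
   then show "(\<lambda>n. X n n) : Z n" by (rule CC.C_memI[OF Z X D])
  qed
  then show "\<exists>x\<in>C $ d. Z = compl_map C CF d x" using D by blast
 qed (rule CC.compl_map_closed)
qed

end

sublocale filtered_dg_right_A_module \<subseteq> fo: filtered_ops p V Fl s
proof (intro filtered_ops.intro filtered_ops_axioms.intro graded_ops_axioms)
 show "sop V g d x : Fl n (d - deg p g)" if "x : Fl n d" for n g d x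
 proof -
  have "x : V $ d" using gr.submoduleD(1)[OF Fl_submodule] that by blast
  from sact_gen[OF this, of g] show ?thesis using Fl_act[OF steenrod_gen_deg that, of g] by simp
 qed
qed (rule Fl_submodule Fl_mono dif_hom Fl_dif; assumption)+

context filtered_dg_right_A_module begin

abbreviation "C \<equiv> completion s p V Fl"
abbreviation "CF \<equiv> compl_fil s p V Fl"

lemma dif_sact_mem:
 assumes a: "a : steenrod_deg p k" and X: "X : C $ d"
 shows "sact p C k (d + 1) a (dif C d X) = sgn_mult (grd C (d - int k + 1)) (int k) (dif C (d - int k) (sact p C k d a X))"
proof (rule fo.C_eqI[where d = "d - int k + 1"])
 have i: "d + 1 - int k = d - int k + 1" by simp
 note dX = fo.dif_C_closed[OF X] and aX = fo.cg.sact_closed[OF a X]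
 show "sact p C k (d + 1) a (dif C d X) : C $ (d - int k + 1)"
  using fo.cg.sact_closed[OF a dX] unfolding i .
 show "sgn_mult (grd C (d - int k + 1)) (int k) (dif C (d - int k) (sact p C k d a X)) : C $ (d - int k + 1)"
  by (intro fo.cm.sgn_mult_closed fo.dif_C_closed aX)
 fix n
 obtain x where x: "x : X (n - s)" "x : V $ d" by (rule fo.C_obtain[OF X])
 have "sact p V k (d + 1) a (dif V d x) : sact p C k (d + 1) a (dif C d X) n"
  by (rule fo.sact_mem[OF a dX fo.dif_mem[OF X x(1)]])
 moreover have "sgn_mult (grd V (d - int k + 1)) (int k) (dif V (d - int k) (sact p V k d a x))
   : sgn_mult (grd C (d - int k + 1)) (int k) (dif C (d - int k) (sact p C k d a X)) n"
  by (intro fo.sgn_mem fo.dif_C_closed aX fo.dif_mem fo.sact_mem a X x(1))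
 ultimately show "\<exists>z. z : sact p C k (d + 1) a (dif C d X) n \<and>
   z : sgn_mult (grd C (d - int k + 1)) (int k) (dif C (d - int k) (sact p C k d a X)) n"
  unfolding dif_act[OF a x(2)] by blast
qed

lemma completion_right_A_module: "right_A_module p C"
proof (intro right_A_module.intro p_prime fo.cm.Fp_module fo.cg.sop_hom)
 fix k d f g X
 assume f: "f : free_deg p k" "g : free_deg p k" "steenrod_class p f = steenrod_class p g" and X: "X : C $ d"
 have "hact p C k d f X = hact p C k d g X"
 proof (rule fo.C_eqI[where d = "d - int k"])
  fix n
  obtain x where x: "x : X n" "x : V $ d" by (rule fo.C_obtain[OF X])
  have "hact p V k d f x = hact p V k d g x" using act_descends[OF f x(2)] f by (simp add: free_act_eq_hact)
  then show "\<exists>z. z : hact p C k d f X n \<and> z : hact p C k d g X n"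
   using fo.hact_mem[OF X x(1), of k f] fo.hact_mem[OF X x(1), of k g] by auto
 qed (rule fo.cg.hact_closed[OF X])+
 then show "free_act p C k d f X = free_act p C k d g X" using f by (simp add: free_act_eq_hact)
qed

theorem completion_filtered: "filtered_dg_right_A_module p C CF s"
proof (intro filtered_dg_right_A_module.intro filtered_dg_right_A_module_axioms.intro dg_right_A_module.intro
  dg_right_A_module_axioms.intro completion_right_A_module fo.dif_C_hom dif_sact_mem fo.CF_submodule)
 interpret CC: filtered_ops p C CF s by (rule fo.C_filtered_ops)
 show "CF m d \<subseteq> CF n d" if "m \<le> n" for m n d by (rule CC.Fl_mono[OF that])
 show "dif C d X : CF (n + s) (d + 1)" if "X : CF n d" for n d X by (rule CC.Fl_dif[OF that])
 show "sact p C k d a X : CF n (d - int k)" if "a : steenrod_deg p k" "X : CF n d" for n k d a X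
  by (rule fo.cg.sact_preserves[where H = "CF n", OF fo.CF_submodule fo.CF_sop that])
 fix d X assume X: "X : C $ d"
 show "dif C (d + 1) (dif C d X) = \<zero>\<^bsub>grd C (d + 2)\<^esub>"
 proof (rule fo.C_eqI[where d = "d + 2"])
  show "dif C (d + 1) (dif C d X) : C $ (d + 2)"
   using fo.dif_C_closed[OF fo.dif_C_closed[OF X]] by (simp add: algebra_simps)
  fix n
  obtain x where x: "x : X (n - s - s)" "x : V $ d" by (rule fo.C_obtain[OF X])
  have "dif V (d + 1) (dif V d x) : dif C (d + 1) (dif C d X) n"
   by (intro fo.dif_mem fo.dif_C_closed X x(1))
  then show "\<exists>z. z : dif C (d + 1) (dif C d X) n \<and> z : \<zero>\<^bsub>grd C (d + 2)\<^esub> n"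
   unfolding dif_dif[OF x(2)] using fo.zero_mem by blast
 qed simp
qed

end

section \<open>The product on the completion\<close>

text \<open>The product is kept separate from the record so that it can be chosen on a completion, which carries none.\<close>

locale filtered_product = filtered_dg_right_A_module p P Fl s
 for p and P :: "('a, 'z) dgmod_scheme" and Fl and s +
 fixes mul :: "int => int => 'a => 'a => 'a"
 assumes mul_left: "!!d e y. y : P $ e ==> (\<lambda>x. mul d e x y) : Hom p (grd P d) (grd P (d + e))"
  and mul_right: "!!d e x. x : P $ d ==> mul d e x : Hom p (grd P e) (grd P (d + e))"
  and mul_Bock: "!!d e x y. [|x : P $ d; y : P $ e|] ==>
    sop P Bock (d + e) (mul d e x y) = mul (d - 1) e (sop P Bock d x) y
     \<oplus>\<^bsub>grd P (d + e - 1)\<^esub> sgn_mult (grd P (d + e - 1)) d (mul d (e - 1) x (sop P Bock e y))"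
  and mul_Pow: "!!r d e x y. [|x : P $ d; y : P $ e|] ==>
    sop P (Pow r) (d + e) (mul d e x y)
    = (\<Oplus>\<^bsub>grd P (d + e - deg p (Pow r))\<^esub>i\<in>{0..r}.
       mul (d - deg p (Pow i)) (e - deg p (Pow (r - i))) (sop P (Pow i) d x) (sop P (Pow (r - i)) e y))"
  and dif_mul: "!!d e x y. [|x : P $ d; y : P $ e|] ==>
    dif P (d + e) (mul d e x y) = mul (d + 1) e (dif P d x) y
     \<oplus>\<^bsub>grd P (d + e + 1)\<^esub> sgn_mult (grd P (d + e + 1)) d (mul d (e + 1) x (dif P e y))"
  and Fl_mul: "!!m n d e x y. [|x : Fl m d; y : Fl n e|] ==> mul d e x y : Fl (m + n) (d + e)"

lemma (in filtered_dg_A_algebra) filtered_product: "filtered_product p P Fl s (gmul P)"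
 by (intro filtered_product.intro filtered_product_axioms.intro filtered_dg_right_A_module_axioms)
  (rule mul_left mul_right mul_Bock mul_Pow dif_mul Fl_mul; assumption)+

context filtered_product begin

lemma mul_closed: "x : P $ d ==> y : P $ e ==> mul d e x y : P $ (d + e)"
 by (rule mod_hom_closed[OF mul_right])

lemma mul_left_hom: "y : P $ e ==> Fp_module_hom p (grd P d) (grd P (d + e)) (\<lambda>x. mul d e x y)"
 by (intro Fp_module_homI gr.Fp_module_axioms mul_left)

lemma mul_right_hom: "x : P $ d ==> Fp_module_hom p (grd P e) (grd P (d + e)) (mul d e x)"
 by (intro Fp_module_homI gr.Fp_module_axioms mul_right)

text \<open>The elements approximated modulo filtration \<open>n\<close> by all products of representatives of sufficiently low level.\<close>

definition cmul :: "int => int => (int => 'a set) => (int => 'a set) => int => 'a set" where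
 "cmul d e X Y n = {z : P $ (d + e). \<exists>m. \<forall>x\<in>X m. \<forall>y\<in>Y m. z \<ominus>\<^bsub>grd P (d + e)\<^esub> mul d e x y : Fl n (d + e)}"

lemma Fl_carrier: "x : Fl n d ==> x : P $ d" using gr.submoduleD(1)[OF Fl_submodule] by blast

end

locale exhaustive_product = filtered_product +
 assumes exhaustive: "!!x d. x : P $ d ==> \<exists>n. x : Fl n d"
begin

text \<open>A single filtration contains the representatives of all levels at most 0, since these differ from a fixed one by elements of filtration 0.\<close>

lemma C_bounded:
 assumes X: "X : C $ d" shows "\<exists>a. \<forall>m\<le>0. \<forall>x\<in>X m. x : Fl a d"
proof -
 obtain x0 where x0: "x0 : X 0" "x0 : P $ d" by (rule fo.C_obtain[OF X])
 obtain a where a: "x0 : Fl a d" using exhaustive[OF x0(2)] by blast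
 have "x : Fl (max a 0) d" if m: "m \<le> 0" and x: "x : X m" for m x
 proof -
  have xc: "x : P $ d" by (rule fo.C_rep(1)[OF X x])
  have "x \<ominus>\<^bsub>grd P d\<^esub> x0 : Fl (max a 0) d"
   using fo.C_diff[OF X x x0(1) m] Fl_mono[of 0 "max a 0" d] by auto
  moreover have "x0 : Fl (max a 0) d" using a Fl_mono[of a "max a 0" d] by auto
  ultimately have "(x \<ominus>\<^bsub>grd P d\<^esub> x0) \<oplus>\<^bsub>grd P d\<^esub> x0 : Fl (max a 0) d" by (rule gr.submoduleD(3)[OF Fl_submodule])
  then show ?thesis using xc x0(2) by (simp add: a_minus_def gr.M.a_assoc gr.M.l_neg)
 qed
 then show ?thesis by blast
qed

text \<open>\<open>xy - x'y' = (x - x')y + x'(y - y')\<close>, where the differences have filtration at most \<open>m\<close> and the other factors bounded filtration.\<close>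

lemma mul_continuous:
 assumes X: "X : C $ d" and Y: "Y : C $ e"
 shows "\<exists>m. \<forall>x\<in>X m. \<forall>x'\<in>X m. \<forall>y\<in>Y m. \<forall>y'\<in>Y m.
  mul d e x y \<ominus>\<^bsub>grd P (d + e)\<^esub> mul d e x' y' : Fl n (d + e)"
proof -
 obtain a where a: "!!m x. m \<le> 0 ==> x : X m ==> x : Fl a d" using C_bounded[OF X] by blast
 obtain b where b: "!!m x. m \<le> 0 ==> x : Y m ==> x : Fl b e" using C_bounded[OF Y] by blast
 \<comment> \<open>Level at most 0 for the bounds \<open>a\<close>, \<open>b\<close>; level at most \<open>n - a\<close>, \<open>n - b\<close> for the products with the differences.\<close>
 define m where "m = min 0 (min (n - a) (n - b))"
 have m: "m \<le> 0" "m + b \<le> n" "a + m \<le> n" by (auto simp: m_def)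
 show ?thesis
 proof (intro exI ballI)
  fix x x' y y' assume x: "x : X m" "x' : X m" and y: "y : Y m" "y' : Y m"
  note xc = fo.C_rep(1)[OF X x(1)] fo.C_rep(1)[OF X x(2)] and yc = fo.C_rep(1)[OF Y y(1)] fo.C_rep(1)[OF Y y(2)]
  note cl = mul_closed[OF xc(1) yc(1)] mul_closed[OF xc(2) yc(1)] mul_closed[OF xc(2) yc(2)]
  have "mul d e (x \<ominus>\<^bsub>grd P d\<^esub> x') y : Fl (m + b) (d + e)"
   by (rule Fl_mul[OF fo.C_diff[OF X x order_refl] b[OF m(1) y(1)]])
  then have 1: "mul d e x y \<ominus>\<^bsub>grd P (d + e)\<^esub> mul d e x' y : Fl n (d + e)"
   using Fl_mono[OF m(2)] unfolding Fp_module_hom.diff[OF mul_left_hom[OF yc(1)] xc] by blast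
  have "mul d e x' (y \<ominus>\<^bsub>grd P e\<^esub> y') : Fl (a + m) (d + e)"
   by (rule Fl_mul[OF a[OF m(1) x(2)] fo.C_diff[OF Y y order_refl]])
  then have 2: "mul d e x' y \<ominus>\<^bsub>grd P (d + e)\<^esub> mul d e x' y' : Fl n (d + e)"
   using Fl_mono[OF m(3)] unfolding Fp_module_hom.diff[OF mul_right_hom[OF xc(2)] yc] by blast
  show "mul d e x y \<ominus>\<^bsub>grd P (d + e)\<^esub> mul d e x' y' : Fl n (d + e)"
   using gr.submoduleD(3)[OF Fl_submodule 1 2] unfolding fo.q.diff_trans[OF cl] .
 qed
qed

lemma cmul_coset:
 assumes X: "X : C $ d" and Y: "Y : C $ e"
 shows "\<exists>m. \<forall>k\<le>m. \<forall>x\<in>X k. \<forall>y\<in>Y k. cmul d e X Y n = Fl n (d + e) +>\<^bsub>grd P (d + e)\<^esub> mul d e x y"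
proof -
 obtain m where m: "!!x y x' y'. x : X m ==> x' : X m ==> y : Y m ==> y' : Y m ==>
  mul d e x y \<ominus>\<^bsub>grd P (d + e)\<^esub> mul d e x' y' : Fl n (d + e)" using mul_continuous[OF X Y] by blast
 show ?thesis
 proof (rule exI[of _ m], intro allI impI ballI)
  fix k x y assume k: "k \<le> m" and x: "x : X k" and y: "y : Y k"
  note x' = fo.C_mono[OF X x k] and y' = fo.C_mono[OF Y y k]
  note xy = mul_closed[OF fo.C_rep(1)[OF X x] fo.C_rep(1)[OF Y y]]
  have *: "z \<ominus>\<^bsub>grd P (d + e)\<^esub> mul d e x' y' : Fl n (d + e)"
   if z: "z : P $ (d + e)" "z \<ominus>\<^bsub>grd P (d + e)\<^esub> mul d e u v : Fl n (d + e)"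
    and u: "u : X m" "x' : X m" "v : Y m" "y' : Y m" for z u v x' y'
   using gr.submoduleD(3)[OF Fl_submodule z(2) m[OF u(1,2,3,4)]] z(1) u
   by (simp add: fo.q.diff_trans mul_closed fo.C_rep(1)[OF X] fo.C_rep(1)[OF Y])
  show "cmul d e X Y n = Fl n (d + e) +>\<^bsub>grd P (d + e)\<^esub> mul d e x y"
  proof (rule Set.set_eqI)
  fix z
  show "z : cmul d e X Y n \<longleftrightarrow> z : Fl n (d + e) +>\<^bsub>grd P (d + e)\<^esub> mul d e x y"
  proof
   assume "z : cmul d e X Y n"
   then obtain l where z: "z : P $ (d + e)"
    and l: "!!x y. x : X l ==> y : Y l ==> z \<ominus>\<^bsub>grd P (d + e)\<^esub> mul d e x y : Fl n (d + e)"
    unfolding cmul_def by blast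
   obtain u where u: "u : X (min l m)" by (rule fo.C_obtain[OF X])
   obtain v where v: "v : Y (min l m)" by (rule fo.C_obtain[OF Y])
   have "z \<ominus>\<^bsub>grd P (d + e)\<^esub> mul d e x y : Fl n (d + e)"
    by (rule *[OF z l[OF fo.C_mono[OF X u] fo.C_mono[OF Y v]] fo.C_mono[OF X u] x' fo.C_mono[OF Y v] y']) auto
   then show "z : Fl n (d + e) +>\<^bsub>grd P (d + e)\<^esub> mul d e x y" using z by (simp add: fo.q.coset_iff[OF xy])
  next
   assume "z : Fl n (d + e) +>\<^bsub>grd P (d + e)\<^esub> mul d e x y"
   then have "z : P $ (d + e)" "z \<ominus>\<^bsub>grd P (d + e)\<^esub> mul d e x y : Fl n (d + e)"
    by (auto simp: fo.q.coset_iff[OF xy])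
   from this *[OF this x' _ y'] show "z : cmul d e X Y n" unfolding cmul_def by blast
  qed
  qed
 qed
qed

lemma cmul_mem:
 assumes X: "X : C $ d" and Y: "Y : C $ e"
 shows "\<forall>\<^sub>F m in at_bot. \<forall>x\<in>X m. \<forall>y\<in>Y m. mul d e x y : cmul d e X Y n"
proof -
 obtain m where m: "!!k x y. k \<le> m ==> x : X k ==> y : Y k ==> cmul d e X Y n = Fl n (d + e) +>\<^bsub>grd P (d + e)\<^esub> mul d e x y"
  using cmul_coset[OF X Y] by blast
 have "mul d e x y : cmul d e X Y n" if "k \<le> m" "x : X k" "y : Y k" for k x y
  unfolding m[OF that] by (intro fo.q.coset_self mul_closed fo.C_rep(1)[OF X that(2)] fo.C_rep(1)[OF Y that(3)])
 then show ?thesis unfolding eventually_at_bot_linorder by blast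
qed

lemma eventually_mono_level:
 assumes X: "X : C $ d" shows "\<forall>\<^sub>F m in at_bot. X m \<subseteq> X n"
 using fo.C_mono[OF X] unfolding eventually_at_bot_linorder by blast

lemma cmul_closed:
 assumes X: "X : C $ d" and Y: "Y : C $ e"
 shows "cmul d e X Y : C $ (d + e)"
proof (rule fo.C_closedI)
 fix n
 obtain m where m: "!!k x y. k \<le> m ==> x : X k ==> y : Y k ==> cmul d e X Y n = Fl n (d + e) +>\<^bsub>grd P (d + e)\<^esub> mul d e x y"
  using cmul_coset[OF X Y] by blast
 obtain x where x: "x : X m" "x : P $ d" by (rule fo.C_obtain[OF X])
 obtain y where y: "y : Y m" "y : P $ e" by (rule fo.C_obtain[OF Y])
 show "cmul d e X Y n : carrier (quot_mod (grd P (d + e)) (Fl n (d + e)))"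
  unfolding m[OF order_refl x(1) y(1)] by (intro fo.q.coset_closed mul_closed x y)
next
 fix k n :: int
 obtain m where m: "\<forall>x\<in>X m. \<forall>y\<in>Y m. mul d e x y : cmul d e X Y k" "\<forall>x\<in>X m. \<forall>y\<in>Y m. mul d e x y : cmul d e X Y n"
  using eventually_happens'[OF trivial_limit_at_bot_linorder eventually_conj[OF cmul_mem[OF X Y] cmul_mem[OF X Y]]] by blast
 obtain x where x: "x : X m" by (rule fo.C_obtain[OF X])
 obtain y where y: "y : Y m" by (rule fo.C_obtain[OF Y])
 show "\<exists>z. z : cmul d e X Y k \<and> z : cmul d e X Y n" using m x y by blast
qed

text \<open>It suffices to compare both sides on representatives of sufficiently low level. Three families are allowed, as needed for associativity; identities in two variables repeat one.\<close>

lemma C_eqI_eventually: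
 assumes Z: "Z : C $ k" "Z' : C $ k"
  and X: "X : C $ d" and Y: "Y : C $ e" and W: "W : C $ f"
  and ev: "!!n. \<forall>\<^sub>F m in at_bot. \<forall>x\<in>X m. \<forall>y\<in>Y m. \<forall>w\<in>W m. \<exists>z. z : Z n \<and> z : Z' n"
 shows "Z = Z'"
proof (rule fo.C_eqI[OF Z])
 fix n
 obtain m where m: "\<forall>x\<in>X m. \<forall>y\<in>Y m. \<forall>w\<in>W m. \<exists>z. z : Z n \<and> z : Z' n"
  using eventually_happens'[OF trivial_limit_at_bot_linorder ev] by blast
 obtain x where "x : X m" by (rule fo.C_obtain[OF X])
 moreover obtain y where "y : Y m" by (rule fo.C_obtain[OF Y])
 moreover obtain w where "w : W m" by (rule fo.C_obtain[OF W])
 ultimately show "\<exists>z. z : Z n \<and> z : Z' n" using m by blast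
qed

lemma cmul_left: assumes Y: "Y : C $ e"
 shows "(\<lambda>X. cmul d e X Y) : Hom p (grd C d) (grd C (d + e))"
proof (rule mod_homI[OF fo.C_module fo.C_module cmul_closed[OF _ Y]])
 fix X X' assume X: "X : C $ d" "X' : C $ d"
 note XX = fo.C_closed(2)[OF X]
 show "cmul d e (X \<oplus>\<^bsub>grd C d\<^esub> X') Y = cmul d e X Y \<oplus>\<^bsub>grd C (d + e)\<^esub> cmul d e X' Y" (is "?L = ?R")
 proof (rule C_eqI_eventually[OF cmul_closed[OF XX Y] _ X Y])
  fix n
  show "\<forall>\<^sub>F m in at_bot. \<forall>x\<in>X m. \<forall>x'\<in>X' m. \<forall>y\<in>Y m. \<exists>z. z : ?L n \<and> z : ?R n"
   using cmul_mem[OF XX Y, of n] cmul_mem[OF X(1) Y, of n] cmul_mem[OF X(2) Y, of n]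
  proof eventually_elim
   case (elim m)
   show ?case
   proof (intro ballI)
    fix x x' y assume x: "x : X m" "x' : X' m" and y: "y : Y m"
    have "mul d e (x \<oplus>\<^bsub>grd P d\<^esub> x') y = mul d e x y \<oplus>\<^bsub>grd P (d + e)\<^esub> mul d e x' y"
     by (rule mod_hom_add[OF mul_left[OF fo.C_rep(1)[OF Y y]] fo.C_rep(1)[OF X(1) x(1)] fo.C_rep(1)[OF X(2) x(2)]])
    moreover have "mul d e (x \<oplus>\<^bsub>grd P d\<^esub> x') y : ?L n" using elim(1) fo.add_mem[OF X x] y by blast
    moreover have "mul d e x y \<oplus>\<^bsub>grd P (d + e)\<^esub> mul d e x' y : ?R n"
     using elim x y by (intro fo.add_mem cmul_closed X Y) auto
    ultimately show "\<exists>z. z : ?L n \<and> z : ?R n" by auto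
   qed
  qed
 qed (intro fo.C_closed cmul_closed X Y)
qed

lemma cmul_right: assumes X: "X : C $ d"
 shows "cmul d e X : Hom p (grd C e) (grd C (d + e))"
proof (rule mod_homI[OF fo.C_module fo.C_module cmul_closed[OF X]])
 fix Y Y' assume Y: "Y : C $ e" "Y' : C $ e"
 note YY = fo.C_closed(2)[OF Y]
 show "cmul d e X (Y \<oplus>\<^bsub>grd C e\<^esub> Y') = cmul d e X Y \<oplus>\<^bsub>grd C (d + e)\<^esub> cmul d e X Y'" (is "?L = ?R")
 proof (rule C_eqI_eventually[OF cmul_closed[OF X YY] _ X Y])
  fix n
  show "\<forall>\<^sub>F m in at_bot. \<forall>x\<in>X m. \<forall>y\<in>Y m. \<forall>y'\<in>Y' m. \<exists>z. z : ?L n \<and> z : ?R n"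
   using cmul_mem[OF X YY, of n] cmul_mem[OF X Y(1), of n] cmul_mem[OF X Y(2), of n]
  proof eventually_elim
   case (elim m)
   show ?case
   proof (intro ballI)
    fix x y y' assume x: "x : X m" and y: "y : Y m" "y' : Y' m"
    have "mul d e x (y \<oplus>\<^bsub>grd P e\<^esub> y') = mul d e x y \<oplus>\<^bsub>grd P (d + e)\<^esub> mul d e x y'"
     by (rule mod_hom_add[OF mul_right[OF fo.C_rep(1)[OF X x]] fo.C_rep(1)[OF Y(1) y(1)] fo.C_rep(1)[OF Y(2) y(2)]])
    moreover have "mul d e x (y \<oplus>\<^bsub>grd P e\<^esub> y') : ?L n" using elim(1) fo.add_mem[OF Y y] x by blast
    moreover have "mul d e x y \<oplus>\<^bsub>grd P (d + e)\<^esub> mul d e x y' : ?R n"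
     using elim x y by (intro fo.add_mem cmul_closed X Y) auto
    ultimately show "\<exists>z. z : ?L n \<and> z : ?R n" by auto
   qed
  qed
 qed (intro fo.C_closed cmul_closed X Y)
qed

lemma cmul_Pow:
 assumes X: "X : C $ d" and Y: "Y : C $ e"
 shows "sop C (Pow r) (d + e) (cmul d e X Y) = (\<Oplus>\<^bsub>grd C (d + e - deg p (Pow r))\<^esub>i\<in>{0..r}.
   cmul (d - deg p (Pow i)) (e - deg p (Pow (r - i))) (sop C (Pow i) d X) (sop C (Pow (r - i)) e Y))"
  (is "?L = finsum (grd C ?D) ?R _")
proof -
 have D: "d - deg p (Pow i) + (e - deg p (Pow (r - i))) = ?D" if "i : {0..r}" for i
  using pow_deg_add[OF prime_gt_0_nat[OF p_prime], of i "r - i"] that by simp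
 note PX = fo.sop_C_closed[OF X] and PY = fo.sop_C_closed[OF Y]
 have R: "?R i : C $ ?D" if "i : {0..r}" for i
  using cmul_closed[OF PX PY, of "Pow i" "Pow (r - i)"] unfolding D[OF that] .
 show ?thesis
 proof (rule C_eqI_eventually[OF fo.sop_C_closed[OF cmul_closed[OF X Y]] _ X Y Y])
  show "finsum (grd C ?D) ?R {0..r} : C $ ?D" by (rule fo.cm.M.finsum_closed) (use R in auto)
  fix n
  have "\<forall>\<^sub>F m in at_bot. \<forall>i\<in>{0..r}. \<forall>x\<in>sop C (Pow i) d X m. \<forall>y\<in>sop C (Pow (r - i)) e Y m.
    mul (d - deg p (Pow i)) (e - deg p (Pow (r - i))) x y : ?R i n"
   by (intro eventually_ball_finite ballI cmul_mem PX PY) simp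
  with cmul_mem[OF X Y, of n]
  show "\<forall>\<^sub>F m in at_bot. \<forall>x\<in>X m. \<forall>y\<in>Y m. \<forall>w\<in>Y m. \<exists>z. z : ?L n \<and> z : finsum (grd C ?D) ?R {0..r} n"
  proof eventually_elim
   case (elim m)
   show ?case
   proof (intro ballI)
    fix x y assume x: "x : X m" and y: "y : Y m"
    have "sop P (Pow r) (d + e) (mul d e x y) : ?L n"
     by (rule fo.sop_mem[OF cmul_closed[OF X Y]]) (use elim(1) x y in blast)
    moreover have "(\<Oplus>\<^bsub>grd P ?D\<^esub>i\<in>{0..r}. mul (d - deg p (Pow i)) (e - deg p (Pow (r - i)))
      (sop P (Pow i) d x) (sop P (Pow (r - i)) e y)) : finsum (grd C ?D) ?R {0..r} n"
     by (rule fo.finsum_mem[OF R]) (use elim(2) fo.sop_mem[OF X x] fo.sop_mem[OF Y y] in blast)+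
    ultimately show "\<exists>z. z : ?L n \<and> z : finsum (grd C ?D) ?R {0..r} n"
     unfolding mul_Pow[OF fo.C_rep(1)[OF X x] fo.C_rep(1)[OF Y y]] by blast
   qed
  qed
 qed
qed

text \<open>Covers \<open>\<beta>\<close> (\<open>c = 0\<close>) and the differential (\<open>c = s\<close>). The degrees \<open>d'\<close>, \<open>e'\<close>, \<open>f\<close> are those of \<open>E x\<close>, \<open>E y\<close> and \<open>E (xy)\<close>.\<close>

lemma cmul_derivation:
 assumes X: "X : C $ d" and Y: "Y : C $ e" and deg: "d' + e = f" "d + e' = f"
  and E: "!!d X x n. X : C $ d ==> x : X (n - c) ==> E d x : CE d X n"
  and closed: "CE d X : C $ d'" "CE e Y : C $ e'" "CE (d + e) (cmul d e X Y) : C $ f"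
  and der: "!!x y. x : P $ d ==> y : P $ e ==> E (d + e) (mul d e x y)
   = mul d' e (E d x) y \<oplus>\<^bsub>grd P f\<^esub> sgn_mult (grd P f) d (mul d e' x (E e y))"
 shows "CE (d + e) (cmul d e X Y) = cmul d' e (CE d X) Y \<oplus>\<^bsub>grd C f\<^esub> sgn_mult (grd C f) d (cmul d e' X (CE e Y))" (is "?L = ?R")
proof -
 note 1 = cmul_closed[OF closed(1) Y, unfolded deg] and 2 = cmul_closed[OF X closed(2), unfolded deg]
 have ev: "\<forall>\<^sub>F m in at_bot. E d ` Z m \<subseteq> CE d Z n" if "Z : C $ d" for Z d n
  using E[OF that fo.C_mono[OF that]] unfolding eventually_at_bot_linorder by blast
 show ?thesis
 proof (rule C_eqI_eventually[OF closed(3) _ X Y Y])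
  show "?R : C $ f" by (intro fo.C_closed fo.cm.sgn_mult_closed 1 2)
  fix n
  obtain k where k: "\<forall>x\<in>CE d X k. \<forall>y\<in>Y k. mul d' e x y : cmul d' e (CE d X) Y n"
   using eventually_happens'[OF trivial_limit_at_bot_linorder cmul_mem[OF closed(1) Y]] by blast
  obtain l where l: "\<forall>x\<in>X l. \<forall>y\<in>CE e Y l. mul d e' x y : cmul d e' X (CE e Y) n"
   using eventually_happens'[OF trivial_limit_at_bot_linorder cmul_mem[OF X closed(2)]] by blast
  from cmul_mem[OF X Y, of "n - c"] eventually_mono_level[OF Y, of k] eventually_mono_level[OF X, of l] ev[OF X, of k] ev[OF Y, of l]
  show "\<forall>\<^sub>F m in at_bot. \<forall>x\<in>X m. \<forall>y\<in>Y m. \<forall>w\<in>Y m. \<exists>z. z : ?L n \<and> z : ?R n"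
  proof eventually_elim
   case (elim m)
   show ?case
   proof (intro ballI)
    fix x y assume x: "x : X m" and y: "y : Y m"
    have "E (d + e) (mul d e x y) : ?L n"
     by (rule E[OF cmul_closed[OF X Y]]) (use elim(1) x y in blast)
    moreover have "mul d' e (E d x) y \<oplus>\<^bsub>grd P f\<^esub> sgn_mult (grd P f) d (mul d e' x (E e y)) : ?R n"
    proof (intro fo.add_mem fo.sgn_mem fo.cm.sgn_mult_closed 1 2)
     show "mul d' e (E d x) y : cmul d' e (CE d X) Y n" using k elim(2,4) x y by blast
     show "mul d e' x (E e y) : cmul d e' X (CE e Y) n" using l elim(3,5) x y by blast
    qed
    ultimately show "\<exists>z. z : ?L n \<and> z : ?R n"
     unfolding der[OF fo.C_rep(1)[OF X x] fo.C_rep(1)[OF Y y]] by blast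
   qed
  qed
 qed
qed

lemma cmul_Bock:
 assumes X: "X : C $ d" and Y: "Y : C $ e"
 shows "sop C Bock (d + e) (cmul d e X Y) = cmul (d - 1) e (sop C Bock d X) Y
   \<oplus>\<^bsub>grd C (d + e - 1)\<^esub> sgn_mult (grd C (d + e - 1)) d (cmul d (e - 1) X (sop C Bock e Y))"
proof (rule cmul_derivation[where c = 0 and E = "sop P Bock" and CE = "sop C Bock", OF X Y])
 have closed: "sop C Bock d X : C $ (d - 1)" if "X : C $ d" for d X
  using fo.sop_C_closed[OF that, of Bock] by (simp add: gen_deg_def)
 show "sop C Bock d X : C $ (d - 1)" "sop C Bock e Y : C $ (e - 1)"
  "sop C Bock (d + e) (cmul d e X Y) : C $ (d + e - 1)" by (rule closed[OF X] closed[OF Y] closed[OF cmul_closed[OF X Y]])+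
qed (simp_all add: fo.sop_mem mul_Bock)

lemma cmul_dif:
 assumes X: "X : C $ d" and Y: "Y : C $ e"
 shows "dif C (d + e) (cmul d e X Y) = cmul (d + 1) e (dif C d X) Y
   \<oplus>\<^bsub>grd C (d + e + 1)\<^esub> sgn_mult (grd C (d + e + 1)) d (cmul d (e + 1) X (dif C e Y))"
 by (rule cmul_derivation[where c = s and E = "dif P" and CE = "dif C", OF X Y])
  (simp_all add: fo.dif_mem dif_mul fo.dif_C_closed cmul_closed X Y)

lemma cmul_CF:
 assumes X: "X : CF m d" and Y: "Y : CF n e"
 shows "cmul d e X Y : CF (m + n) (d + e)"
proof -
 have Xc: "X : C $ d" and Yc: "Y : C $ e" using X Y by (auto simp: fo.CF_iff)
 have "\<forall>\<^sub>F k in at_bot. k \<le> min m n" by (rule eventually_le_at_bot)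
 from eventually_happens'[OF trivial_limit_at_bot_linorder eventually_conj[OF cmul_mem[OF Xc Yc, of "m + n"] this]]
 obtain k where k: "\<forall>x\<in>X k. \<forall>y\<in>Y k. mul d e x y : cmul d e X Y (m + n)" "k \<le> m" "k \<le> n" by auto
 obtain x where x: "x : X k" by (rule fo.C_obtain[OF Xc])
 obtain y where y: "y : Y k" by (rule fo.C_obtain[OF Yc])
 have xy: "mul d e x y : Fl (m + n) (d + e)" by (rule Fl_mul[OF fo.CF_rep[OF X k(2) x] fo.CF_rep[OF Y k(3) y]])
 have xyc: "mul d e x y : cmul d e X Y (m + n)" using k x y by blast
 have "\<zero>\<^bsub>grd P (d + e)\<^esub> \<ominus>\<^bsub>grd P (d + e)\<^esub> mul d e x y : Fl (m + n) (d + e)"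
  by (rule gr.submoduleD(5)[OF Fl_submodule gr.submoduleD(2)[OF Fl_submodule] xy])
 from fo.C_memI[OF cmul_closed[OF Xc Yc] xyc gr.M.zero_closed this]
 show ?thesis using cmul_closed[OF Xc Yc] by (simp add: fo.CF_iff)
qed

theorem completed_product: "filtered_product p C CF s cmul"
 by (intro filtered_product.intro filtered_product_axioms.intro completion_filtered)
  (rule cmul_left cmul_right cmul_Bock cmul_Pow cmul_dif cmul_CF; assumption)+

lemma cmul_assoc:
 assumes X: "X : C $ d" and Y: "Y : C $ e" and Z: "Z : C $ f"
  and assoc: "!!x y z. x : P $ d ==> y : P $ e ==> z : P $ f ==>
   mul (d + e) f (mul d e x y) z = mul d (e + f) x (mul e f y z)"
 shows "cmul (d + e) f (cmul d e X Y) Z = cmul d (e + f) X (cmul e f Y Z)" (is "?L = ?R")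
proof -
 note XY = cmul_closed[OF X Y] and YZ = cmul_closed[OF Y Z]
 show ?thesis
 proof (rule C_eqI_eventually[OF cmul_closed[OF XY Z] _ X Y Z])
  show "?R : C $ (d + e + f)" using cmul_closed[OF X YZ] by (simp add: add.assoc)
  fix n
  obtain k where k: "\<forall>x\<in>cmul d e X Y k. \<forall>y\<in>Z k. mul (d + e) f x y : ?L n"
   using eventually_happens'[OF trivial_limit_at_bot_linorder cmul_mem[OF XY Z]] by blast
  obtain l where l: "\<forall>x\<in>X l. \<forall>y\<in>cmul e f Y Z l. mul d (e + f) x y : ?R n"
   using eventually_happens'[OF trivial_limit_at_bot_linorder cmul_mem[OF X YZ]] by blast
  from cmul_mem[OF X Y, of k] cmul_mem[OF Y Z, of l] eventually_mono_level[OF Z, of k] eventually_mono_level[OF X, of l]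
  show "\<forall>\<^sub>F m in at_bot. \<forall>x\<in>X m. \<forall>y\<in>Y m. \<forall>z\<in>Z m. \<exists>w. w : ?L n \<and> w : ?R n"
  proof eventually_elim
   case (elim m)
   show ?case
   proof (intro ballI)
    fix x y z assume x: "x : X m" and y: "y : Y m" and z: "z : Z m"
    have "mul (d + e) f (mul d e x y) z : ?L n" using k elim(1,3) x y z by blast
    moreover have "mul d (e + f) x (mul e f y z) : ?R n" using l elim(2,4) x y z by blast
    ultimately show "\<exists>w. w : ?L n \<and> w : ?R n"
     unfolding assoc[OF fo.C_rep(1)[OF X x] fo.C_rep(1)[OF Y y] fo.C_rep(1)[OF Z z]] by blast
   qed
  qed
 qed
qed

lemma cmul_rep:
 assumes X: "X : C $ d" and Y: "Y : C $ e" and Z: "Z : C $ (d + e)"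
  and "!!n. \<forall>\<^sub>F m in at_bot. \<exists>x\<in>X m. \<exists>y\<in>Y m. mul d e x y : Z n"
 shows "cmul d e X Y = Z"
proof (rule fo.C_eqI[OF cmul_closed[OF X Y] Z])
 fix n
 from eventually_happens'[OF trivial_limit_at_bot_linorder eventually_conj[OF cmul_mem[OF X Y, of n] assms(4)[of n]]]
 show "\<exists>z. z : cmul d e X Y n \<and> z : Z n" by blast
qed

lemma cmul_compl_map:
 assumes "x : P $ d" "y : P $ e"
 shows "cmul d e (compl_map P Fl d x) (compl_map P Fl e y) = compl_map P Fl (d + e) (mul d e x y)"
proof (rule cmul_rep)
 show "\<forall>\<^sub>F m in at_bot. \<exists>a\<in>compl_map P Fl d x m. \<exists>b\<in>compl_map P Fl e y m. mul d e a b : compl_map P Fl (d + e) (mul d e x y) n" for n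
  by (intro always_eventually allI bexI[of _ x] bexI[of _ y] fo.compl_map_mem mul_closed assms)
qed (intro fo.compl_map_closed mul_closed assms)+

lemma cmul_unit:
 assumes u: "u : P $ 0" and X: "X : C $ d"
 shows "(!!x. x : P $ d ==> mul 0 d u x = x) ==> cmul 0 d (compl_map P Fl 0 u) X = X"
  and "(!!x. x : P $ d ==> mul d 0 x u = x) ==> cmul d 0 X (compl_map P Fl 0 u) = X"
proof -
 have ev: "\<forall>\<^sub>F m in at_bot. \<exists>x\<in>X m. x : X n \<and> x : P $ d" for n
  using eventually_mono_level[OF X, of n]
 proof eventually_elim
  case (elim m)
  obtain x where "x : X m" "x : P $ d" by (rule fo.C_obtain[OF X])
  then show ?case using elim by blast
 qed
 note U = fo.compl_map_closed[OF u] fo.compl_map_mem[OF u]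
 show "cmul 0 d (compl_map P Fl 0 u) X = X" if l: "!!x. x : P $ d ==> mul 0 d u x = x"
 proof (rule cmul_rep[OF U(1) X])
  show "\<forall>\<^sub>F m in at_bot. \<exists>v\<in>compl_map P Fl 0 u m. \<exists>x\<in>X m. mul 0 d v x : X n" for n
   using ev[of n]
  proof eventually_elim
   case (elim m)
   then obtain x where x: "x : X m" "x : X n" "x : P $ d" by blast
   then show ?case using l[OF x(3)] U(2)[of m] by metis
  qed
 qed (simp add: X)
 show "cmul d 0 X (compl_map P Fl 0 u) = X" if r: "!!x. x : P $ d ==> mul d 0 x u = x"
 proof (rule cmul_rep[OF X U(1)])
  show "\<forall>\<^sub>F m in at_bot. \<exists>x\<in>X m. \<exists>v\<in>compl_map P Fl 0 u m. mul d 0 x v : X n" for n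
   using ev[of n]
  proof eventually_elim
   case (elim m)
   then obtain x where x: "x : X m" "x : X n" "x : P $ d" by blast
   then show ?case using r[OF x(3)] U(2)[of m] by metis
  qed
 qed (simp add: X)
qed

end

section \<open>Free modules and tensor squares\<close>

lemma mod_hom_sgn:
 assumes V: "Fp_module p V" and W: "Fp_module p W" and f: "f : Hom p V W"
 shows "(\<lambda>x. sgn_mult W e (f x)) : Hom p V W"
proof -
 interpret W: Fp_module p W by (rule W)
 show ?thesis
  by (rule mod_homI[OF V W]) (simp_all add: mod_hom_closed[OF f] mod_hom_add[OF f] sgn_mult_def W.M.minus_add)
qed

lemma mod_span_hom:
 assumes V: "Fp_module p V" and f: "f : Hom p V W" and W: "Fp_module p W" and H: "submodule H (Fp p) W"
  and S: "S \<subseteq> carrier V" "!!x. x : S ==> f x : H" and x: "x : mod_span (Fp p) V S"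
 shows "f x : H"
proof -
 interpret V: Fp_module p V by (rule V)
 interpret W: Fp_module p W by (rule W)
 interpret f: Fp_module_hom p V W f by (rule Fp_module_homI[OF V W f])
 have "submodule {x : carrier V. f x : H} (Fp p) V"
  by (rule V.submoduleI_additive) (use W.submoduleD(2,3)[OF H] in \<open>auto simp: f.add\<close>)
 from V.mod_span_submodule(3)[OF S(1) this] S x show ?thesis by auto
qed

context
 fixes p :: nat and G :: "'g set"
 assumes p: "prime p"
begin

lemma free_mod_iff: "f : carrier (free_mod (Fp p) G) \<longleftrightarrow>
  (\<forall>g. f g : {0..<int p}) \<and> finite {g. f g \<noteq> 0} \<and> {g. f g \<noteq> 0} \<subseteq> G"
 using prime_gt_1_nat[OF p] by (auto simp: free_mod_def Fp_simps)

lemma free_mod_ops: "\<zero>\<^bsub>free_mod (Fp p) G\<^esub> = (\<lambda>g. 0)"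
 "f \<oplus>\<^bsub>free_mod (Fp p) G\<^esub> f' = (\<lambda>g. (f g + f' g) mod int p)"
 "c \<odot>\<^bsub>free_mod (Fp p) G\<^esub> f = (\<lambda>g. (c * f g) mod int p)"
 using prime_gt_1_nat[OF p] by (simp_all add: free_mod_def Fp_simps)

lemma Fp_module_free_mod: "Fp_module p (free_mod (Fp p) G)"
proof -
 have pp: "int p > 1" using prime_gt_1_nat[OF p] by simp
 have cl: "(\<lambda>g. h g mod int p) : carrier (free_mod (Fp p) G)" if "finite A" "A \<subseteq> G" "!!g. g \<notin> A ==> h g = 0" for h A
 proof -
  have "{g. h g mod int p \<noteq> 0} \<subseteq> A" using that(3) by force
  then show ?thesis using that(1,2) pp by (auto simp: free_mod_iff intro: finite_subset)
 qed
 have sm: "c \<odot>\<^bsub>free_mod (Fp p) G\<^esub> f : carrier (free_mod (Fp p) G)" if "f : carrier (free_mod (Fp p) G)" for c f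
  unfolding free_mod_ops by (rule cl[of "{g. f g \<noteq> 0}"]) (use that in \<open>auto simp: free_mod_iff\<close>)
 show ?thesis
 proof (rule Fp_moduleI[OF p])
  show "abelian_group (free_mod (Fp p) G)"
  proof (rule abelian_groupI)
   fix f assume f: "f : carrier (free_mod (Fp p) G)"
   have "(-1) \<odot>\<^bsub>free_mod (Fp p) G\<^esub> f \<oplus>\<^bsub>free_mod (Fp p) G\<^esub> f = \<zero>\<^bsub>free_mod (Fp p) G\<^esub>"
    by (simp add: free_mod_ops mod_add_left_eq)
   then show "\<exists>h\<in>carrier (free_mod (Fp p) G). h \<oplus>\<^bsub>free_mod (Fp p) G\<^esub> f = \<zero>\<^bsub>free_mod (Fp p) G\<^esub>" using sm[OF f] by blast
   show "\<zero>\<^bsub>free_mod (Fp p) G\<^esub> \<oplus>\<^bsub>free_mod (Fp p) G\<^esub> f = f" using f by (auto simp: free_mod_ops free_mod_iff)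
   fix h assume h: "h : carrier (free_mod (Fp p) G)"
   show "f \<oplus>\<^bsub>free_mod (Fp p) G\<^esub> h : carrier (free_mod (Fp p) G)"
    unfolding free_mod_ops by (rule cl[of "{g. f g \<noteq> 0} \<union> {g. h g \<noteq> 0}"]) (use f h in \<open>auto simp: free_mod_iff\<close>)
  qed (use pp in \<open>auto simp: free_mod_iff free_mod_ops mod_add_left_eq mod_add_right_eq ac_simps\<close>)
 qed (use pp sm in \<open>auto simp: free_mod_iff free_mod_ops mod_simps algebra_simps\<close>)
qed

lemma free_basis_eq: "free_basis (Fp p) g = (\<lambda>h. if h = g then 1 else 0)"
 unfolding free_basis_def Fp_simps ..

lemma free_basis_closed: "g : G ==> free_basis (Fp p) g : carrier (free_mod (Fp p) G)"
 using prime_gt_1_nat[OF p] by (auto simp: free_mod_iff free_basis_eq)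

text \<open>Induction on a finite set containing the support.\<close>

lemma free_mod_span:
 assumes H: "submodule H (Fp p) (free_mod (Fp p) G)" and "!!g. g : G ==> free_basis (Fp p) g : H"
 shows "carrier (free_mod (Fp p) G) \<subseteq> H"
proof -
 interpret F: Fp_module p "free_mod (Fp p) G" by (rule Fp_module_free_mod)
 have "f : H" if "finite A" "f : carrier (free_mod (Fp p) G)" "{g. f g \<noteq> 0} \<subseteq> A" for f A
  using that
 proof (induction A arbitrary: f rule: finite_induct)
  case empty
  then have "f = \<zero>\<^bsub>free_mod (Fp p) G\<^esub>" by (auto simp: free_mod_ops)
  then show ?case using F.submoduleD(2)[OF H] by simp
 next
  case (insert a A)
  let ?f = "f(a := 0)"
  have f: "?f : carrier (free_mod (Fp p) G)" using insert.prems(1) prime_gt_1_nat[OF p]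
   by (auto simp: free_mod_iff elim!: rev_finite_subset)
  have 1: "?f : H" by (rule insert.IH[OF f]) (use insert.prems(2) in auto)
  show ?case
  proof (cases "a : G")
   case True
   have "f = ?f \<oplus>\<^bsub>free_mod (Fp p) G\<^esub> zmult p (free_mod (Fp p) G) (f a) (free_basis (Fp p) a)"
    using insert.prems(1) by (auto simp: free_mod_ops free_basis_eq zmult_def free_mod_iff)
   then show ?thesis using F.submoduleD(3)[OF H 1 F.submoduleD(6)[OF H assms(2)[OF True]]] by metis
  next
   case False
   then have "f a = 0" using insert.prems(1) by (auto simp: free_mod_iff)
   then have "?f = f" by (rule fun_upd_idem)
   then show ?thesis using 1 by simp
  qed
 qed
 then show ?thesis by (auto simp: free_mod_iff)
qed

lemma free_ext_superset:
 assumes W: "Fp_module p W" and h: "!!g. g : G ==> h g : carrier W"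
  and f: "f : carrier (free_mod (Fp p) G)" and A: "finite A" "{g. f g \<noteq> 0} \<subseteq> A" "A \<subseteq> G"
 shows "free_ext (Fp p) W h f = (\<Oplus>\<^bsub>W\<^esub>g\<in>A. zmult p W (f g) (h g))"
proof -
 interpret W: Fp_module p W by (rule W)
 have "free_ext (Fp p) W h f = (\<Oplus>\<^bsub>W\<^esub>g\<in>{g. f g \<noteq> 0}. zmult p W (f g) (h g))"
  unfolding free_ext_def Fp_simps
  by (rule W.M.finsum_cong'[OF refl]) (use h f in \<open>auto simp: free_mod_iff W.smult_zmult\<close>)
 also have "... = (\<Oplus>\<^bsub>W\<^esub>g\<in>A. zmult p W (f g) (h g))"
  by (rule W.finsum_subset) (use A h in auto)
 finally show ?thesis .
qed

lemma free_ext_hom: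
 assumes W: "Fp_module p W" and h: "!!g. g : G ==> h g : carrier W"
 shows "free_ext (Fp p) W h : Hom p (free_mod (Fp p) G) W"
proof (rule mod_homI[OF Fp_module_free_mod W])
 interpret W: Fp_module p W by (rule W)
 interpret F: Fp_module p "free_mod (Fp p) G" by (rule Fp_module_free_mod)
 fix f assume f: "f : carrier (free_mod (Fp p) G)"
 then show "free_ext (Fp p) W h f : carrier W"
  by (subst free_ext_superset[where h = h, OF W h f, of "{g. f g \<noteq> 0}"]) (auto simp: free_mod_iff intro!: W.M.finsum_closed h)
 fix f' assume f': "f' : carrier (free_mod (Fp p) G)"
 \<comment> \<open>The support of a sum may be smaller than the union of the supports.\<close>
 let ?A = "{g. f g \<noteq> 0} \<union> {g. f' g \<noteq> 0}"
 have A: "finite ?A" "?A \<subseteq> G" using f f' by (auto simp: free_mod_iff)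
 have s: "{g. (f \<oplus>\<^bsub>free_mod (Fp p) G\<^esub> f') g \<noteq> 0} \<subseteq> ?A" by (auto simp: free_mod_ops)
 have hc: "g : ?A ==> h g : carrier W" for g using A h by blast
 have "free_ext (Fp p) W h (f \<oplus>\<^bsub>free_mod (Fp p) G\<^esub> f') = (\<Oplus>\<^bsub>W\<^esub>g\<in>?A. zmult p W ((f \<oplus>\<^bsub>free_mod (Fp p) G\<^esub> f') g) (h g))"
  by (rule free_ext_superset[OF W h F.M.a_closed[OF f f'] A(1) s A(2)])
 also have "... = (\<Oplus>\<^bsub>W\<^esub>g\<in>?A. zmult p W (f g) (h g) \<oplus>\<^bsub>W\<^esub> zmult p W (f' g) (h g))"
  by (rule W.M.finsum_cong'[OF refl]) (use hc in \<open>auto simp: free_mod_ops W.zmult_mod W.zmult_l_distr\<close>)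
 also have "... = (\<Oplus>\<^bsub>W\<^esub>g\<in>?A. zmult p W (f g) (h g)) \<oplus>\<^bsub>W\<^esub> (\<Oplus>\<^bsub>W\<^esub>g\<in>?A. zmult p W (f' g) (h g))"
  by (rule W.M.finsum_addf) (use hc in auto)
 also have "(\<Oplus>\<^bsub>W\<^esub>g\<in>?A. zmult p W (f g) (h g)) = free_ext (Fp p) W h f"
  by (rule free_ext_superset[where h = h, OF W h f A(1) _ A(2), symmetric]) auto
 also have "(\<Oplus>\<^bsub>W\<^esub>g\<in>?A. zmult p W (f' g) (h g)) = free_ext (Fp p) W h f'"
  by (rule free_ext_superset[where h = h, OF W h f' A(1) _ A(2), symmetric]) auto
 finally show "free_ext (Fp p) W h (f \<oplus>\<^bsub>free_mod (Fp p) G\<^esub> f') = free_ext (Fp p) W h f \<oplus>\<^bsub>W\<^esub> free_ext (Fp p) W h f'" .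
qed

lemma free_ext_basis:
 assumes W: "Fp_module p W" and h: "!!g. g : G ==> h g : carrier W" and g: "g : G"
 shows "free_ext (Fp p) W h (free_basis (Fp p) g) = h g"
proof -
 interpret W: Fp_module p W by (rule W)
 have "free_ext (Fp p) W h (free_basis (Fp p) g) = (\<Oplus>\<^bsub>W\<^esub>x\<in>{g}. zmult p W (free_basis (Fp p) g x) (h x))"
  by (rule free_ext_superset[where h = h, OF W h free_basis_closed[OF g]]) (use g in \<open>auto simp: free_basis_eq\<close>)
 then show ?thesis using h[OF g] by (simp add: free_basis_eq W.M.finsum_insert)
qed

end

text \<open>The value on a coset is that on an arbitrary representative.\<close>

definition quot_lift :: "('a => 'b) => 'a set => 'b" where "quot_lift f X = f (SOME x. x : X)"

lemma quot_lift:
 assumes V: "Fp_quotient p V K" and W: "Fp_module p W" and f: "f : Hom p V W"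
  and K: "!!x. x : K ==> f x = \<zero>\<^bsub>W\<^esub>"
 shows "quot_lift f : Hom p (quot_mod V K) W"
  and "x : carrier V ==> quot_lift f (K +>\<^bsub>V\<^esub> x) = f x"
proof -
 interpret V: Fp_quotient p V K by (rule V)
 interpret f: Fp_module_hom p V W f by (rule Fp_module_homI[OF V.Fp_module_axioms W f])
 show lift: "quot_lift f (K +>\<^bsub>V\<^esub> x) = f x" if x: "x : carrier V" for x
 proof -
  let ?z = "SOME z. z : K +>\<^bsub>V\<^esub> x"
  have "?z : K +>\<^bsub>V\<^esub> x" using V.coset_self[OF x] by (rule someI)
  then have z: "?z : carrier V" "?z \<ominus>\<^bsub>V\<^esub> x : K" by (auto simp: V.coset_iff[OF x])
  have "f ?z \<ominus>\<^bsub>W\<^esub> f x = \<zero>\<^bsub>W\<^esub>" using K[OF z(2)] by (simp add: f.diff z(1) x)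
  then show ?thesis unfolding quot_lift_def by (rule f.W.diff_eq_zeroD[OF f.closed[OF z(1)] f.closed[OF x]])
 qed
 show "quot_lift f : Hom p (quot_mod V K) W"
 proof (rule mod_homI[OF V.Fp_module_quot W])
  fix X assume "X : carrier (quot_mod V K)"
  then obtain x where x: "x : carrier V" "X = K +>\<^bsub>V\<^esub> x" by (rule V.quotE)
  show "quot_lift f X : carrier W" unfolding x(2) lift[OF x(1)] by (rule f.closed[OF x(1)])
  fix Y assume "Y : carrier (quot_mod V K)"
  then obtain y where y: "y : carrier V" "Y = K +>\<^bsub>V\<^esub> y" by (rule V.quotE)
  show "quot_lift f (X \<oplus>\<^bsub>quot_mod V K\<^esub> Y) = quot_lift f X \<oplus>\<^bsub>W\<^esub> quot_lift f Y"
   using x y by (simp add: V.coset_add lift f.add)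
 qed
qed

context filtered_ops begin

abbreviation "TF d \<equiv> tens_free p V V d"
abbreviation "TK d \<equiv> tens_ker p V V d"
abbreviation "T \<equiv> tensor p V V"
abbreviation "ten d i x y \<equiv> pure_tens p V V d i x y"

lemma TF_module: "Fp_module p (TF d)" unfolding tens_free_def by (rule Fp_module_free_mod[OF p_prime])

lemma gen_closed: "x : V $ i ==> y : V $ (d - i) ==> tens_gen p i x y : carrier (TF d)"
 unfolding tens_free_def tens_gen_def by (rule free_basis_closed[OF p_prime]) simp

end

sublocale filtered_ops \<subseteq> tf: Fp_module p "tens_free p V V d" for d by (rule TF_module)

context filtered_ops begin

lemma smult_gr: "c : carrier (Fp p) ==> x : V $ i ==> c \<odot>\<^bsub>grd V i\<^esub> x : V $ i"
 by (rule gr.smult_closed)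

lemma tens_rels_closed: "tens_rels p V V d \<subseteq> carrier (TF d)"
 unfolding tens_rels_def
 by (intro Un_least subsetI; clarsimp)
  (intro tf.M.minus_closed tf.M.a_closed tf.smult_closed gen_closed gr.M.a_closed smult_gr; assumption)+

lemma TK_submodule: "submodule (TK d) (Fp p) (TF d)" "tens_rels p V V d \<subseteq> TK d"
 unfolding tens_ker_def by (rule tf.mod_span_submodule[OF tens_rels_closed])+

end

sublocale filtered_ops \<subseteq> tq: Fp_quotient p "tens_free p V V d" "tens_ker p V V d" for d
 by (intro Fp_quotient.intro Fp_quotient_axioms.intro TF_module TK_submodule)

context filtered_ops begin

lemma T_grd: "grd T d = quot_mod (TF d) (TK d)" by (simp add: tensor_def)

lemma T_module: "Fp_module p (grd T d)" unfolding T_grd by (rule tq.Fp_module_quot)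

text \<open>The argument \<open>i\<close> is the degree of the first factor; the maps for different \<open>i\<close> are independent.\<close>

definition bilin :: "int => (int, 'c, 'n) module_scheme => (int => 'a => 'a => 'c) => bool" where
 "bilin d W h \<longleftrightarrow>
   (\<forall>i. \<forall>y\<in>V $ (d - i). (\<lambda>x. h i x y) : Hom p (grd V i) W) \<and>
   (\<forall>i. \<forall>x\<in>V $ i. h i x : Hom p (grd V (d - i)) W)"

lemma bilinD:
 assumes "bilin d W h"
 shows "y : V $ (d - i) ==> (\<lambda>x. h i x y) : Hom p (grd V i) W"
  and "x : V $ i ==> h i x : Hom p (grd V (d - i)) W"
  and "x : V $ i ==> y : V $ (d - i) ==> h i x y : carrier W"
proof -
 show "(\<lambda>x. h i x y) : Hom p (grd V i) W" if "y : V $ (d - i)" for i y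
  using assms that by (simp add: bilin_def)
 show *: "h i x : Hom p (grd V (d - i)) W" if "x : V $ i" for i x
  using assms that by (simp add: bilin_def)
 show "h i x y : carrier W" if "x : V $ i" "y : V $ (d - i)" for i x y
  by (rule mod_hom_closed[OF *[OF that(1)] that(2)])
qed

lemma bilinI:
 assumes "!!i y. y : V $ (d - i) ==> (\<lambda>x. h i x y) : Hom p (grd V i) W"
  and "!!i x. x : V $ i ==> h i x : Hom p (grd V (d - i)) W"
 shows "bilin d W h"
 using assms by (simp add: bilin_def)

lemma bilin_sum:
 assumes W: "Fp_module p W" and h: "bilin d W h" "bilin d W k"
 shows "bilin d W (\<lambda>i x y. h i x y \<oplus>\<^bsub>W\<^esub> k i x y)"
 by (rule bilinI; rule mod_hom_sum[OF gr.Fp_module_axioms W]; rule bilinD(1,2)[OF h(1)] bilinD(1,2)[OF h(2)]; assumption)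

lemma bilin_sgn:
 assumes W: "Fp_module p W" and h: "bilin d W h"
 shows "bilin d W (\<lambda>i x y. sgn_mult W i (h i x y))"
 by (rule bilinI; rule mod_hom_sgn[OF gr.Fp_module_axioms W]; rule bilinD(1,2)[OF h]; assumption)

lemma bilin_finsum:
 assumes W: "Fp_module p W" and h: "!!j. j : A ==> bilin d W (h j)"
 shows "bilin d W (\<lambda>i x y. \<Oplus>\<^bsub>W\<^esub>j\<in>A. h j i x y)"
 by (rule bilinI; rule mod_hom_finsum[OF gr.Fp_module_axioms W]; rule bilinD(1,2)[OF h]; assumption)

text \<open>The universal property of the tensor product: the linear extension of a bilinear map kills the four kinds of bilinearity relations.\<close>

lemma bilin_free_ext:
 assumes W: "Fp_module p W" and h: "bilin d W h"
 shows "free_ext (Fp p) W (\<lambda>(i, x, y). h i x y) : Hom p (TF d) W" (is "?f : _")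
  and "x : V $ i ==> y : V $ (d - i) ==> free_ext (Fp p) W (\<lambda>(i, x, y). h i x y) (tens_gen p i x y) = h i x y"
  and "w : TK d ==> free_ext (Fp p) W (\<lambda>(i, x, y). h i x y) w = \<zero>\<^bsub>W\<^esub>"
proof -
 let ?G = "{(i, x, y). x : V $ i \<and> y : V $ (d - i)}"
 have c: "(\<lambda>(i, x, y). h i x y) g : carrier W" if "g : ?G" for g using that bilinD(3)[OF h] by auto
 show f: "?f : Hom p (TF d) W" unfolding tens_free_def by (rule free_ext_hom[where h = "\<lambda>(i, x, y). h i x y", OF p_prime W c])
 show gen: "?f (tens_gen p i x y) = h i x y" if "x : V $ i" "y : V $ (d - i)" for i x y
  using free_ext_basis[where h = "\<lambda>(i, x, y). h i x y" and g = "(i, x, y)" and G = ?G, OF p_prime W c] that by (simp add: tens_gen_def)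
 interpret W: Fp_module p W by (rule W)
 interpret f: Fp_module_hom p "TF d" W ?f by (rule Fp_module_homI[OF TF_module W f])
 have fs: "?f (c \<odot>\<^bsub>TF d\<^esub> w) = c \<odot>\<^bsub>W\<^esub> ?f w" if "c : carrier (Fp p)" "w : carrier (TF d)" for c w
  using f that by (auto simp: mod_hom_def)
 have add: "h i (x \<oplus>\<^bsub>grd V i\<^esub> x') y = h i x y \<oplus>\<^bsub>W\<^esub> h i x' y" "c : carrier (Fp p) ==> h i (c \<odot>\<^bsub>grd V i\<^esub> x) y = c \<odot>\<^bsub>W\<^esub> h i x y"
  if "x : V $ i" "x' : V $ i" "y : V $ (d - i)" for i x x' y c
  using bilinD(1)[OF h that(3)] that by (auto simp: mod_hom_def)
 have add': "h i x (y \<oplus>\<^bsub>grd V (d - i)\<^esub> y') = h i x y \<oplus>\<^bsub>W\<^esub> h i x y'" "c : carrier (Fp p) ==> h i x (c \<odot>\<^bsub>grd V (d - i)\<^esub> y) = c \<odot>\<^bsub>W\<^esub> h i x y"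
  if "x : V $ i" "y : V $ (d - i)" "y' : V $ (d - i)" for i x y' y c
  using bilinD(2)[OF h that(1)] that by (auto simp: mod_hom_def)
 have z: "x \<ominus>\<^bsub>W\<^esub> x = \<zero>\<^bsub>W\<^esub>" if "x : carrier W" for x using that by (simp add: a_minus_def W.M.r_neg)
 have "submodule {\<zero>\<^bsub>W\<^esub>} (Fp p) W" by (rule W.submoduleI_additive) auto
 moreover have "?f r : {\<zero>\<^bsub>W\<^esub>}" if "r : tens_rels p V V d" for r
  using that unfolding tens_rels_def
  by (elim UnE CollectE exE conjE; hypsubst)
   (simp_all add: f.diff f.add fs gen gen_closed gr.smult_closed tf.smult_closed add add' bilinD(3)[OF h] W.smult_closed z)
 ultimately show "?f w = \<zero>\<^bsub>W\<^esub>" if "w : TK d"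
  using mod_span_hom[OF TF_module f W _ tens_rels_closed] that unfolding tens_ker_def by blast
qed

definition tens_lift :: "(int, 'c, 'n) module_scheme => (int => 'a => 'a => 'c) => ('a, 'a) tens => 'c" where
 "tens_lift W h = quot_lift (free_ext (Fp p) W (\<lambda>(i, x, y). h i x y))"

lemma tens_lift:
 assumes W: "Fp_module p W" and h: "bilin d W h"
 shows "tens_lift W h : Hom p (grd T d) W"
  and "x : V $ i ==> y : V $ (d - i) ==> tens_lift W h (ten d i x y) = h i x y"
 using quot_lift[OF tq.Fp_quotient_axioms W bilin_free_ext(1,3)[OF W h]] gen_closed bilin_free_ext(2)[OF W h]
 unfolding tens_lift_def T_grd pure_tens_def by auto

lemma ten_closed: "x : V $ i ==> y : V $ (d - i) ==> ten d i x y : T $ d"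
 unfolding pure_tens_def T_grd by (intro tq.coset_closed gen_closed)

lemma bilin_ten: "bilin d (grd T d) (ten d)"
proof -
 have rel: "TK d +>\<^bsub>TF d\<^esub> w = TK d +>\<^bsub>TF d\<^esub> w'" if "w \<ominus>\<^bsub>TF d\<^esub> w' : tens_rels p V V d" "w : carrier (TF d)" "w' : carrier (TF d)" for w w'
  using that TK_submodule(2) by (auto simp: tq.coset_eq)
 show ?thesis
  unfolding bilin_def
 proof (intro conjI allI ballI)
  fix i y assume y: "y : V $ (d - i)"
  show "(\<lambda>x. ten d i x y) : Hom p (grd V i) (grd T d)"
  proof (rule mod_homI[OF gr.Fp_module_axioms T_module ten_closed[OF _ y]])
   fix x x' assume x: "x : V $ i" "x' : V $ i"
   have "TK d +>\<^bsub>TF d\<^esub> tens_gen p i (x \<oplus>\<^bsub>grd V i\<^esub> x') y = TK d +>\<^bsub>TF d\<^esub> (tens_gen p i x y \<oplus>\<^bsub>TF d\<^esub> tens_gen p i x' y)"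
    by (rule rel) (use x y in \<open>auto simp: tens_rels_def gen_closed\<close>)
   then show "ten d i (x \<oplus>\<^bsub>grd V i\<^esub> x') y = ten d i x y \<oplus>\<^bsub>grd T d\<^esub> ten d i x' y"
    using x y by (simp add: pure_tens_def T_grd tq.coset_add gen_closed)
  qed
 next
  fix i x assume x: "x : V $ i"
  show "ten d i x : Hom p (grd V (d - i)) (grd T d)"
  proof (rule mod_homI[OF gr.Fp_module_axioms T_module ten_closed[OF x]])
   fix y y' assume y: "y : V $ (d - i)" "y' : V $ (d - i)"
   have "TK d +>\<^bsub>TF d\<^esub> tens_gen p i x (y \<oplus>\<^bsub>grd V (d - i)\<^esub> y') = TK d +>\<^bsub>TF d\<^esub> (tens_gen p i x y \<oplus>\<^bsub>TF d\<^esub> tens_gen p i x y')"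
    by (rule rel) (use x y in \<open>auto simp: tens_rels_def gen_closed\<close>)
   then show "ten d i x (y \<oplus>\<^bsub>grd V (d - i)\<^esub> y') = ten d i x y \<oplus>\<^bsub>grd T d\<^esub> ten d i x y'"
    using x y by (simp add: pure_tens_def T_grd tq.coset_add gen_closed)
  qed
 qed
qed

lemma bilin_ten_comp:
 assumes f: "!!i. f i : Hom p (grd V i) (grd V (j i))" and g: "!!i. g i : Hom p (grd V (d - i)) (grd V (d' - j i))"
 shows "bilin d (grd T d') (\<lambda>i x y. ten d' (j i) (f i x) (g i y))"
proof (rule bilinI)
 show "(\<lambda>x. ten d' (j i) (f i x) (g i y)) : Hom p (grd V i) (grd T d')" if "y : V $ (d - i)" for i y
  by (rule mod_hom_comp[OF f bilinD(1)[OF bilin_ten mod_hom_closed[OF g that]]])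
 show "(\<lambda>y. ten d' (j i) (f i x) (g i y)) : Hom p (grd V (d - i)) (grd T d')" if "x : V $ i" for i x
  by (rule mod_hom_comp[OF g bilinD(2)[OF bilin_ten mod_hom_closed[OF f that]]])
qed

lemma tens_span:
 assumes H: "submodule H (Fp p) (grd T d)" and "!!i x y. x : V $ i ==> y : V $ (d - i) ==> ten d i x y : H"
 shows "T $ d \<subseteq> H"
proof -
 have "submodule {w : carrier (TF d). TK d +>\<^bsub>TF d\<^esub> w : H} (Fp p) (TF d)"
  by (rule tf.submoduleI_additive)
   (use tq.qt.submoduleD(2,3)[OF H[unfolded T_grd]] in \<open>auto simp: tq.coset_add[symmetric] tq.co.zero\<close>)
 then have "carrier (TF d) \<subseteq> {w : carrier (TF d). TK d +>\<^bsub>TF d\<^esub> w : H}"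
  unfolding tens_free_def
  by (rule free_mod_span[OF p_prime])
   (use assms(2) gen_closed in \<open>auto simp: pure_tens_def tens_free_def tens_gen_def\<close>)
 then show ?thesis by (auto simp: T_grd tq.quot_carrier)
qed

lemma tens_hom_eqI:
 assumes f: "f : Hom p (grd T d) W" and f': "f' : Hom p (grd T d) W" and W: "Fp_module p W"
  and eq: "!!i x y. x : V $ i ==> y : V $ (d - i) ==> f (ten d i x y) = f' (ten d i x y)"
  and t: "t : T $ d"
 shows "f t = f' t"
proof -
 interpret T: Fp_module p "grd T d" by (rule T_module)
 interpret f: Fp_module_hom p "grd T d" W f by (rule Fp_module_homI[OF T_module W f])
 interpret f': Fp_module_hom p "grd T d" W f' by (rule Fp_module_homI[OF T_module W f'])
 have "submodule {t : T $ d. f t = f' t} (Fp p) (grd T d)"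
  by (rule T.submoduleI_additive) (auto simp: f.add f'.add)
 from tens_span[OF this] eq ten_closed t show ?thesis by blast
qed

text \<open>The extension to the free module of a map that is bilinear only modulo the relations carries relations to relations, because its composite with the projection is the extension of a bilinear map.\<close>

lemma tens_descend:
 assumes c: "!!i x y. x : V $ i ==> y : V $ (d - i) ==> h (i, x, y) : carrier (TF d')"
  and h': "bilin d (grd T d') h'"
  and eq: "!!i x y. x : V $ i ==> y : V $ (d - i) ==> TK d' +>\<^bsub>TF d'\<^esub> h (i, x, y) = h' i x y"
 shows "quot_map (TF d') (TK d') (free_ext (Fp p) (TF d') h) : Hom p (grd T d) (grd T d')" (is "?D : _")
  and "x : V $ i ==> y : V $ (d - i) ==>
   quot_map (TF d') (TK d') (free_ext (Fp p) (TF d') h) (ten d i x y) = h' i x y"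
proof -
 let ?G = "{(i, x, y). x : V $ i \<and> y : V $ (d - i)}"
 let ?f = "free_ext (Fp p) (TF d') h" and ?f' = "free_ext (Fp p) (grd T d') (\<lambda>(i, x, y). h' i x y)"
 have c': "h g : carrier (TF d')" if "g : ?G" for g using that c by auto
 have f: "?f : Hom p (TF d) (TF d')" unfolding tens_free_def[of p V V d]
  by (rule free_ext_hom[where h = h, OF p_prime TF_module c'])
 interpret f: Fp_module_hom p "TF d" "TF d'" ?f by (rule Fp_module_homI[OF TF_module TF_module f])
 interpret f': Fp_module_hom p "TF d" "grd T d'" ?f' by (rule Fp_module_homI[OF TF_module T_module bilin_free_ext(1)[OF T_module h']])
 have gen: "?f (tens_gen p i x y) = h (i, x, y)" if "x : V $ i" "y : V $ (d - i)" for i x y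
  using free_ext_basis[where h = h and g = "(i, x, y)" and G = ?G, OF p_prime TF_module c'] that by (simp add: tens_gen_def)
 have q: "TK d' +>\<^bsub>TF d'\<^esub> ?f w = ?f' w" if w: "w : carrier (TF d)" for w
 proof -
  have "submodule {w : carrier (TF d). TK d' +>\<^bsub>TF d'\<^esub> ?f w = ?f' w} (Fp p) (TF d)"
  proof (rule tf.submoduleI_additive)
   show "\<zero>\<^bsub>TF d\<^esub> : {w : carrier (TF d). TK d' +>\<^bsub>TF d'\<^esub> ?f w = ?f' w}" using tq.co.zero[of d'] f'.zero by (simp add: T_grd)
   fix v w assume "v : {w : carrier (TF d). TK d' +>\<^bsub>TF d'\<^esub> ?f w = ?f' w}" "w : {w : carrier (TF d). TK d' +>\<^bsub>TF d'\<^esub> ?f w = ?f' w}"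
   then show "v \<oplus>\<^bsub>TF d\<^esub> w : {w : carrier (TF d). TK d' +>\<^bsub>TF d'\<^esub> ?f w = ?f' w}"
    using f'.add[of v w] by (simp add: f.add tq.coset_add[symmetric] T_grd)
  qed auto
  then have "carrier (TF d) \<subseteq> {w : carrier (TF d). TK d' +>\<^bsub>TF d'\<^esub> ?f w = ?f' w}"
   unfolding tens_free_def[of p V V d]
  proof (rule free_mod_span[OF p_prime])
   fix g assume "g : ?G"
   then obtain i x y where g: "g = (i, x, y)" "x : V $ i" "y : V $ (d - i)" by auto
   then have "free_basis (Fp p) g = tens_gen p i x y" by (simp add: tens_gen_def)
   then show "free_basis (Fp p) g : {w : carrier (free_mod (Fp p) ?G). TK d' +>\<^bsub>TF d'\<^esub> ?f w = ?f' w}"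
    using gen_closed[OF g(2,3)] gen[OF g(2,3)] eq[OF g(2,3)] bilin_free_ext(2)[OF T_module h' g(2,3)] by (simp add: tens_free_def[of p V V d])
  qed
  then show ?thesis using w by blast
 qed
 have K: "?f w : TK d'" if w: "w : TK d" for w
 proof -
  have wc: "w : carrier (TF d)" using w tf.submoduleD(1)[OF TK_submodule(1)] by blast
  have "TK d' +>\<^bsub>TF d'\<^esub> ?f w = TK d' +>\<^bsub>TF d'\<^esub> \<zero>\<^bsub>TF d'\<^esub>"
   unfolding q[OF wc] bilin_free_ext(3)[OF T_module h' w] by (simp add: T_grd)
  then have "?f w \<ominus>\<^bsub>TF d'\<^esub> \<zero>\<^bsub>TF d'\<^esub> : TK d'" unfolding tq.coset_eq[OF f.closed[OF wc] tf.M.zero_closed] .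
  then show ?thesis using wc by (simp add: a_minus_def tf.uminus_zero)
 qed
 have D: "?D (TK d +>\<^bsub>TF d\<^esub> w) = ?f' w" if w: "w : carrier (TF d)" for w
  using quot_map_coset[OF tq.Fp_quotient_axioms tq.Fp_quotient_axioms f K tq.coset_closed[OF w] tq.coset_self[OF w]] q[OF w] by simp
 show "?D (ten d i x y) = h' i x y" if "x : V $ i" "y : V $ (d - i)" for i x y
  unfolding pure_tens_def D[OF gen_closed[OF that]] by (rule bilin_free_ext(2)[OF T_module h' that])
 show "?D : Hom p (grd T d) (grd T d')"
 proof (rule mod_homI[OF T_module T_module])
  fix X assume "X : T $ d"
  then obtain x where x: "x : carrier (TF d)" "X = TK d +>\<^bsub>TF d\<^esub> x" unfolding T_grd by (rule tq.quotE)
  show "?D X : T $ d'" unfolding x(2) D[OF x(1)] by (rule f'.closed[OF x(1)])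
  fix Y assume "Y : T $ d"
  then obtain y where y: "y : carrier (TF d)" "Y = TK d +>\<^bsub>TF d\<^esub> y" unfolding T_grd by (rule tq.quotE)
  have "X \<oplus>\<^bsub>grd T d\<^esub> Y = TK d +>\<^bsub>TF d\<^esub> (x \<oplus>\<^bsub>TF d\<^esub> y)" using x y by (simp add: T_grd tq.coset_add)
  then show "?D (X \<oplus>\<^bsub>grd T d\<^esub> Y) = ?D X \<oplus>\<^bsub>grd T d'\<^esub> ?D Y"
   unfolding x(2) y(2) by (simp only: D x(1) y(1) tf.M.a_closed f'.add)
 qed
qed

end

lemma mod_hom_id: "(\<lambda>x. x) : mod_hom R V V" by (auto simp: mod_hom_def)

context filtered_ops begin

lemma T_sop: "sop T g d = quot_map (TF (d - deg p g)) (TK (d - deg p g))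
  (free_ext (Fp p) (TF (d - deg p g)) (diag_op p V V g d))"
 by (simp add: tensor_def Let_def)

lemma sop_Pow_ten:
 shows "sop T (Pow r) d : Hom p (grd T d) (grd T (d - deg p (Pow r)))"
  and "x : V $ i ==> y : V $ (d - i) ==> sop T (Pow r) d (ten d i x y) =
   (\<Oplus>\<^bsub>grd T (d - deg p (Pow r))\<^esub>j\<in>{0..r}. ten (d - deg p (Pow r)) (i - deg p (Pow j))
    (sop V (Pow j) i x) (sop V (Pow (r - j)) (d - i) y))"
proof -
 let ?D = "d - deg p (Pow r)"
 let ?t = "\<lambda>j i x y. tens_gen p (i - deg p (Pow j)) (sop V (Pow j) i x) (sop V (Pow (r - j)) (d - i) y)"
 let ?h' = "\<lambda>i x y. \<Oplus>\<^bsub>grd T ?D\<^esub>j\<in>{0..r}. ten ?D (i - deg p (Pow j)) (sop V (Pow j) i x) (sop V (Pow (r - j)) (d - i) y)"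
 have E: "d - i - deg p (Pow (r - j)) = ?D - (i - deg p (Pow j))" if "j : {0..r}" for i j
  using pow_deg_add[OF prime_gt_0_nat[OF p_prime], of j "r - j"] that by simp
 have t: "?t j i x y : carrier (TF ?D)" if "j : {0..r}" "x : V $ i" "y : V $ (d - i)" for i j x y
  by (intro gen_closed sp.closed that(2)) (use sp.closed[OF that(3), of "Pow (r - j)"] in \<open>simp only: E[OF that(1)]\<close>)
 have d: "diag_op p V V (Pow r) d (i, x, y) = (\<Oplus>\<^bsub>TF ?D\<^esub>j\<in>{0..r}. ?t j i x y)" for i x y
  by (simp add: diag_op_def Let_def)
 have b: "bilin d (grd T ?D) ?h'"
 proof (rule bilin_finsum[OF T_module bilin_ten_comp[OF sop_hom]])
  show "sop V (Pow (r - j)) (d - i) : Hom p (grd V (d - i)) (grd V (?D - (i - deg p (Pow j))))" if "j : {0..r}" for i j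
   using sop_hom[of "Pow (r - j)" "d - i"] unfolding E[OF that] .
 qed
 have c: "diag_op p V V (Pow r) d (i, x, y) : carrier (TF ?D)" if "x : V $ i" "y : V $ (d - i)" for i x y
  unfolding d by (rule tf.M.finsum_closed) (use t that in blast)
 have e: "TK ?D +>\<^bsub>TF ?D\<^esub> diag_op p V V (Pow r) d (i, x, y) = ?h' i x y"
  if "x : V $ i" "y : V $ (d - i)" for i x y
  unfolding d pure_tens_def T_grd by (rule tq.co.finsum) (use t that in blast)
 show "sop T (Pow r) d : Hom p (grd T d) (grd T ?D)"
  and "x : V $ i ==> y : V $ (d - i) ==> sop T (Pow r) d (ten d i x y) = ?h' i x y"
  unfolding T_sop using tens_descend[OF c b e] by blast+
qed

text \<open>Covers \<open>\<beta>\<close> and the differential; \<open>j i\<close> is the degree of \<open>E x\<close> for \<open>x\<close> of degree \<open>i\<close>.\<close>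

lemma ten_derivation:
 assumes E: "!!i. E i : Hom p (grd V i) (grd V (j i))" and j: "!!i. d' - j i = d - i" "!!i. j (d - i) = d' - i"
  and h: "!!i x y. h (i, x, y) = tens_gen p (j i) (E i x) y \<oplus>\<^bsub>TF d'\<^esub> sgn_mult (TF d') i (tens_gen p i x (E (d - i) y))"
 shows "quot_map (TF d') (TK d') (free_ext (Fp p) (TF d') h) : Hom p (grd T d) (grd T d')"
  and "x : V $ i ==> y : V $ (d - i) ==>
   quot_map (TF d') (TK d') (free_ext (Fp p) (TF d') h) (ten d i x y)
   = ten d' (j i) (E i x) y \<oplus>\<^bsub>grd T d'\<^esub> sgn_mult (grd T d') i (ten d' i x (E (d - i) y))"
proof -
 let ?h' = "\<lambda>i x y. ten d' (j i) (E i x) y \<oplus>\<^bsub>grd T d'\<^esub> sgn_mult (grd T d') i (ten d' i x (E (d - i) y))"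
 have "bilin d (grd T d') (\<lambda>i x y. ten d' (j i) (E i x) y)"
  by (rule bilin_ten_comp[OF E, where g = "\<lambda>i y. y"]) (simp only: j mod_hom_id)
 moreover have "bilin d (grd T d') (\<lambda>i x y. ten d' i x (E (d - i) y))"
  by (rule bilin_ten_comp[where f = "\<lambda>i x. x", OF mod_hom_id]) (use E in \<open>simp only: j(2)[symmetric]\<close>)
 ultimately have b: "bilin d (grd T d') ?h'" by (intro bilin_sum bilin_sgn T_module)
 have t: "tens_gen p (j i) (E i x) y : carrier (TF d')" "tens_gen p i x (E (d - i) y) : carrier (TF d')"
  if "x : V $ i" "y : V $ (d - i)" for i x y
  by (rule gen_closed[OF mod_hom_closed[OF E that(1)]], simp only: j(1) that)
   (rule gen_closed[OF that(1)], simp only: j(2)[symmetric] mod_hom_closed[OF E that(2)])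
 have c: "h (i, x, y) : carrier (TF d')" if "x : V $ i" "y : V $ (d - i)" for i x y
  unfolding h using t[OF that] by blast
 have e: "TK d' +>\<^bsub>TF d'\<^esub> h (i, x, y) = ?h' i x y"
  if "x : V $ i" "y : V $ (d - i)" for i x y
  unfolding h pure_tens_def T_grd using t[OF that] by (simp only: tq.co.add tq.co.sgn tf.sgn_mult_closed)
 show "quot_map (TF d') (TK d') (free_ext (Fp p) (TF d') h) : Hom p (grd T d) (grd T d')"
  and "x : V $ i ==> y : V $ (d - i) ==>
   quot_map (TF d') (TK d') (free_ext (Fp p) (TF d') h) (ten d i x y) = ?h' i x y"
  using tens_descend[OF c b e] by blast+
qed

lemma sop_Bock_ten:
 shows "sop T Bock d : Hom p (grd T d) (grd T (d - 1))"
  and "x : V $ i ==> y : V $ (d - i) ==> sop T Bock d (ten d i x y) =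
   ten (d - 1) (i - 1) (sop V Bock i x) y \<oplus>\<^bsub>grd T (d - 1)\<^esub> sgn_mult (grd T (d - 1)) i (ten (d - 1) i x (sop V Bock (d - i) y))"
proof -
 have g: "deg p Bock = 1" by (simp add: gen_deg_def)
 have h: "diag_op p V V Bock d (i, x, y) = tens_gen p (i - 1) (sop V Bock i x) y
  \<oplus>\<^bsub>TF (d - 1)\<^esub> sgn_mult (TF (d - 1)) i (tens_gen p i x (sop V Bock (d - i) y))" for i x y
  by (simp add: diag_op_def Let_def gen_deg_def)
 have j: "d - 1 - (i - 1) = d - i" "d - i - 1 = d - 1 - i" for i by simp_all
 show "sop T Bock d : Hom p (grd T d) (grd T (d - 1))"
  and "x : V $ i ==> y : V $ (d - i) ==> sop T Bock d (ten d i x y) =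
   ten (d - 1) (i - 1) (sop V Bock i x) y \<oplus>\<^bsub>grd T (d - 1)\<^esub> sgn_mult (grd T (d - 1)) i (ten (d - 1) i x (sop V Bock (d - i) y))"
  unfolding T_sop g using ten_derivation[where j = "\<lambda>i. i - 1", OF sop_hom[of Bock, unfolded g] j h] by blast+
qed

lemma T_sop_hom: "sop T g d : Hom p (grd T d) (grd T (d - deg p g))"
 using sop_Pow_ten(1) sop_Bock_ten(1) by (cases g) (simp_all add: gen_deg_def)

lemma dif_ten:
 shows T_dif_hom: "dif T d : Hom p (grd T d) (grd T (d + 1))"
  and "x : V $ i ==> y : V $ (d - i) ==> dif T d (ten d i x y) =
   ten (d + 1) (i + 1) (dif V i x) y \<oplus>\<^bsub>grd T (d + 1)\<^esub> sgn_mult (grd T (d + 1)) i (ten (d + 1) i x (dif V (d - i) y))"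
proof -
 have dif: "dif T d = quot_map (TF (d + 1)) (TK (d + 1)) (free_ext (Fp p) (TF (d + 1)) (diag_dif p V V d))"
  by (simp add: tensor_def)
 have h: "diag_dif p V V d (i, x, y) = tens_gen p (i + 1) (dif V i x) y \<oplus>\<^bsub>TF (d + 1)\<^esub> sgn_mult (TF (d + 1)) i (tens_gen p i x (dif V (d - i) y))" for i x y
  by (simp add: diag_dif_def Let_def)
 have j: "d + 1 - (i + 1) = d - i" "d - i + 1 = d + 1 - i" for i by simp_all
 show "dif T d : Hom p (grd T d) (grd T (d + 1))"
  and "x : V $ i ==> y : V $ (d - i) ==> dif T d (ten d i x y) =
   ten (d + 1) (i + 1) (dif V i x) y \<oplus>\<^bsub>grd T (d + 1)\<^esub> sgn_mult (grd T (d + 1)) i (ten (d + 1) i x (dif V (d - i) y))"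
  unfolding dif using ten_derivation[where j = "\<lambda>i. i + 1", OF dif_hom j h] by blast+
qed

abbreviation "TFl \<equiv> tensor_fil p V Fl V Fl"

lemma TFl_gens: "{ten d i x y | a b i x y. a + b = n \<and> x : Fl a i \<and> y : Fl b (d - i)} \<subseteq> T $ d"
 using gr.submoduleD(1)[OF Fl_submodule] by (auto intro!: ten_closed)

lemma TFl_submodule: "submodule (TFl n d) (Fp p) (grd T d)"
 unfolding tensor_fil_def by (rule Fp_module.mod_span_submodule(1)[OF T_module TFl_gens])

lemma ten_TFl:
 assumes "x : Fl a i" "y : Fl b (d - i)" "a + b \<le> n" shows "ten d i x y : TFl n d"
proof -
 have "y : Fl (n - a) (d - i)" using assms(2,3) Fl_mono[of b "n - a"] by auto
 then have "ten d i x y : {ten d i x y | a b i x y. a + b = n \<and> x : Fl a i \<and> y : Fl b (d - i)}"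
  using assms(1) by (intro CollectI exI[of _ a] exI[of _ "n - a"] exI[of _ i] exI[of _ x] exI[of _ y]) simp
 then show ?thesis unfolding tensor_fil_def using Fp_module.mod_span_submodule(2)[OF T_module TFl_gens] by blast
qed

lemma TFl_hom:
 assumes f: "f : Hom p (grd T d) W" and W: "Fp_module p W" "submodule H (Fp p) W"
  and ten: "!!a b i x y. a + b = n ==> x : Fl a i ==> y : Fl b (d - i) ==> f (ten d i x y) : H"
  and t: "t : TFl n d"
 shows "f t : H"
 by (rule mod_span_hom[OF T_module f W TFl_gens _ t[unfolded tensor_fil_def]]) (use ten in auto)

lemma tensor_filtered_ops: "filtered_ops p T TFl s"
proof (intro filtered_ops.intro filtered_ops_axioms.intro graded_ops.intro p_prime TFl_submodule T_sop_hom T_dif_hom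
  Fp_module.Fp_module T_module)
 note Flc = gr.submoduleD(1)[OF Fl_submodule, THEN subsetD]
 have id: "(\<lambda>x. x) : Hom p (grd T d) (grd T d)" for d by (rule mod_hom_id)
 show "TFl m d \<subseteq> TFl n d" if "m \<le> n" for m n d
  by (rule subsetI, rule TFl_hom[OF id T_module TFl_submodule]) (rule ten_TFl, use that in auto)
 show "sop T g d t : TFl n (d - deg p g)" if "t : TFl n d" for n g d t
 proof (rule TFl_hom[OF T_sop_hom T_module TFl_submodule _ that])
  fix a b i x y assume n: "a + b = n" and x: "x : Fl a i" and y: "y : Fl b (d - i)"
  show "sop T g d (ten d i x y) : TFl n (d - deg p g)"
  proof (cases g)
   case Bock
   have g: "deg p Bock = 1" by (simp add: gen_deg_def)
   have j: "d - 1 - (i - 1) = d - i" "d - 1 - i = d - i - 1" by simp_all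
   have "ten (d - 1) (i - 1) (sop V Bock i x) y : TFl n (d - 1)"
    using Fl_sop[OF x, of Bock] y n by (intro ten_TFl[where a = a and b = b]) (simp_all add: j gen_deg_def)
   moreover have "ten (d - 1) i x (sop V Bock (d - i) y) : TFl n (d - 1)"
    using Fl_sop[OF y, of Bock] x n by (intro ten_TFl[where a = a and b = b]) (simp_all add: j gen_deg_def)
   moreover have "sgn_mult (grd T (d - 1)) i z : TFl n (d - 1)" if "z : TFl n (d - 1)" for z
    using Fp_module.submoduleD(4)[OF T_module TFl_submodule] that by (simp add: sgn_mult_def)
   ultimately show ?thesis unfolding Bock g sop_Bock_ten(2)[OF Flc[OF x] Flc[OF y]]
    by (intro Fp_module.submoduleD(3)[OF T_module TFl_submodule])
  next
   case (Pow r)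
   have E: "d - i - deg p (Pow (r - j)) = d - deg p (Pow r) - (i - deg p (Pow j))" if "j : {0..r}" for j
    using pow_deg_add[OF prime_gt_0_nat[OF p_prime], of j "r - j"] that by simp
   show ?thesis unfolding Pow sop_Pow_ten(2)[OF Flc[OF x] Flc[OF y]]
   proof (rule Fp_module.finsum_submodule[OF T_module TFl_submodule], rule Pi_I)
    fix j assume j: "j : {0..r}"
    show "ten (d - deg p (Pow r)) (i - deg p (Pow j)) (sop V (Pow j) i x) (sop V (Pow (r - j)) (d - i) y) : TFl n (d - deg p (Pow r))"
     by (rule ten_TFl[OF Fl_sop[OF x] Fl_sop[OF y, of "Pow (r - j)", unfolded E[OF j]]]) (simp add: n)
   qed
  qed
 qed
 show "dif T d t : TFl (n + s) (d + 1)" if "t : TFl n d" for n d t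
 proof (rule TFl_hom[OF T_dif_hom T_module TFl_submodule _ that])
  fix a b i x y assume n: "a + b = n" and x: "x : Fl a i" and y: "y : Fl b (d - i)"
  have j: "d + 1 - (i + 1) = d - i" "d + 1 - i = d - i + 1" by simp_all
  have "ten (d + 1) (i + 1) (dif V i x) y : TFl (n + s) (d + 1)"
   using Fl_dif[OF x] y n by (intro ten_TFl[where a = "a + s" and b = b]) (simp_all add: j)
  moreover have "ten (d + 1) i x (dif V (d - i) y) : TFl (n + s) (d + 1)"
   using Fl_dif[OF y] x n by (intro ten_TFl[where a = a and b = "b + s"]) (simp_all add: j)
  moreover have "sgn_mult (grd T (d + 1)) i z : TFl (n + s) (d + 1)" if "z : TFl (n + s) (d + 1)" for z
   using Fp_module.submoduleD(4)[OF T_module TFl_submodule] that by (simp add: sgn_mult_def)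
  ultimately show "dif T d (ten d i x y) : TFl (n + s) (d + 1)" unfolding dif_ten(2)[OF Flc[OF x] Flc[OF y]]
   by (intro Fp_module.submoduleD(3)[OF T_module TFl_submodule])
 qed
qed

lemma sop_compl_map:
 assumes "x : V $ d"
 shows "sop C g d (compl_map V Fl d x) = compl_map V Fl (d - deg p g) (sop V g d x)"
 by (rule C_eqI[OF sop_C_closed[OF compl_map_closed[OF assms]] compl_map_closed[OF sp.closed[OF assms]]])
  (use sop_mem[OF compl_map_closed compl_map_mem] compl_map_mem[OF sp.closed] assms in blast)

lemma compl_map_zero: "compl_map V Fl d \<zero>\<^bsub>grd V d\<^esub> = \<zero>\<^bsub>grd C d\<^esub>"
 by (rule C_eqI[OF compl_map_closed C_closed(1)]) (use compl_map_mem zero_mem in blast)+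

end

section \<open>The product as a map out of the completed tensor square\<close>

locale complete_product = filtered_product +
 assumes complete: "complete_Hausdorff s p P Fl"
begin

interpretation tt: filtered_ops p "tensor p P P" "tensor_fil p P Fl P Fl" s by (rule fo.tensor_filtered_ops)

abbreviation "CT \<equiv> ctensor s p P Fl P Fl"

definition tmul :: "int => ('a, 'a) tens => 'a" where
 "tmul d = fo.tens_lift (grd P d) (\<lambda>i. mul i (d - i))"

lemma bilin_mul: "fo.bilin d (grd P d) (\<lambda>i. mul i (d - i))"
proof (rule fo.bilinI)
 show "(\<lambda>x. mul i (d - i) x y) : Hom p (grd P i) (grd P d)" if "y : P $ (d - i)" for i y
  using mul_left[OF that, of i] by simp
 show "mul i (d - i) x : Hom p (grd P (d - i)) (grd P d)" if "x : P $ i" for i x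
  using mul_right[OF that, of "d - i"] by simp
qed

lemma tmul_hom: "tmul d : Hom p (grd fo.T d) (grd P d)"
 and tmul_ten: "x : P $ i ==> y : P $ (d - i) ==> tmul d (fo.ten d i x y) = mul i (d - i) x y"
 unfolding tmul_def using fo.tens_lift[OF gr.Fp_module_axioms bilin_mul] by blast+

interpretation tm: Fp_module_hom p "grd fo.T d" "grd P d" "tmul d" for d
 by (rule Fp_module_homI[OF fo.T_module gr.Fp_module_axioms tmul_hom])

lemma tmul_fil: "t : fo.TFl n d ==> tmul d t : Fl n d"
proof (rule fo.TFl_hom[OF tmul_hom gr.Fp_module_axioms Fl_submodule])
 fix a b i x y assume n: "a + b = n" and x: "x : Fl a i" and y: "y : Fl b (d - i)"
 have "mul i (d - i) x y : Fl (a + b) (i + (d - i))" by (rule Fl_mul[OF x y])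
 then show "tmul d (fo.ten d i x y) : Fl n d" unfolding tmul_ten[OF Fl_carrier[OF x] Fl_carrier[OF y]] n by simp
qed

lemma tmul_derivation:
 assumes x: "x : P $ i" and y: "y : P $ (d - i)"
  and x': "x' : P $ i'" and y': "y' : P $ e'" and j: "d' - i' = d - i" "d' - i = e'"
 shows "tmul d' (fo.ten d' i' x' y \<oplus>\<^bsub>grd fo.T d'\<^esub> sgn_mult (grd fo.T d') i (fo.ten d' i x y'))
  = mul i' (d - i) x' y \<oplus>\<^bsub>grd P d'\<^esub> sgn_mult (grd P d') i (mul i e' x y')"
proof -
 have c: "y : P $ (d' - i')" "y' : P $ (d' - i)" using y y' by (simp_all only: j)
 note t = fo.ten_closed[OF x' c(1)] fo.ten_closed[OF x c(2)]
 show ?thesis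
  unfolding tm.add[OF t(1) tt.gr.sgn_mult_closed[OF t(2)]] tm.sgn[OF t(2)] tmul_ten[OF x' c(1)] tmul_ten[OF x c(2)] j ..
qed

text \<open>On pure tensors this is the Cartan formula.\<close>

lemma tmul_sop: "t : fo.T $ d ==> tmul (d - deg p g) (sop fo.T g d t) = sop P g d (tmul d t)"
proof (rule fo.tens_hom_eqI[OF mod_hom_comp[OF fo.T_sop_hom tmul_hom] mod_hom_comp[OF tmul_hom sop_hom] gr.Fp_module_axioms])
 fix i x y assume x: "x : P $ i" and y: "y : P $ (d - i)"
 show "tmul (d - deg p g) (sop fo.T g d (fo.ten d i x y)) = sop P g d (tmul d (fo.ten d i x y))"
 proof (cases g)
  case Bock
  have g: "deg p Bock = 1" by (simp add: gen_deg_def)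
  have j: "d - 1 - (i - 1) = d - i" "d - 1 - i = d - i - 1" "i + (d - i) = d" by simp_all
  show ?thesis unfolding Bock g fo.sop_Bock_ten(2)[OF x y] tmul_ten[OF x y]
   using tmul_derivation[OF x y sp.closed[OF x, of Bock, unfolded g] sp.closed[OF y, of Bock, unfolded g] j(1,2)]
    mul_Bock[OF x y] unfolding j by simp
 next
  case (Pow r)
  let ?D = "d - deg p (Pow r)"
  have E: "d - i - deg p (Pow (r - j)) = ?D - (i - deg p (Pow j))" if "j : {0..r}" for j
   using pow_deg_add[OF prime_gt_0_nat[OF p_prime], of j "r - j"] that by simp
  note cx = sp.closed[OF x] and cy = sp.closed[OF y]
  have t: "fo.ten ?D (i - deg p (Pow j)) (sop P (Pow j) i x) (sop P (Pow (r - j)) (d - i) y) : fo.T $ ?D"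
   if "j : {0..r}" for j
   using fo.ten_closed[OF cx cy[of "Pow (r - j)", unfolded E[OF that]]] .
  have e: "tmul ?D (fo.ten ?D (i - deg p (Pow j)) (sop P (Pow j) i x) (sop P (Pow (r - j)) (d - i) y))
    = mul (i - deg p (Pow j)) (d - i - deg p (Pow (r - j))) (sop P (Pow j) i x) (sop P (Pow (r - j)) (d - i) y)"
   if "j : {0..r}" for j
   unfolding E[OF that] by (rule tmul_ten[OF cx cy[of "Pow (r - j)", unfolded E[OF that]]])
  have i: "i + (d - i) = d" by simp
  have "tmul ?D (sop fo.T (Pow r) d (fo.ten d i x y)) = (\<Oplus>\<^bsub>grd P ?D\<^esub>j\<in>{0..r}.
    tmul ?D (fo.ten ?D (i - deg p (Pow j)) (sop P (Pow j) i x) (sop P (Pow (r - j)) (d - i) y)))"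
   unfolding fo.sop_Pow_ten(2)[OF x y] by (rule tm.finsum) (use t in blast)
  also have "... = (\<Oplus>\<^bsub>grd P ?D\<^esub>j\<in>{0..r}.
    mul (i - deg p (Pow j)) (d - i - deg p (Pow (r - j))) (sop P (Pow j) i x) (sop P (Pow (r - j)) (d - i) y))"
   by (rule gr.M.finsum_cong'[OF refl]) (use e tm.closed[OF t] in auto)
  also have "... = sop P (Pow r) d (tmul d (fo.ten d i x y))"
   unfolding tmul_ten[OF x y] using mul_Pow[OF x y, of r] unfolding i by (rule sym)
  finally show ?thesis unfolding Pow .
 qed
qed

text \<open>On pure tensors this is the Leibniz rule.\<close>

lemma tmul_dif: "t : fo.T $ d ==> tmul (d + 1) (dif fo.T d t) = dif P d (tmul d t)"
proof (rule fo.tens_hom_eqI[OF mod_hom_comp[OF fo.T_dif_hom tmul_hom] mod_hom_comp[OF tmul_hom dif_hom] gr.Fp_module_axioms])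
 fix i x y assume x: "x : P $ i" and y: "y : P $ (d - i)"
 have j: "d + 1 - (i + 1) = d - i" "d + 1 - i = d - i + 1" "i + (d - i) = d" by simp_all
 show "tmul (d + 1) (dif fo.T d (fo.ten d i x y)) = dif P d (tmul d (fo.ten d i x y))"
  unfolding fo.dif_ten(2)[OF x y] tmul_ten[OF x y]
  using tmul_derivation[OF x y mod_hom_closed[OF dif_hom x] mod_hom_closed[OF dif_hom y] j(1,2)]
   dif_mul[OF x y] unfolding j by simp
qed

text \<open>The limit of the products of representatives.\<close>

definition mu :: "int => ('a, 'a) ctens => 'a" where
 "mu d \<xi> = (THE z. z : P $ d \<and> (\<forall>n. \<forall>t\<in>\<xi> n. z \<ominus>\<^bsub>grd P d\<^esub> tmul d t : Fl n d))"

lemma compl_map_inj: "x : P $ d ==> y : P $ d ==> (!!n. x \<ominus>\<^bsub>grd P d\<^esub> y : Fl n d) ==> x = y"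
proof -
 assume x: "x : P $ d" and y: "y : P $ d" and xy: "!!n. x \<ominus>\<^bsub>grd P d\<^esub> y : Fl n d"
 have "compl_map P Fl d x = compl_map P Fl d y" unfolding compl_map_def using fo.q.coset_eq[OF x y] xy by blast
 then show "x = y" using complete x y unfolding complete_Hausdorff_def bij_betw_def inj_on_def by blast
qed

text \<open>The products of representatives form a coherent family of cosets; completeness provides the limit, the Hausdorff property its uniqueness.\<close>

lemma mu_ex1:
 assumes \<xi>: "\<xi> : CT $ d"
 shows "\<exists>!z. z : P $ d \<and> (\<forall>n. \<forall>t\<in>\<xi> n. z \<ominus>\<^bsub>grd P d\<^esub> tmul d t : Fl n d)"
proof (rule ex_ex1I)
 define t where "t n = (SOME t. t : \<xi> n)" for n
 have t: "t n : \<xi> n" for n unfolding t_def by (rule tt.C_obtain[OF \<xi>, of n]) (rule someI)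
 note tc = tt.C_rep(1)[OF \<xi>]
 have d: "tmul d u \<ominus>\<^bsub>grd P d\<^esub> tmul d v : Fl n d" if "u : \<xi> m" "v : \<xi> n" "m \<le> n" for u v m n
  using tmul_fil[OF tt.C_diff[OF \<xi> that]] unfolding tm.diff[OF tc[OF that(1)] tc[OF that(2)]] .
 have Z: "(\<lambda>n. Fl n d +>\<^bsub>grd P d\<^esub> tmul d (t n)) : C $ d"
  by (rule fo.C_I[OF tm.closed[OF tc[OF t]]]) (rule d[OF t t])
 then obtain z where z: "z : P $ d" "compl_map P Fl d z = (\<lambda>n. Fl n d +>\<^bsub>grd P d\<^esub> tmul d (t n))"
  using complete unfolding complete_Hausdorff_def bij_betw_def image_iff by (metis (no_types, lifting) image_iff)
 have "z \<ominus>\<^bsub>grd P d\<^esub> tmul d v : Fl n d" if v: "v : \<xi> n" for n v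
 proof -
  have "Fl n d +>\<^bsub>grd P d\<^esub> z = Fl n d +>\<^bsub>grd P d\<^esub> tmul d (t n)" using z(2) by (simp add: compl_map_def fun_eq_iff)
  then have "z \<ominus>\<^bsub>grd P d\<^esub> tmul d (t n) : Fl n d" unfolding fo.q.coset_eq[OF z(1) tm.closed[OF tc[OF t]]] .
  from gr.submoduleD(3)[OF Fl_submodule this d[OF t v order_refl]]
  show ?thesis unfolding fo.q.diff_trans[OF z(1) tm.closed[OF tc[OF t]] tm.closed[OF tc[OF v]]] .
 qed
 then show "\<exists>z. z : P $ d \<and> (\<forall>n. \<forall>t\<in>\<xi> n. z \<ominus>\<^bsub>grd P d\<^esub> tmul d t : Fl n d)" using z(1) by blast
 fix z z' assume z: "z : P $ d \<and> (\<forall>n. \<forall>t\<in>\<xi> n. z \<ominus>\<^bsub>grd P d\<^esub> tmul d t : Fl n d)"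
  and z': "z' : P $ d \<and> (\<forall>n. \<forall>t\<in>\<xi> n. z' \<ominus>\<^bsub>grd P d\<^esub> tmul d t : Fl n d)"
 show "z = z'"
 proof (rule compl_map_inj)
  fix n
  note tn = tm.closed[OF tc[OF t[of n]]]
  have 1: "z \<ominus>\<^bsub>grd P d\<^esub> tmul d (t n) : Fl n d" and 2: "z' \<ominus>\<^bsub>grd P d\<^esub> tmul d (t n) : Fl n d" using z z' t by blast+
  have "tmul d (t n) \<ominus>\<^bsub>grd P d\<^esub> z' : Fl n d"
   using gr.submoduleD(4)[OF Fl_submodule 2] z' tn by (simp add: fo.q.minus_diff)
  from gr.submoduleD(3)[OF Fl_submodule 1 this] show "z \<ominus>\<^bsub>grd P d\<^esub> z' : Fl n d"
   using z z' tn by (simp add: fo.q.diff_trans)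
 qed (use z z' in auto)
qed

lemma mu_closed: "\<xi> : CT $ d ==> mu d \<xi> : P $ d"
 and mu_approx: "\<xi> : CT $ d ==> t : \<xi> n ==> mu d \<xi> \<ominus>\<^bsub>grd P d\<^esub> tmul d t : Fl n d"
 using theI'[OF mu_ex1] unfolding mu_def by blast+

lemma mu_eqI:
 assumes \<xi>: "\<xi> : CT $ d" and z: "z : P $ d"
  and "!!n. \<exists>t\<in>\<xi> n. z \<ominus>\<^bsub>grd P d\<^esub> tmul d t : Fl n d"
 shows "mu d \<xi> = z"
proof (rule compl_map_inj[OF mu_closed[OF \<xi>] z])
 fix n
 obtain t where t: "t : \<xi> n" "z \<ominus>\<^bsub>grd P d\<^esub> tmul d t : Fl n d" using assms(3) by blast
 note tc = tm.closed[OF tt.C_rep(1)[OF \<xi> t(1)]]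
 have "tmul d t \<ominus>\<^bsub>grd P d\<^esub> z : Fl n d" using gr.submoduleD(4)[OF Fl_submodule t(2)] z tc by (simp add: fo.q.minus_diff)
 from gr.submoduleD(3)[OF Fl_submodule mu_approx[OF \<xi> t(1)] this] show "mu d \<xi> \<ominus>\<^bsub>grd P d\<^esub> z : Fl n d"
  using z tc mu_closed[OF \<xi>] by (simp add: fo.q.diff_trans)
qed

lemma mu_hom: "mu d : Hom p (grd CT d) (grd P d)"
proof (rule mod_homI[OF tt.C_module gr.Fp_module_axioms mu_closed])
 fix \<xi> \<eta> assume \<xi>: "\<xi> : CT $ d" and \<eta>: "\<eta> : CT $ d"
 note c = mu_closed[OF \<xi>] mu_closed[OF \<eta>]
 show "mu d (\<xi> \<oplus>\<^bsub>grd CT d\<^esub> \<eta>) = mu d \<xi> \<oplus>\<^bsub>grd P d\<^esub> mu d \<eta>"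
 proof (rule mu_eqI[OF tt.C_closed(2)[OF \<xi> \<eta>]])
  fix n
  obtain t where t: "t : \<xi> n" "t : fo.T $ d" by (rule tt.C_obtain[OF \<xi>])
  obtain v where v: "v : \<eta> n" "v : fo.T $ d" by (rule tt.C_obtain[OF \<eta>])
  have "(mu d \<xi> \<ominus>\<^bsub>grd P d\<^esub> tmul d t) \<oplus>\<^bsub>grd P d\<^esub> (mu d \<eta> \<ominus>\<^bsub>grd P d\<^esub> tmul d v) : Fl n d"
   by (rule gr.submoduleD(3)[OF Fl_submodule mu_approx[OF \<xi> t(1)] mu_approx[OF \<eta> v(1)]])
  then have "mu d \<xi> \<oplus>\<^bsub>grd P d\<^esub> mu d \<eta> \<ominus>\<^bsub>grd P d\<^esub> tmul d (t \<oplus>\<^bsub>grd fo.T d\<^esub> v) : Fl n d"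
   using c t v by (simp add: a_minus_def gr.M.minus_add gr.M.a_ac tm.add)
  then show "\<exists>w\<in>(\<xi> \<oplus>\<^bsub>grd CT d\<^esub> \<eta>) n. mu d \<xi> \<oplus>\<^bsub>grd P d\<^esub> mu d \<eta> \<ominus>\<^bsub>grd P d\<^esub> tmul d w : Fl n d"
   using tt.add_mem[OF \<xi> \<eta> t(1) v(1)] by blast
 qed (use c in blast)
qed

lemma mu_sop:
 assumes \<xi>: "\<xi> : CT $ d"
 shows "mu (d - deg p g) (sop CT g d \<xi>) = sop P g d (mu d \<xi>)"
proof (rule mu_eqI[OF tt.sop_C_closed[OF \<xi>] sp.closed[OF mu_closed[OF \<xi>]]])
 fix n
 obtain t where t: "t : \<xi> n" "t : fo.T $ d" by (rule tt.C_obtain[OF \<xi>])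
 have "sop P g d (mu d \<xi> \<ominus>\<^bsub>grd P d\<^esub> tmul d t) : Fl n (d - deg p g)" by (rule fo.Fl_sop[OF mu_approx[OF \<xi> t(1)]])
 then show "\<exists>w\<in>sop CT g d \<xi> n. sop P g d (mu d \<xi>) \<ominus>\<^bsub>grd P (d - deg p g)\<^esub> tmul (d - deg p g) w : Fl n (d - deg p g)"
  using tt.sop_mem[OF \<xi> t(1), of g] unfolding sp.diff[OF mu_closed[OF \<xi>] tm.closed[OF t(2)]] tmul_sop[OF t(2), symmetric] by blast
qed

lemma mu_dif:
 assumes \<xi>: "\<xi> : CT $ d"
 shows "mu (d + 1) (dif CT d \<xi>) = dif P d (mu d \<xi>)"
proof (rule mu_eqI[OF tt.dif_C_closed[OF \<xi>] mod_hom_closed[OF dif_hom mu_closed[OF \<xi>]]])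
 fix n
 obtain t where t: "t : \<xi> (n - s)" "t : fo.T $ d" by (rule tt.C_obtain[OF \<xi>])
 have "dif P d (mu d \<xi> \<ominus>\<^bsub>grd P d\<^esub> tmul d t) : Fl (n - s + s) (d + 1)" by (rule Fl_dif[OF mu_approx[OF \<xi> t(1)]])
 then show "\<exists>w\<in>dif CT d \<xi> n. dif P d (mu d \<xi>) \<ominus>\<^bsub>grd P (d + 1)\<^esub> tmul (d + 1) w : Fl n (d + 1)"
  using tt.dif_mem[OF \<xi> t(1)] unfolding df.diff[OF mu_closed[OF \<xi>] tm.closed[OF t(2)]] tmul_dif[OF t(2), symmetric] by auto
qed

text \<open>A pure tensor represents its own class at every level.\<close>

lemma mu_pure:
 assumes x: "x : P $ d" and y: "y : P $ e"
 shows "mu (d + e) (pure_ctens p P Fl P Fl d e x y) = mul d e x y"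
proof -
 have e: "d + e - d = e" by simp
 have t: "fo.ten (d + e) d x y : fo.T $ (d + e)" by (rule fo.ten_closed[OF x]) (simp only: e y)
 have "tmul (d + e) (fo.ten (d + e) d x y) = mul d e x y" using tmul_ten[OF x, of y "d + e"] y unfolding e by blast
 then have "mul d e x y \<ominus>\<^bsub>grd P (d + e)\<^esub> tmul (d + e) (fo.ten (d + e) d x y) : Fl n (d + e)" for n
  using gr.submoduleD(2)[OF Fl_submodule] mul_closed[OF x y] by (simp add: a_minus_def gr.M.r_neg)
 then show ?thesis unfolding pure_ctens_def
  by (intro mu_eqI[OF tt.compl_map_closed[OF t] mul_closed[OF x y]]) (use tt.compl_map_mem[OF t] in blast)
qed

theorem complete_algebra:
 assumes un: "un : P $ 0"
  and unit: "!!d x. x : P $ d ==> mul 0 d un x = x" "!!d x. x : P $ d ==> mul d 0 x un = x"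
  and un_Bock: "sop P Bock 0 un = \<zero>\<^bsub>grd P (-1)\<^esub>"
  and un_Pow: "!!r. r > 0 ==> sop P (Pow r) 0 un = \<zero>\<^bsub>grd P (- deg p (Pow r))\<^esub>"
  and assoc: "!!d e f x y z. x : P $ d ==> y : P $ e ==> z : P $ f ==>
   mul (d + e) f (mul d e x y) z = mul d (e + f) x (mul e f y z)"
 shows "complete_dg_A_algebra p P Fl s un mu"
proof (intro complete_dg_A_algebra.intro complete_dg_A_algebra_axioms.intro filtered_dg_right_A_module_axioms complete mu_hom un un_Bock un_Pow)
 show "mu d \<xi> : Fl n d" if "\<xi> : compl_fil s p fo.T fo.TFl n d" for n d \<xi>
 proof -
  have \<xi>: "\<xi> : CT $ d" and "\<zero>\<^bsub>grd fo.T d\<^esub> : \<xi> n" using that by (simp_all add: tt.CF_iff)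
  from mu_approx[OF this] show ?thesis using mu_closed[OF \<xi>] by (simp add: a_minus_def gr.uminus_zero)
 qed
 show "mu (d - int k) (sact p CT k d a \<xi>) = sact p P k d a (mu d \<xi>)"
  if "a : steenrod_deg p k" "\<xi> : CT $ d" for k d a \<xi>
  using sact_natural[where h = mu and m = 0, OF tt.C_graded_ops graded_ops_axioms _ _ that] mu_hom mu_sop by (simp add: sgn_mult_def)
 show "mu (d + 1) (dif CT d \<xi>) = dif P d (mu d \<xi>)" if "\<xi> : CT $ d" for d \<xi> by (rule mu_dif[OF that])
 show "mu (0 + d) (pure_ctens p P Fl P Fl 0 d un x) = x" if "x : P $ d" for d x
  unfolding mu_pure[OF un that] by (rule unit(1)[OF that])
 show "mu (d + 0) (pure_ctens p P Fl P Fl d 0 x un) = x" if "x : P $ d" for d x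
  unfolding mu_pure[OF that un] by (rule unit(2)[OF that])
 show "mu (d + e + f) (pure_ctens p P Fl P Fl (d + e) f (mu (d + e) (pure_ctens p P Fl P Fl d e x y)) z)
   = mu (d + (e + f)) (pure_ctens p P Fl P Fl d (e + f) x (mu (e + f) (pure_ctens p P Fl P Fl e f y z)))"
  if "x : P $ d" "y : P $ e" "z : P $ f" for d e f x y z
  unfolding mu_pure[OF that(1,2)] mu_pure[OF that(2,3)] mu_pure[OF mul_closed[OF that(1,2)] that(3)]
   mu_pure[OF that(1) mul_closed[OF that(2,3)]] by (rule assoc[OF that])
qed

end

section \<open>The completion of \<open>r\<^sub>+(M)\<close>\<close>

lemma quot_trivial:
 assumes "Fp_quotient p W (carrier W)"
 shows "carrier (quot_mod W (carrier W)) = {\<zero>\<^bsub>quot_mod W (carrier W)\<^esub>}"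
proof -
 interpret Fp_quotient p W "carrier W" by (rule assms)
 have "carrier W +>\<^bsub>W\<^esub> x = carrier W" if "x : carrier W" for x using that by (auto simp: coset_iff)
 then show ?thesis using M.zero_closed by (auto simp: quot_carrier quot_zero)
qed

theorem proposition9p2:
  fixes p :: nat and M :: "'a dgalg"
  assumes "prime p"
    and "dg_A_algebra p M"
    and "\<And>d x. x \<in> carrier (grd M d) \<Longrightarrow> sop M Bock d x = \<zero>\<^bsub>grd M (d - 1)\<^esub>"
  shows "filtered_dg_A_algebra p (r_plus p M) (r_fil p M) 1
    \<and> (\<exists>mu. complete_dg_A_algebra p (R_plus p M) (R_fil p M) 1
               (to_R p M 0 (gunit (r_plus p M))) mu
             \<and> extends_r_mul p M mu)
    \<and> (bounded_below M \<longrightarrow>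
         rel_bounded_below (r_plus p M) (r_fil p M) \<and> rel_bounded_below (R_plus p M) (R_fil p M))"
proof -
 interpret B: bock_trivial p M using assms by (intro bock_trivial.intro bock_trivial_axioms.intro)
 interpret r: filtered_dg_A_algebra p "r_plus p M" "r_fil p M" 1 by (rule B.r_plus_filtered)
 interpret rx: exhaustive_product p "r_plus p M" "r_fil p M" 1 "gmul (r_plus p M)"
  by (intro exhaustive_product.intro exhaustive_product_axioms.intro r.filtered_product) (use B.r_fil_exhaustive in simp)
 note R = R_plus_def[of p M] R_fil_def[of p M] to_R_def[of p M]
 interpret cp: complete_product p "R_plus p M" "R_fil p M" 1 rx.cmul
  unfolding R by (intro complete_product.intro complete_product_axioms.intro rx.completed_product r.fo.completion_complete)
 have mul: "rx.cmul d e (to_R p M d x) (to_R p M e y) = to_R p M (d + e) (gmul (r_plus p M) d e x y)"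
  if "x : (r_plus p M) $ d" "y : (r_plus p M) $ e" for d e x y
  unfolding R by (rule rx.cmul_compl_map[OF that])
 have toR: "to_R p M d x : (R_plus p M) $ d" if "x : (r_plus p M) $ d" for d x
  unfolding R by (rule r.fo.compl_map_closed[OF that])
 have "complete_dg_A_algebra p (R_plus p M) (R_fil p M) 1 (to_R p M 0 (gunit (r_plus p M))) cp.mu"
 proof (rule cp.complete_algebra[OF toR[OF r.unit_closed]])
  show "rx.cmul 0 d (to_R p M 0 (gunit (r_plus p M))) X = X" "rx.cmul d 0 X (to_R p M 0 (gunit (r_plus p M))) = X"
   if "X : (R_plus p M) $ d" for d X
   using rx.cmul_unit[OF r.unit_closed that[unfolded R] ] r.unit_left r.unit_right unfolding R by blast+
  show "sop (R_plus p M) Bock 0 (to_R p M 0 (gunit (r_plus p M))) = \<zero>\<^bsub>grd (R_plus p M) (- 1)\<^esub>"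
  proof -
   have g: "0 - deg p Bock = - 1" by (simp add: gen_deg_def)
   show ?thesis using r.fo.sop_compl_map[OF r.unit_closed, of Bock] unfolding R g r.unit_Bock r.fo.compl_map_zero .
  qed
  show "sop (R_plus p M) (Pow k) 0 (to_R p M 0 (gunit (r_plus p M))) = \<zero>\<^bsub>grd (R_plus p M) (- deg p (Pow k))\<^esub>" if "k > 0" for k
   using r.fo.sop_compl_map[OF r.unit_closed, of "Pow k"] unfolding R diff_0 r.unit_Pow[OF that] r.fo.compl_map_zero .
  show "rx.cmul (d + e) f (rx.cmul d e X Y) Z = rx.cmul d (e + f) X (rx.cmul e f Y Z)"
   if "X : (R_plus p M) $ d" "Y : (R_plus p M) $ e" "Z : (R_plus p M) $ f" for d e f X Y Z
   by (rule rx.cmul_assoc[OF that[unfolded R] r.mul_assoc])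
 qed
 moreover have "extends_r_mul p M cp.mu"
  unfolding extends_r_mul_def using cp.mu_pure[OF toR toR] mul by simp
 moreover have "rel_bounded_below (r_plus p M) (r_fil p M) \<and> rel_bounded_below (R_plus p M) (R_fil p M)" if "bounded_below M"
 proof -
  obtain k where "\<forall>d<k. M $ d = {\<zero>\<^bsub>grd M d\<^esub>}" using \<open>bounded_below M\<close> unfolding bounded_below_def ..
  then have k: "M $ d = {\<zero>\<^bsub>grd M d\<^esub>}" if "d < k" for d using that by blast
  have F: "r_fil p M n d = (r_plus p M) $ d" if "d \<le> n + int p * k" for n d
   using B.r_fil_bounded_below[OF k that] by simp
  have CF: "R_fil p M n d = (R_plus p M) $ d" if "d \<le> n + int p * k" for n d
  proof -
   have "\<zero>\<^bsub>grd (r_plus p M) d\<^esub> : X n" if X: "X : (R_plus p M) $ d" for X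
   proof (rule r.fo.C_obtain[OF X[unfolded R], of n])
    fix x assume x: "x : X n" "x : (r_plus p M) $ d"
    show ?thesis by (rule r.fo.C_memI[OF X[unfolded R] x(1)]) (use x F[OF \<open>d \<le> _\<close>] in auto)
   qed
   then show ?thesis unfolding R by (auto simp: r.fo.CF_iff)
  qed
  have t: "carrier (quot_mod (grd (r_plus p M) d) (r_fil p M n d)) = {\<zero>\<^bsub>quot_mod (grd (r_plus p M) d) (r_fil p M n d)\<^esub>}"
   "carrier (quot_mod (grd (R_plus p M) d) (R_fil p M n d)) = {\<zero>\<^bsub>quot_mod (grd (R_plus p M) d) (R_fil p M n d)\<^esub>}"
   if "d \<le> n + int p * k" for n d
   using quot_trivial[OF r.fo.q.Fp_quotient_axioms[of d n, unfolded F[OF that]]]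
    quot_trivial[OF cp.fo.q.Fp_quotient_axioms[of d n, unfolded CF[OF that]]] unfolding F[OF that] CF[OF that] by simp_all
  show ?thesis unfolding rel_bounded_below_def
   by (rule conjI; rule exI[of _ "int p * k"]; intro allI impI; rule t; assumption)
 qed
 ultimately show ?thesis using B.r_plus_filtered by blast
qed

end
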